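(* Consider the distributed stochastic bilevel problem and the algorithm LoPA-LG (local gradient scheme) described in the context, and suppose that the assumptions on network connectivity, outer-level functions, inner-level functions, bounded heterogeneity and stochastic gradient estimates listed in the context hold. Then there exists a proper choice of the step-sizes $\alpha,\beta,\lambda>0$, $\gamma\in(0,1)$, $\tau\in(0,1)$ such that, for any total number of iterations $K$, $$\frac{1}{K+1}\sum_{k=0}^K \mathbb E\big[\|\nabla\Phi(\bar x^k)\|^2\big]\le \frac{4(\mathbb E[V^0]-\mathbb E[V^K])}{\tau\alpha(K+1)}+4\alpha\,\sigma_{LG}^2+\frac{4\vartheta}{m}\alpha^2b^2,$$ where $$\sigma_{LG}^2=\Big(\frac1m\frac{d_3}{\tau}+\frac{d_4}{\tau}\Big)(\sigma_{f,x}^2+2M^2\sigma_{g,x\theta}^2)\frac{\gamma^2}{\alpha^2}+2\frac{d_1}{\tau}(\sigma_{f,\theta}^2+2M^2\sigma_{g,\theta\theta}^2)\frac{\lambda^2}{\alpha^2}+2\frac{d_2}{\tau}\sigma_{g,\theta}^2\frac{\beta^2}{\alpha^2},\qquad \vartheta=\frac{24\alpha\varphi}{(1-\rho)^2\gamma},$$ $$\varphi=\Big(L_{fg,x}+\frac{32C_{g,x\theta}^2L_{fg,\theta}}{\mu_g^2}\Big)\Big(1+\frac{4L_{g,\theta}^2}{\omega_\theta^2}\Big),\qquad \omega_\theta=\frac{\mu_gL_{g,\theta}}{2(\mu_g+L_{g,\theta})},$$ $M=C_{f,\theta}/\mu_g$, $L_{fg,x}=2L_{f,x}^2+4M^2L_{g,x\theta}^2$,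 $L_{fg,\theta}=2L_{f,\theta}^2+4M^2L_{g,\theta\theta}^2$, $V^k$ is the Lyapunov function defined in the context, and its coefficients are $$d_0=1,\quad d_1=\frac{8C_{g,x\theta}^2\tau\alpha}{\mu_g\lambda},\quad d_2=\Big(L_{fg,x}+\frac{32C_{g,x\theta}^2L_{fg,\theta}}{\mu_g^2}\Big)\frac{\tau\alpha}{\omega_\theta\beta},\quad d_3=\frac{\tau\alpha}{2\gamma},\quad d_4=\frac{24\varphi\tau\alpha^4}{(1-\rho)^2\gamma},\quad d_5=\frac{2\varphi\alpha}{1-\rho},\quad d_6=0.$$
   Context: **Problem.** Let $\mathcal V=\{1,\dots,m\}$. For each $i\in\mathcal V$ let $f_i,g_i:\mathbb R^n\times\mathbb R^p\to\mathbb R$ with $f_i(x,\theta)=\mathbb E_{\varsigma_i\sim\mathcal D_{f_i}}[\hat f_i(x,\theta;\varsigma_i)]$ and $g_i(x,\theta)=\mathbb E_{\xi_i\sim\mathcal D_{g_i}}[\hat g_i(x,\theta;\xi_i)]$. Put $\theta_i^*(x)=\arg\min_{\theta}g_i(x,\theta)$, $\Phi_i(x)=f_i(x,\theta_i^*(x))$ and $\Phi=\frac1m\sum_{i=1}^m\Phi_i$. The problem is $\min_{x}\Phi(x)$. $\nabla_x,\nabla_\theta$ are partial gradients; $\nabla^2_{x\theta}g_i\in\mathbb R^{n\times p}$ and $\nabla^2_{\theta\theta}g_i$ are the Jacobian and Hessian. $\|\cdot\|$ is the Euclidean/spectral norm. **Network connectivity.** The undirected graph $\mathcal G=(\mathcal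 V,\mathcal E)$ is connected; $W=[w_{ij}]\in\mathbb R^{m\times m}$ satisfies $w_{ij}=w_{ji}>0$ iff $(i,j)\in\mathcal E$ and $w_{ij}=0$ otherwise, and $W$ is doubly stochastic. Consequently $\rho:=\|W-\frac1m1_m1_m^{\rm T}\|^2\in[0,1)$. $\mathcal N_i$ denotes the neighbors of $i$. **Outer-level functions.** With positive constants $L_{f,x},L_{f,\theta},C_{f,\theta}$, each $f_i$ satisfies: (i) $f_i$ is continuously differentiable; (ii) for any $\theta$, $\nabla_xf_i(\cdot,\theta)$ is $L_{f,x}$-Lipschitz in $x$, and for any $x$, $\nabla_\theta f_i(x,\cdot)$ is $L_{f,\theta}$-Lipschitz in $\theta$; (iii) $\|\nabla_\theta f_i(x,\theta_i^*(x))\|\le C_{f,\theta}$ for any $x$. **Inner-level functions.** With positive constants $\mu_g,L_{g,\theta},L_{g,x\theta},L_{g,\theta\theta},C_{g,x\theta}$, each $g_i$ satisfies: (i) for any $x$, $g_i(x,\cdot)$ is $\mu_g$-strongly convex, and $g_i$ is twice continuously differentiable; (ii) for any $x$, $\nabla_\theta g_i(x,\cdot)$ is $L_{g,\theta}$-Lipschitz in $\theta$; $\nabla^2_{x\theta}g_i(\cdot,\cdot)$ and $\nabla^2_{\theta\theta}g_i(\cdot,\cdot)$ are $L_{g,x\theta}$- and $L_{g,\theta\theta}$-Lipschitz; (iii) $\|\nabla^2_{x\theta}g_i(x,\theta)\|\le C_{g,x\theta}$ for all $x,\theta$. **Bounded heterogeneity.** With $\nabla_xf=\frac1m\sum_j\nabla_xf_j$,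 $\nabla_\theta f=\frac1m\sum_j\nabla_\theta f_j$, there are positive constants $b_f^2,b_g^2$ such that (i) $\sum_i\|\nabla_xf_i(x,\theta)-\nabla_xf(x,\theta)\|^2\le b_f^2$ and $\sum_i\|\nabla_\theta f_i(x,\theta)-\nabla_\theta f(x,\theta)\|^2\le b_f^2$ for all $x,\theta$; (ii) $\frac1m\sum_{i,j}\|\nabla_\theta g_i(x,\theta_j^*(x))-\nabla_\theta g_j(x,\theta_j^*(x))\|^2\le b_g^2$ for all $x$; (iii) $\frac1m\sum_{i,j}\|\nabla^2_{x\theta}g_i(x,\theta_j^*(x))-\nabla^2_{x\theta}g_j(x,\theta_j^*(x))\|^2\le b_g^2$ and $\frac1m\sum_{i,j}\|\nabla^2_{\theta\theta}g_i(x,\theta_j^*(x))-\nabla^2_{\theta\theta}g_j(x,\theta_j^*(x))\|^2\le b_g^2$ for all $x$. Set $$b^2=4\Big(1+\tfrac{C_{g,x\theta}^2}{\mu_g^2}\Big)b_f^2+4\Big(\tfrac{4C_{f,\theta}^2C_{g,x\theta}^2}{\mu_g^4}+\tfrac{4C_{f,\theta}^2}{\mu_g^2}+\tfrac{L_{f,x}^2}{\mu_g^2}+\tfrac{L_{f,\theta}^2C_{g,x\theta}^2}{\mu_g^4}+\tfrac{4C_{f,\theta}^2C_{g,x\theta}^2L_{g,\theta\theta}^2}{\mu_g^6}+\tfrac{4C_{f,\theta}^2L_{g,x\theta}^2}{\mu_g^4}\Big)b_g^2.$$ **Stochastic gradient estimates.** The random variables $\xi_{i,1}^k,\xi_{i,2}^k,\xi_{i,3}^k,\varsigma_{i,1}^k,\varsigma_{i,2}^k$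 are mutually independent for any $k$ and independent across iterations. For all $x,\theta,k$: the estimators $\nabla_\theta\hat g_i(x,\theta;\xi_{i,1}^k)$, $\nabla^2_{\theta\theta}\hat g_i(x,\theta;\xi_{i,2}^k)$, $\nabla^2_{x\theta}\hat g_i(x,\theta;\xi_{i,3}^k)$, $\nabla_\theta\hat f_i(x,\theta;\varsigma_{i,1}^k)$, $\nabla_x\hat f_i(x,\theta;\varsigma_{i,2}^k)$ are unbiased for $\nabla_\theta g_i,\nabla^2_{\theta\theta}g_i,\nabla^2_{x\theta}g_i,\nabla_\theta f_i,\nabla_xf_i$ at $(x,\theta)$, with variances (expected squared norm of the deviation) at most $\sigma_{g,\theta}^2,\sigma_{g,\theta\theta}^2,\sigma_{g,x\theta}^2,\sigma_{f,\theta}^2,\sigma_{f,x}^2$ respectively. **Algorithm LoPA.** Each node $i$ iterates, for $k\ge0$, with $d_i^k=\nabla_\theta\hat g_i(x_i^k,\theta_i^k;\xi_{i,1}^k)$, $h_i^k=\nabla^2_{\theta\theta}\hat g_i(x_i^k,\theta_i^k;\xi_{i,2}^k)v_i^k-\nabla_\theta\hat f_i(x_i^k,\theta_i^k;\varsigma_{i,1}^k)$, $s_i^k=\nabla_x\hat f_i(x_i^k,\theta_i^k;\varsigma_{i,2}^k)-\nabla^2_{x\theta}\hat g_i(x_i^k,\theta_i^k;\xi_{i,3}^k)v_i^k$: $$\theta_i^{k+1}=\theta_i^k-\beta d_i^k,\quad v_i^{k+1}=v_i^k-\lambda h_i^k,\quad x_i^{k+1}=(1-\tau)x_i^k+\tau\Big(\sum_{j\in\mathcal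 N_i}w_{ij}x_j^k-\alpha y_i^k\Big),\quad z_i^{k+1}=s_i^k+(1-\gamma)(z_i^k-s_i^k).$$ (The sum represents the $i$-th block of $(W\otimes I_n)x^k$.) LoPA-LG uses $y_i^{k+1}=z_i^{k+1}$. Initialization: $y_i^0=z_i^0$. **Notation.** $x^k=\mathrm{col}\{x_i^k\}_{i=1}^m$, $\bar x^k=\frac1m\sum_ix_i^k$, similarly for $y,z,\theta,v,s$. $v_i^*(x)=[\nabla^2_{\theta\theta}g_i(x,\theta_i^*(x))]^{-1}\nabla_\theta f_i(x,\theta_i^*(x))$; $\theta^*(\bar x^k)=\mathrm{col}\{\theta_i^*(\bar x^k)\}$, $v^*(\bar x^k)=\mathrm{col}\{v_i^*(\bar x^k)\}$, $\nabla\tilde\Phi(\bar x^k)=\mathrm{col}\{\nabla\Phi_i(\bar x^k)\}$. The Lyapunov function is $$V^k=d_0\Phi(\bar x^k)+\tfrac{d_1}{m}\|v^k-v^*(\bar x^k)\|^2+\tfrac{d_2}{m}\|\theta^k-\theta^*(\bar x^k)\|^2+d_3\|\nabla\Phi(\bar x^k)-\bar z^k\|^2+\tfrac{d_4}{m}\|\nabla\tilde\Phi(\bar x^k)-z^k\|^2+\tfrac{d_5}{m}\|x^k-1_m\otimes\bar x^k\|^2+\tfrac{d_6}{m}\|y^k-1_m\otimes\bar y^k\|^2.$$ *)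

theory Defs
  imports "HOL-Probability.Probability"
begin

section \<open>Calculus on Euclidean space\<close>

definition gradient :: "('a::real_inner \<Rightarrow> real) \<Rightarrow> 'a \<Rightarrow> 'a" where
  "gradient F z = (THE D. GDERIV F z :> D)"

definition cont_diff :: "('a::real_normed_vector \<Rightarrow> 'b::real_normed_vector) \<Rightarrow> bool" where
  "cont_diff F \<longleftrightarrow> F differentiable_on UNIV \<and>
     (\<forall>h. continuous_on UNIV (\<lambda>z. frechet_derivative F (at z) h))"

definition twice_cont_diff :: "('a::real_inner \<Rightarrow> real) \<Rightarrow> bool" where
  "twice_cont_diff F \<longleftrightarrow> cont_diff F \<and> cont_diff (gradient F)"

definition strongly_convex :: "real \<Rightarrow> ('a::real_normed_vector \<Rightarrow> real) \<Rightarrow> bool" where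
  "strongly_convex \<mu> F \<longleftrightarrow> (\<forall>s t. \<forall>u\<in>{0..1}.
     F ((1 - u) *\<^sub>R s + u *\<^sub>R t) \<le> (1 - u) * F s + u * F t - \<mu> / 2 * u * (1 - u) * (norm (s - t))\<^sup>2)"

text \<open>The library norm on matrices is the Frobenius norm, so the spectral norm is introduced separately.\<close>

definition spectral_norm :: "real^'a^'b \<Rightarrow> real" where
  "spectral_norm A = onorm (\<lambda>u. A *v u)"

definition grad_x :: "(real^'n \<Rightarrow> real^'p \<Rightarrow> real) \<Rightarrow> real^'n \<Rightarrow> real^'p \<Rightarrow> real^'n" where
  "grad_x F x \<theta> = gradient (\<lambda>u. F u \<theta>) x"

definition grad_t :: "(real^'n \<Rightarrow> real^'p \<Rightarrow> real) \<Rightarrow> real^'n \<Rightarrow> real^'p \<Rightarrow> real^'p" where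
  "grad_t F x \<theta> = gradient (\<lambda>t. F x t) \<theta>"

definition hess_xt :: "(real^'n \<Rightarrow> real^'p \<Rightarrow> real) \<Rightarrow> real^'n \<Rightarrow> real^'p \<Rightarrow> real^'p^'n" where
  "hess_xt F x \<theta> = jacobian (\<lambda>t. grad_x F x t) (at \<theta>)"

definition hess_tt :: "(real^'n \<Rightarrow> real^'p \<Rightarrow> real) \<Rightarrow> real^'n \<Rightarrow> real^'p \<Rightarrow> real^'p^'p" where
  "hess_tt F x \<theta> = jacobian (\<lambda>t. grad_t F x t) (at \<theta>)"


section \<open>The bilevel problem\<close>

definition theta_star :: "(real^'n \<Rightarrow> real^'p \<Rightarrow> real) \<Rightarrow> real^'n \<Rightarrow> real^'p" where
  "theta_star g x = arg_min (g x) (\<lambda>_. True)"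

definition v_star ::
  "(real^'n \<Rightarrow> real^'p \<Rightarrow> real) \<Rightarrow> (real^'n \<Rightarrow> real^'p \<Rightarrow> real) \<Rightarrow> real^'n \<Rightarrow> real^'p" where
  "v_star f g x = matrix_inv (hess_tt g x (theta_star g x)) *v grad_t f x (theta_star g x)"

definition Phi_i ::
  "(real^'n \<Rightarrow> real^'p \<Rightarrow> real) \<Rightarrow> (real^'n \<Rightarrow> real^'p \<Rightarrow> real) \<Rightarrow> real^'n \<Rightarrow> real" where
  "Phi_i f g x = f x (theta_star g x)"

definition Phi ::
  "('m::finite \<Rightarrow> real^'n \<Rightarrow> real^'p \<Rightarrow> real) \<Rightarrow> ('m \<Rightarrow> real^'n \<Rightarrow> real^'p \<Rightarrow> real)
    \<Rightarrow> real^'n \<Rightarrow> real" where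
  "Phi f g x = (\<Sum>i\<in>UNIV. Phi_i (f i) (g i) x) / real CARD('m)"

text \<open>\<open>F i x \<theta>\<close> is the mean of the sample function \<open>Fh i x \<theta>\<close> under the law \<open>D i\<close>.\<close>

definition expectation_of ::
  "('m \<Rightarrow> real^'n \<Rightarrow> real^'p \<Rightarrow> real) \<Rightarrow> ('m \<Rightarrow> real^'n \<Rightarrow> real^'p \<Rightarrow> 's \<Rightarrow> real)
    \<Rightarrow> ('m \<Rightarrow> 's measure) \<Rightarrow> bool" where
  "expectation_of F Fh D \<longleftrightarrow> (\<forall>i. prob_space (D i) \<and>
     (\<forall>x \<theta>. integrable (D i) (Fh i x \<theta>) \<and> F i x \<theta> = (\<integral>s. Fh i x \<theta> s \<partial>D i)))"

record problem_constants =
  L_fx :: real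
  L_ft :: real
  C_ft :: real
  mu_g :: real
  L_gt :: real
  L_gxt :: real
  L_gtt :: real
  C_gxt :: real
  b_f :: real
  b_g :: real
  s_gt :: real
  s_gtt :: real
  s_gxt :: real
  s_ft :: real
  s_fx :: real


section \<open>Assumptions\<close>

definition rho :: "real^'m^'m \<Rightarrow> real" where
  "rho W = (spectral_norm (W - (\<chi> i j. 1 / real CARD('m))))\<^sup>2"

text \<open>The edge set may contain self-loops, so that positive diagonal weights are allowed.
  The bound on \<open>rho\<close> is part of the assumption: for the two-cycle without
  self-loops all other clauses hold and \<open>rho W = 1\<close>.\<close>

definition network :: "('m::finite \<times> 'm) set \<Rightarrow> real^'m^'m \<Rightarrow> bool" where
  "network E W \<longleftrightarrow> sym E \<and> (\<forall>i j. (i, j) \<in> E\<^sup>*) \<and>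
     (\<forall>i j. W $ i $ j = W $ j $ i) \<and>
     (\<forall>i j. W $ i $ j > 0 \<longleftrightarrow> (i, j) \<in> E) \<and>
     (\<forall>i j. (i, j) \<notin> E \<longrightarrow> W $ i $ j = 0) \<and>
     (\<forall>i. (\<Sum>j\<in>UNIV. W $ i $ j) = 1) \<and> (\<forall>j. (\<Sum>i\<in>UNIV. W $ i $ j) = 1) \<and>
     rho W < 1"

definition outer_functions ::
  "problem_constants \<Rightarrow> ('m \<Rightarrow> real^'n \<Rightarrow> real^'p \<Rightarrow> real) \<Rightarrow> ('m \<Rightarrow> real^'n \<Rightarrow> real^'p \<Rightarrow> real) \<Rightarrow> bool" where
  "outer_functions c f g \<longleftrightarrow> L_fx c > 0 \<and> L_ft c > 0 \<and> C_ft c > 0 \<and>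
     (\<forall>i. cont_diff (\<lambda>(x, \<theta>). f i x \<theta>) \<and>
       (\<forall>\<theta>. (L_fx c)-lipschitz_on UNIV (\<lambda>x. grad_x (f i) x \<theta>)) \<and>
       (\<forall>x. (L_ft c)-lipschitz_on UNIV (\<lambda>\<theta>. grad_t (f i) x \<theta>)) \<and>
       (\<forall>x. norm (grad_t (f i) x (theta_star (g i) x)) \<le> C_ft c))"

definition inner_functions ::
  "problem_constants \<Rightarrow> ('m \<Rightarrow> real^'n \<Rightarrow> real^'p \<Rightarrow> real) \<Rightarrow> bool" where
  "inner_functions c g \<longleftrightarrow>
     mu_g c > 0 \<and> L_gt c > 0 \<and> L_gxt c > 0 \<and> L_gtt c > 0 \<and> C_gxt c > 0 \<and>
     (\<forall>i. (\<forall>x. strongly_convex (mu_g c) (g i x)) \<and>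
       twice_cont_diff (\<lambda>(x, \<theta>). g i x \<theta>) \<and>
       (\<forall>x. (L_gt c)-lipschitz_on UNIV (\<lambda>\<theta>. grad_t (g i) x \<theta>)) \<and>
       (\<forall>x \<theta> x' \<theta>'. spectral_norm (hess_xt (g i) x \<theta> - hess_xt (g i) x' \<theta>')
          \<le> L_gxt c * norm ((x, \<theta>) - (x', \<theta>'))) \<and>
       (\<forall>x \<theta> x' \<theta>'. spectral_norm (hess_tt (g i) x \<theta> - hess_tt (g i) x' \<theta>')
          \<le> L_gtt c * norm ((x, \<theta>) - (x', \<theta>'))) \<and>
       (\<forall>x \<theta>. spectral_norm (hess_xt (g i) x \<theta>) \<le> C_gxt c))"

definition bounded_heterogeneity ::
  "problem_constants \<Rightarrow> ('m::finite \<Rightarrow> real^'n \<Rightarrow> real^'p \<Rightarrow> real) \<Rightarrow> ('m \<Rightarrow> real^'n \<Rightarrow> real^'p \<Rightarrow> real)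
    \<Rightarrow> bool" where
  "bounded_heterogeneity c f g \<longleftrightarrow> b_f c > 0 \<and> b_g c > 0 \<and>
     (\<forall>x \<theta>. (\<Sum>i\<in>UNIV. (norm (grad_x (f i) x \<theta>
        - (\<Sum>j\<in>UNIV. grad_x (f j) x \<theta>) /\<^sub>R real CARD('m)))\<^sup>2) \<le> (b_f c)\<^sup>2) \<and>
     (\<forall>x \<theta>. (\<Sum>i\<in>UNIV. (norm (grad_t (f i) x \<theta>
        - (\<Sum>j\<in>UNIV. grad_t (f j) x \<theta>) /\<^sub>R real CARD('m)))\<^sup>2) \<le> (b_f c)\<^sup>2) \<and>
     (\<forall>x. (\<Sum>i\<in>UNIV. \<Sum>j\<in>UNIV. (norm (grad_t (g i) x (theta_star (g j) x)
        - grad_t (g j) x (theta_star (g j) x)))\<^sup>2) / real CARD('m) \<le> (b_g c)\<^sup>2) \<and>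
     (\<forall>x. (\<Sum>i\<in>UNIV. \<Sum>j\<in>UNIV. (spectral_norm (hess_xt (g i) x (theta_star (g j) x)
        - hess_xt (g j) x (theta_star (g j) x)))\<^sup>2) / real CARD('m) \<le> (b_g c)\<^sup>2) \<and>
     (\<forall>x. (\<Sum>i\<in>UNIV. \<Sum>j\<in>UNIV. (spectral_norm (hess_tt (g i) x (theta_star (g j) x)
        - hess_tt (g j) x (theta_star (g j) x)))\<^sup>2) / real CARD('m) \<le> (b_g c)\<^sup>2)"

record ('w, 'm, 'b, 'c) samples =
  xi1 :: "nat \<Rightarrow> 'm \<Rightarrow> 'w \<Rightarrow> 'b"
  xi2 :: "nat \<Rightarrow> 'm \<Rightarrow> 'w \<Rightarrow> 'b"
  xi3 :: "nat \<Rightarrow> 'm \<Rightarrow> 'w \<Rightarrow> 'b"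
  vs1 :: "nat \<Rightarrow> 'm \<Rightarrow> 'w \<Rightarrow> 'c"
  vs2 :: "nat \<Rightarrow> 'm \<Rightarrow> 'w \<Rightarrow> 'c"

datatype 'm source = Init | Xi1 nat 'm | Xi2 nat 'm | Xi3 nat 'm | Vs1 nat 'm | Vs2 nat 'm

text \<open>The sigma-algebra on \<open>space M\<close> generated by each source of randomness;
  \<open>init\<close> is the (possibly constant) random initial point.\<close>

fun source_events ::
  "'w measure \<Rightarrow> ('m \<Rightarrow> 'c measure) \<Rightarrow> ('m \<Rightarrow> 'b measure) \<Rightarrow> ('w, 'm, 'b, 'c) samples
    \<Rightarrow> ('w \<Rightarrow> 'i::topological_space) \<Rightarrow> 'm source \<Rightarrow> 'w set set" where
  "source_events M Df Dg S init Init = sets (vimage_algebra (space M) init borel)"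
| "source_events M Df Dg S init (Xi1 k i) = sets (vimage_algebra (space M) (xi1 S k i) (Dg i))"
| "source_events M Df Dg S init (Xi2 k i) = sets (vimage_algebra (space M) (xi2 S k i) (Dg i))"
| "source_events M Df Dg S init (Xi3 k i) = sets (vimage_algebra (space M) (xi3 S k i) (Dg i))"
| "source_events M Df Dg S init (Vs1 k i) = sets (vimage_algebra (space M) (vs1 S k i) (Df i))"
| "source_events M Df Dg S init (Vs2 k i) = sets (vimage_algebra (space M) (vs2 S k i) (Df i))"

definition unbiased_estimate ::
  "'w measure \<Rightarrow> ('a::euclidean_space \<Rightarrow> real) \<Rightarrow> ('w \<Rightarrow> 'a) \<Rightarrow> 'a \<Rightarrow> real \<Rightarrow> bool" where
  "unbiased_estimate M nrm X a \<sigma> \<longleftrightarrow>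
     integrable M X \<and> (\<integral>\<omega>. X \<omega> \<partial>M) = a \<and>
     integrable M (\<lambda>\<omega>. (nrm (X \<omega> - a))\<^sup>2) \<and> (\<integral>\<omega>. (nrm (X \<omega> - a))\<^sup>2 \<partial>M) \<le> \<sigma>\<^sup>2"

text \<open>Implicit in taking expectations along the iterates: the sampled derivatives exist and are
  jointly measurable in the point and the sample.\<close>

definition sampled_derivatives ::
  "('m \<Rightarrow> real^'n \<Rightarrow> real^'p \<Rightarrow> 'c \<Rightarrow> real) \<Rightarrow> ('m \<Rightarrow> real^'n \<Rightarrow> real^'p \<Rightarrow> 'b \<Rightarrow> real)
    \<Rightarrow> ('m \<Rightarrow> 'c measure) \<Rightarrow> ('m \<Rightarrow> 'b measure) \<Rightarrow> bool" where
  "sampled_derivatives fh gh Df Dg \<longleftrightarrow> (\<forall>i.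
     (\<forall>s\<in>space (Df i). \<forall>x \<theta>.
        (\<lambda>u. fh i u \<theta> s) differentiable (at x) \<and> (\<lambda>t. fh i x t s) differentiable (at \<theta>)) \<and>
     (\<forall>s\<in>space (Dg i). \<forall>x \<theta>.
        (\<lambda>u. gh i u \<theta> s) differentiable (at x) \<and> (\<lambda>t. gh i x t s) differentiable (at \<theta>) \<and>
        (\<lambda>t. grad_x (\<lambda>u v. gh i u v s) x t) differentiable (at \<theta>) \<and>
        (\<lambda>t. grad_t (\<lambda>u v. gh i u v s) x t) differentiable (at \<theta>)) \<and>
     (\<lambda>(x, \<theta>, s). grad_x (\<lambda>u v. fh i u v s) x \<theta>) \<in> borel \<Otimes>\<^sub>M borel \<Otimes>\<^sub>M Df i \<rightarrow>\<^sub>M borel \<and>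
     (\<lambda>(x, \<theta>, s). grad_t (\<lambda>u v. fh i u v s) x \<theta>) \<in> borel \<Otimes>\<^sub>M borel \<Otimes>\<^sub>M Df i \<rightarrow>\<^sub>M borel \<and>
     (\<lambda>(x, \<theta>, s). grad_t (\<lambda>u v. gh i u v s) x \<theta>) \<in> borel \<Otimes>\<^sub>M borel \<Otimes>\<^sub>M Dg i \<rightarrow>\<^sub>M borel \<and>
     (\<lambda>(x, \<theta>, s). hess_tt (\<lambda>u v. gh i u v s) x \<theta>) \<in> borel \<Otimes>\<^sub>M borel \<Otimes>\<^sub>M Dg i \<rightarrow>\<^sub>M borel \<and>
     (\<lambda>(x, \<theta>, s). hess_xt (\<lambda>u v. gh i u v s) x \<theta>) \<in> borel \<Otimes>\<^sub>M borel \<Otimes>\<^sub>M Dg i \<rightarrow>\<^sub>M borel)"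

definition stochastic_estimates ::
  "problem_constants \<Rightarrow> ('m \<Rightarrow> real^'n \<Rightarrow> real^'p \<Rightarrow> real) \<Rightarrow> ('m \<Rightarrow> real^'n \<Rightarrow> real^'p \<Rightarrow> real)
    \<Rightarrow> ('m \<Rightarrow> real^'n \<Rightarrow> real^'p \<Rightarrow> 'c \<Rightarrow> real) \<Rightarrow> ('m \<Rightarrow> real^'n \<Rightarrow> real^'p \<Rightarrow> 'b \<Rightarrow> real)
    \<Rightarrow> ('m \<Rightarrow> 'c measure) \<Rightarrow> ('m \<Rightarrow> 'b measure) \<Rightarrow> 'w measure \<Rightarrow> ('w, 'm, 'b, 'c) samples
    \<Rightarrow> ('w \<Rightarrow> 'i::topological_space) \<Rightarrow> bool" where
  "stochastic_estimates c f g fh gh Df Dg M S init \<longleftrightarrow>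
     sampled_derivatives fh gh Df Dg \<and>
     (\<forall>k i. xi1 S k i \<in> M \<rightarrow>\<^sub>M Dg i \<and> xi2 S k i \<in> M \<rightarrow>\<^sub>M Dg i \<and> xi3 S k i \<in> M \<rightarrow>\<^sub>M Dg i \<and>
        vs1 S k i \<in> M \<rightarrow>\<^sub>M Df i \<and> vs2 S k i \<in> M \<rightarrow>\<^sub>M Df i) \<and>
     prob_space.indep_sets M (source_events M Df Dg S init) UNIV \<and>
     (\<forall>k i x \<theta>.
        unbiased_estimate M norm (\<lambda>\<omega>. grad_t (\<lambda>u v. gh i u v (xi1 S k i \<omega>)) x \<theta>)
          (grad_t (g i) x \<theta>) (s_gt c) \<and>
        unbiased_estimate M spectral_norm (\<lambda>\<omega>. hess_tt (\<lambda>u v. gh i u v (xi2 S k i \<omega>)) x \<theta>)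
          (hess_tt (g i) x \<theta>) (s_gtt c) \<and>
        unbiased_estimate M spectral_norm (\<lambda>\<omega>. hess_xt (\<lambda>u v. gh i u v (xi3 S k i \<omega>)) x \<theta>)
          (hess_xt (g i) x \<theta>) (s_gxt c) \<and>
        unbiased_estimate M norm (\<lambda>\<omega>. grad_t (\<lambda>u v. fh i u v (vs1 S k i \<omega>)) x \<theta>)
          (grad_t (f i) x \<theta>) (s_ft c) \<and>
        unbiased_estimate M norm (\<lambda>\<omega>. grad_x (\<lambda>u v. fh i u v (vs2 S k i \<omega>)) x \<theta>)
          (grad_x (f i) x \<theta>) (s_fx c))"


section \<open>The algorithm\<close>

record step_sizes =
  alpha :: real
  beta :: real
  lambda :: real
  gamma :: real
  tau :: real

text \<open>Stacked vectors are elements of \<open>(real^'n)^'m\<close>, whose norm is the Euclidean norm of \<open>col\<close>.\<close>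

record ('n, 'p, 'm) state =
  st_x :: "((real, 'n::finite) vec, 'm::finite) vec"
  st_\<theta> :: "((real, 'p::finite) vec, 'm::finite) vec"
  st_v :: "((real, 'p::finite) vec, 'm::finite) vec"
  st_z :: "((real, 'n::finite) vec, 'm::finite) vec"
  st_y :: "((real, 'n::finite) vec, 'm::finite) vec"

definition lopa_lg_step ::
  "('m::finite \<times> 'm) set \<Rightarrow> real^'m^'m
    \<Rightarrow> ('m \<Rightarrow> real^'n \<Rightarrow> real^'p \<Rightarrow> 'c \<Rightarrow> real) \<Rightarrow> ('m \<Rightarrow> real^'n \<Rightarrow> real^'p \<Rightarrow> 'b \<Rightarrow> real)
    \<Rightarrow> ('w, 'm, 'b, 'c) samples \<Rightarrow> step_sizes \<Rightarrow> nat \<Rightarrow> 'w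
    \<Rightarrow> ('n, 'p, 'm) state \<Rightarrow> ('n, 'p, 'm) state" where
  "lopa_lg_step E W fh gh S p k \<omega> st =
    (let x = st_x st; \<theta> = st_\<theta> st; v = st_v st; z = st_z st; y = st_y st;
       d = (\<chi> i. grad_t (\<lambda>a b. gh i a b (xi1 S k i \<omega>)) (x $ i) (\<theta> $ i));
       h = (\<chi> i. hess_tt (\<lambda>a b. gh i a b (xi2 S k i \<omega>)) (x $ i) (\<theta> $ i) *v (v $ i)
              - grad_t (\<lambda>a b. fh i a b (vs1 S k i \<omega>)) (x $ i) (\<theta> $ i));
       s = (\<chi> i. grad_x (\<lambda>a b. fh i a b (vs2 S k i \<omega>)) (x $ i) (\<theta> $ i)
              - hess_xt (\<lambda>a b. gh i a b (xi3 S k i \<omega>)) (x $ i) (\<theta> $ i) *v (v $ i));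
       z' = s + (1 - gamma p) *\<^sub>R (z - s)
     in \<lparr> st_x = (\<chi> i. (1 - tau p) *\<^sub>R (x $ i)
              + tau p *\<^sub>R ((\<Sum>j | (i, j) \<in> E. W $ i $ j *\<^sub>R (x $ j)) - alpha p *\<^sub>R (y $ i))),
          st_\<theta> = \<theta> - beta p *\<^sub>R d,
          st_v = v - lambda p *\<^sub>R h,
          st_z = z',
          st_y = z' \<rparr>)"

text \<open>\<open>init\<close> yields \<open>(x, \<theta>, v, z)\<close> at iteration 0.\<close>

primrec lopa_lg ::
  "('m::finite \<times> 'm) set \<Rightarrow> real^'m^'m
    \<Rightarrow> ('m \<Rightarrow> real^'n \<Rightarrow> real^'p \<Rightarrow> 'c \<Rightarrow> real) \<Rightarrow> ('m \<Rightarrow> real^'n \<Rightarrow> real^'p \<Rightarrow> 'b \<Rightarrow> real)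
    \<Rightarrow> ('w, 'm, 'b, 'c) samples
    \<Rightarrow> ('w \<Rightarrow> (real^'n^'m) \<times> (real^'p^'m) \<times> (real^'p^'m) \<times> (real^'n^'m))
    \<Rightarrow> step_sizes \<Rightarrow> nat \<Rightarrow> 'w \<Rightarrow> ('n, 'p, 'm) state" where
  "lopa_lg E W fh gh S init p 0 =
    (\<lambda>\<omega>. case init \<omega> of (x, \<theta>, v, z) \<Rightarrow>
      \<lparr> st_x = x, st_\<theta> = \<theta>, st_v = v, st_z = z, st_y = z \<rparr>)"
| "lopa_lg E W fh gh S init p (Suc k) =
    (\<lambda>\<omega>. lopa_lg_step E W fh gh S p k \<omega> (lopa_lg E W fh gh S init p k \<omega>))"

definition avg :: "real^'n^'m \<Rightarrow> real^'n" where
  "avg u = (\<Sum>i\<in>UNIV. u $ i) /\<^sub>R real CARD('m)"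


section \<open>Constants and Lyapunov function\<close>

definition M_const :: "problem_constants \<Rightarrow> real" where
  "M_const c = C_ft c / mu_g c"

definition L_fgx :: "problem_constants \<Rightarrow> real" where
  "L_fgx c = 2 * (L_fx c)\<^sup>2 + 4 * (M_const c)\<^sup>2 * (L_gxt c)\<^sup>2"

definition L_fgt :: "problem_constants \<Rightarrow> real" where
  "L_fgt c = 2 * (L_ft c)\<^sup>2 + 4 * (M_const c)\<^sup>2 * (L_gtt c)\<^sup>2"

definition omega_t :: "problem_constants \<Rightarrow> real" where
  "omega_t c = mu_g c * L_gt c / (2 * (mu_g c + L_gt c))"

definition phi_const :: "problem_constants \<Rightarrow> real" where
  "phi_const c = (L_fgx c + 32 * (C_gxt c)\<^sup>2 * L_fgt c / (mu_g c)\<^sup>2)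
     * (1 + 4 * (L_gt c)\<^sup>2 / (omega_t c)\<^sup>2)"

definition b_sq :: "problem_constants \<Rightarrow> real" where
  "b_sq c = 4 * (1 + (C_gxt c)\<^sup>2 / (mu_g c)\<^sup>2) * (b_f c)\<^sup>2
     + 4 * (4 * (C_ft c)\<^sup>2 * (C_gxt c)\<^sup>2 / mu_g c ^ 4
          + 4 * (C_ft c)\<^sup>2 / (mu_g c)\<^sup>2
          + (L_fx c)\<^sup>2 / (mu_g c)\<^sup>2
          + (L_ft c)\<^sup>2 * (C_gxt c)\<^sup>2 / mu_g c ^ 4
          + 4 * (C_ft c)\<^sup>2 * (C_gxt c)\<^sup>2 * (L_gtt c)\<^sup>2 / mu_g c ^ 6
          + 4 * (C_ft c)\<^sup>2 * (L_gxt c)\<^sup>2 / mu_g c ^ 4) * (b_g c)\<^sup>2"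

definition d0 :: real where "d0 = 1"

definition d1 :: "problem_constants \<Rightarrow> step_sizes \<Rightarrow> real" where
  "d1 c p = 8 * (C_gxt c)\<^sup>2 * tau p * alpha p / (mu_g c * lambda p)"

definition d2 :: "problem_constants \<Rightarrow> step_sizes \<Rightarrow> real" where
  "d2 c p = (L_fgx c + 32 * (C_gxt c)\<^sup>2 * L_fgt c / (mu_g c)\<^sup>2)
     * (tau p * alpha p / (omega_t c * beta p))"

definition d3 :: "step_sizes \<Rightarrow> real" where
  "d3 p = tau p * alpha p / (2 * gamma p)"

definition d4 :: "problem_constants \<Rightarrow> real \<Rightarrow> step_sizes \<Rightarrow> real" where
  "d4 c \<rho> p = 24 * phi_const c * tau p * alpha p ^ 4 / ((1 - \<rho>)\<^sup>2 * gamma p)"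

definition d5 :: "problem_constants \<Rightarrow> real \<Rightarrow> step_sizes \<Rightarrow> real" where
  "d5 c \<rho> p = 2 * phi_const c * alpha p / (1 - \<rho>)"

definition d6 :: real where "d6 = 0"

definition vartheta :: "problem_constants \<Rightarrow> real \<Rightarrow> step_sizes \<Rightarrow> real" where
  "vartheta c \<rho> p = 24 * alpha p * phi_const c / ((1 - \<rho>)\<^sup>2 * gamma p)"

definition sigma_LG_sq :: "nat \<Rightarrow> problem_constants \<Rightarrow> real \<Rightarrow> step_sizes \<Rightarrow> real" where
  "sigma_LG_sq m c \<rho> p =
     (1 / real m * (d3 p / tau p) + d4 c \<rho> p / tau p)
        * ((s_fx c)\<^sup>2 + 2 * (M_const c)\<^sup>2 * (s_gxt c)\<^sup>2) * ((gamma p)\<^sup>2 / (alpha p)\<^sup>2)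
     + 2 * (d1 c p / tau p)
        * ((s_ft c)\<^sup>2 + 2 * (M_const c)\<^sup>2 * (s_gtt c)\<^sup>2) * ((lambda p)\<^sup>2 / (alpha p)\<^sup>2)
     + 2 * (d2 c p / tau p) * (s_gt c)\<^sup>2 * ((beta p)\<^sup>2 / (alpha p)\<^sup>2)"

definition lyapunov ::
  "problem_constants \<Rightarrow> real \<Rightarrow> step_sizes
    \<Rightarrow> ('m::finite \<Rightarrow> real^'n \<Rightarrow> real^'p \<Rightarrow> real) \<Rightarrow> ('m \<Rightarrow> real^'n \<Rightarrow> real^'p \<Rightarrow> real)
    \<Rightarrow> ('n, 'p, 'm) state \<Rightarrow> real" where
  "lyapunov c \<rho> p f g st =
    (let m = real CARD('m); x = st_x st; y = st_y st; z = st_z st; xb = avg x in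
       d0 * Phi f g xb
       + d1 c p / m * (norm (st_v st - (\<chi> i. v_star (f i) (g i) xb)))\<^sup>2
       + d2 c p / m * (norm (st_\<theta> st - (\<chi> i. theta_star (g i) xb)))\<^sup>2
       + d3 p * (norm (gradient (Phi f g) xb - avg z))\<^sup>2
       + d4 c \<rho> p / m * (norm ((\<chi> i. gradient (Phi_i (f i) (g i)) xb) - z))\<^sup>2
       + d5 c \<rho> p / m * (norm (x - (\<chi> i. xb)))\<^sup>2
       + d6 / m * (norm (y - (\<chi> i. avg y)))\<^sup>2)"

end

theory Submission
  imports Defs
begin

text \<open>
The rate is obtained for step sizes with fixed \<open>beta\<close> and \<open>lambda\<close>, a fixed small \<open>alpha\<close>, a \<open>gamma\<close> that is small
compared with these, and a \<open>tau\<close> that is small compared with \<open>gamma\<close>.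

The outer functions are Lipschitz-smooth in each variable separately.  As \<open>x * \<theta> * ln (x\<^sup>2 + \<theta>\<^sup>2)\<close> shows, this
leaves the mixed derivative unbounded, so the gradient of the hyperobjective need not be Lipschitz and the usual
descent inequality is not available.  What does hold is an almost Lipschitz bound: for every \<open>\<eta>\<close> in \<open>(0, 1]\<close> the
gradients at \<open>x\<close> and \<open>y\<close> differ by at most \<open>\<eta> + (C / \<eta>) * norm (x - y)\<close>.  It comes from evaluating mixed second
differences of \<open>f\<close> in two orders (\<open>mixed_difference\<close>, \<open>fx_variation\<close>, \<open>ft_variation\<close>), together with the
boundedness of the gradient of \<open>f\<close> in the inner variable along the solution curve and the differentiability of the inner solution
(\<open>sol_has_derivative\<close>, \<open>mixed_derivative_symmetric\<close>, \<open>hypergrad_almost_lipschitz\<close>).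

Such a bound is enough because of the last term of the rate.  The product of \<open>vartheta\<close> and the square of \<open>alpha\<close> is
of order \<open>alpha ^ 3 / gamma\<close>, so for small \<open>gamma\<close> it dominates every error per iteration that is bounded
independently of \<open>gamma\<close>.  Allowing jumps \<open>\<eta> = gamma\<close> of the gradient makes the tracking error such a quantity,
and the price, a slope \<open>C / gamma\<close>, is paid by the small \<open>tau\<close>.

In expectation the algorithm satisfies a system of scalar recursions (\<open>moment_recursion\<close>), in which every noise
enters through its variance because samples are independent of the present state (\<open>indep_noise\<close>,
\<open>drift_plus_noise\<close>).  The system contains one feedback loop, from the tracking error through the disagreement of the
nodes back to the tracking error; its gain is of order \<open>alpha\<^sup>2\<close>, which fixes \<open>alpha\<close>.  The initial errors are
not forgotten at a useful rate when \<open>gamma\<close> and \<open>tau\<close> are small, but by \<open>leaky_sum\<close> they contribute no more than a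
constant per iteration.  Finally, the sum of squared gradients runs up to \<open>K\<close> whereas only \<open>K\<close> decrements of the
Lyapunov function are available; the surplus gradient is covered by a multiple of the squared gradient in the
potential (\<open>telescoped\<close>, \<open>step_size_choice\<close>).\<close>

section \<open>Maps that are Lipschitz up to small jumps\<close>

text \<open>A quantitative form of uniform continuity: a jump of any prescribed size \<open>\<eta>\<close> is tolerated, at the price
of a slope \<open>C / \<eta>\<close>.  Every Lipschitz map has this property, and so does every Hoelder-1/2 map.  The
explicit dependence on \<open>\<eta>\<close> matters later, where \<open>\<eta>\<close> is set to the momentum parameter.\<close>

definition almost_lipschitz :: "('a::real_normed_vector \<Rightarrow> 'b::real_normed_vector) \<Rightarrow> bool" where
  "almost_lipschitz F \<longleftrightarrow> (\<exists>C\<ge>0. \<forall>\<eta>. 0 < \<eta> \<longrightarrow> \<eta> \<le> 1 \<longrightarrow>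
     (\<forall>x y. norm (F x - F y) \<le> \<eta> + C / \<eta> * norm (x - y)))"

text \<open>Rescaling \<open>\<eta>\<close> shows that a constant factor in front of the tolerated jump is harmless; all closure
properties below rest on this.\<close>

lemma almost_lipschitzI:
  assumes K: "K \<ge> 0" and C: "C \<ge> 0"
    and le: "\<And>\<eta> x y. 0 < \<eta> \<Longrightarrow> \<eta> \<le> 1 \<Longrightarrow> norm (F x - F y) \<le> K * \<eta> + C / \<eta> * norm (x - y)"
  shows "almost_lipschitz F"
  unfolding almost_lipschitz_def
proof (intro exI conjI allI impI)
  show "0 \<le> C * (K + 1)" using K C by simp
  fix \<eta> :: real and x y assume \<eta>: "0 < \<eta>" "\<eta> \<le> 1"
  define \<delta> where "\<delta> = \<eta> / (K + 1)"
  have d: "0 < \<delta>" "\<delta> \<le> 1" using \<eta> K by (auto simp: \<delta>_def field_simps)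
  have "norm (F x - F y) \<le> K * \<delta> + C / \<delta> * norm (x - y)" by (rule le[OF d])
  moreover have "K * \<delta> \<le> \<eta>" using K \<eta> by (auto simp: \<delta>_def field_simps)
  moreover have "C / \<delta> = C * (K + 1) / \<eta>" by (simp add: \<delta>_def)
  ultimately show "norm (F x - F y) \<le> \<eta> + C * (K + 1) / \<eta> * norm (x - y)" by simp
qed

lemma almost_lipschitz_continuous:
  assumes "almost_lipschitz F"
  shows "continuous_on UNIV F"
proof -
  obtain C where C: "C \<ge> 0" and le: "\<And>\<eta> x y. 0 < \<eta> \<Longrightarrow> \<eta> \<le> 1 \<Longrightarrow> norm (F x - F y) \<le> \<eta> + C / \<eta> * norm (x - y)"
    using assms unfolding almost_lipschitz_def by blast
  show ?thesis unfolding continuous_on_iff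
  proof (intro ballI allI impI)
    fix x :: 'a and e :: real assume e: "0 < e"
    define \<eta> where "\<eta> = min 1 (e/2)"
    have \<eta>: "0 < \<eta>" "\<eta> \<le> 1" "\<eta> \<le> e/2" using e by (auto simp: \<eta>_def)
    show "\<exists>d>0. \<forall>y\<in>UNIV. dist y x < d \<longrightarrow> dist (F y) (F x) < e"
    proof (intro exI conjI ballI impI)
      show "0 < (e/2) / (C / \<eta> + 1)" using e C \<eta> by (intro divide_pos_pos add_nonneg_pos) auto
      fix y assume "dist y x < (e/2) / (C / \<eta> + 1)"
      moreover have "0 < C / \<eta> + 1" using C \<eta> by (intro add_nonneg_pos) auto
      ultimately have "(C / \<eta> + 1) * norm (y - x) < e/2"
        by (subst (asm) pos_less_divide_eq) (auto simp: dist_norm mult.commute)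
      moreover have "C / \<eta> * norm (y - x) \<le> (C / \<eta> + 1) * norm (y - x)"
        by (intro mult_right_mono) auto
      ultimately show "dist (F y) (F x) < e"
        using le[OF \<eta>(1,2), of y x] \<eta>(3) by (simp add: dist_norm)
    qed
  qed
qed

lemma almost_lipschitz_add:
  assumes "almost_lipschitz F" "almost_lipschitz H"
  shows "almost_lipschitz (\<lambda>x. F x + H x)"
proof -
  obtain C where C: "C \<ge> 0" "\<And>\<eta> x y. 0 < \<eta> \<Longrightarrow> \<eta> \<le> 1 \<Longrightarrow> norm (F x - F y) \<le> \<eta> + C / \<eta> * norm (x - y)"
    using assms(1) unfolding almost_lipschitz_def by blast
  obtain B where B: "B \<ge> 0" "\<And>\<eta> x y. 0 < \<eta> \<Longrightarrow> \<eta> \<le> 1 \<Longrightarrow> norm (H x - H y) \<le> \<eta> + B / \<eta> * norm (x - y)"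
    using assms(2) unfolding almost_lipschitz_def by blast
  show ?thesis
  proof (rule almost_lipschitzI[of 2 "C + B"])
    fix \<eta> :: real and x y assume \<eta>: "0 < \<eta>" "\<eta> \<le> 1"
    have "norm (F x + H x - (F y + H y)) \<le> norm (F x - F y) + norm (H x - H y)"
      using norm_triangle_ineq[of "F x - F y" "H x - H y"] by (simp add: algebra_simps)
    then show "norm (F x + H x - (F y + H y)) \<le> 2 * \<eta> + (C + B) / \<eta> * norm (x - y)"
      using C(2)[OF \<eta>, of x y] B(2)[OF \<eta>, of x y] by (simp add: add_divide_distrib algebra_simps)
  qed (use C B in auto)
qed

lemma almost_lipschitz_scaleR:
  assumes "almost_lipschitz F"
  shows "almost_lipschitz (\<lambda>x. c *\<^sub>R F x)"
proof -
  obtain C where C: "C \<ge> 0" "\<And>\<eta> x y. 0 < \<eta> \<Longrightarrow> \<eta> \<le> 1 \<Longrightarrow> norm (F x - F y) \<le> \<eta> + C / \<eta> * norm (x - y)"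
    using assms unfolding almost_lipschitz_def by blast
  show ?thesis
  proof (rule almost_lipschitzI[of "\<bar>c\<bar>" "\<bar>c\<bar> * C"])
    fix \<eta> :: real and x y assume \<eta>: "0 < \<eta>" "\<eta> \<le> 1"
    have "norm (c *\<^sub>R F x - c *\<^sub>R F y) = \<bar>c\<bar> * norm (F x - F y)"
      by (simp flip: scaleR_diff_right)
    also have "\<dots> \<le> \<bar>c\<bar> * (\<eta> + C / \<eta> * norm (x - y))"
      by (intro mult_left_mono C(2)[OF \<eta>]) auto
    finally show "norm (c *\<^sub>R F x - c *\<^sub>R F y) \<le> \<bar>c\<bar> * \<eta> + \<bar>c\<bar> * C / \<eta> * norm (x - y)"
      by (simp add: algebra_simps)
  qed (use C in auto)
qed

lemma almost_lipschitz_sum: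
  assumes "finite I" "\<And>i. i \<in> I \<Longrightarrow> almost_lipschitz (F i)"
  shows "almost_lipschitz (\<lambda>x. \<Sum>i\<in>I. F i x)"
  using assms
proof (induction I)
  case empty
  show ?case by (simp, rule almost_lipschitzI[of 0 0]) auto
next
  case (insert i I)
  then show ?case by (simp add: almost_lipschitz_add)
qed

lemma gradient_linear_approximation:
  fixes F :: "'a::euclidean_space \<Rightarrow> real"
  assumes D: "\<And>z. GDERIV F z :> D z"
    and B: "\<And>z. norm (z - x) \<le> norm h \<Longrightarrow> norm (D z - D x) \<le> B"
  shows "\<bar>F (x + h) - F x - D x \<bullet> h\<bar> \<le> B * norm h"
proof -
  have "norm ((F (x + h) - (x + h) \<bullet> D x) - (F x - x \<bullet> D x)) \<le> B * norm ((x + h) - x)"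
  proof (rule differentiable_bound[where S = "cball x (norm h)" and f' = "\<lambda>z k. k \<bullet> D z - k \<bullet> D x"])
    fix z assume z: "z \<in> cball x (norm h)"
    have "(F has_derivative (\<lambda>k. k \<bullet> D z)) (at z within cball x (norm h))"
      using D[of z] unfolding gderiv_def by (rule has_derivative_at_withinI)
    then show "((\<lambda>z. F z - z \<bullet> D x) has_derivative (\<lambda>k. k \<bullet> D z - k \<bullet> D x)) (at z within cball x (norm h))"
      by (auto intro!: derivative_eq_intros)
    show "onorm (\<lambda>k. k \<bullet> D z - k \<bullet> D x) \<le> B"
    proof (rule onorm_le)
      fix k
      have "norm (k \<bullet> D z - k \<bullet> D x) \<le> norm k * norm (D z - D x)"
        using Cauchy_Schwarz_ineq2[of k "D z - D x"] by (simp add: inner_diff_right)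
      also have "\<dots> \<le> norm k * B" using z B[of z] by (intro mult_left_mono) (auto simp: dist_norm norm_minus_commute)
      finally show "norm (k \<bullet> D z - k \<bullet> D x) \<le> B * norm k" by (simp add: mult.commute)
    qed
  qed (auto simp: dist_norm)
  then show ?thesis by (simp add: inner_add_left inner_commute algebra_simps)
qed

text \<open>Tests a vector against all directions of one fixed length; the length is the free scale that the
estimates on mixed differences optimise over.\<close>

lemma norm_le_via_inner:
  fixes w :: "'a::real_inner"
  assumes "e > 0" "\<And>h. norm h = e \<Longrightarrow> w \<bullet> h \<le> B" "B \<ge> 0"
  shows "norm w * e \<le> B"
proof (cases "w = 0")
  case False
  have "w \<bullet> ((e / norm w) *\<^sub>R w) \<le> B" using False assms by (intro assms(2)) simp
  then show ?thesis using False by (simp add: power2_norm_eq_inner[symmetric] power2_eq_square mult.commute)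
qed (use assms in auto)

section \<open>Separately smooth objectives\<close>

text \<open>Here \<open>sol\<close> stands for the minimiser map of the inner problem.  The gradient in each variable is
Lipschitz only in that same variable, so the mixed derivative of \<open>f\<close> may be unbounded.\<close>

locale outer_objective =
  fixes f :: "'a::euclidean_space \<Rightarrow> 'b::euclidean_space \<Rightarrow> real"
    and fx :: "'a \<Rightarrow> 'b \<Rightarrow> 'a" and ft :: "'a \<Rightarrow> 'b \<Rightarrow> 'b" and sol :: "'a \<Rightarrow> 'b"
    and Lx Lt Cf l :: real
  assumes grad_fx: "\<And>x t. GDERIV (\<lambda>u. f u t) x :> fx x t"
    and grad_ft: "\<And>x t. GDERIV (\<lambda>s. f x s) t :> ft x t"
    and nonneg: "Lx \<ge> 0" "Lt \<ge> 0" "Cf \<ge> 0" "l \<ge> 0"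
    and fx_lipschitz: "\<And>x y t. norm (fx x t - fx y t) \<le> Lx * norm (x - y)"
    and ft_lipschitz: "\<And>x s t. norm (ft x s - ft x t) \<le> Lt * norm (s - t)"
    and ft_bounded: "\<And>x. norm (ft x (sol x)) \<le> Cf"
    and sol_lipschitz: "\<And>x y. norm (sol x - sol y) \<le> l * norm (x - y)"
begin

lemma ft_growth: "norm (ft x t) \<le> Cf + Lt * norm (t - sol x)"
proof -
  have "norm (ft x t) \<le> norm (ft x (sol x)) + norm (ft x t - ft x (sol x))"
    using norm_triangle_ineq[of "ft x (sol x)" "ft x t - ft x (sol x)"] by simp
  then show ?thesis using ft_bounded[of x] ft_lipschitz[of x t "sol x"] by linarith
qed

text \<open>The second difference of \<open>f\<close> over the parallelogram spanned by \<open>h\<close> and \<open>k\<close> can be computed in two orders.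
Each order needs a first-order expansion in one variable only, hence only the separate Lipschitz
constants, and comparing the two transfers information between the partial gradients.\<close>

lemma mixed_difference:
  "\<bar>(fx x (t + k) - fx x t) \<bullet> h - (ft (x + h) t - ft x t) \<bullet> k\<bar>
     \<le> 2 * Lx * (norm h)\<^sup>2 + 2 * Lt * (norm k)\<^sup>2"
proof -
  have X: "\<bar>f (x + h) s - f x s - fx x s \<bullet> h\<bar> \<le> Lx * (norm h)\<^sup>2" for s
  proof -
    have "\<bar>f (x + h) s - f x s - fx x s \<bullet> h\<bar> \<le> (Lx * norm h) * norm h"
    proof (rule gradient_linear_approximation[OF grad_fx])
      fix z assume "norm (z - x) \<le> norm h"
      then have "Lx * norm (z - x) \<le> Lx * norm h" using nonneg by (intro mult_left_mono) auto
      then show "norm (fx z s - fx x s) \<le> Lx * norm h" using fx_lipschitz[of z s x] by linarith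
    qed
    then show ?thesis by (simp add: power2_eq_square mult.assoc)
  qed
  have T: "\<bar>f u (t + k) - f u t - ft u t \<bullet> k\<bar> \<le> Lt * (norm k)\<^sup>2" for u
  proof -
    have "\<bar>f u (t + k) - f u t - ft u t \<bullet> k\<bar> \<le> (Lt * norm k) * norm k"
    proof (rule gradient_linear_approximation[OF grad_ft])
      fix z assume "norm (z - t) \<le> norm k"
      then have "Lt * norm (z - t) \<le> Lt * norm k" using nonneg by (intro mult_left_mono) auto
      then show "norm (ft u z - ft u t) \<le> Lt * norm k" using ft_lipschitz[of u z t] by linarith
    qed
    then show ?thesis by (simp add: power2_eq_square mult.assoc)
  qed
  show ?thesis
    using X[of "t + k"] X[of t] T[of "x + h"] T[of x]
    by (simp add: inner_diff_left)
qed

text \<open>The slope that survives in the variation bounds below after the scale has been chosen.\<close>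

definition K where "K = 2 * Lx + 2 * Lt + Lt * l"

lemma K_nonneg: "K \<ge> 0"
  using nonneg by (simp add: K_def)

text \<open>Near the solution curve \<open>ft\<close> is bounded, so the mixed difference with a step \<open>h\<close> of length \<open>\<eta>\<close> bounds the
change of \<open>fx\<close> by \<open>norm k / \<eta>\<close> plus an error linear in \<open>\<eta>\<close>.  Displacements longer than \<open>\<eta>\<close> are treated
with their own length as the scale.\<close>

lemma fx_variation:
  assumes "\<eta> > 0"
  shows "norm (fx x (sol x + k) - fx x (sol x)) \<le> 2 * Lx * \<eta> + (2 * Cf / \<eta> + K) * norm k"
proof -
  \<comment> \<open>The mixed difference with a step of arbitrary length \<open>e\<close>, to be chosen as \<open>\<eta>\<close> or \<open>norm k\<close>.\<close>
  have main: "norm (fx x (sol x + k) - fx x (sol x)) * e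
      \<le> norm k * (2 * Cf + Lt * l * e) + 2 * Lx * e\<^sup>2 + 2 * Lt * (norm k)\<^sup>2" (is "_ \<le> ?B") if e: "e > 0" for e
  proof (rule norm_le_via_inner[OF e])
    fix h :: 'a assume h: "norm h = e"
    have "norm (ft (x + h) (sol x) - ft x (sol x)) \<le> norm (ft (x + h) (sol x)) + norm (ft x (sol x))"
      by (rule norm_triangle_ineq4)
    also have "\<dots> \<le> (Cf + Lt * norm (sol x - sol (x + h))) + Cf"
      using ft_growth[of "x + h" "sol x"] ft_bounded[of x] by linarith
    also have "Lt * norm (sol x - sol (x + h)) \<le> Lt * (l * e)"
      using sol_lipschitz[of x "x + h"] h nonneg by (intro mult_left_mono) auto
    finally have 1: "norm (ft (x + h) (sol x) - ft x (sol x)) \<le> 2 * Cf + Lt * l * e" by (simp add: mult.assoc)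
    have "(ft (x + h) (sol x) - ft x (sol x)) \<bullet> k \<le> norm (ft (x + h) (sol x) - ft x (sol x)) * norm k"
      by (rule norm_cauchy_schwarz)
    also have "\<dots> \<le> (2 * Cf + Lt * l * e) * norm k" using 1 by (intro mult_right_mono) auto
    finally show "(fx x (sol x + k) - fx x (sol x)) \<bullet> h \<le> ?B"
      using mixed_difference[of x "sol x" k h] h by (simp add: mult.commute)
  next
    show "0 \<le> ?B" using nonneg e by auto
  qed
  show ?thesis
  proof (cases "norm k \<le> \<eta>")
    case True
    have "norm k * norm k \<le> norm k * \<eta>" using True by (intro mult_left_mono) auto
    then have "2 * Lt * (norm k)\<^sup>2 \<le> 2 * Lt * (norm k * \<eta>)"
      using nonneg by (intro mult_left_mono) (auto simp: power2_eq_square)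
    moreover have "0 \<le> Lx * norm k * \<eta>" using nonneg assms by auto
    ultimately have "norm (fx x (sol x + k) - fx x (sol x)) * \<eta>
        \<le> (2 * Lx * \<eta> + (2 * Cf / \<eta> + K) * norm k) * \<eta>"
      using main[OF assms] assms by (simp add: K_def algebra_simps power2_eq_square)
    then show ?thesis using assms by simp
  next
    case False
    then have k: "norm k > 0" "norm k \<ge> \<eta>" using assms by auto
    have "norm (fx x (sol x + k) - fx x (sol x)) * norm k
        \<le> (2 * Cf + K * norm k) * norm k"
      using main[OF k(1)] by (simp add: K_def algebra_simps power2_eq_square)
    then have "norm (fx x (sol x + k) - fx x (sol x)) \<le> 2 * Cf + K * norm k" using k by simp
    moreover have "2 * Cf * 1 \<le> 2 * Cf * (norm k / \<eta>)"
      using k assms nonneg by (intro mult_left_mono) (auto simp: field_simps)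
    moreover have "0 \<le> 2 * Lx * \<eta>" using nonneg assms by simp
    ultimately show ?thesis by (simp add: algebra_simps)
  qed
qed

text \<open>The same argument with the two variables exchanged; the bound on the change of \<open>fx\<close> that it needs is
the one just proved.\<close>

lemma ft_variation:
  assumes "\<eta> > 0"
  shows "norm (ft (x + h) (sol x) - ft x (sol x)) \<le> 2 * Lt * \<eta> + (2 * Cf / \<eta> + 4 * Lx + K) * norm h"
proof (cases "norm h \<le> \<eta>")
  case True
  have "norm (ft (x + h) (sol x) - ft x (sol x)) * \<eta>
      \<le> norm h * (2 * Cf + (2 * Lx + K) * \<eta>) + 2 * Lx * (norm h)\<^sup>2 + 2 * Lt * \<eta>\<^sup>2" (is "_ \<le> ?B")
  proof (rule norm_le_via_inner[OF assms])
    fix k :: 'b assume k: "norm k = \<eta>"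
    have 1: "norm (fx x (sol x + k) - fx x (sol x)) \<le> 2 * Cf + (2 * Lx + K) * \<eta>"
      using fx_variation[OF assms, of x k] k assms by (simp add: algebra_simps)
    have "(fx x (sol x + k) - fx x (sol x)) \<bullet> h \<le> norm (fx x (sol x + k) - fx x (sol x)) * norm h"
      by (rule norm_cauchy_schwarz)
    also have "\<dots> \<le> (2 * Cf + (2 * Lx + K) * \<eta>) * norm h" using 1 by (intro mult_right_mono) auto
    finally show "(ft (x + h) (sol x) - ft x (sol x)) \<bullet> k \<le> ?B"
      using mixed_difference[of x "sol x" k h] k by (simp add: mult.commute)
  next
    show "0 \<le> ?B" using nonneg assms K_nonneg by auto
  qed
  moreover have "norm h * norm h \<le> norm h * \<eta>" using True by (intro mult_left_mono) auto
  then have "2 * Lx * (norm h)\<^sup>2 \<le> 2 * Lx * (norm h * \<eta>)"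
    using nonneg by (intro mult_left_mono) (auto simp: power2_eq_square)
  ultimately have "norm (ft (x + h) (sol x) - ft x (sol x)) * \<eta>
      \<le> (2 * Lt * \<eta> + (2 * Cf / \<eta> + 4 * Lx + K) * norm h) * \<eta>"
    using assms by (simp add: algebra_simps power2_eq_square)
  then show ?thesis using assms by simp
next
  case False
  have "norm (ft (x + h) (sol x) - ft x (sol x)) \<le> norm (ft (x + h) (sol x)) + norm (ft x (sol x))"
    by (rule norm_triangle_ineq4)
  also have "\<dots> \<le> (Cf + Lt * norm (sol x - sol (x + h))) + Cf"
    using ft_growth[of "x + h" "sol x"] ft_bounded[of x] by linarith
  also have "Lt * norm (sol x - sol (x + h)) \<le> Lt * (l * norm h)"
    using sol_lipschitz[of x "x + h"] nonneg by (intro mult_left_mono) auto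
  finally have 1: "norm (ft (x + h) (sol x) - ft x (sol x)) \<le> 2 * Cf + Lt * l * norm h" by (simp add: mult.assoc)
  have 2: "2 * Cf * 1 \<le> 2 * Cf * (norm h / \<eta>)"
    using False assms nonneg by (intro mult_left_mono) (auto simp: field_simps)
  have 3: "0 \<le> 2 * Lt * \<eta>" "0 \<le> Lx * norm h" "0 \<le> Lt * norm h" using nonneg assms by auto
  show ?thesis using 1 2 3 by (simp add: K_def algebra_simps)
qed

lemma fx_sol_almost_lipschitz: "almost_lipschitz (\<lambda>x. fx x (sol x))"
proof (rule almost_lipschitzI[of "2 * Lx" "(2 * Cf + K) * l + Lx"])
  fix \<eta> :: real and x y :: 'a assume \<eta>: "0 < \<eta>" "\<eta> \<le> 1"
  have "norm (fx x (sol x) - fx y (sol y))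
      \<le> norm (fx x (sol x + (sol y - sol x)) - fx x (sol x)) + norm (fx x (sol y) - fx y (sol y))"
    using norm_triangle_ineq4[of "fx x (sol x) - fx x (sol y)" "fx y (sol y) - fx x (sol y)"]
    by (simp add: norm_minus_commute)
  also have "\<dots> \<le> 2 * Lx * \<eta> + (2 * Cf / \<eta> + K) * norm (sol y - sol x) + Lx * norm (x - y)"
    using fx_variation[OF \<eta>(1), of x "sol y - sol x"] fx_lipschitz[of x "sol y" y] by linarith
  also have "(2 * Cf / \<eta> + K) * norm (sol y - sol x) \<le> ((2 * Cf + K) / \<eta>) * (l * norm (x - y))"
  proof (rule mult_mono)
    have "K \<le> K / \<eta>" using K_nonneg \<eta> by (simp add: le_divide_eq mult_left_le)
    then show "2 * Cf / \<eta> + K \<le> (2 * Cf + K) / \<eta>" by (simp add: add_divide_distrib)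
    show "norm (sol y - sol x) \<le> l * norm (x - y)" using sol_lipschitz[of y x] by (simp add: norm_minus_commute)
  qed (use K_nonneg \<eta> nonneg in auto)
  also have "Lx * norm (x - y) \<le> Lx / \<eta> * norm (x - y)"
    using nonneg \<eta> by (intro mult_right_mono) (auto simp: le_divide_eq mult_left_le)
  finally show "norm (fx x (sol x) - fx y (sol y)) \<le> 2 * Lx * \<eta> + ((2 * Cf + K) * l + Lx) / \<eta> * norm (x - y)"
    by (simp add: add_divide_distrib algebra_simps)
qed (use nonneg K_nonneg in auto)

lemma ft_sol_almost_lipschitz: "almost_lipschitz (\<lambda>x. ft x (sol x))"
proof (rule almost_lipschitzI[of "2 * Lt" "2 * Cf + 4 * Lx + K + Lt * l"])
  fix \<eta> :: real and x y :: 'a assume \<eta>: "0 < \<eta>" "\<eta> \<le> 1"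
  have "norm (ft x (sol x) - ft y (sol y))
      \<le> norm (ft (x + (y - x)) (sol x) - ft x (sol x)) + norm (ft y (sol x) - ft y (sol y))"
    using norm_triangle_ineq4[of "ft x (sol x) - ft y (sol x)" "ft y (sol y) - ft y (sol x)"]
    by (simp add: norm_minus_commute)
  also have "\<dots> \<le> 2 * Lt * \<eta> + (2 * Cf / \<eta> + 4 * Lx + K) * norm (y - x) + Lt * norm (sol x - sol y)"
    using ft_variation[OF \<eta>(1), of x "y - x"] ft_lipschitz[of y "sol x" "sol y"] by linarith
  also have "Lt * norm (sol x - sol y) \<le> Lt * (l * norm (x - y))"
    using nonneg sol_lipschitz by (intro mult_left_mono) auto
  also have "Lt * (l * norm (x - y)) \<le> Lt * l / \<eta> * norm (x - y)"
  proof -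
    have "Lt * l * 1 \<le> Lt * l * (1 / \<eta>)" using nonneg \<eta> by (intro mult_left_mono) auto
    then have "(Lt * l) * norm (x - y) \<le> (Lt * l / \<eta>) * norm (x - y)" by (intro mult_right_mono) auto
    then show ?thesis by (simp add: mult.assoc)
  qed
  also have "(2 * Cf / \<eta> + 4 * Lx + K) * norm (y - x) \<le> (2 * Cf + 4 * Lx + K) / \<eta> * norm (x - y)"
  proof -
    have "(4 * Lx + K) * 1 \<le> (4 * Lx + K) * (1 / \<eta>)" using nonneg K_nonneg \<eta> by (intro mult_left_mono) auto
    then have "2 * Cf / \<eta> + 4 * Lx + K \<le> (2 * Cf + 4 * Lx + K) / \<eta>" by (simp add: add_divide_distrib)
    then have "(2 * Cf / \<eta> + 4 * Lx + K) * norm (x - y) \<le> (2 * Cf + 4 * Lx + K) / \<eta> * norm (x - y)"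
      by (intro mult_right_mono) auto
    then show ?thesis by (simp add: norm_minus_commute)
  qed
  finally show "norm (ft x (sol x) - ft y (sol y))
      \<le> 2 * Lt * \<eta> + (2 * Cf + 4 * Lx + K + Lt * l) / \<eta> * norm (x - y)"
    by (simp add: add_divide_distrib algebra_simps)
qed (use nonneg K_nonneg in auto)

text \<open>Away from the solution curve only this growth bound remains.  It is enough to compare the computed
hypergradient estimate with the true gradient.\<close>

lemma fx_coarse:
  obtains C where "C \<ge> 0"
    "\<And>x t y. norm (fx x t - fx y (sol y)) \<le> C * (1 + norm (x - y) + norm (t - sol y))"
proof -
  obtain B where B: "B \<ge> 0" "\<And>\<eta> x y. 0 < \<eta> \<Longrightarrow> \<eta> \<le> 1 \<Longrightarrow>
      norm (fx x (sol x) - fx y (sol y)) \<le> \<eta> + B / \<eta> * norm (x - y)"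
    using fx_sol_almost_lipschitz unfolding almost_lipschitz_def by blast
  define C where "C = 2 * Lx + 1 + (2 * Cf + K) + (2 * Cf + K) * l + B"
  have nn: "2 * Cf + K \<ge> 0" using nonneg K_nonneg by auto
  then have nl: "(2 * Cf + K) * l \<ge> 0" using nonneg by simp
  show ?thesis
  proof (rule that[of C])
    show "C \<ge> 0" using nonneg B(1) nn nl by (simp add: C_def)
    fix x t y
    have "norm (fx x t - fx y (sol y)) \<le> norm (fx x (sol x + (t - sol x)) - fx x (sol x)) + norm (fx x (sol x) - fx y (sol y))"
      using norm_triangle_ineq[of "fx x t - fx x (sol x)" "fx x (sol x) - fx y (sol y)"] by simp
    also have "\<dots> \<le> 2 * Lx + (2 * Cf + K) * norm (t - sol x) + (1 + B * norm (x - y))"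
      using fx_variation[of 1 x "t - sol x"] B(2)[of 1 x y] by simp
    also have "(2 * Cf + K) * norm (t - sol x) \<le> (2 * Cf + K) * (norm (t - sol y) + l * norm (x - y))"
    proof (intro mult_left_mono nn)
      have "norm (t - sol x) \<le> norm (t - sol y) + norm (sol x - sol y)"
        using norm_triangle_ineq4[of "t - sol y" "sol x - sol y"] by simp
      then show "norm (t - sol x) \<le> norm (t - sol y) + l * norm (x - y)" using sol_lipschitz[of x y] by linarith
    qed
    finally have 1: "norm (fx x t - fx y (sol y)) \<le> (2 * Lx + 1) + (2 * Cf + K) * norm (t - sol y)
        + ((2 * Cf + K) * l + B) * norm (x - y)" by (simp add: algebra_simps)
    have "2 * Lx + 1 \<le> C" "2 * Cf + K \<le> C" "(2 * Cf + K) * l + B \<le> C"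
      unfolding C_def using nonneg nn nl B(1) by linarith+
    then have "(2 * Lx + 1) * 1 \<le> C * 1" "(2 * Cf + K) * norm (t - sol y) \<le> C * norm (t - sol y)"
      "((2 * Cf + K) * l + B) * norm (x - y) \<le> C * norm (x - y)"
      by (auto intro: mult_right_mono)
    then show "norm (fx x t - fx y (sol y)) \<le> C * (1 + norm (x - y) + norm (t - sol y))"
      using 1 by (simp add: algebra_simps)
  qed
qed

end

section \<open>Differentiability of the inner solution\<close>

text \<open>\<open>G\<close> plays the role of the inner gradient in the inner variable, with partial derivatives \<open>GX\<close> and \<open>GT\<close>.
Strong monotonicity makes its zero \<open>sol x\<close> unique and differentiable in \<open>x\<close>.\<close>

locale inner_objective =
  fixes G :: "'a::euclidean_space \<Rightarrow> 'b::euclidean_space \<Rightarrow> 'b"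
    and GX :: "'a \<Rightarrow> 'b \<Rightarrow> 'a \<Rightarrow> 'b" and GT :: "'a \<Rightarrow> 'b \<Rightarrow> 'b \<Rightarrow> 'b" and sol :: "'a \<Rightarrow> 'b"
    and \<mu> C L :: real
  assumes G_derivative: "\<And>x t. ((\<lambda>z. G (fst z) (snd z)) has_derivative
        (\<lambda>z. GX x t (fst z) + GT x t (snd z))) (at (x, t))"
    and constants: "\<mu> > 0" "C \<ge> 0" "L \<ge> 0"
    and strongly_monotone: "\<And>x s t. \<mu> * (norm (t - s))\<^sup>2 \<le> (G x t - G x s) \<bullet> (t - s)"
    and G_sol: "\<And>x. G x (sol x) = 0"
    and GX_bounded: "\<And>x t h. norm (GX x t h) \<le> C * norm h"
    and GX_lipschitz: "\<And>x t y s h. norm (GX x t h - GX y s h) \<le> L * (norm (x - y) + norm (t - s)) * norm h"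
    and GT_lipschitz: "\<And>x t y s h. norm (GT x t h - GT y s h) \<le> L * (norm (x - y) + norm (t - s)) * norm h"
begin

lemma G_derivative_x: "((\<lambda>u. G u t) has_derivative GX x t) (at x)"
proof -
  have 0: "GT x t 0 = 0"
    using linear_0[OF has_derivative_linear[OF G_derivative[of x t]]] GX_bounded[of x t 0] by simp
  have "((\<lambda>u. (u, t)) has_derivative (\<lambda>h. (h, 0))) (at x)"
    by (auto intro!: derivative_eq_intros)
  from has_derivative_compose[OF this G_derivative[of x t]] 0 show ?thesis by simp
qed

lemma G_derivative_t: "(G x has_derivative GT x t) (at t)"
proof -
  have 0: "GX x t 0 = 0" using GX_bounded[of x t 0] by simp
  have "((\<lambda>s. (x, s)) has_derivative (\<lambda>k. (0, k))) (at t)"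
    by (auto intro!: derivative_eq_intros)
  from has_derivative_compose[OF this G_derivative[of x t]] 0 show ?thesis by simp
qed

lemma linear_GX: "linear (GX x t)" and linear_GT: "linear (GT x t)"
  by (rule has_derivative_linear[OF G_derivative_x]) (rule has_derivative_linear[OF G_derivative_t])

lemma G_lipschitz_x: "norm (G x t - G y t) \<le> C * norm (x - y)"
proof (rule differentiable_bound[where S = UNIV and f' = "\<lambda>u. GX u t"])
  show "((\<lambda>u. G u t) has_derivative GX u t) (at u within UNIV)" for u
    using G_derivative_x by simp
  show "onorm (GX u t) \<le> C" for u by (rule onorm_le[OF GX_bounded])
qed auto

definition l where "l = C / \<mu>"

lemma l_nonneg: "l \<ge> 0" using constants by (simp add: l_def)

lemma sol_lipschitz: "norm (sol x - sol y) \<le> l * norm (x - y)"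
proof -
  have "\<mu> * (norm (sol x - sol y))\<^sup>2 \<le> (G x (sol x) - G x (sol y)) \<bullet> (sol x - sol y)"
    by (rule strongly_monotone)
  also have "\<dots> = (G y (sol y) - G x (sol y)) \<bullet> (sol x - sol y)" by (simp add: G_sol)
  also have "\<dots> \<le> norm (G y (sol y) - G x (sol y)) * norm (sol x - sol y)" by (rule norm_cauchy_schwarz)
  also have "\<dots> \<le> (C * norm (x - y)) * norm (sol x - sol y)"
    using G_lipschitz_x[of y "sol y" x] by (intro mult_right_mono) (auto simp: norm_minus_commute)
  finally have "(\<mu> * norm (sol x - sol y)) * norm (sol x - sol y) \<le> (C * norm (x - y)) * norm (sol x - sol y)"
    by (simp add: power2_eq_square mult.assoc)
  then have "\<mu> * norm (sol x - sol y) \<le> C * norm (x - y)"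
    using constants by (cases "sol x = sol y") auto
  then show ?thesis using constants by (simp add: l_def field_simps)
qed

text \<open>Strong monotonicity along the line through \<open>t\<close> in direction \<open>k\<close>, divided by the squared step, in the
limit of a vanishing step.\<close>

lemma GT_coercive: "\<mu> * (norm k)\<^sup>2 \<le> GT x t k \<bullet> k"
proof -
  have "((\<lambda>s::real. t + s *\<^sub>R k) has_derivative (\<lambda>s. s *\<^sub>R k)) (at 0)"
    by (auto intro!: derivative_eq_intros)
  then have "((\<lambda>s. G x (t + s *\<^sub>R k)) has_derivative (\<lambda>s. GT x t (s *\<^sub>R k))) (at 0)"
    by (rule has_derivative_compose) (use G_derivative_t[of x t] in simp)
  then have "((\<lambda>s. G x (t + s *\<^sub>R k) \<bullet> k) has_derivative (\<lambda>s. GT x t (s *\<^sub>R k) \<bullet> k)) (at 0)"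
    by (auto intro!: derivative_eq_intros)
  then have "((\<lambda>s. G x (t + s *\<^sub>R k) \<bullet> k) has_real_derivative (GT x t k \<bullet> k)) (at 0)"
    unfolding has_field_derivative_def by (rule has_derivative_eq_rhs) (auto simp: linear_scale[OF linear_GT])
  then have "((\<lambda>s. (G x (t + s *\<^sub>R k) \<bullet> k - G x t \<bullet> k) / s) \<longlongrightarrow> GT x t k \<bullet> k) (at 0)"
    by (simp add: has_field_derivative_iff)
  moreover have "\<forall>\<^sub>F s in at 0. \<mu> * (norm k)\<^sup>2 \<le> (G x (t + s *\<^sub>R k) \<bullet> k - G x t \<bullet> k) / s"
  proof (rule eventually_mono[OF eventually_neq_at_within[of 0 0]])
    fix s :: real assume s: "s \<noteq> 0"
    have "\<mu> * (norm k)\<^sup>2 * s\<^sup>2 \<le> (G x (t + s *\<^sub>R k) \<bullet> k - G x t \<bullet> k) * s"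
      using strongly_monotone[of "t + s *\<^sub>R k" t x] by (simp add: power_mult_distrib inner_diff_left algebra_simps)
    also have "\<dots> = ((G x (t + s *\<^sub>R k) \<bullet> k - G x t \<bullet> k) / s) * s\<^sup>2"
      using s by (simp add: power2_eq_square)
    finally show "\<mu> * (norm k)\<^sup>2 \<le> (G x (t + s *\<^sub>R k) \<bullet> k - G x t \<bullet> k) / s"
      using s by (subst (asm) mult_le_cancel_right) auto
  qed
  ultimately show ?thesis by (rule tendsto_lowerbound) simp
qed

lemma GT_lower_bound: "\<mu> * norm k \<le> norm (GT x t k)"
proof (cases "k = 0")
  case False
  have "\<mu> * norm k * norm k \<le> norm (GT x t k) * norm k"
    using GT_coercive[of k x t] norm_cauchy_schwarz[of "GT x t k" k] by (simp add: power2_eq_square)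
  then show ?thesis using False by simp
qed simp

lemma bij_GT: "bij (GT x t)"
proof -
  have "inj (GT x t)"
    unfolding linear_injective_0[OF linear_GT]
    using GT_lower_bound[of _ x t] constants by (metis mult_le_0_iff norm_le_zero_iff norm_zero not_le)
  then show ?thesis using linear_injective_imp_surjective[OF linear_GT] by (simp add: bij_def)
qed

text \<open>The derivative of the solution map, obtained by differentiating \<open>G x (sol x) = 0\<close>.\<close>

definition J where "J x h = inv (GT x (sol x)) (- GX x (sol x) h)"

lemma GT_J: "GT x (sol x) (J x h) = - GX x (sol x) h"
  unfolding J_def by (rule surj_f_inv_f[OF bij_is_surj[OF bij_GT]])

lemma J_bounded: "norm (J x h) \<le> l * norm h"
  using GT_lower_bound[of "J x h" x "sol x"] GX_bounded[of x "sol x" h] constants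
  by (simp add: GT_J l_def field_simps)

lemma linear_J: "linear (J x)"
proof (rule linearI)
  have inj: "inj (GT x (sol x))" using bij_GT by (rule bij_is_inj)
  show "J x (a + b) = J x a + J x b" for a b
    by (rule injD[OF inj]) (simp add: GT_J linear_add[OF linear_GT] linear_add[OF linear_GX])
  show "J x (r *\<^sub>R a) = r *\<^sub>R J x a" for r a
    by (rule injD[OF inj]) (simp add: GT_J linear_scale[OF linear_GT] linear_scale[OF linear_GX])
qed

text \<open>Since \<open>sol\<close> is known to be Lipschitz, the first-order expansion of \<open>G\<close> at \<open>(x, sol x)\<close> has an error that is
small compared with \<open>norm (y - x)\<close>; applying the lower bound on \<open>GT\<close> to it gives the expansion of \<open>sol\<close>.\<close>

lemma sol_has_derivative: "(sol has_derivative J x) (at x)"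
  unfolding has_derivative_at_alt
proof (intro conjI allI impI)
  show "bounded_linear (J x)" using linear_J by (simp add: linear_conv_bounded_linear)
  fix e :: real assume e: "0 < e"
  define \<epsilon> where "\<epsilon> = e * \<mu> / (1 + l)"
  have l1: "1 + l > 0" using l_nonneg by simp
  have \<epsilon>: "\<epsilon> > 0" using e constants l1 by (simp add: \<epsilon>_def)
  obtain d where d: "d > 0" and dle: "\<And>z. norm (z - (x, sol x)) < d \<Longrightarrow>
      norm (G (fst z) (snd z) - G x (sol x) - (GX x (sol x) (fst (z - (x, sol x))) + GT x (sol x) (snd (z - (x, sol x)))))
        \<le> \<epsilon> * norm (z - (x, sol x))"
    using G_derivative[of x "sol x"] \<epsilon> unfolding has_derivative_at_alt fst_conv snd_conv by blast
  show "\<exists>d>0. \<forall>y. norm (y - x) < d \<longrightarrow> norm (sol y - sol x - J x (y - x)) \<le> e * norm (y - x)"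
  proof (intro exI conjI allI impI)
    show "d / (1 + l) > 0" using d l1 by simp
    fix y assume y: "norm (y - x) < d / (1 + l)"
    have n: "norm ((y, sol y) - (x, sol x)) \<le> (1 + l) * norm (y - x)"
      using norm_Pair_le[of "y - x" "sol y - sol x"] sol_lipschitz[of y x] by (simp add: algebra_simps)
    also have "\<dots> < d" using y l1 by (simp add: field_simps)
    finally have "norm ((y, sol y) - (x, sol x)) < d" .
    from dle[OF this] have "norm (GX x (sol x) (y - x) + GT x (sol x) (sol y - sol x))
        \<le> \<epsilon> * norm ((y, sol y) - (x, sol x))"
      unfolding fst_conv snd_conv G_sol diff_Pair by (simp only: diff_0 norm_minus_cancel diff_self)
    also have "\<dots> \<le> \<epsilon> * ((1 + l) * norm (y - x))" using n \<epsilon> by (intro mult_left_mono) auto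
    also have "\<dots> = e * \<mu> * norm (y - x)" using l1 by (simp add: \<epsilon>_def)
    also have "GX x (sol x) (y - x) + GT x (sol x) (sol y - sol x) = GT x (sol x) (sol y - sol x - J x (y - x))"
      by (simp add: linear_diff[OF linear_GT] GT_J)
    finally have "\<mu> * norm (sol y - sol x - J x (y - x)) \<le> e * \<mu> * norm (y - x)"
      using GT_lower_bound[of "sol y - sol x - J x (y - x)" x "sol x"] by linarith
    then show "norm (sol y - sol x - J x (y - x)) \<le> e * norm (y - x)"
      using constants by (simp add: mult.commute mult.left_commute)
  qed
qed

lemma J_lipschitz: "norm (J x h - J y h) \<le> L * (1 + l)\<^sup>2 / \<mu> * norm (x - y) * norm h"
proof -
  have r: "norm (x - y) + norm (sol x - sol y) \<le> (1 + l) * norm (x - y)"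
    using sol_lipschitz[of x y] by (simp add: algebra_simps)
  have "\<mu> * norm (J x h - J y h) \<le> norm (GT x (sol x) (J x h - J y h))" by (rule GT_lower_bound)
  also have "GT x (sol x) (J x h - J y h) =
      - (GX x (sol x) h - GX y (sol y) h) - (GT x (sol x) (J y h) - GT y (sol y) (J y h))"
    by (simp add: linear_diff[OF linear_GT] GT_J)
  also have "norm \<dots> \<le> norm (GX x (sol x) h - GX y (sol y) h) + norm (GT x (sol x) (J y h) - GT y (sol y) (J y h))"
    by (metis norm_minus_cancel norm_triangle_ineq4)
  also have "\<dots> \<le> L * ((1 + l) * norm (x - y)) * norm h + L * ((1 + l) * norm (x - y)) * (l * norm h)"
  proof (rule add_mono)
    have "L * (norm (x - y) + norm (sol x - sol y)) * norm h \<le> L * ((1 + l) * norm (x - y)) * norm h"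
      using r constants by (intro mult_right_mono mult_left_mono) auto
    then show "norm (GX x (sol x) h - GX y (sol y) h) \<le> L * ((1 + l) * norm (x - y)) * norm h"
      using GX_lipschitz[of x "sol x" h y "sol y"] by linarith
    have "L * (norm (x - y) + norm (sol x - sol y)) * norm (J y h) \<le> L * ((1 + l) * norm (x - y)) * (l * norm h)"
      using r constants J_bounded[of y h] l_nonneg by (intro mult_mono) auto
    then show "norm (GT x (sol x) (J y h) - GT y (sol y) (J y h)) \<le> L * ((1 + l) * norm (x - y)) * (l * norm h)"
      using GT_lipschitz[of x "sol x" "J y h" y "sol y"] by linarith
  qed
  finally have "\<mu> * norm (J x h - J y h) \<le> L * (1 + l)\<^sup>2 * norm (x - y) * norm h"
    by (simp add: power2_eq_square algebra_simps)
  then show ?thesis using constants by (simp add: field_simps)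
qed

end

locale bilevel = inner_objective G GX GT sol \<mu> C L
    + outer_objective f fx ft sol Lx Lt Cf "C / \<mu>"
  for f :: "'a::euclidean_space \<Rightarrow> 'b::euclidean_space \<Rightarrow> real"
    and fx ft and G :: "'a \<Rightarrow> 'b \<Rightarrow> 'b" and GX GT sol \<mu> C L Lx Lt Cf +
  assumes f_derivative: "\<And>x t. ((\<lambda>z. f (fst z) (snd z)) has_derivative
        (\<lambda>z. fst z \<bullet> fx x t + snd z \<bullet> ft x t)) (at (x, t))"
begin

text \<open>The vector representing the functional \<open>\<lambda>h. J x h \<bullet> ft x (sol x)\<close>: the part of the hypergradient that
comes from moving the inner solution.\<close>

definition adj where "adj x = (\<Sum>b\<in>Basis. (J x b \<bullet> ft x (sol x)) *\<^sub>R b)"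

lemma inner_adj: "h \<bullet> adj x = J x h \<bullet> ft x (sol x)"
proof -
  have "J x h = J x (\<Sum>b\<in>Basis. (h \<bullet> b) *\<^sub>R b)" by (simp add: euclidean_representation)
  also have "\<dots> = (\<Sum>b\<in>Basis. (h \<bullet> b) *\<^sub>R J x b)"
    by (simp add: linear_sum[OF linear_J] linear_scale[OF linear_J])
  finally show ?thesis by (simp add: adj_def inner_sum_left inner_sum_right mult.commute)
qed

lemma adj_bounded: "norm (adj x) \<le> C / \<mu> * Cf"
proof -
  have "norm (adj x) * 1 \<le> C / \<mu> * Cf"
  proof (rule norm_le_via_inner)
    fix h :: 'a assume h: "norm h = 1"
    have "adj x \<bullet> h = J x h \<bullet> ft x (sol x)" by (simp add: inner_adj flip: inner_commute[of h])
    also have "\<dots> \<le> norm (J x h) * norm (ft x (sol x))" by (rule norm_cauchy_schwarz)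
    also have "\<dots> \<le> (l * norm h) * Cf"
      using J_bounded[of x h] ft_bounded l_nonneg by (intro mult_mono) auto
    finally show "adj x \<bullet> h \<le> C / \<mu> * Cf" using h by (simp add: l_def)
  qed (use constants nonneg in auto)
  then show ?thesis by simp
qed

lemma adj_almost_lipschitz: "almost_lipschitz adj"
proof -
  obtain B where B: "B \<ge> 0" "\<And>\<eta> x y. 0 < \<eta> \<Longrightarrow> \<eta> \<le> 1 \<Longrightarrow>
      norm (ft x (sol x) - ft y (sol y)) \<le> \<eta> + B / \<eta> * norm (x - y)"
    using ft_sol_almost_lipschitz unfolding almost_lipschitz_def by blast
  define Q where "Q = L * (1 + l)\<^sup>2 / \<mu>"
  have Q: "Q \<ge> 0" using constants by (simp add: Q_def)
  show ?thesis
  proof (rule almost_lipschitzI[of l "l * B + Q * Cf"])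
    fix \<eta> :: real and x y :: 'a assume \<eta>: "0 < \<eta>" "\<eta> \<le> 1"
    have "norm (adj x - adj y) * 1 \<le> l * \<eta> + (l * B + Q * Cf) / \<eta> * norm (x - y)"
    proof (rule norm_le_via_inner)
      fix h :: 'a assume h: "norm h = 1"
      have "(adj x - adj y) \<bullet> h = h \<bullet> adj x - h \<bullet> adj y" 
        by (simp add: inner_diff_right inner_commute[of _ h])
      also have "\<dots> = J x h \<bullet> (ft x (sol x) - ft y (sol y)) + (J x h - J y h) \<bullet> ft y (sol y)"
        by (simp add: inner_adj inner_diff_left inner_diff_right)
      also have "\<dots> \<le> norm (J x h) * norm (ft x (sol x) - ft y (sol y)) + norm (J x h - J y h) * norm (ft y (sol y))"
        by (intro add_mono norm_cauchy_schwarz)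
      also have "\<dots> \<le> l * (\<eta> + B / \<eta> * norm (x - y)) + (Q * norm (x - y)) * Cf"
      proof (intro add_mono mult_mono)
        show "norm (J x h) \<le> l" using J_bounded[of x h] h by simp
        show "norm (ft x (sol x) - ft y (sol y)) \<le> \<eta> + B / \<eta> * norm (x - y)" by (rule B(2)[OF \<eta>])
        show "norm (J x h - J y h) \<le> Q * norm (x - y)" using J_lipschitz[of x h y] h by (simp add: Q_def)
      qed (use l_nonneg Q ft_bounded in auto)
      also have "(Q * norm (x - y)) * Cf \<le> (Q * Cf) / \<eta> * norm (x - y)"
      proof -
        have "Q * Cf * 1 \<le> Q * Cf * (1 / \<eta>)" using Q nonneg \<eta> by (intro mult_left_mono) auto
        then have "(Q * Cf) * norm (x - y) \<le> (Q * Cf / \<eta>) * norm (x - y)" by (intro mult_right_mono) auto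
        then show ?thesis by (simp add: mult.assoc mult.commute mult.left_commute)
      qed
      finally show "(adj x - adj y) \<bullet> h \<le> l * \<eta> + (l * B + Q * Cf) / \<eta> * norm (x - y)"
        by (simp add: add_divide_distrib algebra_simps)
    qed (use \<eta> B Q l_nonneg nonneg in auto)
    then show "norm (adj x - adj y) \<le> l * \<eta> + (l * B + Q * Cf) / \<eta> * norm (x - y)" by simp
  qed (use B Q l_nonneg nonneg in auto)
qed

text \<open>The chain rule for \<open>x \<mapsto> f x (sol x)\<close>.\<close>

definition hypergrad where "hypergrad x = fx x (sol x) + adj x"

lemma hypergrad_GDERIV: "GDERIV (\<lambda>x. f x (sol x)) x :> hypergrad x"
proof -
  have "((\<lambda>u. (u, sol u)) has_derivative (\<lambda>h. (h, J x h))) (at x)"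
    by (intro has_derivative_Pair has_derivative_ident sol_has_derivative)
  from has_derivative_compose[OF this f_derivative[of x "sol x"]]
  show ?thesis by (simp add: gderiv_def hypergrad_def inner_add_right inner_adj)
qed

lemma hypergrad_almost_lipschitz: "almost_lipschitz hypergrad"
  unfolding hypergrad_def by (intro almost_lipschitz_add fx_sol_almost_lipschitz adj_almost_lipschitz)

end

section \<open>Partial gradients and mixed second derivatives\<close>

lemma GDERIV_unique:
  fixes F :: "'a::euclidean_space \<Rightarrow> real"
  assumes "GDERIV F z :> D" "GDERIV F z :> E"
  shows "D = E"
proof -
  have "(\<lambda>h. h \<bullet> D) = (\<lambda>h. h \<bullet> E)"
    using assms unfolding gderiv_def by (rule has_derivative_unique)
  then have "(D - E) \<bullet> D = (D - E) \<bullet> E" by meson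
  then have "(D - E) \<bullet> (D - E) = 0" by (simp add: inner_diff_right)
  then show ?thesis by simp
qed

lemma gradient_eqI:
  fixes F :: "'a::euclidean_space \<Rightarrow> real"
  assumes "GDERIV F z :> D"
  shows "gradient F z = D"
  unfolding gradient_def using assms GDERIV_unique by blast

lemma gradient_GDERIV:
  fixes F :: "'a::euclidean_space \<Rightarrow> real"
  assumes "F differentiable (at z)"
  shows "GDERIV F z :> gradient F z" "gradient F z = (\<Sum>b\<in>Basis. frechet_derivative F (at z) b *\<^sub>R b)"
proof -
  let ?d = "frechet_derivative F (at z)"
  have d: "(F has_derivative ?d) (at z)" using assms by (simp add: frechet_derivative_works)
  then have lin: "linear ?d" by (rule has_derivative_linear)
  have "?d h = h \<bullet> (\<Sum>b\<in>Basis. ?d b *\<^sub>R b)" for h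
  proof -
    have "?d h = ?d (\<Sum>b\<in>Basis. (h \<bullet> b) *\<^sub>R b)" by (simp add: euclidean_representation)
    also have "\<dots> = (\<Sum>b\<in>Basis. (h \<bullet> b) *\<^sub>R ?d b)"
      by (simp add: linear_sum[OF lin] linear_scale[OF lin])
    finally show ?thesis by (simp add: inner_sum_right mult.commute)
  qed
  then have "?d = (\<lambda>h. h \<bullet> (\<Sum>b\<in>Basis. ?d b *\<^sub>R b))" by blast
  then have *: "GDERIV F z :> (\<Sum>b\<in>Basis. ?d b *\<^sub>R b)" unfolding gderiv_def using d by simp
  then show eq: "gradient F z = (\<Sum>b\<in>Basis. ?d b *\<^sub>R b)" by (rule gradient_eqI)
  show "GDERIV F z :> gradient F z" using * eq by simp
qed

lemma partial_gradients:
  fixes F :: "real^'n \<Rightarrow> real^'p \<Rightarrow> real"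
  assumes "cont_diff (\<lambda>(x, \<theta>). F x \<theta>)"
  shows "gradient (\<lambda>(x, \<theta>). F x \<theta>) (x, t) = (grad_x F x t, grad_t F x t)"
    and "((\<lambda>z. F (fst z) (snd z)) has_derivative
          (\<lambda>z. fst z \<bullet> grad_x F x t + snd z \<bullet> grad_t F x t)) (at (x, t))"
    and "GDERIV (\<lambda>u. F u t) x :> grad_x F x t"
    and "GDERIV (\<lambda>s. F x s) t :> grad_t F x t"
    and "continuous_on UNIV (\<lambda>z. grad_x F (fst z) (snd z))"
    and "continuous_on UNIV (\<lambda>z. grad_t F (fst z) (snd z))"
proof -
  let ?F = "\<lambda>(x, \<theta>). F x \<theta>"
  define P where "P = gradient ?F"
  have diff: "?F differentiable (at z)" for z
    using assms[unfolded cont_diff_def differentiable_on_def] by (metis UNIV_I)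
  have FP: "(?F has_derivative (\<lambda>h. h \<bullet> P z)) (at z)" for z
    using gradient_GDERIV(1)[OF diff[of z]] by (simp add: gderiv_def P_def)
  have x: "GDERIV (\<lambda>u. F u t) x :> fst (P (x, t))" for x t
  proof -
    have "((\<lambda>u. (u, t)) has_derivative (\<lambda>h. (h, 0))) (at x)" by (auto intro!: derivative_eq_intros)
    from has_derivative_compose[OF this FP[of "(x, t)"]] show ?thesis
      by (simp add: gderiv_def inner_prod_def)
  qed
  have t: "GDERIV (\<lambda>s. F x s) t :> snd (P (x, t))" for x t
  proof -
    have "((\<lambda>u. (x, u)) has_derivative (\<lambda>h. (0, h))) (at t)" by (auto intro!: derivative_eq_intros)
    from has_derivative_compose[OF this FP[of "(x, t)"]] show ?thesis
      by (simp add: gderiv_def inner_prod_def)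
  qed
  have gx: "grad_x F x t = fst (P (x, t))" for x t
    unfolding grad_x_def by (rule gradient_eqI[OF x])
  have gt: "grad_t F x t = snd (P (x, t))" for x t
    unfolding grad_t_def by (rule gradient_eqI[OF t])
  show "gradient ?F (x, t) = (grad_x F x t, grad_t F x t)" by (simp add: gx gt P_def)
  show "((\<lambda>z. F (fst z) (snd z)) has_derivative
          (\<lambda>z. fst z \<bullet> grad_x F x t + snd z \<bullet> grad_t F x t)) (at (x, t))"
    using FP[of "(x, t)"] by (simp add: gx gt case_prod_unfold inner_prod_def)
  show "GDERIV (\<lambda>u. F u t) x :> grad_x F x t" using x by (simp add: gx)
  show "GDERIV (\<lambda>s. F x s) t :> grad_t F x t" using t by (simp add: gt)
  have "P = (\<lambda>z. \<Sum>b\<in>Basis. frechet_derivative ?F (at z) b *\<^sub>R b)"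
    unfolding P_def using gradient_GDERIV(2)[OF diff] by blast
  then have "continuous_on UNIV P"
    using assms by (auto intro!: continuous_intros simp: cont_diff_def)
  then show "continuous_on UNIV (\<lambda>z. grad_x F (fst z) (snd z))"
    and "continuous_on UNIV (\<lambda>z. grad_t F (fst z) (snd z))"
    by (auto simp: gx gt intro: continuous_intros)
qed

lemma norm_matrix_vector_le: "norm (A *v u) \<le> spectral_norm A * norm u"
  unfolding spectral_norm_def by (rule onorm) (rule matrix_vector_mul_bounded_linear)

lemma spectral_norm_nonneg: "0 \<le> spectral_norm A"
  unfolding spectral_norm_def by (rule onorm_pos_le) (rule matrix_vector_mul_bounded_linear)

lemma norm_transpose_vector_le: "norm (transpose A *v u) \<le> spectral_norm A * norm u"
proof -
  have "norm (transpose A *v u) * 1 \<le> spectral_norm A * norm u"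
  proof (rule norm_le_via_inner)
    fix h :: "real^'a" assume h: "norm h = 1"
    have "(transpose A *v u) \<bullet> h = u \<bullet> (A *v h)"
      by (metis dot_lmul_matrix transpose_matrix_vector)
    also have "\<dots> \<le> norm u * norm (A *v h)" by (rule norm_cauchy_schwarz)
    also have "\<dots> \<le> norm u * spectral_norm A"
      using norm_matrix_vector_le[of A h] h by (intro mult_left_mono) auto
    finally show "(transpose A *v u) \<bullet> h \<le> spectral_norm A * norm u" by (simp add: mult.commute)
  qed (auto intro: mult_nonneg_nonneg spectral_norm_nonneg)
  then show ?thesis by simp
qed

text \<open>A first-order estimate with a linearly small error factor survives the passage to the derivative.  It
is used twice in a row below, once for each variable of a mixed derivative.\<close>

lemma derivative_estimate:
  fixes \<phi> :: "real \<Rightarrow> real"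
  assumes d: "(\<phi> has_real_derivative d) (at 0)"
    and le: "\<And>r. r > 0 \<Longrightarrow> \<bar>\<phi> r - \<phi> 0 - r * a\<bar> \<le> (A + B * r) * r"
  shows "\<bar>d - a\<bar> \<le> A"
proof -
  have "((\<lambda>r. (\<phi> r - \<phi> 0) / r) \<longlongrightarrow> d) (at_right 0)"
    using d unfolding has_field_derivative_iff by (simp add: filterlim_at_split)
  then have 1: "((\<lambda>r. \<bar>(\<phi> r - \<phi> 0) / r - a\<bar>) \<longlongrightarrow> \<bar>d - a\<bar>) (at_right 0)"
    by (intro tendsto_intros)
  have 2: "((\<lambda>r. A + B * r) \<longlongrightarrow> A + B * 0) (at_right 0)"
    by (intro tendsto_intros)
  have 3: "\<forall>\<^sub>F r in at_right 0. \<bar>(\<phi> r - \<phi> 0) / r - a\<bar> \<le> A + B * r"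
    unfolding eventually_at_right_field
  proof (intro exI conjI allI impI)
    show "(0::real) < 1" by simp
    fix r :: real assume r: "0 < r"
    have "(\<phi> r - \<phi> 0) / r - a = (\<phi> r - \<phi> 0 - r * a) / r"
      using r by (simp add: diff_divide_distrib)
    then have "\<bar>(\<phi> r - \<phi> 0) / r - a\<bar> = \<bar>\<phi> r - \<phi> 0 - r * a\<bar> / r"
      using r by (simp add: abs_divide)
    also have "\<dots> \<le> (A + B * r) * r / r" using le[OF r] r by (intro divide_right_mono) auto
    finally show "\<bar>(\<phi> r - \<phi> 0) / r - a\<bar> \<le> A + B * r" using r by simp
  qed
  have "\<bar>d - a\<bar> \<le> A + B * 0"
    by (rule tendsto_le[OF trivial_limit_at_right_real 2 1 3])
  then show ?thesis by simp
qed

text \<open>Symmetry of second derivatives in the form needed here: the derivative of the inner gradient in the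
outer variable is the transpose of the matrix \<open>X\<close> of the inner derivative of the outer gradient.  The
mixed second difference over an \<open>s\<close> by \<open>r\<close> parallelogram is expanded with \<open>X\<close> alone; letting first \<open>r\<close> and
then \<open>s\<close> tend to zero turns it into the other mixed derivative.\<close>

lemma mixed_derivative_symmetric:
  fixes g :: "real^'n \<Rightarrow> real^'p \<Rightarrow> real"
  assumes gx: "\<And>x t. GDERIV (\<lambda>u. g u t) x :> gx x t"
    and gt: "\<And>x t. GDERIV (\<lambda>s. g x s) t :> gt x t"
    and X: "\<And>x t. ((\<lambda>s. gx x s) has_derivative (\<lambda>k. X x t *v k)) (at t)"
    and Y: "((\<lambda>u. gt u t) has_derivative Y) (at x)"
    and L: "L \<ge> 0" "\<And>x t y s. spectral_norm (X x t - X y s) \<le> L * norm ((x, t) - (y, s))"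
  shows "Y h = transpose (X x t) *v h"
proof -
  have main: "Y h \<bullet> k = h \<bullet> (X x t *v k)" for k
  proof -
    \<comment> \<open>The mixed second difference, with an error of higher order in both \<open>s\<close> and \<open>r\<close>.\<close>
    have E: "\<bar>(g (x + s *\<^sub>R h) (t + r *\<^sub>R k) - g x (t + r *\<^sub>R k)) - (g (x + s *\<^sub>R h) t - g x t) - r * (s * (h \<bullet> (X x t *v k)))\<bar>
        \<le> (L * s\<^sup>2 * (norm h)\<^sup>2 * norm k + (L * s * norm h * (norm k)\<^sup>2) * r) * r" if rs: "r > 0" "s > 0" for r s
    proof -
      define D where "D u = gx u (t + r *\<^sub>R k) - gx u t - r *\<^sub>R (X x t *v k)" for u
      define B where "B = L * (s * norm h + r * norm k) * (r * norm k)"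
      have Dle: "norm (D u) \<le> B" if u: "norm (u - x) \<le> s * norm h" for u
      proof -
        have "norm ((gx u (t + r *\<^sub>R k) - X x t *v (t + r *\<^sub>R k)) - (gx u t - X x t *v t))
            \<le> (L * (s * norm h + r * norm k)) * norm ((t + r *\<^sub>R k) - t)"
        proof (rule differentiable_bound[where S = "cball t (r * norm k)"
              and f' = "\<lambda>w k. (X u w - X x t) *v k"])
          fix w assume w: "w \<in> cball t (r * norm k)"
          have "(gx u has_derivative (\<lambda>k. X u w *v k)) (at w within cball t (r * norm k))"
            using X by (rule has_derivative_at_withinI)
          moreover have "((\<lambda>w. X x t *v w) has_derivative (\<lambda>k. X x t *v k)) (at w within cball t (r * norm k))"
            by (rule bounded_linear_imp_has_derivative) (rule matrix_vector_mul_bounded_linear)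
          ultimately show "((\<lambda>w. gx u w - X x t *v w) has_derivative (\<lambda>k. (X u w - X x t) *v k))
              (at w within cball t (r * norm k))"
            unfolding matrix_vector_mult_diff_rdistrib by (rule has_derivative_diff)
          have "spectral_norm (X u w - X x t) \<le> L * norm ((u, w) - (x, t))" by (rule L(2))
          also have "\<dots> \<le> L * (s * norm h + r * norm k)"
            using norm_Pair_le[of "u - x" "w - t"] u w L(1)
            by (intro mult_left_mono) (auto simp: dist_norm norm_minus_commute)
          finally show "onorm (\<lambda>k. (X u w - X x t) *v k) \<le> L * (s * norm h + r * norm k)"
            by (simp add: spectral_norm_def)
        qed (use rs in \<open>auto simp: dist_norm\<close>)
        moreover have "(gx u (t + r *\<^sub>R k) - X x t *v (t + r *\<^sub>R k)) - (gx u t - X x t *v t) = D u"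
          by (simp add: D_def matrix_vector_right_distrib matrix_vector_mult_scaleR)
        ultimately show ?thesis using rs by (simp add: B_def)
      qed
      define \<psi> where "\<psi> u = g u (t + r *\<^sub>R k) - g u t - u \<bullet> (r *\<^sub>R (X x t *v k))" for u
      have "norm (\<psi> (x + s *\<^sub>R h) - \<psi> x) \<le> B * norm ((x + s *\<^sub>R h) - x)"
      proof (rule differentiable_bound[where S = "cball x (s * norm h)" and f' = "\<lambda>u h. h \<bullet> D u"])
        fix u assume u: "u \<in> cball x (s * norm h)"
        have "(\<psi> has_derivative (\<lambda>h. h \<bullet> D u)) (at u)"
          unfolding \<psi>_def D_def inner_diff_right
          using gx[of "t + r *\<^sub>R k" u] gx[of t u] unfolding gderiv_def
          by (intro has_derivative_diff bounded_linear_imp_has_derivative bounded_linear_inner_left) auto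
        then show "(\<psi> has_derivative (\<lambda>h. h \<bullet> D u)) (at u within cball x (s * norm h))"
          by (rule has_derivative_at_withinI)
        show "onorm (\<lambda>h. h \<bullet> D u) \<le> B"
        proof (rule onorm_le)
          fix h'
          have "norm (h' \<bullet> D u) \<le> norm h' * norm (D u)" using Cauchy_Schwarz_ineq2[of h' "D u"] by simp
          also have "\<dots> \<le> norm h' * B" using u by (intro mult_left_mono Dle) (auto simp: dist_norm norm_minus_commute)
          finally show "norm (h' \<bullet> D u) \<le> B * norm h'" by (simp add: mult.commute)
        qed
      qed (use rs in \<open>auto simp: dist_norm\<close>)
      then have "\<bar>\<psi> (x + s *\<^sub>R h) - \<psi> x\<bar> \<le> B * (s * norm h)" using rs by simp
      moreover have "B * (s * norm h) = (L * s\<^sup>2 * (norm h)\<^sup>2 * norm k + (L * s * norm h * (norm k)\<^sup>2) * r) * r"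
        by (simp add: B_def power2_eq_square algebra_simps)
      moreover have "\<psi> (x + s *\<^sub>R h) - \<psi> x = (g (x + s *\<^sub>R h) (t + r *\<^sub>R k) - g x (t + r *\<^sub>R k)) - (g (x + s *\<^sub>R h) t - g x t) - r * (s * (h \<bullet> (X x t *v k)))"
        by (simp add: \<psi>_def inner_add_left algebra_simps)
      ultimately show ?thesis by simp
    qed
    \<comment> \<open>Division by \<open>r\<close> and the limit \<open>r \<rightarrow> 0\<close>.\<close>
    have F: "\<bar>(gt (x + s *\<^sub>R h) t - gt x t) \<bullet> k - s * (h \<bullet> (X x t *v k))\<bar> \<le> L * s\<^sup>2 * (norm h)\<^sup>2 * norm k" if s: "s > 0" for s
    proof (rule derivative_estimate)
      have line: "((\<lambda>r::real. t + r *\<^sub>R k) has_derivative (\<lambda>r. r *\<^sub>R k)) (at 0)"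
        by (auto intro!: derivative_eq_intros)
      have "((\<lambda>r. g u (t + r *\<^sub>R k)) has_real_derivative gt u t \<bullet> k) (at 0)" for u
      proof -
        have "(g u has_derivative (\<lambda>h. h \<bullet> gt u t)) (at (t + 0 *\<^sub>R k))"
          using gt[of u t] by (simp add: gderiv_def)
        from has_derivative_compose[OF line this] show ?thesis
          by (simp add: has_field_derivative_def inner_commute mult.commute mult_commute_abs)
      qed
      from DERIV_diff[OF this[of "x + s *\<^sub>R h"] this[of x]]
      show "((\<lambda>r. g (x + s *\<^sub>R h) (t + r *\<^sub>R k) - g x (t + r *\<^sub>R k)) has_real_derivative
          (gt (x + s *\<^sub>R h) t - gt x t) \<bullet> k) (at 0)" by (simp add: inner_diff_left)
      fix r :: real assume "r > 0"
      from E[OF this s] show "\<bar>g (x + s *\<^sub>R h) (t + r *\<^sub>R k) - g x (t + r *\<^sub>R k) -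
           (g (x + s *\<^sub>R h) (t + 0 *\<^sub>R k) - g x (t + 0 *\<^sub>R k)) - r * (s * (h \<bullet> (X x t *v k)))\<bar>
        \<le> (L * s\<^sup>2 * (norm h)\<^sup>2 * norm k + (L * s * norm h * (norm k)\<^sup>2) * r) * r" by simp
    qed
    have "\<bar>Y h \<bullet> k - h \<bullet> (X x t *v k)\<bar> \<le> 0"
    proof (rule derivative_estimate)
      have line: "((\<lambda>s::real. x + s *\<^sub>R h) has_derivative (\<lambda>s. s *\<^sub>R h)) (at 0)"
        by (auto intro!: derivative_eq_intros)
      have "((\<lambda>u. gt u t) has_derivative Y) (at (x + 0 *\<^sub>R h))" using Y by simp
      from has_derivative_compose[OF line this]
      have "((\<lambda>s. gt (x + s *\<^sub>R h) t \<bullet> k) has_derivative (\<lambda>s. Y (s *\<^sub>R h) \<bullet> k)) (at 0)"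
        by (auto intro!: derivative_eq_intros)
      then show "((\<lambda>s. gt (x + s *\<^sub>R h) t \<bullet> k) has_real_derivative Y h \<bullet> k) (at 0)"
        unfolding has_field_derivative_def
        by (rule has_derivative_eq_rhs) (auto simp: linear_scale[OF has_derivative_linear[OF Y]])
      fix s :: real assume s: "s > 0"
      show "\<bar>gt (x + s *\<^sub>R h) t \<bullet> k - gt (x + 0 *\<^sub>R h) t \<bullet> k - s * (h \<bullet> (X x t *v k))\<bar>
          \<le> (0 + (L * (norm h)\<^sup>2 * norm k) * s) * s"
        using F[OF s] by (simp add: inner_diff_left power2_eq_square algebra_simps)
    qed
    then show ?thesis by simp
  qed
  have "Y h \<bullet> k = (transpose (X x t) *v h) \<bullet> k" for k
    using main[of k] by (metis dot_lmul_matrix transpose_matrix_vector)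
  then show ?thesis by (metis vector_eq_rdot)
qed

section \<open>Regularity of the hyperobjective\<close>

lemma strongly_convex_first_order:
  fixes F :: "'a::euclidean_space \<Rightarrow> real"
  assumes sc: "strongly_convex \<mu> F" and D: "GDERIV F s :> D"
  shows "F s + D \<bullet> (t - s) + \<mu> / 2 * (norm (t - s))\<^sup>2 \<le> F t"
proof -
  define N where "N = \<mu> / 2 * (norm (t - s))\<^sup>2"
  have line: "((\<lambda>u::real. s + u *\<^sub>R (t - s)) has_derivative (\<lambda>u. u *\<^sub>R (t - s))) (at 0)"
    by (auto intro!: derivative_eq_intros)
  have "(F has_derivative (\<lambda>h. h \<bullet> D)) (at (s + 0 *\<^sub>R (t - s)))" using D by (simp add: gderiv_def)
  from has_derivative_compose[OF line this]
  have "((\<lambda>u. F (s + u *\<^sub>R (t - s))) has_real_derivative D \<bullet> (t - s)) (at 0)"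
    by (simp add: has_field_derivative_def inner_commute mult_commute_abs)
  then have 1: "((\<lambda>u. (F (s + u *\<^sub>R (t - s)) - F s) / u) \<longlongrightarrow> D \<bullet> (t - s)) (at_right 0)"
    unfolding has_field_derivative_iff by (simp add: filterlim_at_split)
  have 2: "((\<lambda>u. F t - F s - N * (1 - u)) \<longlongrightarrow> F t - F s - N * (1 - 0)) (at_right 0)"
    by (intro tendsto_intros)
  have 3: "\<forall>\<^sub>F u in at_right 0. (F (s + u *\<^sub>R (t - s)) - F s) / u \<le> F t - F s - N * (1 - u)"
    unfolding eventually_at_right_field
  proof (intro exI conjI allI impI)
    show "(0::real) < 1" by simp
    fix u :: real assume u: "0 < u" "u < 1"
    have "s + u *\<^sub>R (t - s) = (1 - u) *\<^sub>R s + u *\<^sub>R t" by (simp add: algebra_simps)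
    then have "F (s + u *\<^sub>R (t - s)) \<le> (1 - u) * F s + u * F t - \<mu> / 2 * u * (1 - u) * (norm (s - t))\<^sup>2"
      using sc u unfolding strongly_convex_def by simp
    then have "F (s + u *\<^sub>R (t - s)) - F s \<le> (F t - F s - N * (1 - u)) * u"
      by (simp add: N_def norm_minus_commute algebra_simps)
    then show "(F (s + u *\<^sub>R (t - s)) - F s) / u \<le> F t - F s - N * (1 - u)"
      using u by (simp add: pos_divide_le_eq)
  qed
  have "D \<bullet> (t - s) \<le> F t - F s - N * (1 - 0)"
    by (rule tendsto_le[OF trivial_limit_at_right_real 2 1 3])
  then show ?thesis by (simp add: N_def)
qed

lemma strongly_convex_monotone:
  fixes F :: "'a::euclidean_space \<Rightarrow> real"
  assumes "strongly_convex \<mu> F" and "\<And>z. GDERIV F z :> D z"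
  shows "\<mu> * (norm (t - s))\<^sup>2 \<le> (D t - D s) \<bullet> (t - s)"
  using strongly_convex_first_order[OF assms(1) assms(2)[of s], of t]
    strongly_convex_first_order[OF assms(1) assms(2)[of t], of s]
  by (simp add: inner_diff_left inner_diff_right norm_minus_commute)

text \<open>Strong convexity makes the function exceed its value at the origin outside a ball, so a minimiser
exists and the choice made by \<open>arg_min\<close> is a genuine minimiser; its gradient vanishes.\<close>

lemma strongly_convex_arg_min:
  fixes F :: "'a::euclidean_space \<Rightarrow> real"
  assumes sc: "strongly_convex \<mu> F" "\<mu> > 0" and D: "\<And>z. GDERIV F z :> D z"
  shows "D (arg_min F (\<lambda>_. True)) = 0"
proof -
  define R where "R = 2 * norm (D 0) / \<mu>"
  have R: "R \<ge> 0" using sc by (simp add: R_def)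
  have "continuous_on (cball 0 R) F"
  proof (rule continuous_at_imp_continuous_on, rule ballI)
    fix x show "isCont F x" using D[of x] unfolding gderiv_def by (rule has_derivative_continuous)
  qed
  then obtain z where z: "z \<in> cball 0 R" "\<And>t. t \<in> cball 0 R \<Longrightarrow> F z \<le> F t"
    using continuous_attains_inf[of "cball 0 R" F] R by auto
  have min: "F z \<le> F t" for t
  proof (cases "t \<in> cball 0 R")
    case False
    then have t: "norm t > R" by simp
    have "F 0 + D 0 \<bullet> t + \<mu> / 2 * (norm t)\<^sup>2 \<le> F t"
      using strongly_convex_first_order[OF sc(1) D[of 0], of t] by simp
    moreover have "- (norm (D 0) * norm t) \<le> D 0 \<bullet> t"
      using Cauchy_Schwarz_ineq2[of "D 0" t] by linarith
    moreover have "norm (D 0) * norm t \<le> \<mu> / 2 * (norm t)\<^sup>2"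
    proof -
      have "norm (D 0) \<le> \<mu> / 2 * norm t" using t sc(2) by (simp add: R_def field_simps)
      then have "norm (D 0) * norm t \<le> (\<mu> / 2 * norm t) * norm t" by (intro mult_right_mono) auto
      then show ?thesis by (simp add: power2_eq_square)
    qed
    moreover have "F z \<le> F 0" using z R by simp
    ultimately show ?thesis by linarith
  qed (use z in auto)
  define m where "m = arg_min F (\<lambda>_. True)"
  have "is_arg_min F (\<lambda>_. True) m"
    unfolding m_def arg_min_def by (rule someI[of _ z]) (use min in \<open>auto simp: is_arg_min_def not_less\<close>)
  then have "F m \<le> F t" for t by (auto simp: is_arg_min_def not_less)
  then have "(\<lambda>h. h \<bullet> D m) = (\<lambda>h. 0)"
    using D[of m] unfolding gderiv_def
    by (intro differential_zero_maxmin[where S = UNIV and f = F and x = m]) auto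
  then have "D m \<bullet> D m = 0" by meson
  then show ?thesis by (simp add: m_def)
qed

lemma lipschitz_derivative_bound:
  fixes F :: "'a::real_normed_vector \<Rightarrow> 'b::real_inner"
  assumes d: "(F has_derivative F') (at z)" and lip: "\<And>x y. norm (F x - F y) \<le> L * norm (x - y)"
  shows "norm (F' h) \<le> L * norm h"
proof -
  define w where "w = F' h"
  have lin: "linear F'" using d by (rule has_derivative_linear)
  have line: "((\<lambda>s::real. z + s *\<^sub>R h) has_derivative (\<lambda>s. s *\<^sub>R h)) (at 0)"
    by (auto intro!: derivative_eq_intros)
  have "(F has_derivative F') (at (z + 0 *\<^sub>R h))" using d by simp
  from has_derivative_compose[OF line this]
  have "((\<lambda>s. F (z + s *\<^sub>R h) \<bullet> w) has_derivative (\<lambda>s. F' (s *\<^sub>R h) \<bullet> w)) (at 0)"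
    by (auto intro!: derivative_eq_intros)
  then have "((\<lambda>s. F (z + s *\<^sub>R h) \<bullet> w) has_real_derivative w \<bullet> w) (at 0)"
    unfolding has_field_derivative_def
    by (rule has_derivative_eq_rhs) (auto simp: linear_scale[OF lin] w_def)
  then have "\<bar>w \<bullet> w - 0\<bar> \<le> L * norm h * norm w"
  proof (rule derivative_estimate)
    fix r :: real assume r: "r > 0"
    have "\<bar>(F (z + r *\<^sub>R h) - F z) \<bullet> w\<bar> \<le> norm (F (z + r *\<^sub>R h) - F z) * norm w"
      by (rule Cauchy_Schwarz_ineq2)
    also have "\<dots> \<le> (L * norm (r *\<^sub>R h)) * norm w"
      using lip[of "z + r *\<^sub>R h" z] by (intro mult_right_mono) auto
    finally show "\<bar>F (z + r *\<^sub>R h) \<bullet> w - F (z + 0 *\<^sub>R h) \<bullet> w - r * 0\<bar> \<le> (L * norm h * norm w + 0 * r) * r"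
      using r by (simp add: inner_diff_left mult_ac)
  qed
  then have "norm w * norm w \<le> (L * norm h) * norm w"
    by (simp add: power2_norm_eq_inner[symmetric] power2_eq_square)
  then show ?thesis using order_trans[OF norm_ge_zero lip[of h 0]] unfolding w_def[symmetric]
    by (cases "w = 0") auto
qed

lemma entry_le_spectral_norm:
  fixes A :: "real^'a^'b"
  shows "\<bar>A $ i $ j\<bar> \<le> spectral_norm A"
proof -
  have "A $ i $ j = (A *v axis j 1) $ i" by (simp add: matrix_vector_mult_basis column_def)
  then have "\<bar>A $ i $ j\<bar> \<le> norm (A *v axis j 1)" using component_le_norm_cart[of "A *v axis j 1" i] by simp
  also have "\<dots> \<le> spectral_norm A" using norm_matrix_vector_le[of A "axis j 1"] by (simp add: norm_axis_1)
  finally show ?thesis .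
qed

lemma spectral_lipschitz_continuous:
  fixes A :: "'z::real_normed_vector \<Rightarrow> real^'a^'b"
  assumes "\<And>z w. spectral_norm (A z - A w) \<le> L * norm (z - w)"
  shows "continuous_on UNIV A"
proof -
  have "continuous_on UNIV (\<lambda>z. A z $ i $ j)" for i j
  proof (rule lipschitz_on_continuous_on[of "max L 0"], rule lipschitz_onI)
    fix z w
    have "\<bar>(A z - A w) $ i $ j\<bar> \<le> L * norm (z - w)"
      using entry_le_spectral_norm[of "A z - A w" i j] assms[of z w] by linarith
    also have "\<dots> \<le> max L 0 * norm (z - w)" by (intro mult_right_mono) auto
    finally show "dist (A z $ i $ j) (A w $ i $ j) \<le> max L 0 * dist z w" by (simp add: dist_norm)
  qed simp
  then have "continuous_on UNIV (\<lambda>z. \<chi> i j. A z $ i $ j)" by (intro continuous_on_vec_lambda)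
  then show ?thesis by (simp add: vec_lambda_eta)
qed

lemma transpose_diff: "transpose (A - B) = transpose A - transpose (B :: real^'a^'b)"
  by (simp add: transpose_def vec_eq_iff)

text \<open>The deterministic assumptions on the outer and inner functions.\<close>

locale problem =
  fixes c :: problem_constants
    and f g :: "'m::finite \<Rightarrow> real^'n \<Rightarrow> real^'p \<Rightarrow> real"
  assumes outer: "outer_functions c f g" and inner: "inner_functions c g"
begin

abbreviation "sol i \<equiv> theta_star (g i)"

lemma C1_f: "cont_diff (\<lambda>(x, \<theta>). f i x \<theta>)" and C1_g: "cont_diff (\<lambda>(x, \<theta>). g i x \<theta>)"
  using outer inner by (auto simp: outer_functions_def inner_functions_def twice_cont_diff_def)

lemma grad_t_g_monotone: "mu_g c * (norm (t - s))\<^sup>2 \<le> (grad_t (g i) x t - grad_t (g i) x s) \<bullet> (t - s)"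
  using inner
  by (intro strongly_convex_monotone[where F = "g i x"] partial_gradients(4)[OF C1_g[of i]])
    (auto simp: inner_functions_def)

lemma grad_t_g_sol: "grad_t (g i) x (sol i x) = 0"
  unfolding theta_star_def using inner
  by (intro strongly_convex_arg_min[where D = "grad_t (g i) x"] partial_gradients(4)[OF C1_g[of i]])
    (auto simp: inner_functions_def)

lemma second_derivatives:
  shows "((\<lambda>z. grad_t (g i) (fst z) (snd z)) has_derivative
      (\<lambda>z. transpose (hess_xt (g i) x t) *v fst z + hess_tt (g i) x t *v snd z)) (at (x, t))"
proof -
  let ?G = "\<lambda>(x, \<theta>). g i x \<theta>"
  let ?P = "gradient ?G"
  define DP where "DP z = frechet_derivative ?P (at z)" for z
  have "?P differentiable (at z)" for z
    using inner unfolding inner_functions_def twice_cont_diff_def cont_diff_def differentiable_on_def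
    by (metis UNIV_I)
  then have P: "(?P has_derivative DP z) (at z)" for z
    unfolding DP_def by (simp add: frechet_derivative_works)
  have Peq: "?P = (\<lambda>z. (grad_x (g i) (fst z) (snd z), grad_t (g i) (fst z) (snd z)))"
  proof
    fix z show "?P z = (grad_x (g i) (fst z) (snd z), grad_t (g i) (fst z) (snd z))"
      using partial_gradients(1)[OF C1_g, of i "fst z" "snd z"] by simp
  qed
  have lin: "linear (DP z)" for z using P by (rule has_derivative_linear)
  have Dx: "((\<lambda>z. grad_x (g i) (fst z) (snd z)) has_derivative (\<lambda>h. fst (DP z h))) (at z)" for z
    using has_derivative_fst[OF P[of z]] by (simp add: Peq)
  have Dt: "((\<lambda>z. grad_t (g i) (fst z) (snd z)) has_derivative (\<lambda>h. snd (DP z h))) (at z)" for z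
    using has_derivative_snd[OF P[of z]] by (simp add: Peq)
  have inx: "((\<lambda>u. (u, t)) has_derivative (\<lambda>h. (h, 0))) (at x)" for x :: "real^'n" and t :: "real^'p"
    by (auto intro!: derivative_eq_intros)
  have int: "((\<lambda>s. (x, s)) has_derivative (\<lambda>k. (0, k))) (at t)" for x :: "real^'n" and t :: "real^'p"
    by (auto intro!: derivative_eq_intros)
  have X: "((\<lambda>s. grad_x (g i) x s) has_derivative (\<lambda>k. hess_xt (g i) x t *v k)) (at t)" for x t
    using has_derivative_compose[OF int Dx] unfolding hess_xt_def jacobian_works[symmetric] differentiable_def
    by auto
  have T: "((\<lambda>s. grad_t (g i) x s) has_derivative (\<lambda>k. hess_tt (g i) x t *v k)) (at t)" for x t
    using has_derivative_compose[OF int Dt] unfolding hess_tt_def jacobian_works[symmetric] differentiable_def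
    by auto
  have Y: "((\<lambda>u. grad_t (g i) u t) has_derivative (\<lambda>h. snd (DP (x, t) (h, 0)))) (at x)"
    using has_derivative_compose[OF inx Dt] by simp
  have 1: "snd (DP (x, t) (h, 0)) = transpose (hess_xt (g i) x t) *v h" for h
    using inner
    by (intro mixed_derivative_symmetric[OF partial_gradients(3)[OF C1_g] partial_gradients(4)[OF C1_g] X Y, where L = "L_gxt c"])
      (auto simp: inner_functions_def less_imp_le)
  have 2: "snd (DP (x, t) (0, k)) = hess_tt (g i) x t *v k" for k
    using has_derivative_unique[OF _ T[of x t]] has_derivative_compose[OF int Dt, of x t] by (simp add: fun_eq_iff)
  have "snd (DP (x, t) z) = transpose (hess_xt (g i) x t) *v fst z + hess_tt (g i) x t *v snd z" for z
    using linear_add[OF lin, of "(x, t)" "(fst z, 0)" "(0, snd z)"] 1[of "fst z"] 2[of "snd z"] by simp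
  then show ?thesis using Dt[of "(x, t)"] by simp
qed

text \<open>The assumptions on the problem make every node an instance of the analysis above, with the transposed
mixed Hessian as derivative of the inner gradient in the outer variable.\<close>

lemma bilevel: "bilevel (f i) (grad_x (f i)) (grad_t (f i)) (grad_t (g i))
    (\<lambda>x t h. transpose (hess_xt (g i) x t) *v h) (\<lambda>x t k. hess_tt (g i) x t *v k) (sol i)
    (mu_g c) (C_gxt c) (L_gxt c + L_gtt c) (L_fx c) (L_ft c) (C_ft c)"
proof -
  have pos: "mu_g c > 0" "C_gxt c > 0" "L_gxt c > 0" "L_gtt c > 0" "L_fx c > 0" "L_ft c > 0" "C_ft c > 0"
    using inner outer by (auto simp: inner_functions_def outer_functions_def)
  have lip: "spectral_norm (hess_xt (g i) x \<theta> - hess_xt (g i) x' \<theta>') \<le> L_gxt c * norm ((x, \<theta>) - (x', \<theta>'))"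
    "spectral_norm (hess_tt (g i) x \<theta> - hess_tt (g i) x' \<theta>') \<le> L_gtt c * norm ((x, \<theta>) - (x', \<theta>'))"
    "spectral_norm (hess_xt (g i) x \<theta>) \<le> C_gxt c" for x \<theta> x' \<theta>'
    using inner by (auto simp: inner_functions_def)
  have pair: "norm ((x, t) - (y, s)) \<le> norm (x - y) + norm (t - s)" for x y :: "real^'n" and t s :: "real^'p"
    by (simp add: norm_Pair_le)
  have wk: "norm w \<le> (L_gxt c + L_gtt c) * (norm (x - y) + norm (t - s)) * norm h"
    if "norm w \<le> N * norm h" "N \<le> L * norm ((x, t) - (y, s))" "0 \<le> L" "L \<le> L_gxt c + L_gtt c"
    for w :: "real^'p" and N L and h :: "'z::real_normed_vector" and x y :: "real^'n" and t s :: "real^'p"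
  proof -
    have "N \<le> (L_gxt c + L_gtt c) * (norm (x - y) + norm (t - s))"
      using that pair[of x t y s] by (intro order_trans[OF that(2)] mult_mono) auto
    then show ?thesis using that(1) mult_right_mono[of N _ "norm h"] order_trans by (metis norm_ge_zero)
  qed
  interpret inner_objective "grad_t (g i)" "\<lambda>x t h. transpose (hess_xt (g i) x t) *v h"
    "\<lambda>x t k. hess_tt (g i) x t *v k" "sol i" "mu_g c" "C_gxt c" "L_gxt c + L_gtt c"
  proof
    show "norm (transpose (hess_xt (g i) x t) *v h) \<le> C_gxt c * norm h" for x t h
      by (rule order_trans[OF norm_transpose_vector_le]) (intro mult_right_mono lip, simp)
    show "norm (transpose (hess_xt (g i) x t) *v h - transpose (hess_xt (g i) y s) *v h)
        \<le> (L_gxt c + L_gtt c) * (norm (x - y) + norm (t - s)) * norm h" for x t y s h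
    proof (rule wk[OF _ lip(1)])
      show "norm (transpose (hess_xt (g i) x t) *v h - transpose (hess_xt (g i) y s) *v h)
        \<le> spectral_norm (hess_xt (g i) x t - hess_xt (g i) y s) * norm h"
        using norm_transpose_vector_le[of "hess_xt (g i) x t - hess_xt (g i) y s" h]
        by (simp only: transpose_diff matrix_vector_mult_diff_rdistrib)
    qed (use pos in auto)
    show "norm (hess_tt (g i) x t *v h - hess_tt (g i) y s *v h)
        \<le> (L_gxt c + L_gtt c) * (norm (x - y) + norm (t - s)) * norm h" for x t y s h
    proof (rule wk[OF _ lip(2)])
      show "norm (hess_tt (g i) x t *v h - hess_tt (g i) y s *v h)
        \<le> spectral_norm (hess_tt (g i) x t - hess_tt (g i) y s) * norm h"
        using norm_matrix_vector_le[of "hess_tt (g i) x t - hess_tt (g i) y s" h]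
        by (simp add: matrix_vector_mult_diff_rdistrib)
    qed (use pos in auto)
  qed (use pos second_derivatives grad_t_g_monotone grad_t_g_sol in auto)
  show ?thesis
  proof
    show "norm (sol i x - sol i y) \<le> C_gxt c / mu_g c * norm (x - y)" for x y
      using sol_lipschitz by (simp add: l_def)
    show "norm (grad_x (f i) x t - grad_x (f i) y t) \<le> L_fx c * norm (x - y)" for x y t
      using outer by (auto simp: outer_functions_def lipschitz_on_def dist_norm)
    show "norm (grad_t (f i) x s - grad_t (f i) x t) \<le> L_ft c * norm (s - t)" for x s t
      using outer by (auto simp: outer_functions_def lipschitz_on_def dist_norm)
    show "norm (grad_t (f i) x (sol i x)) \<le> C_ft c" for x
      using outer by (auto simp: outer_functions_def)
  qed (use pos partial_gradients[OF C1_f] in auto)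
qed

abbreviation "grad_Phi i \<equiv> gradient (Phi_i (f i) (g i))"

lemma positive_constants:
  "mu_g c > 0" "L_gt c > 0" "L_gxt c > 0" "L_gtt c > 0" "C_gxt c > 0" "L_fx c > 0" "L_ft c > 0" "C_ft c > 0"
  using inner outer by (auto simp: inner_functions_def outer_functions_def)

lemma grad_Phi:
  shows grad_Phi_GDERIV: "GDERIV (Phi_i (f i) (g i)) x :> grad_Phi i x"
    and grad_Phi_almost_lipschitz: "almost_lipschitz (grad_Phi i)"
    and grad_Phi_near_grad_x: "norm (grad_Phi i x - grad_x (f i) x (sol i x)) \<le> C_gxt c / mu_g c * C_ft c"
proof -
  interpret b: bilevel "f i" "grad_x (f i)" "grad_t (f i)" "grad_t (g i)"
    "\<lambda>x t h. transpose (hess_xt (g i) x t) *v h" "\<lambda>x t k. hess_tt (g i) x t *v k" "sol i"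
    "mu_g c" "C_gxt c" "L_gxt c + L_gtt c" "L_fx c" "L_ft c" "C_ft c"
    by (rule bilevel)
  have G: "GDERIV (Phi_i (f i) (g i)) x :> b.hypergrad x" for x
    unfolding Phi_i_def using b.hypergrad_GDERIV .
  have eq: "grad_Phi i = b.hypergrad" using gradient_eqI[OF G] by blast
  show "GDERIV (Phi_i (f i) (g i)) x :> grad_Phi i x" using G by (simp add: eq)
  show "almost_lipschitz (grad_Phi i)" using b.hypergrad_almost_lipschitz by (simp add: eq)
  show "norm (grad_Phi i x - grad_x (f i) x (sol i x)) \<le> C_gxt c / mu_g c * C_ft c"
    using b.adj_bounded[of x] unfolding eq b.hypergrad_def by (simp only: add_diff_cancel_left')
qed

lemma grad_x_coarse:
  obtains C where "C \<ge> 0"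
    "\<And>i x t y. norm (grad_x (f i) x t - grad_x (f i) y (sol i y)) \<le> C * (1 + norm (x - y) + norm (t - sol i y))"
proof -
  have "\<exists>C\<ge>0. \<forall>x t y. norm (grad_x (f i) x t - grad_x (f i) y (sol i y)) \<le> C * (1 + norm (x - y) + norm (t - sol i y))" for i
  proof -
    interpret b: bilevel "f i" "grad_x (f i)" "grad_t (f i)" "grad_t (g i)"
      "\<lambda>x t h. transpose (hess_xt (g i) x t) *v h" "\<lambda>x t k. hess_tt (g i) x t *v k" "sol i"
      "mu_g c" "C_gxt c" "L_gxt c + L_gtt c" "L_fx c" "L_ft c" "C_ft c"
      by (rule bilevel)
    show ?thesis using b.fx_coarse by metis
  qed
  then obtain B where B: "\<And>i. B i \<ge> 0"
    "\<And>i x t y. norm (grad_x (f i) x t - grad_x (f i) y (sol i y)) \<le> B i * (1 + norm (x - y) + norm (t - sol i y))"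
    by metis
  show ?thesis
  proof (rule that[of "\<Sum>i\<in>UNIV. B i"])
    show "0 \<le> (\<Sum>i\<in>UNIV. B i)" using B by (intro sum_nonneg) auto
    fix i x t y
    have "B i \<le> (\<Sum>i\<in>UNIV. B i)" using B by (intro member_le_sum) auto
    then have "B i * (1 + norm (x - y) + norm (t - sol i y)) \<le> (\<Sum>i\<in>UNIV. B i) * (1 + norm (x - y) + norm (t - sol i y))"
      by (intro mult_right_mono) auto
    then show "norm (grad_x (f i) x t - grad_x (f i) y (sol i y)) \<le> (\<Sum>i\<in>UNIV. B i) * (1 + norm (x - y) + norm (t - sol i y))"
      using B(2)[of i x t y] by linarith
  qed
qed

lemma grad_t_f_growth: "norm (grad_t (f i) x t) \<le> C_ft c + L_ft c * norm (t - sol i x)"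
  and sol_lipschitz: "norm (sol i x - sol i y) \<le> C_gxt c / mu_g c * norm (x - y)"
  and hess_tt_coercive: "mu_g c * (norm k)\<^sup>2 \<le> (hess_tt (g i) x t *v k) \<bullet> k"
  and hess_tt_lower_bound: "mu_g c * norm k \<le> norm (hess_tt (g i) x t *v k)"
  and grad_t_f_sol_almost_lipschitz: "almost_lipschitz (\<lambda>x. grad_t (f i) x (sol i x))"
  and grad_t_g_derivative: "(grad_t (g i) x has_derivative (\<lambda>k. hess_tt (g i) x t *v k)) (at t)"
proof -
  interpret b: bilevel "f i" "grad_x (f i)" "grad_t (f i)" "grad_t (g i)"
    "\<lambda>x t h. transpose (hess_xt (g i) x t) *v h" "\<lambda>x t k. hess_tt (g i) x t *v k" "sol i"
    "mu_g c" "C_gxt c" "L_gxt c + L_gtt c" "L_fx c" "L_ft c" "C_ft c"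
    by (rule bilevel)
  show "norm (grad_t (f i) x t) \<le> C_ft c + L_ft c * norm (t - sol i x)" by (rule b.ft_growth)
  show "norm (sol i x - sol i y) \<le> C_gxt c / mu_g c * norm (x - y)"
    using b.sol_lipschitz by (simp add: b.l_def)
  show "mu_g c * (norm k)\<^sup>2 \<le> (hess_tt (g i) x t *v k) \<bullet> k" by (rule b.GT_coercive)
  show "mu_g c * norm k \<le> norm (hess_tt (g i) x t *v k)" by (rule b.GT_lower_bound)
  show "almost_lipschitz (\<lambda>x. grad_t (f i) x (sol i x))" by (rule b.ft_sol_almost_lipschitz)
  show "(grad_t (g i) x has_derivative (\<lambda>k. hess_tt (g i) x t *v k)) (at t)" by (rule b.G_derivative_t)
qed

lemma grad_t_g_lipschitz: "norm (grad_t (g i) x s - grad_t (g i) x t) \<le> L_gt c * norm (s - t)"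
  using inner by (auto simp: inner_functions_def lipschitz_on_def dist_norm)

lemma hess_tt_bounded: "norm (hess_tt (g i) x t *v k) \<le> L_gt c * norm k"
  by (rule lipschitz_derivative_bound[OF grad_t_g_derivative grad_t_g_lipschitz])

lemma hess_xt_bounded: "norm (hess_xt (g i) x t *v k) \<le> C_gxt c * norm k"
  by (rule order_trans[OF norm_matrix_vector_le], intro mult_right_mono)
    (use inner in \<open>auto simp: inner_functions_def\<close>)

lemma continuous_gradients:
  "continuous_on UNIV (\<lambda>z. grad_x (f i) (fst z) (snd z))"
  "continuous_on UNIV (\<lambda>z. grad_t (f i) (fst z) (snd z))"
  "continuous_on UNIV (\<lambda>z. grad_t (g i) (fst z) (snd z))"
  "continuous_on UNIV (\<lambda>z. hess_tt (g i) (fst z) (snd z))"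
  "continuous_on UNIV (\<lambda>z. hess_xt (g i) (fst z) (snd z))"
proof -
  show "continuous_on UNIV (\<lambda>z. grad_x (f i) (fst z) (snd z))"
    "continuous_on UNIV (\<lambda>z. grad_t (f i) (fst z) (snd z))"
    "continuous_on UNIV (\<lambda>z. grad_t (g i) (fst z) (snd z))"
    by (intro partial_gradients(5,6)[OF C1_f] partial_gradients(6)[OF C1_g])+
  have "spectral_norm (hess_tt (g i) (fst z) (snd z) - hess_tt (g i) (fst w) (snd w)) \<le> L_gtt c * norm (z - w)" for z w
    using inner unfolding inner_functions_def by (metis prod.collapse)
  then show "continuous_on UNIV (\<lambda>z. hess_tt (g i) (fst z) (snd z))" by (rule spectral_lipschitz_continuous)
  have "spectral_norm (hess_xt (g i) (fst z) (snd z) - hess_xt (g i) (fst w) (snd w)) \<le> L_gxt c * norm (z - w)" for z w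
    using inner unfolding inner_functions_def by (metis prod.collapse)
  then show "continuous_on UNIV (\<lambda>z. hess_xt (g i) (fst z) (snd z))" by (rule spectral_lipschitz_continuous)
qed

lemma hess_v_star: "hess_tt (g i) x (sol i x) *v v_star (f i) (g i) x = grad_t (f i) x (sol i x)"
proof -
  let ?H = "hess_tt (g i) x (sol i x)"
  have "inj ((*v) ?H)"
    unfolding linear_injective_0[OF matrix_vector_mul_linear]
    using hess_tt_lower_bound[of _ i x "sol i x"] positive_constants(1)
    by (metis mult_le_0_iff norm_le_zero_iff norm_zero not_le)
  then have "invertible ?H"
    by (simp add: invertible_left_inverse matrix_left_invertible_injective)
  then have "?H ** matrix_inv ?H = mat 1"
    unfolding invertible_def matrix_inv_def by (rule someI2_ex) simp
  then show ?thesis by (simp add: v_star_def matrix_vector_mul_assoc)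
qed

lemma v_star_bounded: "norm (v_star (f i) (g i) x) \<le> M_const c"
proof -
  have "mu_g c * norm (v_star (f i) (g i) x) \<le> norm (grad_t (f i) x (sol i x))"
    using hess_tt_lower_bound[of "v_star (f i) (g i) x" i x "sol i x"] by (simp add: hess_v_star)
  also have "\<dots> \<le> C_ft c" using outer by (auto simp: outer_functions_def)
  finally show ?thesis using positive_constants(1) by (simp add: M_const_def field_simps)
qed

lemma sol_continuous: "continuous_on UNIV (sol i)"
  by (rule lipschitz_on_continuous_on[of "C_gxt c / mu_g c"], rule lipschitz_onI)
    (use sol_lipschitz positive_constants in \<open>auto simp: dist_norm less_imp_le\<close>)

lemma v_star_continuous: "continuous_on UNIV (v_star (f i) (g i))"
  unfolding continuous_on_def
proof
  fix x
  let ?v = "v_star (f i) (g i)" and ?H = "\<lambda>y. hess_tt (g i) y (sol i y)" and ?b = "\<lambda>y. grad_t (f i) y (sol i y)"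
  have pair: "continuous_on UNIV (\<lambda>y. (y, sol i y))"
    by (intro continuous_intros sol_continuous)
  have H: "continuous_on UNIV ?H"
    using continuous_on_compose2[OF continuous_gradients(4) pair] by simp
  have b: "continuous_on UNIV ?b" by (rule almost_lipschitz_continuous[OF grad_t_f_sol_almost_lipschitz])
  have "((\<lambda>y. (norm (?b y - ?b x) + norm (?H y *v ?v x - ?H x *v ?v x)) / mu_g c)
      \<longlongrightarrow> (norm (?b x - ?b x) + norm (?H x *v ?v x - ?H x *v ?v x)) / mu_g c) (at x)"
  proof -
    have "(?b \<longlongrightarrow> ?b x) (at x)" using b by (simp add: continuous_on_def)
    moreover have "continuous_on UNIV (\<lambda>y. ?H y *v ?v x)"
      unfolding matrix_vector_mult_def by (intro continuous_intros H)
    then have "((\<lambda>y. ?H y *v ?v x) \<longlongrightarrow> ?H x *v ?v x) (at x)" by (simp add: continuous_on_def)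
    ultimately show ?thesis using positive_constants(1) by (intro tendsto_intros) auto
  qed
  then have lim: "((\<lambda>y. (norm (?b y - ?b x) + norm (?H y *v ?v x - ?H x *v ?v x)) / mu_g c) \<longlongrightarrow> 0) (at x)"
    by simp
  have "((\<lambda>y. ?v y - ?v x) \<longlongrightarrow> 0) (at x)"
  proof (rule Lim_null_comparison[OF _ lim])
    show "\<forall>\<^sub>F y in at x. norm (?v y - ?v x) \<le> (norm (?b y - ?b x) + norm (?H y *v ?v x - ?H x *v ?v x)) / mu_g c"
    proof (rule always_eventually, rule allI)
      fix y
      have "mu_g c * norm (?v y - ?v x) \<le> norm (?H y *v (?v y - ?v x))" by (rule hess_tt_lower_bound)
      also have "?H y *v (?v y - ?v x) = (?b y - ?b x) - (?H y *v ?v x - ?H x *v ?v x)"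
        by (simp add: matrix_vector_mult_diff_distrib hess_v_star)
      also have "norm \<dots> \<le> norm (?b y - ?b x) + norm (?H y *v ?v x - ?H x *v ?v x)" by (rule norm_triangle_ineq4)
      finally show "norm (?v y - ?v x) \<le> (norm (?b y - ?b x) + norm (?H y *v ?v x - ?H x *v ?v x)) / mu_g c"
        using positive_constants(1) by (simp add: field_simps)
    qed
  qed
  then show "(?v \<longlongrightarrow> ?v x) (at x within UNIV)" by (simp add: LIM_zero_iff)
qed

text \<open>The gradients of the nodes stay within a bounded distance of each other although each is evaluated at
its own inner solution.  Bounded heterogeneity of the inner gradients bounds the distance of the
inner solutions, and the growth bound on the outer gradient converts this into a bound on the
gradients at these solutions.\<close>

lemma gradient_dissimilarity:
  assumes het: "bounded_heterogeneity c f g"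
  obtains A where "A \<ge> 0" "\<And>i j x. norm (grad_Phi i x - grad_Phi j x) \<le> A"
proof -
  obtain C where C: "C \<ge> 0"
    "\<And>i x t y. norm (grad_x (f i) x t - grad_x (f i) y (sol i y)) \<le> C * (1 + norm (x - y) + norm (t - sol i y))"
    using grad_x_coarse by metis
  define m where "m = real CARD('m)"
  have m: "m > 0" by (simp add: m_def)
  define s where "s = sqrt m * b_g c / mu_g c"
  have bg: "b_g c > 0" "b_f c > 0" using het by (auto simp: bounded_heterogeneity_def)
  have sol: "norm (sol j x - sol i x) \<le> s" for i j x
  proof -
    have "(norm (grad_t (g i) x (sol j x) - grad_t (g j) x (sol j x)))\<^sup>2
        \<le> (\<Sum>j\<in>UNIV. (norm (grad_t (g i) x (sol j x) - grad_t (g j) x (sol j x)))\<^sup>2)"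
      by (rule member_le_sum[of j UNIV "\<lambda>j. (norm (grad_t (g i) x (sol j x) - grad_t (g j) x (sol j x)))\<^sup>2"]) auto
    also have "\<dots> \<le> (\<Sum>i\<in>UNIV. \<Sum>j\<in>UNIV. (norm (grad_t (g i) x (sol j x) - grad_t (g j) x (sol j x)))\<^sup>2)"
      by (rule member_le_sum[of i UNIV "\<lambda>i. \<Sum>j\<in>UNIV. (norm (grad_t (g i) x (sol j x) - grad_t (g j) x (sol j x)))\<^sup>2"])
        (auto intro: sum_nonneg)
    also have "\<dots> \<le> m * (b_g c)\<^sup>2"
      using het m unfolding bounded_heterogeneity_def m_def by (simp add: divide_le_eq mult.commute)
    also have "\<dots> = (sqrt m * b_g c)\<^sup>2" using m by (simp add: power_mult_distrib)
    finally have G: "norm (grad_t (g i) x (sol j x)) \<le> sqrt m * b_g c"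
      using bg m by (simp add: grad_t_g_sol power2_le_iff_abs_le)
    have "mu_g c * norm (sol j x - sol i x) * norm (sol j x - sol i x)
        \<le> (grad_t (g i) x (sol j x) - grad_t (g i) x (sol i x)) \<bullet> (sol j x - sol i x)"
      using grad_t_g_monotone[of "sol j x" "sol i x" i x] by (simp add: power2_eq_square)
    also have "\<dots> \<le> norm (grad_t (g i) x (sol j x)) * norm (sol j x - sol i x)"
      by (simp add: grad_t_g_sol norm_cauchy_schwarz)
    also have "\<dots> \<le> (sqrt m * b_g c) * norm (sol j x - sol i x)" using G by (intro mult_right_mono) auto
    finally have "mu_g c * norm (sol j x - sol i x) \<le> sqrt m * b_g c"
      using bg m by (cases "sol j x = sol i x") auto
    then show ?thesis using positive_constants(1) by (simp add: s_def field_simps)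
  qed
  have fx: "norm (grad_x (f i) x t - (\<Sum>j\<in>UNIV. grad_x (f j) x t) /\<^sub>R m) \<le> b_f c" for i x t
  proof -
    have "(norm (grad_x (f i) x t - (\<Sum>j\<in>UNIV. grad_x (f j) x t) /\<^sub>R m))\<^sup>2
      \<le> (\<Sum>i\<in>UNIV. (norm (grad_x (f i) x t - (\<Sum>j\<in>UNIV. grad_x (f j) x t) /\<^sub>R m))\<^sup>2)"
      by (rule member_le_sum[of i UNIV "\<lambda>i. (norm (grad_x (f i) x t - (\<Sum>j\<in>UNIV. grad_x (f j) x t) /\<^sub>R m))\<^sup>2"]) auto
    also have "\<dots> \<le> (b_f c)\<^sup>2" using het by (simp add: bounded_heterogeneity_def m_def)
    finally show ?thesis using bg by (simp add: power2_le_iff_abs_le)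
  qed
  define A where "A = 2 * (C_gxt c / mu_g c * C_ft c) + C * (1 + s) + 2 * b_f c"
  show ?thesis
  proof (rule that[of A])
    show "A \<ge> 0" using C bg m positive_constants by (simp add: A_def s_def)
    fix i j x
    have "norm (grad_x (f i) x (sol i x) - grad_x (f i) x (sol j x)) \<le> C * (1 + s)"
      using C(2)[of i x "sol j x" x] mult_left_mono[OF sol[of j x i] C(1)]
      by (simp add: norm_minus_commute algebra_simps)
    moreover have "norm (grad_x (f i) x (sol j x) - grad_x (f j) x (sol j x)) \<le> 2 * b_f c"
      using norm_triangle_ineq4[of "grad_x (f i) x (sol j x) - (\<Sum>j'\<in>UNIV. grad_x (f j') x (sol j x)) /\<^sub>R m"
          "grad_x (f j) x (sol j x) - (\<Sum>j'\<in>UNIV. grad_x (f j') x (sol j x)) /\<^sub>R m"]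
        fx[of i x "sol j x"] fx[of j x "sol j x"] by simp
    ultimately have 1: "norm (grad_x (f i) x (sol i x) - grad_x (f j) x (sol j x)) \<le> C * (1 + s) + 2 * b_f c"
      using norm_triangle_ineq[of "grad_x (f i) x (sol i x) - grad_x (f i) x (sol j x)"
          "grad_x (f i) x (sol j x) - grad_x (f j) x (sol j x)"] by simp
    have "norm (grad_Phi i x - grad_Phi j x) \<le> norm (grad_Phi i x - grad_x (f i) x (sol i x))
        + norm (grad_x (f i) x (sol i x) - grad_x (f j) x (sol j x)) + norm (grad_Phi j x - grad_x (f j) x (sol j x))"
      by norm
    then show "norm (grad_Phi i x - grad_Phi j x) \<le> A"
      using 1 grad_Phi_near_grad_x[of i x] grad_Phi_near_grad_x[of j x] by (simp add: A_def)
  qed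
qed

lemma Phi_GDERIV: "GDERIV (Phi f g) x :> (\<Sum>i\<in>UNIV. grad_Phi i x) /\<^sub>R real CARD('m)"
proof -
  have "((\<lambda>x. \<Sum>i\<in>UNIV. Phi_i (f i) (g i) x) has_derivative (\<lambda>h. \<Sum>i\<in>UNIV. h \<bullet> grad_Phi i x)) (at x)"
    using grad_Phi_GDERIV by (intro has_derivative_sum) (simp add: gderiv_def)
  then have "((\<lambda>x. (\<Sum>i\<in>UNIV. Phi_i (f i) (g i) x) / real CARD('m)) has_derivative
      (\<lambda>h. (\<Sum>i\<in>UNIV. h \<bullet> grad_Phi i x) / real CARD('m))) (at x)"
    by (rule bounded_linear.has_derivative[OF bounded_linear_divide])
  then show ?thesis unfolding gderiv_def Phi_def
    by (simp add: inner_sum_right divide_inverse mult.commute)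
qed

lemma gradient_Phi: "gradient (Phi f g) x = (\<Sum>i\<in>UNIV. grad_Phi i x) /\<^sub>R real CARD('m)"
  by (rule gradient_eqI[OF Phi_GDERIV])

lemma gradient_Phi_almost_lipschitz: "almost_lipschitz (gradient (Phi f g))"
  unfolding gradient_Phi by (intro almost_lipschitz_scaleR almost_lipschitz_sum grad_Phi_almost_lipschitz) auto

end

section \<open>Scalar recursions and the choice of step sizes\<close>

text \<open>A geometrically forgetting sequence costs its initial value once per step plus the sum of its inputs,
with no factor \<open>1 / c\<close> in front of the initial value.  This is what allows the rates \<open>\<tau>\<close> and \<open>\<gamma>\<close> to be
sent to zero while the initial errors of the algorithm stay fixed.\<close>

lemma leaky_sum:
  fixes s r :: "nat \<Rightarrow> real"
  assumes c: "0 < c" "c \<le> 1" and r: "\<And>k. r k \<ge> 0" and s0: "s 0 \<ge> 0"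
    and step: "\<And>k. s (Suc k) \<le> (1 - c) * s k + c * r k"
  shows "(\<Sum>k\<le>K. s k) \<le> real (K + 1) * s 0 + (\<Sum>k<K. r k)"
proof -
  \<comment> \<open>The excess over the initial value starts at zero and obeys the same recursion.\<close>
  define t where "t k = max 0 (s k - s 0)" for k
  have t0: "t k \<ge> 0" for k by (simp add: t_def)
  have ts: "t (Suc k) \<le> (1 - c) * t k + c * r k" for k
  proof -
    have "(1 - c) * (s k - s 0) \<le> (1 - c) * t k" using c by (intro mult_left_mono) (auto simp: t_def)
    moreover have "s (Suc k) - s 0 \<le> (1 - c) * (s k - s 0) + c * r k - c * s 0"
      using step[of k] by (simp add: algebra_simps)
    moreover have "0 \<le> (1 - c) * t k + c * r k" "0 \<le> c * s 0" using c r[of k] t0[of k] s0 by auto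
    ultimately show ?thesis by (simp add: t_def[of "Suc k"])
  qed
  have "(\<Sum>k\<le>K. t k) + (1 - c) / c * t K \<le> (\<Sum>k<K. r k)"
  proof (induction K)
    case 0
    show ?case by (simp add: t_def)
  next
    case (Suc K)
    have "t (Suc K) + (1 - c) / c * t (Suc K) = t (Suc K) / c" using c by (simp add: field_simps)
    also have "\<dots> \<le> ((1 - c) * t K + c * r K) / c" using ts c by (intro divide_right_mono) auto
    also have "\<dots> = (1 - c) / c * t K + r K" using c by (simp add: add_divide_distrib)
    finally show ?case using Suc.IH by simp
  qed
  moreover have "0 \<le> (1 - c) / c * t K" using c t0[of K] by simp
  moreover have "(\<Sum>k\<le>K. s k) \<le> (\<Sum>k\<le>K. s 0 + t k)" by (intro sum_mono) (simp add: t_def)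
  ultimately show ?thesis by (simp add: sum.distrib)
qed

text \<open>Values produced by eliminating the error sequences from each other: a level is the amount per
iteration caused by constants and initial errors, a gain is the factor in front of the accumulated
\<open>\<epsilon> * n\<close>.  They depend on neither the step sizes nor the horizon, which is what the choice of step sizes
exploits.\<close>

definition "inner_level C T0 v0 = T0 + C + v0 + C + C * (T0 + C :: real)"
definition "tracking_level C y0 Z0 T0 v0 = (y0 + C) + C * inner_level C T0 v0 + C * (1 + C)\<^sup>2 * (Z0 + C :: real)"
definition "error_level C y0 Z0 T0 v0 = 1 + inner_level C T0 v0 + (1 + (1 + C)\<^sup>2) * (Z0 + C :: real)
  + 2 * tracking_level C y0 Z0 T0 v0 * (1 + C * (1 + (1 + C)\<^sup>2))"
definition "tracking_gain C = C + C * (C + (C :: real)\<^sup>2)"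
definition "error_gain C = 1 + C + C\<^sup>2 + 2 * tracking_gain C * (1 + C * (1 + (1 + C :: real)\<^sup>2))"

text \<open>The coupled inequalities satisfied by the second moments of the algorithm.  The sequences stand for
the objective \<open>\<phi>\<close>, the squared gradient \<open>G\<close>, the squared mean direction \<open>n\<close>, the tracking error \<open>q\<close> of the
mean and \<open>y\<close> of all nodes, the consensus error \<open>Z\<close>, the inner error \<open>T\<close> and the adjoint variable \<open>v\<close>.
The factor \<open>1 / \<gamma> ^ 4\<close> arises from tracking a gradient whose slope is only known to be \<open>1 / \<gamma>\<close> after
allowing jumps of size \<open>\<gamma>\<close>.\<close>

locale moment_recursion =
  fixes \<phi> G n q y Z T v :: "nat \<Rightarrow> real" and C c \<alpha> \<gamma> \<tau> :: real
  assumes nonneg: "\<And>k. G k \<ge> 0" "\<And>k. n k \<ge> 0" "\<And>k. q k \<ge> 0" "\<And>k. y k \<ge> 0" "\<And>k. Z k \<ge> 0" "\<And>k. T k \<ge> 0" "\<And>k. v k \<ge> 0"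
    and C: "C \<ge> 0" and c: "0 < c" "c \<le> 1"
    and par: "0 < \<alpha>" "\<alpha> < 1" "0 < \<gamma>" "\<gamma> < 1" "0 < \<tau>" "\<tau> < 1"
    and objective: "\<And>k. \<phi> (Suc k) \<le> \<phi> k - \<tau> * \<alpha> / 2 * G k - \<tau> * \<alpha> / 4 * n k + \<tau> * \<alpha> / 2 * q k + \<tau> * \<alpha> * C"
    and gradient: "\<And>k. G (Suc k) \<le> 3 / 2 * G k + C * (1 + (\<tau> * \<alpha>)\<^sup>2 * n k)"
    and mean_tracking: "\<And>k. q (Suc k) \<le> (1 - \<gamma>) * q k + \<gamma> * (C * (1 + Z k + T k + v k + (\<tau> * \<alpha>)\<^sup>2 / \<gamma> ^ 4 * n k))"
    and tracking: "\<And>k. y (Suc k) \<le> (1 - \<gamma>) * y k + \<gamma> * (C * (1 + Z k + T k + v k + (\<tau> * \<alpha>)\<^sup>2 / \<gamma> ^ 4 * n k))"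
    and consensus: "\<And>k. Z (Suc k) \<le> (1 - c * \<tau>) * Z k + c * \<tau> * (\<alpha>\<^sup>2 * (C * (1 + y k)))"
    and inner: "\<And>k. T (Suc k) \<le> (1 - c) * T k + c * (C * (1 + Z k + (\<tau> * \<alpha>)\<^sup>2 * n k))"
    and adjoint: "\<And>k. v (Suc k) \<le> (1 - c) * v k + c * (C * (1 + T k + Z k))"
    and q_le_y: "\<And>k. q k \<le> y k"
begin

definition "\<epsilon> = (\<tau> * \<alpha>)\<^sup>2 / \<gamma> ^ 4"

lemma eps: "0 \<le> \<epsilon>" "(\<tau> * \<alpha>)\<^sup>2 \<le> \<epsilon>"
proof -
  show "0 \<le> \<epsilon>" by (simp add: \<epsilon>_def)
  have "\<gamma> ^ 4 \<le> 1" using par by (intro power_le_one) auto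
  then show "(\<tau> * \<alpha>)\<^sup>2 \<le> \<epsilon>" using par by (simp add: \<epsilon>_def le_divide_eq mult_left_le)
qed

definition "R k = 1 + y k + Z k + T k + v k + \<epsilon> * n k"

abbreviation "a1 \<equiv> inner_level C (T 0) (v 0)"
abbreviation "a3 \<equiv> tracking_level C (y 0) (Z 0) (T 0) (v 0)"
abbreviation "a4 \<equiv> error_level C (y 0) (Z 0) (T 0) (v 0)"

text \<open>The feedback loop runs from the tracking error through the consensus error and back.  Its gain is
proportional to the square of \<open>\<alpha>\<close>, since disagreement among the directions enters the consensus error
with this factor; once it is at most one half, all error sums are controlled.\<close>

lemma sum_R:
  assumes small: "\<alpha>\<^sup>2 * (C\<^sup>2 * (1 + C)\<^sup>2) \<le> 1 / 2"
  shows "(\<Sum>k<K. R k) + (\<Sum>k\<le>K. T k) + (\<Sum>k\<le>K. v k) \<le> 2 * (a4 * real (K + 1) + error_gain C * (\<epsilon> * (\<Sum>k<K. n k)))"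
proof -
  define N where "N = real (K + 1)"
  define SY SZ ST SV SN where "SY = (\<Sum>k\<le>K. y k)" and "SZ = (\<Sum>k\<le>K. Z k)" and "ST = (\<Sum>k\<le>K. T k)"
    and "SV = (\<Sum>k\<le>K. v k)" and "SN = \<epsilon> * (\<Sum>k<K. n k)"
  have nn: "SY \<ge> 0" "SZ \<ge> 0" "ST \<ge> 0" "SV \<ge> 0" "SN \<ge> 0" "N \<ge> 1"
    using nonneg eps by (auto simp: SY_def SZ_def ST_def SV_def SN_def N_def intro!: sum_nonneg mult_nonneg_nonneg)
  have less: "(\<Sum>k<K. s k) \<le> (\<Sum>k\<le>K. s k)" if "\<And>k. s k \<ge> 0" for s :: "nat \<Rightarrow> real"
    using that by (intro sum_mono2) auto
  have K: "real K \<le> N" by (simp add: N_def)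
  have un: "(\<Sum>k<K. (\<tau> * \<alpha>)\<^sup>2 * n k) \<le> SN"
    unfolding SN_def sum_distrib_left using eps(2) nonneg by (intro sum_mono mult_right_mono) auto
  have \<alpha>2: "\<alpha>\<^sup>2 \<le> 1" using par by (intro power_le_one) auto
  have Zs: "SZ \<le> N * Z 0 + \<alpha>\<^sup>2 * (C * (N + SY))"
  proof -
    have "c * \<tau> \<le> 1 * 1" using c par by (intro mult_mono) auto
    then have "SZ \<le> N * Z 0 + (\<Sum>k<K. \<alpha>\<^sup>2 * (C * (1 + y k)))"
      unfolding SZ_def N_def using c par C nonneg consensus by (intro leaky_sum[where c = "c * \<tau>"]) auto
    also have "(\<Sum>k<K. \<alpha>\<^sup>2 * (C * (1 + y k))) = \<alpha>\<^sup>2 * (C * (real K + (\<Sum>k<K. y k)))"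
      by (simp add: sum_distrib_left[symmetric] sum.distrib)
    also have "\<dots> \<le> \<alpha>\<^sup>2 * (C * (N + SY))"
      using C K less[of y] nonneg by (intro mult_left_mono) (auto simp: SY_def)
    finally show ?thesis by simp
  qed
  have Ts: "ST \<le> N * T 0 + C * (N + SZ + SN)"
  proof -
    have "ST \<le> N * T 0 + (\<Sum>k<K. C * (1 + Z k + (\<tau> * \<alpha>)\<^sup>2 * n k))"
      unfolding ST_def N_def using c C nonneg inner by (intro leaky_sum[where c = c]) auto
    also have "(\<Sum>k<K. C * (1 + Z k + (\<tau> * \<alpha>)\<^sup>2 * n k)) = C * (real K + (\<Sum>k<K. Z k) + (\<Sum>k<K. (\<tau> * \<alpha>)\<^sup>2 * n k))"
      by (simp add: sum_distrib_left[symmetric] sum.distrib)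
    also have "\<dots> \<le> C * (N + SZ + SN)"
      using C K un less[of Z] nonneg by (intro mult_left_mono add_mono) (auto simp: SZ_def)
    finally show ?thesis by simp
  qed
  have Vs: "SV \<le> N * v 0 + C * (N + ST + SZ)"
  proof -
    have "SV \<le> N * v 0 + (\<Sum>k<K. C * (1 + T k + Z k))"
      unfolding SV_def N_def using c C nonneg adjoint by (intro leaky_sum[where c = c]) auto
    also have "(\<Sum>k<K. C * (1 + T k + Z k)) = C * (real K + (\<Sum>k<K. T k) + (\<Sum>k<K. Z k))"
      by (simp add: sum_distrib_left[symmetric] sum.distrib)
    also have "\<dots> \<le> C * (N + ST + SZ)"
      using C K less[of Z] less[of T] nonneg by (intro mult_left_mono add_mono) (auto simp: SZ_def ST_def)
    finally show ?thesis by simp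
  qed
  have Ys: "SY \<le> N * y 0 + C * (N + (SZ + ST + SV) + SN)"
  proof -
    have "SY \<le> N * y 0 + (\<Sum>k<K. C * (1 + Z k + T k + v k + \<epsilon> * n k))"
      unfolding SY_def N_def using par C nonneg eps tracking[folded \<epsilon>_def]
      by (intro leaky_sum[where c = \<gamma>]) auto
    also have "(\<Sum>k<K. C * (1 + Z k + T k + v k + \<epsilon> * n k))
        = C * (real K + ((\<Sum>k<K. Z k) + (\<Sum>k<K. T k) + (\<Sum>k<K. v k)) + SN)"
      by (simp add: sum_distrib_left[symmetric] sum.distrib SN_def)
    also have "\<dots> \<le> C * (N + (SZ + ST + SV) + SN)"
      using C K less[of Z] less[of T] less[of v] nonneg
      by (intro mult_left_mono add_mono) (auto simp: SZ_def ST_def SV_def)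
    finally show ?thesis by simp
  qed
  have W: "SZ + ST + SV \<le> N * a1 + (1 + C)\<^sup>2 * SZ + (C + C\<^sup>2) * SN"
  proof -
    have "C * ST \<le> C * (N * T 0 + C * (N + SZ + SN))" using Ts C by (intro mult_left_mono) auto
    then have "SZ + ST + SV \<le> SZ + (N * T 0 + C * (N + SZ + SN)) + (N * v 0 + C * N + C * (N * T 0 + C * (N + SZ + SN)) + C * SZ)"
      using Ts Vs by (simp add: algebra_simps)
    also have "\<dots> = N * a1 + (1 + C)\<^sup>2 * SZ + (C + C\<^sup>2) * SN"
      by (simp add: inner_level_def power2_eq_square algebra_simps)
    finally show ?thesis .
  qed
  have Zs': "(1 + C)\<^sup>2 * SZ \<le> (1 + C)\<^sup>2 * (N * (Z 0 + C)) + (1 + C)\<^sup>2 * (\<alpha>\<^sup>2 * (C * SY))"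
  proof -
    have "\<alpha>\<^sup>2 * (C * N) \<le> C * N" using \<alpha>2 C nn by (intro mult_left_le_one_le) auto
    then have "SZ \<le> N * (Z 0 + C) + \<alpha>\<^sup>2 * (C * SY)" using Zs by (simp add: algebra_simps)
    then have "(1 + C)\<^sup>2 * SZ \<le> (1 + C)\<^sup>2 * (N * (Z 0 + C) + \<alpha>\<^sup>2 * (C * SY))" by (intro mult_left_mono) auto
    then show ?thesis by (simp add: distrib_left)
  qed
  have Y: "SY \<le> 2 * a3 * N + 2 * tracking_gain C * SN"
  proof -
    have "C * (SZ + ST + SV) \<le> C * (N * a1 + ((1 + C)\<^sup>2 * (N * (Z 0 + C)) + (1 + C)\<^sup>2 * (\<alpha>\<^sup>2 * (C * SY))) + (C + C\<^sup>2) * SN)"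
      using W Zs' C by (intro mult_left_mono) auto
    then have "SY \<le> N * y 0 + C * N + C * SN + C * (N * a1 + ((1 + C)\<^sup>2 * (N * (Z 0 + C)) + (1 + C)\<^sup>2 * (\<alpha>\<^sup>2 * (C * SY))) + (C + C\<^sup>2) * SN)"
      using Ys by (simp add: distrib_left)
    also have "\<dots> = a3 * N + tracking_gain C * SN + (\<alpha>\<^sup>2 * (C\<^sup>2 * (1 + C)\<^sup>2)) * SY"
      by (simp add: tracking_level_def tracking_gain_def power2_eq_square algebra_simps)
    also have "(\<alpha>\<^sup>2 * (C\<^sup>2 * (1 + C)\<^sup>2)) * SY \<le> 1 / 2 * SY" using small nn by (intro mult_right_mono) auto
    finally show ?thesis by simp
  qed
  have Z1: "SZ \<le> N * (Z 0 + C) + C * SY"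
  proof -
    have "\<alpha>\<^sup>2 * (C * (N + SY)) \<le> C * (N + SY)" using \<alpha>2 C nn by (intro mult_left_le_one_le) auto
    then show ?thesis using Zs by (simp add: algebra_simps)
  qed
  have tot: "N + SY + (SZ + ST + SV) + SN \<le> a4 * N + error_gain C * SN"
  proof -
    have "(1 + (1 + C)\<^sup>2) * SZ \<le> (1 + (1 + C)\<^sup>2) * (N * (Z 0 + C) + C * SY)"
      using Z1 by (intro mult_left_mono) auto
    then have "N + SY + (SZ + ST + SV) + SN \<le> N + SY + N * a1 + (1 + (1 + C)\<^sup>2) * (N * (Z 0 + C) + C * SY) + (C + C\<^sup>2) * SN + SN"
      using W nn by (simp add: algebra_simps)
    also have "\<dots> = N + N * a1 + (1 + (1 + C)\<^sup>2) * (N * (Z 0 + C)) + (1 + C * (1 + (1 + C)\<^sup>2)) * SY + (1 + C + C\<^sup>2) * SN"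
      by (simp add: algebra_simps)
    also have "(1 + C * (1 + (1 + C)\<^sup>2)) * SY \<le> (1 + C * (1 + (1 + C)\<^sup>2)) * (2 * a3 * N + 2 * tracking_gain C * SN)"
      using Y C by (intro mult_left_mono) auto
    finally show ?thesis by (simp add: error_level_def error_gain_def algebra_simps)
  qed
  have "(\<Sum>k<K. R k) = real K + (\<Sum>k<K. y k) + ((\<Sum>k<K. Z k) + (\<Sum>k<K. T k) + (\<Sum>k<K. v k)) + SN"
    by (simp add: R_def sum.distrib SN_def sum_distrib_left)
  also have "\<dots> \<le> N + SY + (SZ + ST + SV) + SN"
    using K less[of y] less[of Z] less[of T] less[of v] nonneg
    by (intro add_mono) (auto simp: SY_def SZ_def ST_def SV_def)
  finally have "(\<Sum>k<K. R k) \<le> a4 * N + error_gain C * SN" using tot by simp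
  moreover have "ST + SV \<le> a4 * N + error_gain C * SN" using tot nn by linarith
  ultimately show ?thesis by (simp add: N_def SN_def ST_def SV_def)
qed

text \<open>A quarter of the squared gradient, weighted by \<open>\<tau> * \<alpha>\<close>, is included in the potential.  The bound on its increments makes
the last gradient available although only \<open>K\<close> decrements of the potential are summed.\<close>

lemma telescoped:
  assumes \<kappa>: "\<kappa>4 \<ge> 0" "\<kappa>5 \<ge> 0" and Q: "Q = 1 + 2 * C + \<kappa>4 * C + \<kappa>5 * C"
  defines "P \<equiv> \<lambda>k. \<phi> k + \<kappa>4 * (\<tau> * \<alpha> ^ 4 / \<gamma>) * y k + \<kappa>5 * \<alpha> * Z k + \<tau> * \<alpha> / (2 * \<gamma>) * q k + \<tau> * \<alpha> / 4 * G k"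
  shows "P K + \<tau> * \<alpha> / 4 * (\<Sum>k<K. G k) + \<tau> * \<alpha> / 4 * (\<Sum>k<K. n k) \<le> P 0 + \<tau> * \<alpha> * Q * (\<Sum>k<K. R k)"
proof (induction K)
  case (Suc k)
  define u where "u = \<tau> * \<alpha>"
  have u: "u > 0" using par by (simp add: u_def)
  define B where "B = 1 + Z k + T k + v k + \<epsilon> * n k"
  have B: "B \<ge> 0" "B \<le> R k" using nonneg[of k] eps by (auto simp: B_def R_def)
  have a3: "\<alpha> ^ 3 \<le> 1" "\<alpha> ^ 3 > 0" "\<alpha>\<^sup>2 \<le> 1" using par by (auto intro: power_le_one)
  have ct: "c * \<tau> \<ge> 0" "c * \<tau> \<le> 1 * \<tau>" using par c by (auto intro!: mult_right_mono)
  have 1: "\<kappa>4 * (\<tau> * \<alpha> ^ 4 / \<gamma>) * y (Suc k) \<le> \<kappa>4 * (\<tau> * \<alpha> ^ 4 / \<gamma>) * y k + u * (\<kappa>4 * C) * R k"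
  proof -
    have "y (Suc k) \<le> y k + \<gamma> * (C * B)"
    proof -
      have "y (Suc k) \<le> y k - \<gamma> * y k + \<gamma> * (C * B)"
        using tracking[of k] by (simp add: B_def \<epsilon>_def left_diff_distrib)
      moreover have "0 \<le> \<gamma> * y k" using par nonneg by simp
      ultimately show ?thesis by linarith
    qed
    then have "\<kappa>4 * (\<tau> * \<alpha> ^ 4 / \<gamma>) * y (Suc k) \<le> \<kappa>4 * (\<tau> * \<alpha> ^ 4 / \<gamma>) * (y k + \<gamma> * (C * B))"
      using \<kappa> par by (intro mult_left_mono) auto
    also have "\<dots> = \<kappa>4 * (\<tau> * \<alpha> ^ 4 / \<gamma>) * y k + (\<kappa>4 * u * C) * (\<alpha> ^ 3 * B)"
      using par by (simp add: u_def field_simps power_numeral_reduce)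
    also have "(\<kappa>4 * u * C) * (\<alpha> ^ 3 * B) \<le> (\<kappa>4 * u * C) * (1 * R k)"
      using \<kappa> u C a3 B by (intro mult_left_mono mult_mono) auto
    finally show ?thesis by (simp add: mult_ac)
  qed
  have 2: "\<tau> * \<alpha> / (2 * \<gamma>) * q (Suc k) \<le> \<tau> * \<alpha> / (2 * \<gamma>) * q k + u * (C / 2) * R k"
  proof -
    have "q (Suc k) \<le> q k + \<gamma> * (C * B)"
    proof -
      have "q (Suc k) \<le> q k - \<gamma> * q k + \<gamma> * (C * B)"
        using mean_tracking[of k] by (simp add: B_def \<epsilon>_def left_diff_distrib)
      moreover have "0 \<le> \<gamma> * q k" using par nonneg by simp
      ultimately show ?thesis by linarith
    qed
    then have "\<tau> * \<alpha> / (2 * \<gamma>) * q (Suc k) \<le> \<tau> * \<alpha> / (2 * \<gamma>) * (q k + \<gamma> * (C * B))"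
      using par by (intro mult_left_mono) auto
    also have "\<dots> = \<tau> * \<alpha> / (2 * \<gamma>) * q k + (u * (C / 2)) * B"
      using par by (simp add: u_def field_simps)
    also have "(u * (C / 2)) * B \<le> (u * (C / 2)) * R k"
      using u C B by (intro mult_left_mono) auto
    finally show ?thesis by simp
  qed
  have 3: "\<kappa>5 * \<alpha> * Z (Suc k) \<le> \<kappa>5 * \<alpha> * Z k + u * (\<kappa>5 * C) * R k"
  proof -
    have "c * \<tau> * (\<alpha>\<^sup>2 * (C * (1 + y k))) \<le> (1 * \<tau>) * (1 * (C * (1 + y k)))"
      using ct par a3 C nonneg(4)[of k] by (intro mult_mono[of "c * \<tau>" "1 * \<tau>"] mult_right_mono) auto
    also have "\<dots> \<le> \<tau> * (C * R k)"
      using par C nonneg[of k] eps by (auto intro!: mult_left_mono simp: R_def)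
    finally have "Z (Suc k) \<le> Z k + \<tau> * (C * R k)"
      using consensus[of k] mult_nonneg_nonneg[OF ct(1) nonneg(5)[of k]] by (simp add: algebra_simps)
    then have "\<kappa>5 * \<alpha> * Z (Suc k) \<le> \<kappa>5 * \<alpha> * (Z k + \<tau> * (C * R k))"
      using \<kappa> par by (intro mult_left_mono) auto
    then show ?thesis by (simp add: u_def algebra_simps)
  qed
  have 4: "\<tau> * \<alpha> / 4 * G (Suc k) \<le> u / 4 * G k + u / 8 * G k + u * (C / 4) * R k"
  proof -
    have "(\<tau> * \<alpha>)\<^sup>2 * n k \<le> \<epsilon> * n k" using eps nonneg(2)[of k] by (intro mult_right_mono) auto
    then have "C * (1 + (\<tau> * \<alpha>)\<^sup>2 * n k) \<le> C * R k"
      using C nonneg[of k] by (intro mult_left_mono) (auto simp: R_def)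
    then have "u / 4 * G (Suc k) \<le> u / 4 * (3 / 2 * G k + C * R k)"
      using gradient[of k] u by (intro mult_left_mono) auto
    then show ?thesis by (simp add: u_def algebra_simps)
  qed
  have 5: "\<phi> (Suc k) \<le> \<phi> k - u / 2 * G k - u / 4 * n k + u * (1 / 2 + C) * R k"
  proof -
    have y: "q k / 2 + C \<le> 1 / 2 * R k + C * R k"
    proof (rule add_mono)
      have "0 \<le> \<epsilon> * n k" by (rule mult_nonneg_nonneg[OF eps(1) nonneg(2)])
      then have "q k \<le> R k"
        using q_le_y[of k] nonneg(5,6,7)[of k] unfolding R_def by linarith
      then show "q k / 2 \<le> 1 / 2 * R k" by simp
      have "C * 1 \<le> C * R k" using C nonneg[of k] eps by (intro mult_left_mono) (auto simp: R_def)
      then show "C \<le> C * R k" by simp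
    qed
    have "u * (q k / 2 + C) \<le> u * (1 / 2 * R k + C * R k)" using y u by (intro mult_left_mono) auto
    then show ?thesis using objective[of k] by (simp add: u_def algebra_simps)
  qed
  have "R k \<ge> 0" using B by linarith
  then have 6: "u * (1 / 2 + C) * R k + u * (C / 4) * R k + u * (\<kappa>5 * C) * R k + u * (C / 2) * R k + u * (\<kappa>4 * C) * R k \<le> u * Q * R k"
  proof -
    have "(1 / 2 + C + C / 4 + \<kappa>5 * C + C / 2 + \<kappa>4 * C) * (u * R k) \<le> Q * (u * R k)"
      using u C \<open>R k \<ge> 0\<close> by (intro mult_right_mono) (auto simp: Q)
    then show ?thesis by (simp add: algebra_simps)
  qed
  have "u / 8 * G k \<ge> 0" using u nonneg by simp
  then have step: "P (Suc k) \<le> P k - u / 4 * G k - u / 4 * n k + u * Q * R k"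
    using 1 2 3 4 5 6 unfolding P_def u_def[symmetric] by linarith
  show ?case using Suc.IH step unfolding u_def[symmetric] sum.lessThan_Suc distrib_left by linarith
qed (simp add: P_def)

end

text \<open>The order of the choices is essential: \<open>\<alpha>\<close> is fixed by the loop gain, then \<open>\<gamma>\<close> so that the available budget,
which is proportional to \<open>\<alpha> ^ 3 / \<gamma>\<close> per unit of \<open>\<tau> * \<alpha>\<close>, exceeds a level that depends on neither \<open>\<gamma>\<close> nor
\<open>\<tau>\<close>, and \<open>\<tau>\<close> last, so that the motion of the mean is negligible even after division by \<open>\<gamma> ^ 4\<close>.\<close>

lemma step_size_choice:
  fixes C c \<kappa>0 \<kappa>1 \<kappa>2 \<kappa>4 \<kappa>5 \<kappa>v u0 y0 Z0 T0 v0 G0 :: real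
  assumes C: "C \<ge> 0" and c: "0 < c" "c \<le> 1" and \<kappa>0: "\<kappa>0 > 0" and u0: "u0 > 0"
    and \<kappa>: "\<kappa>1 \<ge> 0" "\<kappa>2 \<ge> 0" "\<kappa>4 \<ge> 0" "\<kappa>5 \<ge> 0" "\<kappa>v \<ge> 0"
    and init: "y0 \<ge> 0" "Z0 \<ge> 0" "T0 \<ge> 0" "v0 \<ge> 0" "G0 \<ge> 0"
  obtains \<alpha> \<gamma> \<tau> :: real where "0 < \<alpha>" "\<alpha> < 1" "0 < \<gamma>" "\<gamma> < 1" "0 < \<tau>" "\<tau> < 1" "\<tau> * \<alpha> \<le> u0"
    and "\<And>\<phi> G n q y Z T v K. moment_recursion \<phi> G n q y Z T v C c \<alpha> \<gamma> \<tau> \<Longrightarrow>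
        y 0 = y0 \<Longrightarrow> Z 0 = Z0 \<Longrightarrow> T 0 = T0 \<Longrightarrow> v 0 = v0 \<Longrightarrow> G 0 = G0 \<Longrightarrow>
        \<tau> * \<alpha> / 4 * (\<Sum>k\<le>K. G k)
          + (\<phi> K + \<kappa>4 * (\<tau> * \<alpha> ^ 4 / \<gamma>) * y K + \<kappa>5 * \<alpha> * Z K + \<tau> * \<alpha> / (2 * \<gamma>) * q K
              + \<kappa>2 * (\<tau> * \<alpha>) * T K + \<kappa>1 * (\<tau> * \<alpha>) * (v K + \<kappa>v))
        \<le> (\<phi> 0 + \<kappa>4 * (\<tau> * \<alpha> ^ 4 / \<gamma>) * y 0 + \<kappa>5 * \<alpha> * Z 0 + \<tau> * \<alpha> / (2 * \<gamma>) * q 0)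
          + real (K + 1) * (\<kappa>0 * (\<tau> * \<alpha> ^ 4 / \<gamma>))"
proof -
  define level where "level = error_level C y0 Z0 T0 v0"
  define gain where "gain = error_gain C"
  have a: "level \<ge> 0" "gain \<ge> 0"
    using C init by (simp_all add: level_def gain_def error_level_def tracking_level_def inner_level_def
        error_gain_def tracking_gain_def)
  define Q where "Q = 1 + 2 * C + \<kappa>4 * C + \<kappa>5 * C"
  define Q2 where "Q2 = Q + \<kappa>1 + \<kappa>2"
  have Q: "Q \<ge> 1" "Q2 \<ge> 1" "Q \<le> Q2" using C \<kappa> by (auto simp: Q_def Q2_def)
  define E where "E = C\<^sup>2 * (1 + C)\<^sup>2"
  \<comment> \<open>Makes the gain of the feedback loop at most one half.\<close>
  define \<alpha> where "\<alpha> = 1 / (2 * (1 + E))"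
  have E: "E \<ge> 0" by (simp add: E_def)
  have \<alpha>: "0 < \<alpha>" "\<alpha> < 1" using E by (auto simp: \<alpha>_def)
  have small: "\<alpha>\<^sup>2 * (C\<^sup>2 * (1 + C)\<^sup>2) \<le> 1 / 2"
  proof -
    have "\<alpha> * (\<alpha> * E) \<le> 1 * (1 / 2)"
    proof (rule mult_mono)
      show "\<alpha> * E \<le> 1 / 2" using E by (simp add: \<alpha>_def field_simps)
    qed (use \<alpha> E in auto)
    then show ?thesis by (simp add: E_def power2_eq_square mult.assoc)
  qed
  \<comment> \<open>Everything that has to be paid per iteration, in units of \<open>\<tau> * \<alpha>\<close>.\<close>
  define B where "B = Q2 * (2 * level) + G0 + \<kappa>1 * \<kappa>v"
  have B: "B \<ge> 0" using Q a init \<kappa> by (simp add: B_def)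
  define \<gamma> where "\<gamma> = min (1 / 2) (\<kappa>0 * \<alpha> ^ 3 / (B + 1))"
  have \<gamma>: "0 < \<gamma>" "\<gamma> < 1" using \<kappa>0 \<alpha> B by (auto simp: \<gamma>_def min_def)
  have \<gamma>B: "B \<le> \<kappa>0 * \<alpha> ^ 3 / \<gamma>"
  proof -
    have "\<gamma> \<le> \<kappa>0 * \<alpha> ^ 3 / (B + 1)" by (simp add: \<gamma>_def)
    then have "\<gamma> * (B + 1) \<le> \<kappa>0 * \<alpha> ^ 3" using B by (simp add: pos_le_divide_eq)
    moreover have "\<gamma> * B \<le> \<gamma> * (B + 1)" using \<gamma> by simp
    ultimately have "B * \<gamma> \<le> \<kappa>0 * \<alpha> ^ 3" by (simp add: mult.commute)
    then show ?thesis using \<gamma> by (simp add: pos_le_divide_eq)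
  qed
  \<comment> \<open>With this choice the accumulated motion of the mean costs at most the quarter kept in the descent.\<close>
  define \<tau> where "\<tau> = min (1 / 2) (min u0 (\<gamma> ^ 4 / (8 * Q2 * (gain + 1))))"
  have "0 < \<gamma> ^ 4 / (8 * Q2 * (gain + 1))" using \<gamma> Q a by (intro divide_pos_pos mult_pos_pos) auto
  then have \<tau>: "0 < \<tau>" "\<tau> < 1" "\<tau> \<le> u0" using u0 by (auto simp: \<tau>_def)
  have \<tau>u: "\<tau> * \<alpha> \<le> u0"
  proof -
    have "\<tau> * \<alpha> \<le> \<tau> * 1" using \<tau> \<alpha> by (intro mult_left_mono) auto
    then show ?thesis using \<tau> by linarith
  qed
  have small_eps: "Q2 * (2 * gain) * ((\<tau> * \<alpha>)\<^sup>2 / \<gamma> ^ 4) \<le> 1 / 4"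
  proof -
    have pos: "8 * Q2 * (gain + 1) > 0" using Q a by simp
    have "(\<tau> * \<alpha>)\<^sup>2 \<le> \<tau> * 1"
    proof -
      have "\<tau> * (\<tau> * \<alpha>\<^sup>2) \<le> \<tau> * (1 * 1)"
        using \<tau> \<alpha> by (intro mult_left_mono mult_mono power_le_one) auto
      then show ?thesis by (simp add: power_mult_distrib power2_eq_square mult_ac)
    qed
    also have "\<tau> \<le> \<gamma> ^ 4 / (8 * Q2 * (gain + 1))" by (simp add: \<tau>_def)
    finally have "(\<tau> * \<alpha>)\<^sup>2 * (8 * Q2 * (gain + 1)) \<le> \<gamma> ^ 4" using pos by (simp add: pos_le_divide_eq)
    moreover have "(\<tau> * \<alpha>)\<^sup>2 * (8 * Q2 * gain) \<le> (\<tau> * \<alpha>)\<^sup>2 * (8 * Q2 * (gain + 1))"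
      using Q by (intro mult_left_mono) auto
    ultimately have "(\<tau> * \<alpha>)\<^sup>2 * (8 * Q2 * gain) \<le> \<gamma> ^ 4" by linarith
    then have "(\<tau> * \<alpha>)\<^sup>2 * (8 * Q2 * gain) / \<gamma> ^ 4 \<le> 1" using \<gamma> by simp
    then show ?thesis by (simp add: mult_ac)
  qed
  show ?thesis
  proof (rule that[OF \<alpha> \<gamma> \<tau>(1,2) \<tau>u])
    fix \<phi> G n q y Z T v :: "nat \<Rightarrow> real" and K
    assume rec: "moment_recursion \<phi> G n q y Z T v C c \<alpha> \<gamma> \<tau>"
      and i: "y 0 = y0" "Z 0 = Z0" "T 0 = T0" "v 0 = v0" "G 0 = G0"
    interpret moment_recursion \<phi> G n q y Z T v C c \<alpha> \<gamma> \<tau> by (rule rec)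
    have e: "a4 = level" by (simp add: level_def i)
    define u N SN where "u = \<tau> * \<alpha>" and "N = real (K + 1)" and "SN = (\<Sum>k<K. n k)"
    have u: "u > 0" "N \<ge> 1" "SN \<ge> 0" using \<tau> \<alpha> nonneg by (auto simp: u_def N_def SN_def intro: sum_nonneg)
    have S: "(\<Sum>k<K. R k) + (\<Sum>k\<le>K. T k) + (\<Sum>k\<le>K. v k) \<le> 2 * (level * N + gain * (\<epsilon> * SN))"
      using sum_R[OF small, of K] by (simp add: N_def SN_def e gain_def)
    have TK: "T K \<le> (\<Sum>k\<le>K. T k)" "v K \<le> (\<Sum>k\<le>K. v k)"
      using nonneg by (auto intro!: member_le_sum)
    have RK: "(\<Sum>k<K. R k) \<ge> 0" using nonneg eps by (intro sum_nonneg) (auto simp: R_def)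
    have "u * Q * (\<Sum>k<K. R k) + \<kappa>2 * u * T K + \<kappa>1 * u * v K
        \<le> u * Q2 * ((\<Sum>k<K. R k) + T K + v K)"
    proof -
      have "Q * (\<Sum>k<K. R k) \<le> Q2 * (\<Sum>k<K. R k)" "\<kappa>2 * T K \<le> Q2 * T K" "\<kappa>1 * v K \<le> Q2 * v K"
        using Q RK nonneg \<kappa> by (auto intro!: mult_right_mono simp: Q2_def)
      then have "Q * (\<Sum>k<K. R k) + \<kappa>2 * T K + \<kappa>1 * v K \<le> Q2 * ((\<Sum>k<K. R k) + T K + v K)"
        by (simp add: distrib_left)
      then have "u * (Q * (\<Sum>k<K. R k) + \<kappa>2 * T K + \<kappa>1 * v K) \<le> u * (Q2 * ((\<Sum>k<K. R k) + T K + v K))"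
        using u by (intro mult_left_mono) auto
      then show ?thesis by (simp add: algebra_simps)
    qed
    also have "\<dots> \<le> u * Q2 * (2 * (level * N + gain * (\<epsilon> * SN)))"
      using S TK u Q by (intro mult_left_mono) auto
    also have "\<dots> = u * (Q2 * (2 * level) * N) + u * (Q2 * (2 * gain) * \<epsilon>) * SN" by (simp add: algebra_simps)
    also have "u * (Q2 * (2 * gain) * \<epsilon>) * SN \<le> u * (1 / 4) * SN"
      unfolding \<epsilon>_def using small_eps u by (intro mult_right_mono mult_left_mono) auto
    finally have 1: "u * Q * (\<Sum>k<K. R k) + \<kappa>2 * u * T K + \<kappa>1 * u * v K \<le> u * (Q2 * (2 * level) * N) + u / 4 * SN"
      by simp
    have "u * (Q2 * (2 * level) * N) + u / 4 * G0 + \<kappa>1 * u * \<kappa>v \<le> u * B * N"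
    proof -
      have "G0 / 4 \<le> G0 * N" using mult_left_mono[OF u(2), of G0] init by simp
      moreover have "\<kappa>1 * \<kappa>v * 1 \<le> \<kappa>1 * \<kappa>v * N" using u \<kappa> by (intro mult_left_mono) auto
      ultimately have "Q2 * (2 * level) * N + G0 / 4 + \<kappa>1 * \<kappa>v \<le> B * N" by (simp add: B_def algebra_simps)
      then have "u * (Q2 * (2 * level) * N + G0 / 4 + \<kappa>1 * \<kappa>v) \<le> u * (B * N)" using u by (intro mult_left_mono) auto
      then show ?thesis by (simp add: algebra_simps)
    qed
    also have "u * B * N \<le> u * (\<kappa>0 * \<alpha> ^ 3 / \<gamma>) * N"
      using \<gamma>B u by (intro mult_right_mono mult_left_mono) auto
    also have "\<dots> = N * (\<kappa>0 * (\<tau> * \<alpha> ^ 4 / \<gamma>))"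
      by (simp add: u_def power_numeral_reduce)
    finally have 2: "u * (Q2 * (2 * level) * N) + u / 4 * G0 + \<kappa>1 * u * \<kappa>v \<le> N * (\<kappa>0 * (\<tau> * \<alpha> ^ 4 / \<gamma>))" .
    have sum: "(\<Sum>k\<le>K. G k) = (\<Sum>k<K. G k) + G K" by (simp flip: lessThan_Suc_atMost)
    show "\<tau> * \<alpha> / 4 * (\<Sum>k\<le>K. G k)
          + (\<phi> K + \<kappa>4 * (\<tau> * \<alpha> ^ 4 / \<gamma>) * y K + \<kappa>5 * \<alpha> * Z K + \<tau> * \<alpha> / (2 * \<gamma>) * q K
              + \<kappa>2 * (\<tau> * \<alpha>) * T K + \<kappa>1 * (\<tau> * \<alpha>) * (v K + \<kappa>v))
        \<le> (\<phi> 0 + \<kappa>4 * (\<tau> * \<alpha> ^ 4 / \<gamma>) * y 0 + \<kappa>5 * \<alpha> * Z 0 + \<tau> * \<alpha> / (2 * \<gamma>) * q 0)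
          + real (K + 1) * (\<kappa>0 * (\<tau> * \<alpha> ^ 4 / \<gamma>))"
      using telescoped[OF \<kappa>(3,4) Q_def, of K] 1 2
      unfolding sum u_def[symmetric] N_def[symmetric] SN_def[symmetric] i(5) distrib_left by linarith
  qed
qed

section \<open>Gossip averaging\<close>

lemma norm_sq_stacked: "(norm (x :: real^'n^'m))\<^sup>2 = (\<Sum>i\<in>UNIV. (norm (x $ i))\<^sup>2)"
  by (simp add: power2_norm_eq_inner inner_vec_def)

lemma norm_sq_coordinates: "(norm (x :: real^'n))\<^sup>2 = (\<Sum>i\<in>UNIV. (x $ i)\<^sup>2)"
  unfolding power2_norm_eq_inner inner_vec_def by (simp add: power2_eq_square)

text \<open>The action of \<open>A \<otimes> I\<close> on stacked vectors.\<close>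

definition mix :: "real^'m^'m \<Rightarrow> real^'n^'m \<Rightarrow> real^'n^'m" where
  "mix A x = (\<chi> i. \<Sum>j\<in>UNIV. A $ i $ j *\<^sub>R (x $ j))"

text \<open>The spectral norm is not changed by the tensor factor: the matrix acts on each coordinate of the
blocks separately.\<close>

lemma norm_mix_le: "norm (mix A x) \<le> spectral_norm A * norm x"
proof -
  define col where "col l = (\<chi> j. x $ j $ l)" for l
  have "(norm (mix A x))\<^sup>2 = (\<Sum>i\<in>UNIV. \<Sum>l\<in>UNIV. ((A *v col l) $ i)\<^sup>2)"
    by (simp add: norm_sq_stacked norm_sq_coordinates mix_def matrix_vector_mult_def col_def)
  also have "\<dots> = (\<Sum>l\<in>UNIV. (norm (A *v col l))\<^sup>2)"
    by (subst sum.swap) (simp add: norm_sq_coordinates)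
  also have "\<dots> \<le> (\<Sum>l\<in>UNIV. (spectral_norm A * norm (col l))\<^sup>2)"
    by (intro sum_mono power_mono norm_matrix_vector_le) auto
  also have "\<dots> = (spectral_norm A)\<^sup>2 * (\<Sum>l\<in>UNIV. \<Sum>j\<in>UNIV. (x $ j $ l)\<^sup>2)"
    by (simp add: power_mult_distrib sum_distrib_left norm_sq_coordinates col_def)
  also have "(\<Sum>l\<in>UNIV. \<Sum>j\<in>UNIV. (x $ j $ l)\<^sup>2) = (norm x)\<^sup>2"
    by (subst sum.swap) (simp add: norm_sq_stacked norm_sq_coordinates)
  finally have "(norm (mix A x))\<^sup>2 \<le> (spectral_norm A * norm x)\<^sup>2" by (simp add: power_mult_distrib)
  then show ?thesis by (rule power2_le_imp_le) (simp add: spectral_norm_nonneg)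
qed

lemma avg_add: "avg (x + y) = avg x + avg y"
  and avg_diff: "avg (x - y) = avg x - avg y"
  and avg_scaleR: "avg (a *\<^sub>R x) = a *\<^sub>R avg x"
  by (simp_all add: avg_def sum.distrib sum_subtractf scaleR_right.sum[symmetric] algebra_simps)

lemma norm_avg_sq_le: "(norm (avg (x :: real^'n^'m)))\<^sup>2 * real CARD('m) \<le> (norm x)\<^sup>2"
proof -
  define m where "m = real CARD('m)"
  have m: "m > 0" by (simp add: m_def)
  have "0 \<le> (norm (x - (\<chi> i. avg x)))\<^sup>2" by simp
  also have "\<dots> = (\<Sum>i\<in>UNIV. (norm (x $ i))\<^sup>2 - 2 * (x $ i \<bullet> avg x) + (norm (avg x))\<^sup>2)"
    by (simp add: norm_sq_stacked power2_norm_eq_inner inner_diff_left inner_diff_right inner_commute algebra_simps)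
  also have "\<dots> = (norm x)\<^sup>2 - 2 * ((\<Sum>i\<in>UNIV. x $ i) \<bullet> avg x) + m * (norm (avg x))\<^sup>2"
    by (simp add: sum.distrib sum_subtractf norm_sq_stacked sum_distrib_left inner_sum_left m_def)
  also have "(\<Sum>i\<in>UNIV. x $ i) = m *\<^sub>R avg x" using m by (simp add: avg_def m_def)
  finally show ?thesis using m by (simp add: power2_norm_eq_inner m_def mult.commute)
qed

definition disagreement :: "real^'n^'m \<Rightarrow> real^'n^'m" where
  "disagreement x = x - (\<chi> i. avg x)"

lemma norm_disagreement_le: "norm (disagreement x) \<le> 2 * norm (x :: real^'n^'m)"
proof -
  have "(norm ((\<chi> i. avg x) :: real^'n^'m))\<^sup>2 = (norm (avg x))\<^sup>2 * real CARD('m)"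
    by (simp add: norm_sq_stacked mult.commute)
  also have "\<dots> \<le> (norm x)\<^sup>2" by (rule norm_avg_sq_le)
  finally have "norm ((\<chi> i. avg x) :: real^'n^'m) \<le> norm x" by (rule power2_le_imp_le) simp
  then show ?thesis using norm_triangle_ineq4[of x "\<chi> i. avg x"] by (simp add: disagreement_def)
qed

text \<open>Convexity of the square: the contracting term is retained at full weight, the perturbation pays the
inverse of the contraction rate.\<close>

lemma convex_square_le:
  fixes a b c :: real
  assumes "0 < c" "c \<le> 1"
  shows "((1 - c) * a + b)\<^sup>2 \<le> (1 - c) * a\<^sup>2 + b\<^sup>2 / c"
proof -
  have "(1 - c) * a\<^sup>2 + b\<^sup>2 / c - ((1 - c) * a + b)\<^sup>2 = (1 - c) * (c * a - b)\<^sup>2 / c"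
    using assms by (simp add: field_simps power2_eq_square)
  also have "\<dots> \<ge> 0" using assms by simp
  finally show ?thesis by simp
qed

lemma convex_norm_square_le:
  fixes a b :: "'a::real_inner" and c :: real
  assumes "0 < c" "c \<le> 1"
  shows "(norm ((1 - c) *\<^sub>R a + b))\<^sup>2 \<le> (1 - c) * (norm a)\<^sup>2 + (norm b)\<^sup>2 / c"
proof -
  have "norm ((1 - c) *\<^sub>R a + b) \<le> (1 - c) * norm a + norm b"
    using norm_triangle_ineq[of "(1 - c) *\<^sub>R a" b] assms by simp
  then have "(norm ((1 - c) *\<^sub>R a + b))\<^sup>2 \<le> ((1 - c) * norm a + norm b)\<^sup>2" by (intro power_mono) auto
  then show ?thesis using convex_square_le[OF assms, of "norm a" "norm b"] by linarith
qed

lemma sq_sum2: "(a + b)\<^sup>2 \<le> 2 * a\<^sup>2 + 2 * (b::real)\<^sup>2"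
  using sum_squares_bound[of a b] by (simp add: power2_sum)

lemma norm_sum2_sq: "(norm (a + b))\<^sup>2 \<le> 2 * (norm a)\<^sup>2 + 2 * (norm (b::'a::real_normed_vector))\<^sup>2"
proof -
  have "(norm (a + b))\<^sup>2 \<le> (norm a + norm b)\<^sup>2" by (intro power_mono norm_triangle_ineq) simp
  then show ?thesis using sq_sum2[of "norm a" "norm b"] by linarith
qed

locale gossip =
  fixes E :: "('m::finite \<times> 'm) set" and W :: "real^'m^'m"
  assumes net: "network E W"
begin

text \<open>The contraction rate of one gossip round on the disagreement.\<close>

definition "gap = 1 - spectral_norm (W - (\<chi> i j. 1 / real CARD('m)))"

lemma gap: "0 < gap" "gap \<le> 1"
proof -
  have "(spectral_norm (W - (\<chi> i j. 1 / real CARD('m))))\<^sup>2 < 1"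
    using net by (simp add: network_def rho_def)
  then have "spectral_norm (W - (\<chi> i j. 1 / real CARD('m))) < 1"
    using spectral_norm_nonneg by (simp add: abs_square_less_1)
  then show "0 < gap" by (simp add: gap_def)
  show "gap \<le> 1" by (simp add: gap_def spectral_norm_nonneg)
qed

lemma rho_le: "0 \<le> rho W" "rho W < 1"
  using net by (auto simp: network_def rho_def)

lemma neighbor_sum: "(\<Sum>j | (i, j) \<in> E. W $ i $ j *\<^sub>R (x $ j)) = mix W x $ i"
proof -
  have "W $ i $ j = 0" if "(i, j) \<notin> E" for j
    using net that unfolding network_def by blast
  then show ?thesis unfolding mix_def by (simp, intro sum.mono_neutral_left) auto
qed

lemma avg_mix: "avg (mix W x) = avg x"
proof -
  have "(\<Sum>i\<in>UNIV. mix W x $ i) = (\<Sum>j\<in>UNIV. (\<Sum>i\<in>UNIV. W $ i $ j) *\<^sub>R (x $ j))"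
    by (simp add: mix_def scaleR_left.sum) (rule sum.swap)
  also have "\<dots> = (\<Sum>j\<in>UNIV. x $ j)" using net by (simp add: network_def)
  finally show ?thesis by (simp add: avg_def)
qed

lemma disagreement_mix: "disagreement (mix W x) = mix (W - (\<chi> i j. 1 / real CARD('m))) (disagreement x)"
proof -
  have row: "(\<Sum>j\<in>UNIV. W $ i $ j) = 1" for i using net by (simp add: network_def)
  have 0: "(\<Sum>j\<in>UNIV. disagreement x $ j) = 0"
    by (simp add: disagreement_def sum_subtractf avg_def sum_constant_scaleR del: sum_constant)
  show ?thesis
  proof (rule vec_eq_iff[THEN iffD2], rule allI)
    fix i
    have "mix (W - (\<chi> i j. 1 / real CARD('m))) (disagreement x) $ i
        = (\<Sum>j\<in>UNIV. W $ i $ j *\<^sub>R disagreement x $ j) - (1 / real CARD('m)) *\<^sub>R (\<Sum>j\<in>UNIV. disagreement x $ j)"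
      by (simp add: mix_def scaleR_diff_left sum_subtractf scaleR_right.sum)
    also have "\<dots> = (\<Sum>j\<in>UNIV. W $ i $ j *\<^sub>R (x $ j)) - (\<Sum>j\<in>UNIV. W $ i $ j) *\<^sub>R avg x"
      unfolding 0 by (simp add: disagreement_def scaleR_diff_right sum_subtractf scaleR_left.sum)
    also have "\<dots> = disagreement (mix W x) $ i"
      by (simp add: row disagreement_def avg_mix) (simp add: mix_def)
    finally show "disagreement (mix W x) $ i = mix (W - (\<chi> i j. 1 / real CARD('m))) (disagreement x) $ i" by simp
  qed
qed

text \<open>Averaging leaves the mean invariant, so the disagreement contracts by the gap, weighted by \<open>\<tau>\<close>; the
perturbation carries a factor \<open>\<tau>\<close> as well, which cancels one power in the quotient.\<close>

lemma disagreement_step: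
  assumes "0 < \<tau>" "\<tau> < 1"
  shows "(norm (disagreement ((1 - \<tau>) *\<^sub>R x + \<tau> *\<^sub>R (mix W x - \<alpha> *\<^sub>R y))))\<^sup>2
    \<le> (1 - gap * \<tau>) * (norm (disagreement x))\<^sup>2 + \<tau> * \<alpha>\<^sup>2 * (norm (disagreement y))\<^sup>2 / gap"
proof -
  have lin: "disagreement (a *\<^sub>R x + b *\<^sub>R (z - r *\<^sub>R w)) = a *\<^sub>R disagreement x + b *\<^sub>R (disagreement z - r *\<^sub>R disagreement w)"
    for a b r :: real and x z w :: "real^'c^'m"
    by (simp add: disagreement_def vec_eq_iff avg_add avg_diff avg_scaleR algebra_simps)
  have gt: "0 < gap * \<tau>" "gap * \<tau> \<le> 1"
    using gap assms by (auto intro: mult_le_one)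
  have "norm (disagreement ((1 - \<tau>) *\<^sub>R x + \<tau> *\<^sub>R (mix W x - \<alpha> *\<^sub>R y)))
      \<le> norm ((1 - \<tau>) *\<^sub>R disagreement x + \<tau> *\<^sub>R disagreement (mix W x)) + norm ((\<tau> * \<alpha>) *\<^sub>R disagreement y)"
    unfolding lin using norm_triangle_ineq4[of "(1 - \<tau>) *\<^sub>R disagreement x + \<tau> *\<^sub>R disagreement (mix W x)" "(\<tau> * \<alpha>) *\<^sub>R disagreement y"]
    by (simp add: scaleR_diff_right add_diff_eq)
  also have "norm ((1 - \<tau>) *\<^sub>R disagreement x + \<tau> *\<^sub>R disagreement (mix W x))
      \<le> (1 - \<tau>) * norm (disagreement x) + \<tau> * norm (disagreement (mix W x))"
    using norm_triangle_ineq[of "(1 - \<tau>) *\<^sub>R disagreement x" "\<tau> *\<^sub>R disagreement (mix W x)"] assms by simp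
  also have "norm (disagreement (mix W x)) \<le> (1 - gap) * norm (disagreement x)"
    using norm_mix_le[of "W - (\<chi> i j. 1 / real CARD('m))" "disagreement x"] by (simp add: disagreement_mix gap_def)
  finally have "norm (disagreement ((1 - \<tau>) *\<^sub>R x + \<tau> *\<^sub>R (mix W x - \<alpha> *\<^sub>R y)))
      \<le> (1 - gap * \<tau>) * norm (disagreement x) + \<tau> * (\<bar>\<alpha>\<bar> * norm (disagreement y))"
    using assms by (simp add: abs_mult algebra_simps)
  then have "(norm (disagreement ((1 - \<tau>) *\<^sub>R x + \<tau> *\<^sub>R (mix W x - \<alpha> *\<^sub>R y))))\<^sup>2
      \<le> ((1 - gap * \<tau>) * norm (disagreement x) + \<tau> * (\<bar>\<alpha>\<bar> * norm (disagreement y)))\<^sup>2"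
    by (intro power_mono) auto
  also have "\<dots> \<le> (1 - gap * \<tau>) * (norm (disagreement x))\<^sup>2 + (\<tau> * (\<bar>\<alpha>\<bar> * norm (disagreement y)))\<^sup>2 / (gap * \<tau>)"
    by (rule convex_square_le[OF gt])
  also have "(\<tau> * (\<bar>\<alpha>\<bar> * norm (disagreement y)))\<^sup>2 / (gap * \<tau>) = \<tau> * \<alpha>\<^sup>2 * (norm (disagreement y))\<^sup>2 / gap"
    using assms gap by (simp add: power_mult_distrib power2_eq_square)
  finally show ?thesis .
qed

end

section \<open>Independent noise\<close>

context prob_space
begin

text \<open>A sample that is independent of the present state may be integrated out with the state frozen.  So
the second moment of the noise is at most the mean of its conditional variance, and the noise is
uncorrelated with every square integrable function of the state.\<close>

lemma indep_noise:
  fixes X :: "'a \<Rightarrow> 's::{second_countable_topology}" and A :: "'s \<Rightarrow> 'e::euclidean_space" and N :: "'s \<times> 'd \<Rightarrow> 'e"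
  assumes rv: "X \<in> borel_measurable M" "\<xi> \<in> measurable M D"
    and ind: "indep_set (sets (vimage_algebra (space M) X borel)) (sets (vimage_algebra (space M) \<xi> D))"
    and N: "N \<in> borel_measurable (borel \<Otimes>\<^sub>M D)"
    and mean: "\<And>x. integrable M (\<lambda>\<omega>. N (x, \<xi> \<omega>))" "\<And>x. (\<integral>\<omega>. N (x, \<xi> \<omega>) \<partial>M) = 0"
    and var: "\<And>x. integrable M (\<lambda>\<omega>. (norm (N (x, \<xi> \<omega>)))\<^sup>2)" "\<And>x. (\<integral>\<omega>. (norm (N (x, \<xi> \<omega>)))\<^sup>2 \<partial>M) \<le> v x"
    and v: "v \<in> borel_measurable borel" "integrable M (\<lambda>\<omega>. v (X \<omega>))"
    and A: "A \<in> borel_measurable borel" "integrable M (\<lambda>\<omega>. (norm (A (X \<omega>)))\<^sup>2)"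
  shows "integrable M (\<lambda>\<omega>. (norm (N (X \<omega>, \<xi> \<omega>)))\<^sup>2)"
    and "(\<integral>\<omega>. (norm (N (X \<omega>, \<xi> \<omega>)))\<^sup>2 \<partial>M) \<le> (\<integral>\<omega>. v (X \<omega>) \<partial>M)"
    and "integrable M (\<lambda>\<omega>. A (X \<omega>) \<bullet> N (X \<omega>, \<xi> \<omega>))"
    and "(\<integral>\<omega>. A (X \<omega>) \<bullet> N (X \<omega>, \<xi> \<omega>) \<partial>M) = 0"
proof -
  note [measurable] = rv N v(1) A(1)
  define PX where "PX = distr M borel X"
  define PD where "PD = distr M D \<xi>"
  interpret PX: prob_space PX unfolding PX_def by (rule prob_space_distr) simp
  interpret PD: prob_space PD unfolding PD_def by (rule prob_space_distr) simp
  interpret P: pair_prob_space PX PD ..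
  have sets [measurable_cong]: "sets PX = sets borel" "sets PD = sets D" by (simp_all add: PX_def PD_def)
  \<comment> \<open>Independence of the generated sigma-algebras says that the joint law is the product law.\<close>
  have joint: "distr M (borel \<Otimes>\<^sub>M D) (\<lambda>\<omega>. (X \<omega>, \<xi> \<omega>)) = PX \<Otimes>\<^sub>M PD"
  proof (rule pair_measure_eqI[symmetric])
    show "sigma_finite_measure PX" "sigma_finite_measure PD" by unfold_locales
    show "sets (PX \<Otimes>\<^sub>M PD) = sets (distr M (borel \<Otimes>\<^sub>M D) (\<lambda>\<omega>. (X \<omega>, \<xi> \<omega>)))"
      by (simp add: sets cong: sets_pair_measure_cong)
    fix B C assume "B \<in> sets PX" "C \<in> sets PD"
    then have BC: "B \<in> sets borel" "C \<in> sets D" by (simp_all add: sets)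
    have "prob ((X -` B \<inter> space M) \<inter> (\<xi> -` C \<inter> space M)) = prob (X -` B \<inter> space M) * prob (\<xi> -` C \<inter> space M)"
      by (rule indep_setD[OF ind]) (use BC in \<open>auto intro: in_vimage_algebra\<close>)
    moreover have "(\<lambda>\<omega>. (X \<omega>, \<xi> \<omega>)) -` (B \<times> C) \<inter> space M = (X -` B \<inter> space M) \<inter> (\<xi> -` C \<inter> space M)" by auto
    moreover have "B \<times> C \<in> sets (borel \<Otimes>\<^sub>M D)" using BC by auto
    ultimately show "emeasure PX B * emeasure PD C = emeasure (distr M (borel \<Otimes>\<^sub>M D) (\<lambda>\<omega>. (X \<omega>, \<xi> \<omega>))) (B \<times> C)"
      using BC by (simp add: PX_def PD_def emeasure_distr emeasure_eq_measure ennreal_mult)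
  qed
  have v0: "0 \<le> v x" for x
    using order_trans[OF _ var(2)[of x]] by (simp add: integral_nonneg_AE)
  have int_v: "integrable PX v" using v by (simp add: PX_def integrable_distr_eq)
  have Nx: "integrable PD (\<lambda>s. N (x, s))" "(\<integral>s. N (x, s) \<partial>PD) = 0"
    "integrable PD (\<lambda>s. (norm (N (x, s)))\<^sup>2)" "(\<integral>s. (norm (N (x, s)))\<^sup>2 \<partial>PD) \<le> v x" for x
    using mean[of x] var[of x] by (simp_all add: PD_def integrable_distr_eq integral_distr)
  have "(\<integral>\<^sup>+ z. ennreal ((norm (N z))\<^sup>2) \<partial>(PX \<Otimes>\<^sub>M PD)) = (\<integral>\<^sup>+ x. (\<integral>\<^sup>+ s. ennreal ((norm (N (x, s)))\<^sup>2) \<partial>PD) \<partial>PX)"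
    by (subst PD.nn_integral_fst[symmetric]) auto
  also have "\<dots> \<le> (\<integral>\<^sup>+ x. ennreal (v x) \<partial>PX)"
    using Nx by (intro nn_integral_mono) (simp add: nn_integral_eq_integral ennreal_leI)
  also have "\<dots> = ennreal (\<integral>x. v x \<partial>PX)" using int_v v0 by (intro nn_integral_eq_integral) auto
  finally have nn: "(\<integral>\<^sup>+ z. ennreal ((norm (N z))\<^sup>2) \<partial>(PX \<Otimes>\<^sub>M PD)) \<le> ennreal (\<integral>x. v x \<partial>PX)" .
  have intN: "integrable (PX \<Otimes>\<^sub>M PD) (\<lambda>z. (norm (N z))\<^sup>2)"
    using nn by (intro integrableI_bounded) (auto simp: top.not_eq_extremum order_le_less_trans)
  show 1: "integrable M (\<lambda>\<omega>. (norm (N (X \<omega>, \<xi> \<omega>)))\<^sup>2)"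
    using intN unfolding joint[symmetric] by (subst (asm) integrable_distr_eq) auto
  have "(\<integral>z. (norm (N z))\<^sup>2 \<partial>(PX \<Otimes>\<^sub>M PD)) \<le> (\<integral>x. v x \<partial>PX)"
    using nn v0 by (subst (asm) nn_integral_eq_integral[OF intN]) (auto simp: ennreal_le_iff integral_nonneg_AE)
  then show "(\<integral>\<omega>. (norm (N (X \<omega>, \<xi> \<omega>)))\<^sup>2 \<partial>M) \<le> (\<integral>\<omega>. v (X \<omega>) \<partial>M)"
    unfolding joint[symmetric] by (simp add: integral_distr PX_def)
  show 2: "integrable M (\<lambda>\<omega>. A (X \<omega>) \<bullet> N (X \<omega>, \<xi> \<omega>))"
  proof (rule Bochner_Integration.integrable_bound)
    show "integrable M (\<lambda>\<omega>. (norm (A (X \<omega>)))\<^sup>2 + (norm (N (X \<omega>, \<xi> \<omega>)))\<^sup>2)" using A(2) 1 by simp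
    show "AE \<omega> in M. norm (A (X \<omega>) \<bullet> N (X \<omega>, \<xi> \<omega>)) \<le> norm ((norm (A (X \<omega>)))\<^sup>2 + (norm (N (X \<omega>, \<xi> \<omega>)))\<^sup>2)"
    proof (rule AE_I2)
      fix \<omega>
      have "\<bar>A (X \<omega>) \<bullet> N (X \<omega>, \<xi> \<omega>)\<bar> \<le> norm (A (X \<omega>)) * norm (N (X \<omega>, \<xi> \<omega>))" by (rule Cauchy_Schwarz_ineq2)
      also have "\<dots> \<le> (norm (A (X \<omega>)))\<^sup>2 + (norm (N (X \<omega>, \<xi> \<omega>)))\<^sup>2"
        using sum_squares_bound[of "norm (A (X \<omega>))" "norm (N (X \<omega>, \<xi> \<omega>))"]
          mult_nonneg_nonneg[OF norm_ge_zero[of "A (X \<omega>)"] norm_ge_zero[of "N (X \<omega>, \<xi> \<omega>)"]] by linarith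
      finally show "norm (A (X \<omega>) \<bullet> N (X \<omega>, \<xi> \<omega>)) \<le> norm ((norm (A (X \<omega>)))\<^sup>2 + (norm (N (X \<omega>, \<xi> \<omega>)))\<^sup>2)" by simp
    qed
  qed measurable
  have intAN: "integrable (PX \<Otimes>\<^sub>M PD) (\<lambda>(x, s). A x \<bullet> N (x, s))"
    unfolding joint[symmetric] by (subst integrable_distr_eq) (use 2 in auto)
  have "(\<integral>\<omega>. A (X \<omega>) \<bullet> N (X \<omega>, \<xi> \<omega>) \<partial>M) = (\<integral>z. (case z of (x, s) \<Rightarrow> A x \<bullet> N (x, s)) \<partial>(PX \<Otimes>\<^sub>M PD))"
    unfolding joint[symmetric] by (subst integral_distr) auto
  also have "\<dots> = (\<integral>x. (\<integral>s. A x \<bullet> N (x, s) \<partial>PD) \<partial>PX)"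
    using P.integral_fst'[OF intAN] by simp
  also have "\<dots> = 0" using Nx by simp
  finally show "(\<integral>\<omega>. A (X \<omega>) \<bullet> N (X \<omega>, \<xi> \<omega>) \<partial>M) = 0" .
qed

text \<open>Only the correlations with \<open>A\<close> vanish; those among the noises are bounded by Cauchy-Schwarz, at a factor
\<open>card I\<close> that enters constants.\<close>

lemma uncorrelated_noise_second_moment:
  fixes A :: "'a \<Rightarrow> 'e::euclidean_space" and N :: "'i \<Rightarrow> 'a \<Rightarrow> 'e"
  assumes I: "finite I"
    and A: "A \<in> borel_measurable M" "integrable M (\<lambda>\<omega>. (norm (A \<omega>))\<^sup>2)"
    and N: "\<And>i. i \<in> I \<Longrightarrow> N i \<in> borel_measurable M" "\<And>i. i \<in> I \<Longrightarrow> integrable M (\<lambda>\<omega>. (norm (N i \<omega>))\<^sup>2)"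
    and AN: "\<And>i. i \<in> I \<Longrightarrow> integrable M (\<lambda>\<omega>. A \<omega> \<bullet> N i \<omega>)" "\<And>i. i \<in> I \<Longrightarrow> (\<integral>\<omega>. A \<omega> \<bullet> N i \<omega> \<partial>M) = 0"
  shows "integrable M (\<lambda>\<omega>. (norm (A \<omega> + (\<Sum>i\<in>I. N i \<omega>)))\<^sup>2)"
    and "(\<integral>\<omega>. (norm (A \<omega> + (\<Sum>i\<in>I. N i \<omega>)))\<^sup>2 \<partial>M)
      \<le> (\<integral>\<omega>. (norm (A \<omega>))\<^sup>2 \<partial>M) + real (card I) * (\<Sum>i\<in>I. \<integral>\<omega>. (norm (N i \<omega>))\<^sup>2 \<partial>M)"
proof -
  note [measurable] = A(1)
  have [measurable]: "(\<lambda>\<omega>. \<Sum>i\<in>I. N i \<omega>) \<in> borel_measurable M" using N(1) by (intro borel_measurable_sum)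
  have cs: "(norm (\<Sum>i\<in>I. N i \<omega>))\<^sup>2 \<le> real (card I) * (\<Sum>i\<in>I. (norm (N i \<omega>))\<^sup>2)" for \<omega>
  proof -
    have "(norm (\<Sum>i\<in>I. N i \<omega>))\<^sup>2 \<le> (\<Sum>i\<in>I. norm (N i \<omega>))\<^sup>2" by (intro power_mono norm_sum) simp
    also have "\<dots> \<le> (\<Sum>i\<in>I. (1::real)\<^sup>2) * (\<Sum>i\<in>I. (norm (N i \<omega>))\<^sup>2)"
      using Cauchy_Schwarz_ineq_sum[of "\<lambda>_. 1" "\<lambda>i. norm (N i \<omega>)" I] by simp
    finally show ?thesis by simp
  qed
  define U where "U \<omega> = (norm (A \<omega>))\<^sup>2 + 2 * (\<Sum>i\<in>I. A \<omega> \<bullet> N i \<omega>) + real (card I) * (\<Sum>i\<in>I. (norm (N i \<omega>))\<^sup>2)" for \<omega>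
  have U: "integrable M U" unfolding U_def using A N AN by (intro Bochner_Integration.integrable_add integrable_mult_right Bochner_Integration.integrable_sum)
  have le: "(norm (A \<omega> + (\<Sum>i\<in>I. N i \<omega>)))\<^sup>2 \<le> U \<omega>" for \<omega>
    using cs[of \<omega>] by (simp add: U_def power2_norm_eq_inner inner_add_left inner_add_right inner_commute inner_sum_right)
  show int: "integrable M (\<lambda>\<omega>. (norm (A \<omega> + (\<Sum>i\<in>I. N i \<omega>)))\<^sup>2)"
  proof (rule Bochner_Integration.integrable_bound[OF U])
    show "AE \<omega> in M. norm ((norm (A \<omega> + (\<Sum>i\<in>I. N i \<omega>)))\<^sup>2) \<le> norm (U \<omega>)"
    proof (rule AE_I2)
      fix \<omega> show "norm ((norm (A \<omega> + (\<Sum>i\<in>I. N i \<omega>)))\<^sup>2) \<le> norm (U \<omega>)"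
        using le[of \<omega>] by simp
    qed
  qed measurable
  have "(\<integral>\<omega>. (norm (A \<omega> + (\<Sum>i\<in>I. N i \<omega>)))\<^sup>2 \<partial>M) \<le> (\<integral>\<omega>. U \<omega> \<partial>M)"
    by (rule integral_mono[OF int U le])
  also have "\<dots> = (\<integral>\<omega>. (norm (A \<omega>))\<^sup>2 \<partial>M) + real (card I) * (\<Sum>i\<in>I. \<integral>\<omega>. (norm (N i \<omega>))\<^sup>2 \<partial>M)"
    unfolding U_def using A N AN by (simp add: Bochner_Integration.integral_sum Bochner_Integration.integrable_sum)
  finally show "(\<integral>\<omega>. (norm (A \<omega> + (\<Sum>i\<in>I. N i \<omega>)))\<^sup>2 \<partial>M)
      \<le> (\<integral>\<omega>. (norm (A \<omega>))\<^sup>2 \<partial>M) + real (card I) * (\<Sum>i\<in>I. \<integral>\<omega>. (norm (N i \<omega>))\<^sup>2 \<partial>M)" .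
qed

end

section \<open>The algorithm as an adapted process\<close>

lemma borel_measurable_vec_nth [measurable (raw)]:
  fixes h :: "'z \<Rightarrow> 'a::euclidean_space^'m"
  assumes "h \<in> borel_measurable N"
  shows "(\<lambda>\<omega>. h \<omega> $ i) \<in> borel_measurable N"
  using assms by (rule borel_measurable_continuous_on[where f = "\<lambda>v. v $ i", rotated])
    (intro continuous_intros)

lemma borel_measurable_vecI:
  fixes h :: "'z \<Rightarrow> 'a::euclidean_space^'m"
  assumes "\<And>i. (\<lambda>\<omega>. h \<omega> $ i) \<in> borel_measurable N"
  shows "h \<in> borel_measurable N"
proof -
  have 1: "h = (\<lambda>\<omega>. \<Sum>i\<in>UNIV. axis i (h \<omega> $ i))"
    by (auto simp: vec_eq_iff axis_def fun_eq_iff if_distrib cong: if_cong)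
  have "linear (axis i :: 'a \<Rightarrow> 'a^'m)" for i
    by (rule linearI) (auto simp: axis_def vec_eq_iff)
  then have "continuous_on UNIV (axis i :: 'a \<Rightarrow> 'a^'m)" for i
    by (rule linear_continuous_on[OF linear_conv_bounded_linear[THEN iffD1]])
  then have "(\<lambda>\<omega>. axis i (h \<omega> $ i) :: 'a^'m) \<in> borel_measurable N" for i
    using assms by (rule borel_measurable_continuous_on)
  then show ?thesis by (subst 1) (intro borel_measurable_sum)
qed

lemma borel_measurable_vec_lambda [measurable (raw)]:
  fixes h :: "'m::finite \<Rightarrow> 'z \<Rightarrow> 'a::euclidean_space"
  assumes "\<And>i. h i \<in> borel_measurable N"
  shows "(\<lambda>\<omega>. \<chi> i. h i \<omega>) \<in> borel_measurable N"
  using assms by (intro borel_measurable_vecI) simp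

lemma borel_measurable_matrix_vector [measurable (raw)]:
  fixes A :: "'z \<Rightarrow> real^'a^'b"
  assumes "A \<in> borel_measurable N" "u \<in> borel_measurable N"
  shows "(\<lambda>\<omega>. A \<omega> *v u \<omega>) \<in> borel_measurable N"
  unfolding matrix_vector_mult_def using assms by measurable

text \<open>The first iterate that a source of randomness can influence.\<close>

primrec time :: "'m source \<Rightarrow> nat" where
  "time Init = 0"
| "time (Xi1 k i) = Suc k"
| "time (Xi2 k i) = Suc k"
| "time (Xi3 k i) = Suc k"
| "time (Vs1 k i) = Suc k"
| "time (Vs2 k i) = Suc k"

locale lopa = prob_space M + problem c f g + gossip E W
  for M :: "'w measure" and c and f g :: "'m::finite \<Rightarrow> real^'n \<Rightarrow> real^'p \<Rightarrow> real"
    and E and W :: "real^'m^'m" +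
  fixes fh :: "'m \<Rightarrow> real^'n \<Rightarrow> real^'p \<Rightarrow> 'c \<Rightarrow> real" and gh :: "'m \<Rightarrow> real^'n \<Rightarrow> real^'p \<Rightarrow> 'b \<Rightarrow> real"
    and Df :: "'m \<Rightarrow> 'c measure" and Dg :: "'m \<Rightarrow> 'b measure" and S :: "('w, 'm, 'b, 'c) samples"
    and init :: "'w \<Rightarrow> (real^'n^'m) \<times> (real^'p^'m) \<times> (real^'p^'m) \<times> (real^'n^'m)"
    and p :: step_sizes
  assumes estimates: "stochastic_estimates c f g fh gh Df Dg M S init"
    and init_measurable: "init \<in> borel_measurable M"
    and init_integrable: "integrable M (\<lambda>\<omega>. (norm (init \<omega>))\<^sup>2)"
begin

abbreviation "events_of \<equiv> source_events M Df Dg S init"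

text \<open>The sigma-algebra generated by all sources up to time \<open>k\<close>; the \<open>k\<close>-th iterate is measurable for it.\<close>

definition past :: "nat \<Rightarrow> 'w measure" where
  "past k = sigma (space M) (\<Union>s\<in>{s. time s \<le> k}. events_of s)"

lemma samples_measurable [measurable]:
  "xi1 S k i \<in> M \<rightarrow>\<^sub>M Dg i" "xi2 S k i \<in> M \<rightarrow>\<^sub>M Dg i" "xi3 S k i \<in> M \<rightarrow>\<^sub>M Dg i"
  "vs1 S k i \<in> M \<rightarrow>\<^sub>M Df i" "vs2 S k i \<in> M \<rightarrow>\<^sub>M Df i"
  using estimates by (auto simp: stochastic_estimates_def)

lemma sources_independent: "indep_sets events_of UNIV"
  using estimates by (simp add: stochastic_estimates_def)

lemma events_of_subset: "events_of s \<subseteq> sets M"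
  using sources_independent by (simp add: indep_sets_def)

lemma past_generators: "(\<Union>s\<in>{s. time s \<le> k}. events_of s) \<subseteq> Pow (space M)"
  using events_of_subset sets.sets_into_space by blast

lemma space_past [simp]: "space (past k) = space M"
  unfolding past_def by (rule space_measure_of[OF past_generators])

lemma sets_past: "sets (past k) = sigma_sets (space M) (\<Union>s\<in>{s. time s \<le> k}. events_of s)"
  unfolding past_def by (rule sets_measure_of[OF past_generators])

lemma past_subset: "sets (past k) \<subseteq> sets M"
  unfolding sets_past by (rule sets.sigma_sets_subset) (use events_of_subset in blast)

lemma past_mono: "k \<le> j \<Longrightarrow> sets (past k) \<subseteq> sets (past j)"
  unfolding sets_past by (intro sigma_sets_mono' UN_mono) auto

lemma measurable_past_mono: "h \<in> past k \<rightarrow>\<^sub>M N \<Longrightarrow> k \<le> j \<Longrightarrow> h \<in> past j \<rightarrow>\<^sub>M N"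
  using past_mono[of k j] by (auto simp: measurable_def)

lemma source_measurable_past:
  assumes "h \<in> M \<rightarrow>\<^sub>M N" "events_of s = sets (vimage_algebra (space M) h N)" "time s \<le> k"
  shows "h \<in> past k \<rightarrow>\<^sub>M N"
proof (rule measurableI)
  show "h x \<in> space N" if "x \<in> space (past k)" for x
    using that measurable_space[OF assms(1)] by simp
  fix A assume "A \<in> sets N"
  then have "h -` A \<inter> space M \<in> events_of s" by (simp add: assms(2) in_vimage_algebra)
  then show "h -` A \<inter> space (past k) \<in> sets (past k)"
    using assms(3) by (auto simp: sets_past)
qed

lemma samples_measurable_past [measurable]:
  "xi1 S k i \<in> past (Suc k) \<rightarrow>\<^sub>M Dg i" "xi2 S k i \<in> past (Suc k) \<rightarrow>\<^sub>M Dg i" "xi3 S k i \<in> past (Suc k) \<rightarrow>\<^sub>M Dg i"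
  "vs1 S k i \<in> past (Suc k) \<rightarrow>\<^sub>M Df i" "vs2 S k i \<in> past (Suc k) \<rightarrow>\<^sub>M Df i"
  using source_measurable_past[of "xi1 S k i" "Dg i" "Xi1 k i" "Suc k"]
    source_measurable_past[of "xi2 S k i" "Dg i" "Xi2 k i" "Suc k"]
    source_measurable_past[of "xi3 S k i" "Dg i" "Xi3 k i" "Suc k"]
    source_measurable_past[of "vs1 S k i" "Df i" "Vs1 k i" "Suc k"]
    source_measurable_past[of "vs2 S k i" "Df i" "Vs2 k i" "Suc k"]
  by simp_all

lemma init_measurable_past: "init \<in> past 0 \<rightarrow>\<^sub>M borel"
  by (rule source_measurable_past[where s = Init]) (use init_measurable in auto)

lemma sampled_measurable [measurable]:
  "(\<lambda>(x, \<theta>, s). grad_x (\<lambda>u v. fh i u v s) x \<theta>) \<in> borel \<Otimes>\<^sub>M borel \<Otimes>\<^sub>M Df i \<rightarrow>\<^sub>M borel"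
  "(\<lambda>(x, \<theta>, s). grad_t (\<lambda>u v. fh i u v s) x \<theta>) \<in> borel \<Otimes>\<^sub>M borel \<Otimes>\<^sub>M Df i \<rightarrow>\<^sub>M borel"
  "(\<lambda>(x, \<theta>, s). grad_t (\<lambda>u v. gh i u v s) x \<theta>) \<in> borel \<Otimes>\<^sub>M borel \<Otimes>\<^sub>M Dg i \<rightarrow>\<^sub>M borel"
  "(\<lambda>(x, \<theta>, s). hess_tt (\<lambda>u v. gh i u v s) x \<theta>) \<in> borel \<Otimes>\<^sub>M borel \<Otimes>\<^sub>M Dg i \<rightarrow>\<^sub>M borel"
  "(\<lambda>(x, \<theta>, s). hess_xt (\<lambda>u v. gh i u v s) x \<theta>) \<in> borel \<Otimes>\<^sub>M borel \<Otimes>\<^sub>M Dg i \<rightarrow>\<^sub>M borel"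
  using estimates by (auto simp: stochastic_estimates_def sampled_derivatives_def)

lemma sampled_measurable_compose [measurable (raw)]:
  assumes "x \<in> borel_measurable N" "\<theta> \<in> borel_measurable N"
  shows "s \<in> N \<rightarrow>\<^sub>M Df i \<Longrightarrow> (\<lambda>\<omega>. grad_x (\<lambda>u v. fh i u v (s \<omega>)) (x \<omega>) (\<theta> \<omega>)) \<in> borel_measurable N"
    and "s \<in> N \<rightarrow>\<^sub>M Df i \<Longrightarrow> (\<lambda>\<omega>. grad_t (\<lambda>u v. fh i u v (s \<omega>)) (x \<omega>) (\<theta> \<omega>)) \<in> borel_measurable N"
    and "r \<in> N \<rightarrow>\<^sub>M Dg i \<Longrightarrow> (\<lambda>\<omega>. grad_t (\<lambda>u v. gh i u v (r \<omega>)) (x \<omega>) (\<theta> \<omega>)) \<in> borel_measurable N"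
    and "r \<in> N \<rightarrow>\<^sub>M Dg i \<Longrightarrow> (\<lambda>\<omega>. hess_tt (\<lambda>u v. gh i u v (r \<omega>)) (x \<omega>) (\<theta> \<omega>)) \<in> borel_measurable N"
    and "r \<in> N \<rightarrow>\<^sub>M Dg i \<Longrightarrow> (\<lambda>\<omega>. hess_xt (\<lambda>u v. gh i u v (r \<omega>)) (x \<omega>) (\<theta> \<omega>)) \<in> borel_measurable N"
  using measurable_compose[OF _ sampled_measurable(1)[of i], of "\<lambda>\<omega>. (x \<omega>, \<theta> \<omega>, s \<omega>)" N]
    measurable_compose[OF _ sampled_measurable(2)[of i], of "\<lambda>\<omega>. (x \<omega>, \<theta> \<omega>, s \<omega>)" N]
    measurable_compose[OF _ sampled_measurable(3)[of i], of "\<lambda>\<omega>. (x \<omega>, \<theta> \<omega>, r \<omega>)" N]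
    measurable_compose[OF _ sampled_measurable(4)[of i], of "\<lambda>\<omega>. (x \<omega>, \<theta> \<omega>, r \<omega>)" N]
    measurable_compose[OF _ sampled_measurable(5)[of i], of "\<lambda>\<omega>. (x \<omega>, \<theta> \<omega>, r \<omega>)" N]
    assms by (auto intro: measurable_Pair)

definition "X k \<omega> = lopa_lg E W fh gh S init p k \<omega>"
definition "xs k \<omega> = st_x (X k \<omega>)"
definition "ts k \<omega> = st_\<theta> (X k \<omega>)"
definition "vs k \<omega> = st_v (X k \<omega>)"
definition "zs k \<omega> = st_z (X k \<omega>)"
text \<open>All variables of the algorithm except \<open>y\<close>, which equals \<open>z\<close> in the local gradient scheme.\<close>

definition "st k \<omega> = (xs k \<omega>, ts k \<omega>, vs k \<omega>, zs k \<omega>)"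

lemma y_eq_z: "st_y (X k \<omega>) = zs k \<omega>"
  by (cases k) (auto simp: X_def zs_def lopa_lg_step_def Let_def split: prod.split)

lemma st_0: "st 0 \<omega> = init \<omega>"
  by (auto simp: X_def zs_def xs_def ts_def vs_def st_def split: prod.split)

lemma xs_Suc: "xs (Suc k) \<omega> = (1 - tau p) *\<^sub>R xs k \<omega> + tau p *\<^sub>R (mix W (xs k \<omega>) - alpha p *\<^sub>R zs k \<omega>)"
  using y_eq_z[of k \<omega>]
  by (simp add: X_def xs_def zs_def lopa_lg_step_def Let_def vec_eq_iff neighbor_sum)

lemma ts_Suc: "ts (Suc k) \<omega> $ i = ts k \<omega> $ i
    - beta p *\<^sub>R grad_t (\<lambda>a b. gh i a b (xi1 S k i \<omega>)) (xs k \<omega> $ i) (ts k \<omega> $ i)"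
  by (simp add: X_def xs_def ts_def lopa_lg_step_def Let_def)

lemma vs_Suc: "vs (Suc k) \<omega> $ i = vs k \<omega> $ i
    - lambda p *\<^sub>R (hess_tt (\<lambda>a b. gh i a b (xi2 S k i \<omega>)) (xs k \<omega> $ i) (ts k \<omega> $ i) *v (vs k \<omega> $ i)
        - grad_t (\<lambda>a b. fh i a b (vs1 S k i \<omega>)) (xs k \<omega> $ i) (ts k \<omega> $ i))"
  by (simp add: X_def xs_def ts_def vs_def lopa_lg_step_def Let_def)

lemma zs_Suc: "zs (Suc k) \<omega> $ i = (1 - gamma p) *\<^sub>R zs k \<omega> $ i
    + gamma p *\<^sub>R (grad_x (\<lambda>a b. fh i a b (vs2 S k i \<omega>)) (xs k \<omega> $ i) (ts k \<omega> $ i)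
        - hess_xt (\<lambda>a b. gh i a b (xi3 S k i \<omega>)) (xs k \<omega> $ i) (ts k \<omega> $ i) *v (vs k \<omega> $ i))"
  by (simp add: X_def xs_def ts_def vs_def zs_def lopa_lg_step_def Let_def algebra_simps)

lemma iterates_measurable_past:
  "xs k \<in> borel_measurable (past k) \<and> ts k \<in> borel_measurable (past k)
   \<and> vs k \<in> borel_measurable (past k) \<and> zs k \<in> borel_measurable (past k)"
proof (induction k)
  case 0
  have [measurable]: "init \<in> borel_measurable (past 0)" by (rule init_measurable_past)
  have "xs 0 = (\<lambda>\<omega>. fst (init \<omega>))" "ts 0 = (\<lambda>\<omega>. fst (snd (init \<omega>)))"
    "vs 0 = (\<lambda>\<omega>. fst (snd (snd (init \<omega>))))" "zs 0 = (\<lambda>\<omega>. snd (snd (snd (init \<omega>))))"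
    using st_0 by (auto simp: st_def fun_eq_iff) (metis fst_conv snd_conv)+
  moreover have "(\<lambda>\<omega>. fst (init \<omega>)) \<in> borel_measurable (past 0)"
    "(\<lambda>\<omega>. fst (snd (init \<omega>))) \<in> borel_measurable (past 0)"
    "(\<lambda>\<omega>. fst (snd (snd (init \<omega>)))) \<in> borel_measurable (past 0)"
    "(\<lambda>\<omega>. snd (snd (snd (init \<omega>)))) \<in> borel_measurable (past 0)"
    by (intro borel_measurable_continuous_on[OF _ init_measurable_past] continuous_intros)+
  ultimately show ?case by simp
next
  case (Suc k)
  then have [measurable]: "xs k \<in> borel_measurable (past (Suc k))" "ts k \<in> borel_measurable (past (Suc k))"
    "vs k \<in> borel_measurable (past (Suc k))" "zs k \<in> borel_measurable (past (Suc k))"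
    by (auto intro: measurable_past_mono)
  have "xs (Suc k) \<in> borel_measurable (past (Suc k))"
    unfolding xs_Suc mix_def by measurable
  moreover have "ts (Suc k) \<in> borel_measurable (past (Suc k))"
    by (rule borel_measurable_vecI, unfold ts_Suc) measurable
  moreover have "vs (Suc k) \<in> borel_measurable (past (Suc k))"
    by (rule borel_measurable_vecI, unfold vs_Suc) measurable
  moreover have "zs (Suc k) \<in> borel_measurable (past (Suc k))"
    by (rule borel_measurable_vecI, unfold zs_Suc) measurable
  ultimately show ?case by simp
qed

lemma st_measurable_past: "st k \<in> borel_measurable (past k)"
  using iterates_measurable_past[of k] unfolding st_def by (intro borel_measurable_Pair) auto

lemma measurable_from_past: "h \<in> past k \<rightarrow>\<^sub>M N \<Longrightarrow> h \<in> M \<rightarrow>\<^sub>M N"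
  using past_subset[of k] by (auto simp: measurable_def)

lemma st_measurable [measurable]: "st k \<in> borel_measurable M"
  by (rule measurable_from_past[OF st_measurable_past])

text \<open>The state at time \<open>k\<close> and a sample drawn at time \<open>k\<close> are generated by disjoint groups of independent
sources.\<close>

lemma state_independent_of_source:
  assumes s: "time s = Suc k" and ev: "events_of s = sets (vimage_algebra (space M) \<xi> D)"
  shows "indep_set (sets (vimage_algebra (space M) (st k) borel)) (sets (vimage_algebra (space M) \<xi> D))"
proof -
  define I where "I = case_bool {s. time s \<le> k} {s}"
  have "indep_sets (\<lambda>b. sigma_sets (space M) (\<Union>s\<in>I b. events_of s)) UNIV"
  proof (rule indep_sets_collect_sigma)
    show "indep_sets events_of (\<Union> (range I))"
      by (rule indep_sets_mono_index[OF _ sources_independent]) simp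
    show "Int_stable (events_of i)" if "i \<in> I j" for i j
      by (cases i) (auto simp: Int_stable_def intro: sets.Int)
    show "disjoint_family I"
      using s by (auto simp: disjoint_family_on_def I_def split: bool.splits)
  qed
  then have "indep_sets (case_bool (sets (vimage_algebra (space M) (st k) borel)) (sets (vimage_algebra (space M) \<xi> D))) UNIV"
  proof (rule indep_sets_mono_sets)
    have "sets (vimage_algebra (space M) (st k) borel) \<subseteq> sets (past k)"
      using measurable_sets[OF st_measurable_past[of k]] by (auto simp: sets_vimage_algebra2)
    then show "case_bool (sets (vimage_algebra (space M) (st k) borel)) (sets (vimage_algebra (space M) \<xi> D)) b
      \<subseteq> sigma_sets (space M) (\<Union>s\<in>I b. events_of s)" for b
      by (cases b) (auto simp: I_def sets_past ev)
  qed
  then show ?thesis by (simp add: indep_set_def)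
qed

end

section \<open>Square integrability along the iterates\<close>

text \<open>The functions of the state that occur below are square integrable along the iterates because the
state is; linear growth is the property that propagates this and is closed under composition.\<close>

definition linear_growth :: "('s::euclidean_space \<Rightarrow> 'e::euclidean_space) \<Rightarrow> bool" where
  "linear_growth h \<longleftrightarrow> h \<in> borel_measurable borel \<and> (\<exists>K\<ge>0. \<forall>s. norm (h s) \<le> K * (1 + norm s))"

lemma linear_growthI:
  fixes h :: "'s::euclidean_space \<Rightarrow> 'e::euclidean_space"
  assumes "h \<in> borel_measurable borel" "\<And>s. norm (h s) \<le> K * (1 + norm s)"
  shows "linear_growth h"
  unfolding linear_growth_def
proof (intro conjI exI allI)
  show "h \<in> borel_measurable borel" by fact
  show "max K 0 \<ge> 0" by simp
  fix s :: 's
  have "K * (1 + norm s) \<le> max K 0 * (1 + norm s)" by (intro mult_right_mono) auto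
  then show "norm (h s) \<le> max K 0 * (1 + norm s)" using assms(2)[of s] by linarith
qed

lemma linear_growth_bounded_linear:
  fixes h :: "'s::euclidean_space \<Rightarrow> 'e::euclidean_space"
  assumes h: "bounded_linear h"
  shows "linear_growth h"
proof -
  obtain K where K: "\<And>s. norm (h s) \<le> norm s * K" "K > 0" using bounded_linear.pos_bounded[OF h] by auto
  show ?thesis
  proof (rule linear_growthI[where K = K])
    show "h \<in> borel_measurable borel" using h by (intro borel_measurable_continuous_onI linear_continuous_on)
    fix s show "norm (h s) \<le> K * (1 + norm s)" using K(1)[of s] K(2) by (simp add: algebra_simps)
  qed
qed

lemma linear_growth_compose:
  assumes F: "linear_growth F" and h: "linear_growth h"
  shows "linear_growth (\<lambda>s. F (h s))"
proof -
  obtain K where K: "K \<ge> 0" "\<And>s. norm (F s) \<le> K * (1 + norm s)" using F by (auto simp: linear_growth_def)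
  obtain B where B: "B \<ge> 0" "\<And>s. norm (h s) \<le> B * (1 + norm s)" using h by (auto simp: linear_growth_def)
  show ?thesis
  proof (rule linear_growthI[where K = "K * (1 + B)"])
    show "(\<lambda>s. F (h s)) \<in> borel_measurable borel"
      using F h by (auto simp: linear_growth_def intro: measurable_compose)
    fix s
    have "norm (F (h s)) \<le> K * (1 + norm (h s))" by (rule K)
    also have "\<dots> \<le> K * (1 + B * (1 + norm s))" using K B by (intro mult_left_mono add_left_mono) auto
    also have "\<dots> \<le> K * (1 + B) * (1 + norm s)" using K B by (simp add: algebra_simps)
    finally show "norm (F (h s)) \<le> K * (1 + B) * (1 + norm s)" .
  qed
qed

lemma linear_growth_Pair:
  assumes "linear_growth h" "linear_growth k"
  shows "linear_growth (\<lambda>s. (h s, k s))"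
proof -
  obtain K where K: "\<And>s. norm (h s) \<le> K * (1 + norm s)" using assms by (auto simp: linear_growth_def)
  obtain B where B: "\<And>s. norm (k s) \<le> B * (1 + norm s)" using assms by (auto simp: linear_growth_def)
  show ?thesis
  proof (rule linear_growthI[where K = "K + B"])
    show "(\<lambda>s. (h s, k s)) \<in> borel_measurable borel" using assms by (auto simp: linear_growth_def)
    fix s show "norm (h s, k s) \<le> (K + B) * (1 + norm s)"
      using norm_Pair_le[of "h s" "k s"] K[of s] B[of s] by (simp add: algebra_simps)
  qed
qed

lemma
  fixes h k :: "'s::euclidean_space \<Rightarrow> 'e::euclidean_space"
  shows linear_growth_add: "linear_growth h \<Longrightarrow> linear_growth k \<Longrightarrow> linear_growth (\<lambda>s. h s + k s)"
  and linear_growth_diff: "linear_growth h \<Longrightarrow> linear_growth k \<Longrightarrow> linear_growth (\<lambda>s. h s - k s)"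
proof -
  assume hk: "linear_growth h" "linear_growth k"
  have "linear_growth (\<lambda>z::'e \<times> 'e. fst z + snd z)" "linear_growth (\<lambda>z::'e \<times> 'e. fst z - snd z)"
    by (intro linear_growth_bounded_linear bounded_linear_add bounded_linear_sub bounded_linear_fst bounded_linear_snd)+
  from linear_growth_compose[OF this(1) linear_growth_Pair[OF hk]] linear_growth_compose[OF this(2) linear_growth_Pair[OF hk]]
  show "linear_growth (\<lambda>s. h s + k s)" "linear_growth (\<lambda>s. h s - k s)" by simp_all
qed

lemma linear_growth_scaleR: "linear_growth h \<Longrightarrow> linear_growth (\<lambda>s. a *\<^sub>R h s)"
  by (rule linear_growth_compose[of "\<lambda>s. a *\<^sub>R s" h]) (intro linear_growth_bounded_linear bounded_linear_scaleR_right)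

lemma linear_growth_const: "linear_growth (\<lambda>s. a)"
  by (rule linear_growthI[where K = "norm a"]) (auto simp: algebra_simps)

lemma linear_growth_almost_lipschitz:
  fixes F :: "'s::euclidean_space \<Rightarrow> 'e::euclidean_space"
  assumes "almost_lipschitz F"
  shows "linear_growth F"
proof -
  obtain C where C: "C \<ge> 0" "\<And>\<eta> x y. 0 < \<eta> \<Longrightarrow> \<eta> \<le> 1 \<Longrightarrow> norm (F x - F y) \<le> \<eta> + C / \<eta> * norm (x - y)"
    using assms unfolding almost_lipschitz_def by blast
  show ?thesis
  proof (rule linear_growthI[where K = "norm (F 0) + 1 + C"])
    show "F \<in> borel_measurable borel"
      by (rule borel_measurable_continuous_onI[OF almost_lipschitz_continuous[OF assms]])
    fix s
    have "norm (F s) \<le> norm (F 0) + norm (F s - F 0)" by norm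
    also have "\<dots> \<le> norm (F 0) + (1 + C * norm s)" using C(2)[of 1 s 0] by simp
    also have "\<dots> \<le> (norm (F 0) + 1 + C) * (1 + norm s)" using C(1) by (simp add: algebra_simps)
    finally show "norm (F s) \<le> (norm (F 0) + 1 + C) * (1 + norm s)" .
  qed
qed

context problem
begin

lemma linear_growth_sol: "linear_growth (sol i)"
proof (rule linear_growthI[where K = "norm (sol i 0) + C_gxt c / mu_g c"])
  show "sol i \<in> borel_measurable borel" by (rule borel_measurable_continuous_onI[OF sol_continuous])
  fix x
  have "norm (sol i x) \<le> norm (sol i 0) + norm (sol i x - sol i 0)" by norm
  also have "\<dots> \<le> norm (sol i 0) + C_gxt c / mu_g c * norm x" using sol_lipschitz[of i x 0] by simp
  also have "\<dots> \<le> (norm (sol i 0) + C_gxt c / mu_g c) * (1 + norm x)"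
  proof -
    have "0 \<le> norm x * norm (sol i 0)" "0 \<le> C_gxt c / mu_g c" using positive_constants by auto
    then show ?thesis unfolding distrib_left distrib_right by (simp only: mult.commute[of "norm x"] mult_1_right)
  qed
  finally show "norm (sol i x) \<le> (norm (sol i 0) + C_gxt c / mu_g c) * (1 + norm x)" .
qed

lemma linear_growth_residual: "linear_growth (\<lambda>z. snd z - sol i (fst z))"
  by (intro linear_growth_diff linear_growth_compose[OF linear_growth_sol] linear_growth_bounded_linear
      bounded_linear_fst bounded_linear_snd)

lemma linear_growth_gradients:
  "linear_growth (\<lambda>z. grad_t (g i) (fst z) (snd z))"
  "linear_growth (\<lambda>z. grad_t (f i) (fst z) (snd z))"
  "linear_growth (\<lambda>z. grad_x (f i) (fst z) (snd z))"
proof -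
  note meas = continuous_gradients[THEN borel_measurable_continuous_onI]
  obtain K where K: "K \<ge> 0" "\<And>z. norm (snd z - sol i (fst z)) \<le> K * (1 + norm z)"
    using linear_growth_residual[of i] by (auto simp: linear_growth_def)
  show "linear_growth (\<lambda>z. grad_t (g i) (fst z) (snd z))"
  proof (rule linear_growthI[OF meas(3), where K = "L_gt c * K"])
    fix z
    have "norm (grad_t (g i) (fst z) (snd z)) \<le> L_gt c * norm (snd z - sol i (fst z))"
      using grad_t_g_lipschitz[of i "fst z" "snd z" "sol i (fst z)"] by (simp add: grad_t_g_sol)
    also have "\<dots> \<le> L_gt c * (K * (1 + norm z))" using K positive_constants by (intro mult_left_mono) auto
    finally show "norm (grad_t (g i) (fst z) (snd z)) \<le> L_gt c * K * (1 + norm z)" by (simp add: mult.assoc)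
  qed
  show "linear_growth (\<lambda>z. grad_t (f i) (fst z) (snd z))"
  proof (rule linear_growthI[OF meas(2), where K = "C_ft c + L_ft c * K"])
    fix z
    have "norm (grad_t (f i) (fst z) (snd z)) \<le> C_ft c + L_ft c * norm (snd z - sol i (fst z))"
      by (rule grad_t_f_growth)
    also have "\<dots> \<le> C_ft c * (1 + norm z) + L_ft c * (K * (1 + norm z))"
      using K positive_constants by (intro add_mono mult_left_mono) (auto simp: algebra_simps)
    finally show "norm (grad_t (f i) (fst z) (snd z)) \<le> (C_ft c + L_ft c * K) * (1 + norm z)"
      by (simp add: algebra_simps)
  qed
  obtain C where C: "C \<ge> 0"
    "\<And>i x t y. norm (grad_x (f i) x t - grad_x (f i) y (sol i y)) \<le> C * (1 + norm (x - y) + norm (t - sol i y))"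
    using grad_x_coarse by metis
  show "linear_growth (\<lambda>z. grad_x (f i) (fst z) (snd z))"
  proof (rule linear_growthI[OF meas(1), where K = "norm (grad_x (f i) 0 (sol i 0)) + C * (1 + norm (sol i 0)) + 2 * C"])
    fix z :: "(real^'n) \<times> (real^'p)"
    have "norm (grad_x (f i) (fst z) (snd z)) \<le> norm (grad_x (f i) 0 (sol i 0)) + norm (grad_x (f i) (fst z) (snd z) - grad_x (f i) 0 (sol i 0))"
      by norm
    also have "norm (grad_x (f i) (fst z) (snd z) - grad_x (f i) 0 (sol i 0)) \<le> C * (1 + norm (fst z) + norm (snd z - sol i 0))"
      using C(2)[of i "fst z" "snd z" 0] by simp
    also have "\<dots> \<le> C * (1 + norm z + (norm z + norm (sol i 0)))"
      using C(1) norm_fst_le[of "fst z" "snd z"] norm_snd_le[of "snd z" "fst z"] norm_triangle_ineq4[of "snd z" "sol i 0"]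
      by (intro mult_left_mono add_mono) auto
    also have "norm (grad_x (f i) 0 (sol i 0)) + C * (1 + norm z + (norm z + norm (sol i 0)))
      \<le> (norm (grad_x (f i) 0 (sol i 0)) + C * (1 + norm (sol i 0)) + 2 * C) * (1 + norm z)"
      using C(1) by (simp add: algebra_simps)
    finally show "norm (grad_x (f i) (fst z) (snd z)) \<le> (norm (grad_x (f i) 0 (sol i 0)) + C * (1 + norm (sol i 0)) + 2 * C) * (1 + norm z)"
      by simp
  qed
qed

lemma linear_growth_hessians:
  "linear_growth (\<lambda>z. hess_tt (g i) (fst z) (fst (snd z)) *v snd (snd z))"
  "linear_growth (\<lambda>z. hess_xt (g i) (fst z) (fst (snd z)) *v snd (snd z))"
proof -
  have pair: "(\<lambda>z::(real^'n) \<times> (real^'p) \<times> (real^'p). (fst z, fst (snd z))) \<in> borel_measurable borel"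
    "(\<lambda>z::(real^'n) \<times> (real^'p) \<times> (real^'p). snd (snd z)) \<in> borel_measurable borel"
    by (intro borel_measurable_continuous_onI continuous_intros)+
  have snd_le: "norm (snd (snd z)) \<le> norm z" for z :: "(real^'n) \<times> (real^'p) \<times> (real^'p)"
    using norm_snd_le[of "snd (snd z)" "fst (snd z)"] norm_snd_le[of "snd z" "fst z"] by simp
  note m = measurable_compose[OF pair(1) borel_measurable_continuous_onI[OF continuous_gradients(4)[of i]]]
    measurable_compose[OF pair(1) borel_measurable_continuous_onI[OF continuous_gradients(5)[of i]]]
  have [measurable]: "(\<lambda>z::(real^'n) \<times> (real^'p) \<times> (real^'p). hess_tt (g i) (fst z) (fst (snd z))) \<in> borel_measurable borel"
    "(\<lambda>z::(real^'n) \<times> (real^'p) \<times> (real^'p). hess_xt (g i) (fst z) (fst (snd z))) \<in> borel_measurable borel"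
    using m by simp_all
  show "linear_growth (\<lambda>z. hess_tt (g i) (fst z) (fst (snd z)) *v snd (snd z))"
  proof (rule linear_growthI[where K = "L_gt c"])
    fix z :: "(real^'n) \<times> (real^'p) \<times> (real^'p)"
    have "L_gt c * norm (snd (snd z)) \<le> L_gt c * (1 + norm z)"
      using snd_le[of z] positive_constants by (intro mult_left_mono) auto
    then show "norm (hess_tt (g i) (fst z) (fst (snd z)) *v snd (snd z)) \<le> L_gt c * (1 + norm z)"
      using hess_tt_bounded order_trans by blast
  qed (use pair(2) in measurable)
  show "linear_growth (\<lambda>z. hess_xt (g i) (fst z) (fst (snd z)) *v snd (snd z))"
  proof (rule linear_growthI[where K = "C_gxt c"])
    fix z :: "(real^'n) \<times> (real^'p) \<times> (real^'p)"
    have "C_gxt c * norm (snd (snd z)) \<le> C_gxt c * (1 + norm z)"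
      using snd_le[of z] positive_constants by (intro mult_left_mono) auto
    then show "norm (hess_xt (g i) (fst z) (fst (snd z)) *v snd (snd z)) \<le> C_gxt c * (1 + norm z)"
      using hess_xt_bounded order_trans by blast
  qed (use pair(2) in measurable)
qed

lemmas linear_growth_problem =
  linear_growth_sol linear_growth_almost_lipschitz[OF grad_Phi_almost_lipschitz]
  linear_growth_almost_lipschitz[OF gradient_Phi_almost_lipschitz]

end

type_synonym ('a, 'b, 'd) iterate = "(real^'a^'d) \<times> (real^'b^'d) \<times> (real^'b^'d) \<times> (real^'a^'d)"

context lopa
begin

text \<open>\<open>\<eta>\<close> is noise at step \<open>k\<close> with conditional variance at most \<open>v\<close>: its second moment is controlled by \<open>v\<close> and
it is uncorrelated with all square integrable functions of the state.\<close>

definition noise :: "nat \<Rightarrow> (('n, 'p, 'm) iterate \<Rightarrow> real) \<Rightarrow> ('w \<Rightarrow> 'e::euclidean_space) \<Rightarrow> bool" where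
  "noise k v \<eta> \<longleftrightarrow> \<eta> \<in> borel_measurable M \<and> integrable M (\<lambda>\<omega>. (norm (\<eta> \<omega>))\<^sup>2) \<and>
     (\<integral>\<omega>. (norm (\<eta> \<omega>))\<^sup>2 \<partial>M) \<le> (\<integral>\<omega>. v (st k \<omega>) \<partial>M) \<and>
     (\<forall>A. A \<in> borel_measurable borel \<longrightarrow> integrable M (\<lambda>\<omega>. (norm (A (st k \<omega>)))\<^sup>2) \<longrightarrow>
        integrable M (\<lambda>\<omega>. A (st k \<omega>) \<bullet> \<eta> \<omega>) \<and> (\<integral>\<omega>. A (st k \<omega>) \<bullet> \<eta> \<omega> \<partial>M) = 0)"

lemma noiseI:
  assumes s: "time s = Suc k" "events_of s = sets (vimage_algebra (space M) \<xi> D)" "\<xi> \<in> M \<rightarrow>\<^sub>M D"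
    and N: "N \<in> borel_measurable (borel \<Otimes>\<^sub>M D)"
    and mean: "\<And>x. integrable M (\<lambda>\<omega>. N (x, \<xi> \<omega>))" "\<And>x. (\<integral>\<omega>. N (x, \<xi> \<omega>) \<partial>M) = 0"
    and var: "\<And>x. integrable M (\<lambda>\<omega>. (norm (N (x, \<xi> \<omega>)))\<^sup>2)" "\<And>x. (\<integral>\<omega>. (norm (N (x, \<xi> \<omega>)))\<^sup>2 \<partial>M) \<le> v x"
    and v: "v \<in> borel_measurable borel" "integrable M (\<lambda>\<omega>. v (st k \<omega>))"
  shows "noise k v (\<lambda>\<omega>. N (st k \<omega>, \<xi> \<omega>))"
proof -
  note ind = state_independent_of_source[OF s(1,2)]
  note * = indep_noise[OF st_measurable s(3) ind N mean var v]
  have [measurable]: "(\<lambda>\<omega>. N (st k \<omega>, \<xi> \<omega>)) \<in> borel_measurable M"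
    using s(3) N by measurable
  show ?thesis unfolding noise_def
    using *[of "\<lambda>_. 0"] *(3,4) by auto
qed

lemma state_square_integrable_compose:
  assumes "integrable M (\<lambda>\<omega>. (norm (st k \<omega>))\<^sup>2)" "linear_growth h"
  shows "(\<lambda>\<omega>. h (st k \<omega>)) \<in> borel_measurable M" "integrable M (\<lambda>\<omega>. (norm (h (st k \<omega>)))\<^sup>2)"
proof -
  have [measurable]: "h \<in> borel_measurable borel" using assms by (simp add: linear_growth_def)
  show [measurable]: "(\<lambda>\<omega>. h (st k \<omega>)) \<in> borel_measurable M" by measurable
  obtain K where K: "K \<ge> 0" "\<And>s. norm (h s) \<le> K * (1 + norm s)" using assms by (auto simp: linear_growth_def)
  show "integrable M (\<lambda>\<omega>. (norm (h (st k \<omega>)))\<^sup>2)"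
  proof (rule Bochner_Integration.integrable_bound)
    show "integrable M (\<lambda>\<omega>. K\<^sup>2 * (2 * 1\<^sup>2 + 2 * (norm (st k \<omega>))\<^sup>2))" using assms by simp
    show "AE \<omega> in M. norm ((norm (h (st k \<omega>)))\<^sup>2) \<le> norm (K\<^sup>2 * (2 * 1\<^sup>2 + 2 * (norm (st k \<omega>))\<^sup>2))"
    proof (rule AE_I2)
      fix \<omega>
      have "(norm (h (st k \<omega>)))\<^sup>2 \<le> (K * (1 + norm (st k \<omega>)))\<^sup>2" using K by (intro power_mono) auto
      also have "\<dots> \<le> K\<^sup>2 * (2 * 1\<^sup>2 + 2 * (norm (st k \<omega>))\<^sup>2)"
        unfolding power_mult_distrib by (intro mult_left_mono sq_sum2) auto
      finally show "norm ((norm (h (st k \<omega>)))\<^sup>2) \<le> norm (K\<^sup>2 * (2 * 1\<^sup>2 + 2 * (norm (st k \<omega>))\<^sup>2))" by simp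
    qed
  qed measurable
qed

text \<open>The basic step in expectation: the squared norm of a drift plus noises is bounded by that of the
drift and the variances.\<close>

lemma drift_plus_noise:
  fixes \<eta> :: "'j \<Rightarrow> 'w \<Rightarrow> 'e::euclidean_space"
  assumes sq: "integrable M (\<lambda>\<omega>. (norm (st k \<omega>))\<^sup>2)" and h: "linear_growth h"
    and I: "finite I" and \<eta>: "\<And>j. j \<in> I \<Longrightarrow> noise k (v j) (\<eta> j)"
  shows "(\<lambda>\<omega>. h (st k \<omega>) + (\<Sum>j\<in>I. \<eta> j \<omega>)) \<in> borel_measurable M"
    and "integrable M (\<lambda>\<omega>. (norm (h (st k \<omega>) + (\<Sum>j\<in>I. \<eta> j \<omega>)))\<^sup>2)"
    and "(\<integral>\<omega>. (norm (h (st k \<omega>) + (\<Sum>j\<in>I. \<eta> j \<omega>)))\<^sup>2 \<partial>M)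
      \<le> (\<integral>\<omega>. (norm (h (st k \<omega>)))\<^sup>2 \<partial>M) + real (card I) * (\<Sum>j\<in>I. \<integral>\<omega>. v j (st k \<omega>) \<partial>M)"
proof -
  note hs = state_square_integrable_compose[OF sq h]
  have hm: "h \<in> borel_measurable borel" using h by (simp add: linear_growth_def)
  show "(\<lambda>\<omega>. h (st k \<omega>) + (\<Sum>j\<in>I. \<eta> j \<omega>)) \<in> borel_measurable M"
    using hs(1) \<eta> by (intro borel_measurable_add borel_measurable_sum) (auto simp: noise_def)
  have *: "integrable M (\<lambda>\<omega>. (norm (h (st k \<omega>) + (\<Sum>j\<in>I. \<eta> j \<omega>)))\<^sup>2)"
    "(\<integral>\<omega>. (norm (h (st k \<omega>) + (\<Sum>j\<in>I. \<eta> j \<omega>)))\<^sup>2 \<partial>M)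
      \<le> (\<integral>\<omega>. (norm (h (st k \<omega>)))\<^sup>2 \<partial>M) + real (card I) * (\<Sum>j\<in>I. \<integral>\<omega>. (norm (\<eta> j \<omega>))\<^sup>2 \<partial>M)"
    using \<eta> hs hm by (intro uncorrelated_noise_second_moment[OF I]; force simp: noise_def)+
  show "integrable M (\<lambda>\<omega>. (norm (h (st k \<omega>) + (\<Sum>j\<in>I. \<eta> j \<omega>)))\<^sup>2)" by fact
  have "real (card I) * (\<Sum>j\<in>I. \<integral>\<omega>. (norm (\<eta> j \<omega>))\<^sup>2 \<partial>M) \<le> real (card I) * (\<Sum>j\<in>I. \<integral>\<omega>. v j (st k \<omega>) \<partial>M)"
    using \<eta> by (intro mult_left_mono sum_mono) (auto simp: noise_def)
  then show "(\<integral>\<omega>. (norm (h (st k \<omega>) + (\<Sum>j\<in>I. \<eta> j \<omega>)))\<^sup>2 \<partial>M)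
      \<le> (\<integral>\<omega>. (norm (h (st k \<omega>)))\<^sup>2 \<partial>M) + real (card I) * (\<Sum>j\<in>I. \<integral>\<omega>. v j (st k \<omega>) \<partial>M)"
    using *(2) by linarith
qed

end

section \<open>Drift and noise of the updates\<close>

lemma borel_measurable_fst_snd [measurable (raw)]:
  fixes h :: "'z \<Rightarrow> 'a::second_countable_topology \<times> 'b::second_countable_topology"
  assumes "h \<in> borel_measurable N"
  shows "(\<lambda>z. fst (h z)) \<in> borel_measurable N" "(\<lambda>z. snd (h z)) \<in> borel_measurable N"
  by (intro borel_measurable_continuous_on[OF _ assms] continuous_intros)+

lemma linear_growth_vec_nth: "linear_growth h \<Longrightarrow> linear_growth (\<lambda>s. h s $ i)"
  by (rule linear_growth_compose[of "\<lambda>v. v $ i" h])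
    (intro linear_growth_bounded_linear bounded_linear_vec_nth)

lemma linear_growth_avg:
  fixes h :: "'s::euclidean_space \<Rightarrow> real^'a^'b"
  shows "linear_growth h \<Longrightarrow> linear_growth (\<lambda>s. avg (h s))"
proof (rule linear_growth_compose[of avg h])
  have "linear (avg :: real^'a^'b \<Rightarrow> real^'a)" by (rule linearI) (simp_all add: avg_add avg_scaleR)
  then show "linear_growth (avg :: real^'a^'b \<Rightarrow> real^'a)"
    by (intro linear_growth_bounded_linear) (simp add: linear_conv_bounded_linear)
qed

lemma linear_growth_mix:
  fixes h :: "'s::euclidean_space \<Rightarrow> real^'a^'b"
  shows "linear_growth h \<Longrightarrow> linear_growth (\<lambda>s. mix A (h s))"
proof (rule linear_growth_compose[of "mix A" h])
  have "linear (mix A :: real^'a^'b \<Rightarrow> real^'a^'b)"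
    by (rule linearI) (simp_all add: mix_def vec_eq_iff scaleR_add_right sum.distrib scaleR_right.sum mult.commute scaleR_left_commute)
  then show "linear_growth (mix A :: real^'a^'b \<Rightarrow> real^'a^'b)"
    by (intro linear_growth_bounded_linear) (simp add: linear_conv_bounded_linear)
qed

lemma linear_growth_components:
  "linear_growth (\<lambda>s :: ('a::finite, 'b::finite, 'd::finite) iterate. fst s)"
  "linear_growth (\<lambda>s :: ('a::finite, 'b::finite, 'd::finite) iterate. fst (snd s))"
  "linear_growth (\<lambda>s :: ('a::finite, 'b::finite, 'd::finite) iterate. fst (snd (snd s)))"
  "linear_growth (\<lambda>s :: ('a::finite, 'b::finite, 'd::finite) iterate. snd (snd (snd s)))"
  by (intro linear_growth_bounded_linear bounded_linear_intros bounded_linear_fst_comp bounded_linear_snd_comp bounded_linear_ident)+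

lemma bounded_linear_matrix_left: "bounded_linear (\<lambda>A :: real^'a^'b. A *v u)"
proof -
  have "linear (\<lambda>A :: real^'a^'b. A *v u)"
    by (rule linearI) (simp_all add: matrix_vector_mult_add_rdistrib matrix_vector_mult_def vec_eq_iff sum_distrib_left
        distrib_right sum.distrib mult.assoc)
  then show ?thesis by (simp add: linear_conv_bounded_linear)
qed

lemma norm_Pair_sq: "(norm (a, b))\<^sup>2 = (norm a)\<^sup>2 + (norm b)\<^sup>2"
  by (simp add: norm_Pair)

context lopa
begin

lemma st_components [simp]: "fst (st k \<omega>) = xs k \<omega>" "fst (snd (st k \<omega>)) = ts k \<omega>"
  "fst (snd (snd (st k \<omega>))) = vs k \<omega>" "snd (snd (snd (st k \<omega>))) = zs k \<omega>"
  by (simp_all add: st_def)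

lemma vector_sample_noise:
  fixes F :: "real^'n \<Rightarrow> real^'p \<Rightarrow> 'd \<Rightarrow> 'e::euclidean_space"
  assumes s: "time s = Suc k" "events_of s = sets (vimage_algebra (space M) \<xi> D)" "\<xi> \<in> M \<rightarrow>\<^sub>M D"
    and F: "(\<lambda>(x, \<theta>, s). F x \<theta> s) \<in> borel \<Otimes>\<^sub>M borel \<Otimes>\<^sub>M D \<rightarrow>\<^sub>M borel"
    and F0: "(\<lambda>z. F0 (fst z) (snd z)) \<in> borel_measurable borel"
    and unb: "\<And>x \<theta>. unbiased_estimate M norm (\<lambda>\<omega>. F x \<theta> (\<xi> \<omega>)) (F0 x \<theta>) \<sigma>"
  shows "noise k (\<lambda>_. \<kappa>\<^sup>2 * \<sigma>\<^sup>2) (\<lambda>\<omega>. \<kappa> *\<^sub>R (F (xs k \<omega> $ i) (ts k \<omega> $ i) (\<xi> \<omega>) - F0 (xs k \<omega> $ i) (ts k \<omega> $ i)))"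
proof -
  define N where "N z = \<kappa> *\<^sub>R (F (fst (fst z) $ i) (fst (snd (fst z)) $ i) (snd z) - F0 (fst (fst z) $ i) (fst (snd (fst z)) $ i))"
    for z :: "('n, 'p, 'm) iterate \<times> 'd"
  have "noise k (\<lambda>_. \<kappa>\<^sup>2 * \<sigma>\<^sup>2) (\<lambda>\<omega>. N (st k \<omega>, \<xi> \<omega>))"
  proof (rule noiseI[OF s])
    have 1: "(\<lambda>z :: ('n, 'p, 'm) iterate \<times> 'd. F (fst (fst z) $ i) (fst (snd (fst z)) $ i) (snd z)) \<in> borel_measurable (borel \<Otimes>\<^sub>M D)"
      using measurable_compose[OF _ F, of "\<lambda>z :: ('n, 'p, 'm) iterate \<times> 'd. (fst (fst z) $ i, fst (snd (fst z)) $ i, snd z)" "borel \<Otimes>\<^sub>M D"]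
      by simp
    have 2: "(\<lambda>z :: ('n, 'p, 'm) iterate \<times> 'd. F0 (fst (fst z) $ i) (fst (snd (fst z)) $ i)) \<in> borel_measurable (borel \<Otimes>\<^sub>M D)"
      using measurable_compose[OF _ F0, of "\<lambda>z :: ('n, 'p, 'm) iterate \<times> 'd. (fst (fst z) $ i, fst (snd (fst z)) $ i)" "borel \<Otimes>\<^sub>M D"]
      by simp
    show "N \<in> borel_measurable (borel \<Otimes>\<^sub>M D)" unfolding N_def using 1 2 by measurable
    fix x :: "('n, 'p, 'm) iterate"
    let ?x = "fst x $ i" and ?t = "fst (snd x) $ i"
    have u: "integrable M (\<lambda>\<omega>. F ?x ?t (\<xi> \<omega>))" "(\<integral>\<omega>. F ?x ?t (\<xi> \<omega>) \<partial>M) = F0 ?x ?t"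
      "integrable M (\<lambda>\<omega>. (norm (F ?x ?t (\<xi> \<omega>) - F0 ?x ?t))\<^sup>2)"
      "(\<integral>\<omega>. (norm (F ?x ?t (\<xi> \<omega>) - F0 ?x ?t))\<^sup>2 \<partial>M) \<le> \<sigma>\<^sup>2"
      using unb[of ?x ?t] by (auto simp: unbiased_estimate_def)
    show "integrable M (\<lambda>\<omega>. N (x, \<xi> \<omega>))" unfolding N_def using u(1) by simp
    show "(\<integral>\<omega>. N (x, \<xi> \<omega>) \<partial>M) = 0" unfolding N_def using u(1,2) by (simp add: prob_space)
    show "integrable M (\<lambda>\<omega>. (norm (N (x, \<xi> \<omega>)))\<^sup>2)" unfolding N_def using u(3) by (simp add: power_mult_distrib)
    show "(\<integral>\<omega>. (norm (N (x, \<xi> \<omega>)))\<^sup>2 \<partial>M) \<le> \<kappa>\<^sup>2 * \<sigma>\<^sup>2" unfolding N_def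
      using u(4) by (simp add: power_mult_distrib mult_left_mono)
  qed auto
  then show ?thesis by (simp add: N_def)
qed

text \<open>The variance bound for the matrix estimates concerns the spectral norm, so it is scaled by the
squared length of the vector that the matrix is applied to, which is part of the state.\<close>

lemma matrix_sample_noise:
  fixes F :: "real^'n \<Rightarrow> real^'p \<Rightarrow> 'd \<Rightarrow> real^'p^'e"
  assumes sq: "integrable M (\<lambda>\<omega>. (norm (st k \<omega>))\<^sup>2)"
    and s: "time s = Suc k" "events_of s = sets (vimage_algebra (space M) \<xi> D)" "\<xi> \<in> M \<rightarrow>\<^sub>M D"
    and F: "(\<lambda>(x, \<theta>, s). F x \<theta> s) \<in> borel \<Otimes>\<^sub>M borel \<Otimes>\<^sub>M D \<rightarrow>\<^sub>M borel"
    and F0: "(\<lambda>z. F0 (fst z) (snd z)) \<in> borel_measurable borel"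
    and unb: "\<And>x \<theta>. unbiased_estimate M spectral_norm (\<lambda>\<omega>. F x \<theta> (\<xi> \<omega>)) (F0 x \<theta>) \<sigma>"
  shows "noise k (\<lambda>s. \<kappa>\<^sup>2 * (\<sigma>\<^sup>2 * (norm (fst (snd (snd s)) $ i))\<^sup>2))
    (\<lambda>\<omega>. \<kappa> *\<^sub>R ((F (xs k \<omega> $ i) (ts k \<omega> $ i) (\<xi> \<omega>) - F0 (xs k \<omega> $ i) (ts k \<omega> $ i)) *v (vs k \<omega> $ i)))"
proof -
  define N where "N z = \<kappa> *\<^sub>R ((F (fst (fst z) $ i) (fst (snd (fst z)) $ i) (snd z) - F0 (fst (fst z) $ i) (fst (snd (fst z)) $ i)) *v (fst (snd (snd (fst z))) $ i))"
    for z :: "('n, 'p, 'm) iterate \<times> 'd"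
  have "noise k (\<lambda>s. \<kappa>\<^sup>2 * (\<sigma>\<^sup>2 * (norm (fst (snd (snd s)) $ i))\<^sup>2)) (\<lambda>\<omega>. N (st k \<omega>, \<xi> \<omega>))"
  proof (rule noiseI[OF s])
    have 1: "(\<lambda>z :: ('n, 'p, 'm) iterate \<times> 'd. F (fst (fst z) $ i) (fst (snd (fst z)) $ i) (snd z)) \<in> borel_measurable (borel \<Otimes>\<^sub>M D)"
      using measurable_compose[OF _ F, of "\<lambda>z :: ('n, 'p, 'm) iterate \<times> 'd. (fst (fst z) $ i, fst (snd (fst z)) $ i, snd z)" "borel \<Otimes>\<^sub>M D"]
      by simp
    have 2: "(\<lambda>z :: ('n, 'p, 'm) iterate \<times> 'd. F0 (fst (fst z) $ i) (fst (snd (fst z)) $ i)) \<in> borel_measurable (borel \<Otimes>\<^sub>M D)"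
      using measurable_compose[OF _ F0, of "\<lambda>z :: ('n, 'p, 'm) iterate \<times> 'd. (fst (fst z) $ i, fst (snd (fst z)) $ i)" "borel \<Otimes>\<^sub>M D"]
      by simp
    show "N \<in> borel_measurable (borel \<Otimes>\<^sub>M D)" unfolding N_def using 1 2 by measurable
    show "(\<lambda>s. \<kappa>\<^sup>2 * (\<sigma>\<^sup>2 * (norm (fst (snd (snd (s :: ('n, 'p, 'm) iterate))) $ i))\<^sup>2)) \<in> borel_measurable borel" by measurable
    have "integrable M (\<lambda>\<omega>. (norm (vs k \<omega> $ i))\<^sup>2)"
      using state_square_integrable_compose(2)[OF sq linear_growth_vec_nth[OF linear_growth_components(3)]] by simp
    then show "integrable M (\<lambda>\<omega>. \<kappa>\<^sup>2 * (\<sigma>\<^sup>2 * (norm (fst (snd (snd (st k \<omega>))) $ i))\<^sup>2))" by simp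
    fix x :: "('n, 'p, 'm) iterate"
    let ?x = "fst x $ i" and ?t = "fst (snd x) $ i" and ?v = "fst (snd (snd x)) $ i"
    have u: "integrable M (\<lambda>\<omega>. F ?x ?t (\<xi> \<omega>))" "(\<integral>\<omega>. F ?x ?t (\<xi> \<omega>) \<partial>M) = F0 ?x ?t"
      "integrable M (\<lambda>\<omega>. (spectral_norm (F ?x ?t (\<xi> \<omega>) - F0 ?x ?t))\<^sup>2)"
      "(\<integral>\<omega>. (spectral_norm (F ?x ?t (\<xi> \<omega>) - F0 ?x ?t))\<^sup>2 \<partial>M) \<le> \<sigma>\<^sup>2"
      using unb[of ?x ?t] by (auto simp: unbiased_estimate_def)
    have d: "integrable M (\<lambda>\<omega>. F ?x ?t (\<xi> \<omega>) - F0 ?x ?t)" "(\<integral>\<omega>. F ?x ?t (\<xi> \<omega>) - F0 ?x ?t \<partial>M) = 0"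
      using u by (simp_all add: prob_space)
    have i1: "integrable M (\<lambda>\<omega>. (F ?x ?t (\<xi> \<omega>) - F0 ?x ?t) *v ?v)"
      using integrable_bounded_linear[OF bounded_linear_matrix_left d(1)] .
    have i2: "(\<integral>\<omega>. (F ?x ?t (\<xi> \<omega>) - F0 ?x ?t) *v ?v \<partial>M) = 0"
      using integral_bounded_linear[OF bounded_linear_matrix_left d(1), of ?v] d(2) by simp
    have le: "(norm ((F ?x ?t (\<xi> \<omega>) - F0 ?x ?t) *v ?v))\<^sup>2 \<le> (spectral_norm (F ?x ?t (\<xi> \<omega>) - F0 ?x ?t))\<^sup>2 * (norm ?v)\<^sup>2" for \<omega>
      unfolding power_mult_distrib[symmetric] by (intro power_mono norm_matrix_vector_le) simp
    have ib: "integrable M (\<lambda>\<omega>. (spectral_norm (F ?x ?t (\<xi> \<omega>) - F0 ?x ?t))\<^sup>2 * (norm ?v)\<^sup>2)" using u(3) by simp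
    have i3: "integrable M (\<lambda>\<omega>. (norm ((F ?x ?t (\<xi> \<omega>) - F0 ?x ?t) *v ?v))\<^sup>2)"
    proof (rule Bochner_Integration.integrable_bound[OF ib])
      show "(\<lambda>\<omega>. (norm ((F ?x ?t (\<xi> \<omega>) - F0 ?x ?t) *v ?v))\<^sup>2) \<in> borel_measurable M"
        using borel_measurable_integrable[OF i1] by measurable
    qed (use le in auto)
    have i4: "(\<integral>\<omega>. (norm ((F ?x ?t (\<xi> \<omega>) - F0 ?x ?t) *v ?v))\<^sup>2 \<partial>M) \<le> \<sigma>\<^sup>2 * (norm ?v)\<^sup>2"
    proof -
      have "(\<integral>\<omega>. (norm ((F ?x ?t (\<xi> \<omega>) - F0 ?x ?t) *v ?v))\<^sup>2 \<partial>M) \<le> (\<integral>\<omega>. (spectral_norm (F ?x ?t (\<xi> \<omega>) - F0 ?x ?t))\<^sup>2 * (norm ?v)\<^sup>2 \<partial>M)"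
        by (rule integral_mono[OF i3 ib le])
      also have "\<dots> = (\<integral>\<omega>. (spectral_norm (F ?x ?t (\<xi> \<omega>) - F0 ?x ?t))\<^sup>2 \<partial>M) * (norm ?v)\<^sup>2" by simp
      also have "\<dots> \<le> \<sigma>\<^sup>2 * (norm ?v)\<^sup>2" using u(4) by (intro mult_right_mono) auto
      finally show ?thesis .
    qed
    show "integrable M (\<lambda>\<omega>. N (x, \<xi> \<omega>))" unfolding N_def using i1 by simp
    show "(\<integral>\<omega>. N (x, \<xi> \<omega>) \<partial>M) = 0" unfolding N_def using i2 by simp
    show "integrable M (\<lambda>\<omega>. (norm (N (x, \<xi> \<omega>)))\<^sup>2)" unfolding N_def using i3 by (simp add: power_mult_distrib)
    show "(\<integral>\<omega>. (norm (N (x, \<xi> \<omega>)))\<^sup>2 \<partial>M) \<le> \<kappa>\<^sup>2 * (\<sigma>\<^sup>2 * (norm ?v)\<^sup>2)" unfolding N_def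
      using i4 by (simp add: power_mult_distrib mult_left_mono)
  qed
  then show ?thesis by (simp add: N_def)
qed

definition "noise_\<theta> k i \<omega> = (- beta p) *\<^sub>R (grad_t (\<lambda>a b. gh i a b (xi1 S k i \<omega>)) (xs k \<omega> $ i) (ts k \<omega> $ i)
    - grad_t (g i) (xs k \<omega> $ i) (ts k \<omega> $ i))"
definition "noise_v k i b \<omega> = (if b
   then (- lambda p) *\<^sub>R ((hess_tt (\<lambda>a b. gh i a b (xi2 S k i \<omega>)) (xs k \<omega> $ i) (ts k \<omega> $ i)
          - hess_tt (g i) (xs k \<omega> $ i) (ts k \<omega> $ i)) *v (vs k \<omega> $ i))
   else lambda p *\<^sub>R (grad_t (\<lambda>a b. fh i a b (vs1 S k i \<omega>)) (xs k \<omega> $ i) (ts k \<omega> $ i)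
          - grad_t (f i) (xs k \<omega> $ i) (ts k \<omega> $ i)))"
text \<open>The factor \<open>\<kappa>\<close> is \<open>gamma p\<close> for the variable of one node and \<open>gamma p / m\<close> for its contribution to the mean.\<close>

definition "noise_z k i \<kappa> b \<omega> = (if b
   then (- \<kappa>) *\<^sub>R ((hess_xt (\<lambda>a b. gh i a b (xi3 S k i \<omega>)) (xs k \<omega> $ i) (ts k \<omega> $ i)
          - hess_xt (g i) (xs k \<omega> $ i) (ts k \<omega> $ i)) *v (vs k \<omega> $ i))
   else \<kappa> *\<^sub>R (grad_x (\<lambda>a b. fh i a b (vs2 S k i \<omega>)) (xs k \<omega> $ i) (ts k \<omega> $ i)
          - grad_x (f i) (xs k \<omega> $ i) (ts k \<omega> $ i)))"

definition "drift_\<theta> i (s :: ('n, 'p, 'm) iterate) = fst (snd s) $ i - beta p *\<^sub>R grad_t (g i) (fst s $ i) (fst (snd s) $ i)"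
definition "drift_v i (s :: ('n, 'p, 'm) iterate) = fst (snd (snd s)) $ i - lambda p *\<^sub>R (hess_tt (g i) (fst s $ i) (fst (snd s) $ i) *v (fst (snd (snd s)) $ i)
   - grad_t (f i) (fst s $ i) (fst (snd s) $ i))"
definition "hypergrad_estimate i (s :: ('n, 'p, 'm) iterate) = grad_x (f i) (fst s $ i) (fst (snd s) $ i) - hess_xt (g i) (fst s $ i) (fst (snd s) $ i) *v (fst (snd (snd s)) $ i)"
definition "drift_z i (s :: ('n, 'p, 'm) iterate) = (1 - gamma p) *\<^sub>R snd (snd (snd s)) $ i + gamma p *\<^sub>R hypergrad_estimate i s"

lemma measurable_exact:
  "(\<lambda>z. grad_x (f i) (fst z) (snd z)) \<in> borel_measurable borel"
  "(\<lambda>z. grad_t (f i) (fst z) (snd z)) \<in> borel_measurable borel"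
  "(\<lambda>z. grad_t (g i) (fst z) (snd z)) \<in> borel_measurable borel"
  "(\<lambda>z. hess_tt (g i) (fst z) (snd z)) \<in> borel_measurable borel"
  "(\<lambda>z. hess_xt (g i) (fst z) (snd z)) \<in> borel_measurable borel"
  by (intro borel_measurable_continuous_onI continuous_gradients)+

lemma unbiased:
  "unbiased_estimate M norm (\<lambda>\<omega>. grad_t (\<lambda>u v. gh i u v (xi1 S k i \<omega>)) x \<theta>) (grad_t (g i) x \<theta>) (s_gt c)"
  "unbiased_estimate M spectral_norm (\<lambda>\<omega>. hess_tt (\<lambda>u v. gh i u v (xi2 S k i \<omega>)) x \<theta>) (hess_tt (g i) x \<theta>) (s_gtt c)"
  "unbiased_estimate M spectral_norm (\<lambda>\<omega>. hess_xt (\<lambda>u v. gh i u v (xi3 S k i \<omega>)) x \<theta>) (hess_xt (g i) x \<theta>) (s_gxt c)"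
  "unbiased_estimate M norm (\<lambda>\<omega>. grad_t (\<lambda>u v. fh i u v (vs1 S k i \<omega>)) x \<theta>) (grad_t (f i) x \<theta>) (s_ft c)"
  "unbiased_estimate M norm (\<lambda>\<omega>. grad_x (\<lambda>u v. fh i u v (vs2 S k i \<omega>)) x \<theta>) (grad_x (f i) x \<theta>) (s_fx c)"
  using estimates unfolding stochastic_estimates_def by blast+

lemma noise_\<theta>: "noise k (\<lambda>_. (beta p)\<^sup>2 * (s_gt c)\<^sup>2) (noise_\<theta> k i)"
  using vector_sample_noise[OF _ _ samples_measurable(1) sampled_measurable(3) measurable_exact(3) unbiased(1),
      of "Xi1 k i" k k i "- beta p" i]
  by (simp add: noise_\<theta>_def[abs_def])

definition "noise_v_var i b (s :: ('n, 'p, 'm) iterate) = (if b then (lambda p)\<^sup>2 * ((s_gtt c)\<^sup>2 * (norm (fst (snd (snd s)) $ i))\<^sup>2)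
   else (lambda p)\<^sup>2 * (s_ft c)\<^sup>2)"
definition "noise_z_var i \<kappa> b (s :: ('n, 'p, 'm) iterate) = (if b then \<kappa>\<^sup>2 * ((s_gxt c)\<^sup>2 * (norm (fst (snd (snd s)) $ i))\<^sup>2)
   else \<kappa>\<^sup>2 * (s_fx c)\<^sup>2)"

lemma noise_v:
  assumes "integrable M (\<lambda>\<omega>. (norm (st k \<omega>))\<^sup>2)"
  shows "noise k (noise_v_var i b) (noise_v k i b)"
  using matrix_sample_noise[OF assms _ _ samples_measurable(2) sampled_measurable(4) measurable_exact(4) unbiased(2),
      of "Xi2 k i" k i "- lambda p" i]
    vector_sample_noise[OF _ _ samples_measurable(4) sampled_measurable(2) measurable_exact(2) unbiased(4),
      of "Vs1 k i" k k i "lambda p" i]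
  by (cases b) (simp_all add: noise_v_def[abs_def] noise_v_var_def[abs_def])

lemma noise_z:
  assumes "integrable M (\<lambda>\<omega>. (norm (st k \<omega>))\<^sup>2)"
  shows "noise k (noise_z_var i \<kappa> b) (noise_z k i \<kappa> b)"
  using matrix_sample_noise[OF assms _ _ samples_measurable(3) sampled_measurable(5) measurable_exact(5) unbiased(3),
      of "Xi3 k i" k i "- \<kappa>" i]
    vector_sample_noise[OF _ _ samples_measurable(5) sampled_measurable(1) measurable_exact(1) unbiased(5),
      of "Vs2 k i" k k i "\<kappa>" i]
  by (cases b) (simp_all add: noise_z_def[abs_def] noise_z_var_def[abs_def])

lemma ts_decompose: "ts (Suc k) \<omega> $ i = drift_\<theta> i (st k \<omega>) + (\<Sum>j\<in>{()}. noise_\<theta> k i \<omega>)"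
  by (simp add: ts_Suc drift_\<theta>_def noise_\<theta>_def algebra_simps)

lemma vs_decompose: "vs (Suc k) \<omega> $ i = drift_v i (st k \<omega>) + (\<Sum>b\<in>UNIV. noise_v k i b \<omega>)"
  by (simp add: vs_Suc drift_v_def noise_v_def UNIV_bool matrix_vector_mult_diff_rdistrib algebra_simps)

lemma zs_decompose: "zs (Suc k) \<omega> $ i = drift_z i (st k \<omega>) + (\<Sum>b\<in>UNIV. noise_z k i (gamma p) b \<omega>)"
  by (simp add: zs_Suc drift_z_def hypergrad_estimate_def noise_z_def UNIV_bool matrix_vector_mult_diff_rdistrib algebra_simps)

lemma linear_growth_drifts:
  "linear_growth (drift_\<theta> i)" "linear_growth (drift_v i)" "linear_growth (drift_z i)" "linear_growth (hypergrad_estimate i)"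
proof -
  note comp = linear_growth_vec_nth[OF linear_growth_components(1)] linear_growth_vec_nth[OF linear_growth_components(2)]
    linear_growth_vec_nth[OF linear_growth_components(3)] linear_growth_vec_nth[OF linear_growth_components(4)]
  note xt = linear_growth_Pair[OF comp(1)[where i = i] comp(2)[where i = i]]
  note xtv = linear_growth_Pair[OF comp(1)[where i = i] linear_growth_Pair[OF comp(2)[where i = i] comp(3)[where i = i]]]
  have G: "linear_growth (\<lambda>s :: ('n, 'p, 'm) iterate. grad_t (g i) (fst s $ i) (fst (snd s) $ i))"
    "linear_growth (\<lambda>s :: ('n, 'p, 'm) iterate. grad_t (f i) (fst s $ i) (fst (snd s) $ i))"
    "linear_growth (\<lambda>s :: ('n, 'p, 'm) iterate. grad_x (f i) (fst s $ i) (fst (snd s) $ i))"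
    "linear_growth (\<lambda>s :: ('n, 'p, 'm) iterate. hess_tt (g i) (fst s $ i) (fst (snd s) $ i) *v (fst (snd (snd s)) $ i))"
    "linear_growth (\<lambda>s :: ('n, 'p, 'm) iterate. hess_xt (g i) (fst s $ i) (fst (snd s) $ i) *v (fst (snd (snd s)) $ i))"
    using linear_growth_compose[OF linear_growth_gradients(1) xt] linear_growth_compose[OF linear_growth_gradients(2) xt]
      linear_growth_compose[OF linear_growth_gradients(3) xt] linear_growth_compose[OF linear_growth_hessians(1) xtv]
      linear_growth_compose[OF linear_growth_hessians(2) xtv] by simp_all
  show "linear_growth (drift_\<theta> i)" unfolding drift_\<theta>_def[abs_def]
    by (intro linear_growth_diff linear_growth_scaleR comp G)
  show "linear_growth (drift_v i)" unfolding drift_v_def[abs_def]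
    by (intro linear_growth_diff linear_growth_scaleR comp G)
  show hg: "linear_growth (hypergrad_estimate i)" unfolding hypergrad_estimate_def[abs_def]
    by (intro linear_growth_diff comp G)
  show "linear_growth (drift_z i)" unfolding drift_z_def[abs_def]
    by (intro linear_growth_add linear_growth_scaleR comp hg)
qed

text \<open>Every update is a drift of linear growth plus noise, so square integrability passes from one iterate
to the next.\<close>

lemma state_square_integrable: "integrable M (\<lambda>\<omega>. (norm (st k \<omega>))\<^sup>2)"
proof (induction k)
  case 0
  show ?case using init_integrable by (simp add: st_0)
next
  case (Suc k)
  have split: "(norm (st (Suc k) \<omega>))\<^sup>2 = (norm (xs (Suc k) \<omega>))\<^sup>2 + ((\<Sum>i\<in>UNIV. (norm (ts (Suc k) \<omega> $ i))\<^sup>2)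
      + ((\<Sum>i\<in>UNIV. (norm (vs (Suc k) \<omega> $ i))\<^sup>2) + (\<Sum>i\<in>UNIV. (norm (zs (Suc k) \<omega> $ i))\<^sup>2)))" for \<omega>
    by (simp add: st_def norm_Pair_sq flip: norm_sq_stacked)
  have "linear_growth (\<lambda>s :: ('n, 'p, 'm) iterate. (1 - tau p) *\<^sub>R fst s + tau p *\<^sub>R (mix W (fst s) - alpha p *\<^sub>R snd (snd (snd s))))"
    by (intro linear_growth_add linear_growth_diff linear_growth_scaleR linear_growth_mix linear_growth_components)
  from state_square_integrable_compose(2)[OF Suc this]
  have x: "integrable M (\<lambda>\<omega>. (norm (xs (Suc k) \<omega>))\<^sup>2)" by (simp add: xs_Suc)
  have t: "integrable M (\<lambda>\<omega>. (norm (ts (Suc k) \<omega> $ i))\<^sup>2)" for i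
    unfolding ts_decompose using noise_\<theta> by (intro drift_plus_noise(2)[OF Suc linear_growth_drifts(1)]) auto
  have v: "integrable M (\<lambda>\<omega>. (norm (vs (Suc k) \<omega> $ i))\<^sup>2)" for i
    unfolding vs_decompose using noise_v[OF Suc] by (intro drift_plus_noise(2)[OF Suc linear_growth_drifts(2)]) auto
  have z: "integrable M (\<lambda>\<omega>. (norm (zs (Suc k) \<omega> $ i))\<^sup>2)" for i
    unfolding zs_decompose using noise_z[OF Suc] by (intro drift_plus_noise(2)[OF Suc linear_growth_drifts(3)]) auto
  show ?case unfolding split using x t v z by (intro Bochner_Integration.integrable_add Bochner_Integration.integrable_sum)
qed

lemmas drift_noise_moment = drift_plus_noise[OF state_square_integrable]
lemmas state_moment = state_square_integrable_compose[OF state_square_integrable]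

end

section \<open>Estimates for one step of each variable\<close>

lemma sq_sum4: "(a + b + c + d)\<^sup>2 \<le> 4 * (a\<^sup>2 + b\<^sup>2 + c\<^sup>2 + (d::real)\<^sup>2)"
  using sq_sum2[of "a + b" "c + d"] sq_sum2[of a b] sq_sum2[of c d] by (simp add: add.assoc)

text \<open>With the tolerated jump equal to \<open>\<gamma>\<close> the tracking error gains \<open>4 * \<gamma>\<close> per step, no more than any other
constant of the recursion, while the slope \<open>B / \<gamma>\<close> only multiplies the motion of the mean.\<close>

lemma jump_square_le:
  fixes d z :: "'a::real_normed_vector"
  assumes \<gamma>: "0 < \<gamma>" and d: "norm d \<le> \<gamma> + B / \<gamma> * (u * norm z)"
  shows "2 / \<gamma> * (norm d)\<^sup>2 \<le> \<gamma> * (4 + 4 * B\<^sup>2 * (u\<^sup>2 / \<gamma> ^ 4 * (norm z)\<^sup>2))"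
proof -
  have "(norm d)\<^sup>2 \<le> (\<gamma> + B / \<gamma> * (u * norm z))\<^sup>2" using d by (intro power_mono) auto
  also have "\<dots> \<le> 2 * \<gamma>\<^sup>2 + 2 * (B / \<gamma> * (u * norm z))\<^sup>2" by (rule sq_sum2)
  finally have "2 / \<gamma> * (norm d)\<^sup>2 \<le> 2 / \<gamma> * (2 * \<gamma>\<^sup>2 + 2 * (B / \<gamma> * (u * norm z))\<^sup>2)"
    using \<gamma> by (intro mult_left_mono) auto
  also have "\<dots> = \<gamma> * (4 + 4 * B\<^sup>2 * (u\<^sup>2 / \<gamma> ^ 4 * (norm z)\<^sup>2))"
    using \<gamma> by (simp add: field_simps power2_eq_square power_numeral_reduce)
  finally show ?thesis .
qed

lemma norm_avg_sq_le_sum: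
  fixes w :: "'m::finite \<Rightarrow> real^'n"
  shows "(norm (avg (\<chi> i. w i)))\<^sup>2 \<le> (\<Sum>i\<in>UNIV. (norm (w i))\<^sup>2) / real CARD('m)"
  using norm_avg_sq_le[of "\<chi> i. w i"] by (simp add: norm_sq_stacked pos_le_divide_eq)

context problem
begin

text \<open>Any step that makes one gradient step contract serves for the inner variable; for the adjoint
variable the step is also small enough for the multiplicative noise of the sampled Hessian to be
absorbed by half of the contraction.\<close>

definition "beta0 = min (mu_g c / (L_gt c)\<^sup>2) (1 / mu_g c)"
definition "lambda0 = min (mu_g c / ((L_gt c)\<^sup>2 + 8 * (s_gtt c)\<^sup>2)) (1 / mu_g c)"

lemma beta0: "0 < beta0" "beta0 * (L_gt c)\<^sup>2 \<le> mu_g c" "beta0 * mu_g c \<le> 1"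
proof -
  have L: "0 < (L_gt c)\<^sup>2" using positive_constants by simp
  show "0 < beta0" using positive_constants by (simp add: beta0_def)
  have "beta0 \<le> mu_g c / (L_gt c)\<^sup>2" "beta0 \<le> 1 / mu_g c" by (simp_all add: beta0_def)
  then show "beta0 * (L_gt c)\<^sup>2 \<le> mu_g c" "beta0 * mu_g c \<le> 1"
    using L positive_constants(1) by (simp_all add: pos_le_divide_eq)
qed

lemma lambda0: "0 < lambda0" "lambda0 * (L_gt c)\<^sup>2 \<le> mu_g c" "8 * lambda0 * (s_gtt c)\<^sup>2 \<le> mu_g c" "lambda0 * mu_g c \<le> 1"
proof -
  have L: "0 < (L_gt c)\<^sup>2 + 8 * (s_gtt c)\<^sup>2" using positive_constants by (intro add_pos_nonneg) auto
  show 0: "0 < lambda0" using L positive_constants by (simp add: lambda0_def)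
  have 1: "lambda0 \<le> mu_g c / ((L_gt c)\<^sup>2 + 8 * (s_gtt c)\<^sup>2)" "lambda0 \<le> 1 / mu_g c" by (simp_all add: lambda0_def)
  then show "lambda0 * mu_g c \<le> 1" using positive_constants(1) by (simp add: pos_le_divide_eq)
  have "lambda0 * (L_gt c)\<^sup>2 + 8 * lambda0 * (s_gtt c)\<^sup>2 \<le> mu_g c"
    using 1(1) L by (simp add: pos_le_divide_eq algebra_simps)
  moreover have "0 \<le> lambda0 * (L_gt c)\<^sup>2" "0 \<le> 8 * lambda0 * (s_gtt c)\<^sup>2" using 0 by simp_all
  ultimately show "lambda0 * (L_gt c)\<^sup>2 \<le> mu_g c" "8 * lambda0 * (s_gtt c)\<^sup>2 \<le> mu_g c" by linarith+
qed

lemma gradient_step_contraction: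
  assumes "0 < s" "s * (L_gt c)\<^sup>2 \<le> mu_g c" "s * mu_g c \<le> 1"
    and "mu_g c * (norm w)\<^sup>2 \<le> h \<bullet> w" "norm h \<le> L_gt c * norm w"
  shows "norm (w - s *\<^sub>R h) \<le> (1 - s * mu_g c / 2) * norm w"
proof (rule power2_le_imp_le)
  have "(norm h)\<^sup>2 \<le> (L_gt c * norm w)\<^sup>2" using assms(5) by (intro power_mono) auto
  then have 1: "s * (s * (norm h)\<^sup>2) \<le> s * (s * (L_gt c * norm w)\<^sup>2)" using assms by (intro mult_left_mono) auto
  have "s * ((s * (L_gt c)\<^sup>2) * (norm w)\<^sup>2) \<le> s * (mu_g c * (norm w)\<^sup>2)"
    using assms by (intro mult_left_mono mult_right_mono) auto
  then have 2: "s * (s * (L_gt c * norm w)\<^sup>2) \<le> s * (mu_g c * (norm w)\<^sup>2)" by (simp add: power_mult_distrib mult_ac)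
  have 3: "s * (mu_g c * (norm w)\<^sup>2) \<le> s * (h \<bullet> w)" using assms by (intro mult_left_mono) auto
  have "(norm (w - s *\<^sub>R h))\<^sup>2 = (norm w)\<^sup>2 - 2 * (s * (h \<bullet> w)) + s * (s * (norm h)\<^sup>2)"
    by (simp add: power2_norm_eq_inner inner_diff_left inner_diff_right inner_commute algebra_simps)
  also have "\<dots> \<le> (norm w)\<^sup>2 - s * (mu_g c * (norm w)\<^sup>2)" using 1 2 3 by linarith
  also have "\<dots> \<le> ((1 - s * mu_g c / 2) * norm w)\<^sup>2"
  proof -
    have "0 \<le> (s * mu_g c / 2 * norm w)\<^sup>2" by simp
    then show ?thesis by (simp add: power2_eq_square algebra_simps)
  qed
  finally show "(norm (w - s *\<^sub>R h))\<^sup>2 \<le> ((1 - s * mu_g c / 2) * norm w)\<^sup>2" .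
  show "0 \<le> (1 - s * mu_g c / 2) * norm w" using assms(3) by (intro mult_nonneg_nonneg) auto
qed

definition "lip = C_gxt c / mu_g c"

lemma lip_nonneg: "lip \<ge> 0"
  using positive_constants by (simp add: lip_def)

lemma sol_lip: "norm (sol i x - sol i y) \<le> lip * norm (x - y)"
  using sol_lipschitz by (simp add: lip_def)

text \<open>The inner step contracts towards the solution at the node's own point \<open>x\<close>; both \<open>y\<close>, the present mean, and
its successor are within a Lipschitz distance of it.\<close>

lemma inner_step:
  assumes s: "0 < s" "s * (L_gt c)\<^sup>2 \<le> mu_g c" "s * mu_g c \<le> 1" and u: "u \<ge> 0"
  shows "(norm (t - s *\<^sub>R grad_t (g i) x t - sol i (y - u *\<^sub>R z)))\<^sup>2
    \<le> (1 - s * mu_g c / 2) * (norm (t - sol i y))\<^sup>2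
      + (8 * lip\<^sup>2 * (norm (x - y))\<^sup>2 + 2 * lip\<^sup>2 * (u\<^sup>2 * (norm z)\<^sup>2)) / (s * mu_g c / 2)"
proof -
  define a where "a = s * mu_g c / 2"
  have a: "0 < a" "a \<le> 1" using s positive_constants(1) by (auto simp: a_def)
  have l: "lip \<ge> 0" by (rule lip_nonneg)
  define b where "b = 2 * (lip * norm (x - y)) + lip * (u * norm z)"
  have "norm ((t - sol i x) - s *\<^sub>R grad_t (g i) x t) \<le> (1 - a) * norm (t - sol i x)"
    unfolding a_def using grad_t_g_monotone[of t "sol i x" i x] grad_t_g_lipschitz[of i x t "sol i x"]
    by (intro gradient_step_contraction[OF s]) (simp_all add: grad_t_g_sol)
  also have "\<dots> \<le> (1 - a) * (norm (t - sol i y) + lip * norm (x - y))"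
  proof (rule mult_left_mono)
    have "norm (t - sol i x) \<le> norm (t - sol i y) + norm (sol i x - sol i y)"
      using norm_triangle_ineq4[of "t - sol i y" "sol i x - sol i y"] by simp
    then show "norm (t - sol i x) \<le> norm (t - sol i y) + lip * norm (x - y)" using sol_lip[of i x y] by linarith
  qed (use a in simp)
  also have "\<dots> \<le> (1 - a) * norm (t - sol i y) + lip * norm (x - y)"
  proof -
    have "a * (lip * norm (x - y)) \<ge> 0" using a l by (intro mult_nonneg_nonneg) auto
    then show ?thesis unfolding left_diff_distrib distrib_left by linarith
  qed
  finally have 1: "norm ((t - sol i x) - s *\<^sub>R grad_t (g i) x t) \<le> (1 - a) * norm (t - sol i y) + lip * norm (x - y)" .
  have "norm (sol i x - sol i (y - u *\<^sub>R z)) \<le> lip * norm (x - (y - u *\<^sub>R z))" by (rule sol_lip)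
  also have "\<dots> \<le> lip * (norm (x - y) + u * norm z)"
    using norm_triangle_ineq[of "x - y" "u *\<^sub>R z"] u l by (intro mult_left_mono) (auto simp: algebra_simps)
  finally have 2: "norm (sol i x - sol i (y - u *\<^sub>R z)) \<le> lip * norm (x - y) + lip * (u * norm z)"
    by (simp add: distrib_left)
  have "t - s *\<^sub>R grad_t (g i) x t - sol i (y - u *\<^sub>R z)
      = ((t - sol i x) - s *\<^sub>R grad_t (g i) x t) + (sol i x - sol i (y - u *\<^sub>R z))" by simp
  then have "norm (t - s *\<^sub>R grad_t (g i) x t - sol i (y - u *\<^sub>R z))
      \<le> norm ((t - sol i x) - s *\<^sub>R grad_t (g i) x t) + norm (sol i x - sol i (y - u *\<^sub>R z))"
    by (simp only: norm_triangle_ineq)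
  then have "norm (t - s *\<^sub>R grad_t (g i) x t - sol i (y - u *\<^sub>R z)) \<le> (1 - a) * norm (t - sol i y) + b"
    using 1 2 unfolding b_def by linarith
  then have "(norm (t - s *\<^sub>R grad_t (g i) x t - sol i (y - u *\<^sub>R z)))\<^sup>2 \<le> ((1 - a) * norm (t - sol i y) + b)\<^sup>2"
    by (intro power_mono) auto
  also have "\<dots> \<le> (1 - a) * (norm (t - sol i y))\<^sup>2 + b\<^sup>2 / a" by (rule convex_square_le[OF a])
  also have "b\<^sup>2 / a \<le> (8 * lip\<^sup>2 * (norm (x - y))\<^sup>2 + 2 * lip\<^sup>2 * (u\<^sup>2 * (norm z)\<^sup>2)) / a"
    using a sq_sum2[of "2 * (lip * norm (x - y))" "lip * (u * norm z)"]
    by (intro divide_right_mono) (simp_all add: b_def power_mult_distrib)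
  finally show ?thesis by (simp add: a_def)
qed

text \<open>The right-hand side of the linear system for the adjoint variable has bounded size up to a multiple of
the inner error, so the length of the variable itself obeys a contracting recursion; its distance from
the bounded target follows.\<close>

lemma adjoint_step:
  assumes s: "0 < s" "s * (L_gt c)\<^sup>2 \<le> mu_g c" "s * mu_g c \<le> 1"
  shows "(norm (v - s *\<^sub>R (hess_tt (g i) x t *v v - grad_t (f i) x t)))\<^sup>2
    \<le> (1 - s * mu_g c / 2) * (norm v)\<^sup>2
      + (2 * s\<^sup>2 * (C_ft c)\<^sup>2 + 4 * s\<^sup>2 * (L_ft c)\<^sup>2 * (norm (t - sol i y))\<^sup>2
          + 4 * s\<^sup>2 * (L_ft c)\<^sup>2 * lip\<^sup>2 * (norm (x - y))\<^sup>2) / (s * mu_g c / 2)"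
proof -
  define a where "a = s * mu_g c / 2"
  have a: "0 < a" "a \<le> 1" using s positive_constants(1) by (auto simp: a_def)
  have l: "lip \<ge> 0" by (rule lip_nonneg)
  define b where "b = s * C_ft c + s * L_ft c * norm (t - sol i x)"
  have "norm (v - s *\<^sub>R (hess_tt (g i) x t *v v)) \<le> (1 - a) * norm v"
    unfolding a_def by (intro gradient_step_contraction[OF s] hess_tt_coercive hess_tt_bounded)
  moreover have "norm (s *\<^sub>R grad_t (f i) x t) \<le> b"
    using mult_left_mono[OF grad_t_f_growth[of i x t], of s] s by (simp add: b_def algebra_simps)
  ultimately have "norm (v - s *\<^sub>R (hess_tt (g i) x t *v v - grad_t (f i) x t)) \<le> (1 - a) * norm v + b"
    using norm_triangle_ineq[of "v - s *\<^sub>R (hess_tt (g i) x t *v v)" "s *\<^sub>R grad_t (f i) x t"]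
    using s by (simp add: scaleR_diff_right algebra_simps)
  then have "(norm (v - s *\<^sub>R (hess_tt (g i) x t *v v - grad_t (f i) x t)))\<^sup>2 \<le> ((1 - a) * norm v + b)\<^sup>2"
    by (intro power_mono) auto
  also have "\<dots> \<le> (1 - a) * (norm v)\<^sup>2 + b\<^sup>2 / a" by (rule convex_square_le[OF a])
  also have "b\<^sup>2 / a \<le> (2 * s\<^sup>2 * (C_ft c)\<^sup>2 + 4 * s\<^sup>2 * (L_ft c)\<^sup>2 * (norm (t - sol i y))\<^sup>2
          + 4 * s\<^sup>2 * (L_ft c)\<^sup>2 * lip\<^sup>2 * (norm (x - y))\<^sup>2) / a"
  proof (rule divide_right_mono)
    have "norm (t - sol i x) \<le> norm (t - sol i y) + norm (sol i x - sol i y)"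
      using norm_triangle_ineq4[of "t - sol i y" "sol i x - sol i y"] by simp
    then have "norm (t - sol i x) \<le> norm (t - sol i y) + lip * norm (x - y)" using sol_lip[of i x y] by linarith
    then have "(norm (t - sol i x))\<^sup>2 \<le> (norm (t - sol i y) + lip * norm (x - y))\<^sup>2" by (intro power_mono) auto
    also have "\<dots> \<le> 2 * (norm (t - sol i y))\<^sup>2 + 2 * (lip * norm (x - y))\<^sup>2" by (rule sq_sum2)
    finally have "2 * (s * L_ft c)\<^sup>2 * (norm (t - sol i x))\<^sup>2 \<le> 2 * (s * L_ft c)\<^sup>2 * (2 * (norm (t - sol i y))\<^sup>2 + 2 * (lip * norm (x - y))\<^sup>2)"
      by (intro mult_left_mono) auto
    moreover have "b\<^sup>2 \<le> 2 * (s * C_ft c)\<^sup>2 + 2 * (s * L_ft c)\<^sup>2 * (norm (t - sol i x))\<^sup>2"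
      using sq_sum2[of "s * C_ft c" "s * L_ft c * norm (t - sol i x)"] by (simp add: b_def power_mult_distrib)
    ultimately show "b\<^sup>2 \<le> 2 * s\<^sup>2 * (C_ft c)\<^sup>2 + 4 * s\<^sup>2 * (L_ft c)\<^sup>2 * (norm (t - sol i y))\<^sup>2
          + 4 * s\<^sup>2 * (L_ft c)\<^sup>2 * lip\<^sup>2 * (norm (x - y))\<^sup>2"
      unfolding power_mult_distrib by (simp add: distrib_left mult_ac)
  qed (use a in simp)
  finally show ?thesis by (simp add: a_def)
qed

lemma uniform_regularity:
  obtains B where "B \<ge> 0"
    "\<And>\<eta> i x y. 0 < \<eta> \<Longrightarrow> \<eta> \<le> 1 \<Longrightarrow> norm (grad_Phi i x - grad_Phi i y) \<le> \<eta> + B / \<eta> * norm (x - y)"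
proof -
  have "\<exists>B. \<forall>i. B i \<ge> 0 \<and> (\<forall>\<eta>. 0 < \<eta> \<longrightarrow> \<eta> \<le> 1 \<longrightarrow> (\<forall>x y. norm (grad_Phi i x - grad_Phi i y) \<le> \<eta> + B i / \<eta> * norm (x - y)))"
    using grad_Phi_almost_lipschitz unfolding almost_lipschitz_def by metis
  then obtain B where B: "\<And>i. B i \<ge> 0"
    "\<And>i \<eta> x y. 0 < \<eta> \<Longrightarrow> \<eta> \<le> 1 \<Longrightarrow> norm (grad_Phi i x - grad_Phi i y) \<le> \<eta> + B i / \<eta> * norm (x - y)"
    by metis
  show ?thesis
  proof (rule that[of "\<Sum>i\<in>UNIV. B i"])
    show "0 \<le> (\<Sum>i\<in>UNIV. B i)" using B by (intro sum_nonneg) auto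
    fix \<eta> :: real and i :: 'm and x y :: "real^'n" assume \<eta>: "0 < \<eta>" "\<eta> \<le> 1"
    have "B i \<le> (\<Sum>i\<in>UNIV. B i)" using B by (intro member_le_sum) auto
    then have "B i / \<eta> * norm (x - y) \<le> (\<Sum>i\<in>UNIV. B i) / \<eta> * norm (x - y)"
      using \<eta> by (intro mult_right_mono divide_right_mono) auto
    then show "norm (grad_Phi i x - grad_Phi i y) \<le> \<eta> + (\<Sum>i\<in>UNIV. B i) / \<eta> * norm (x - y)"
      using B(2)[OF \<eta>, of i x y] by linarith
  qed
qed

text \<open>Both the exact hypergradient and its estimate differ from partial gradients of \<open>f\<close> by bounded terms
and a multiple of \<open>norm v\<close>, so the growth bound suffices.\<close>

lemma hypergradient_error:
  obtains H where "H \<ge> 0"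
    "\<And>i x t v y. (norm (grad_Phi i y - (grad_x (f i) x t - hess_xt (g i) x t *v v)))\<^sup>2
      \<le> H * (1 + (norm (x - y))\<^sup>2 + (norm (t - sol i y))\<^sup>2 + (norm v)\<^sup>2)"
proof -
  obtain C where C: "C \<ge> 0"
    "\<And>i x t y. norm (grad_x (f i) x t - grad_x (f i) y (sol i y)) \<le> C * (1 + norm (x - y) + norm (t - sol i y))"
    using grad_x_coarse by metis
  define Q where "Q = C + lip * C_ft c + C_gxt c"
  have Q: "Q \<ge> 0" "C \<le> Q" "C_gxt c \<le> Q" using C lip_nonneg positive_constants by (auto simp: Q_def)
  show ?thesis
  proof (rule that[of "4 * Q\<^sup>2"])
    fix i x t v y
    have "norm (grad_Phi i y - (grad_x (f i) x t - hess_xt (g i) x t *v v))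
      \<le> norm (grad_Phi i y - grad_x (f i) y (sol i y)) + norm (grad_x (f i) x t - grad_x (f i) y (sol i y)) + norm (hess_xt (g i) x t *v v)"
      by norm
    also have "\<dots> \<le> lip * C_ft c + C * (1 + norm (x - y) + norm (t - sol i y)) + C_gxt c * norm v"
      by (intro add_mono grad_Phi_near_grad_x[folded lip_def] C(2) hess_xt_bounded)
    also have "\<dots> = (lip * C_ft c + C) * 1 + C * norm (x - y) + C * norm (t - sol i y) + C_gxt c * norm v"
      by (simp add: algebra_simps)
    also have "\<dots> \<le> Q * 1 + Q * norm (x - y) + Q * norm (t - sol i y) + Q * norm v"
      using Q positive_constants by (intro add_mono mult_right_mono) (auto simp: Q_def)
    also have "\<dots> = Q * (1 + norm (x - y) + norm (t - sol i y) + norm v)" by (simp add: algebra_simps)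
    finally have "(norm (grad_Phi i y - (grad_x (f i) x t - hess_xt (g i) x t *v v)))\<^sup>2
        \<le> (Q * (1 + norm (x - y) + norm (t - sol i y) + norm v))\<^sup>2" by (intro power_mono) auto
    also have "\<dots> \<le> Q\<^sup>2 * (4 * (1\<^sup>2 + (norm (x - y))\<^sup>2 + (norm (t - sol i y))\<^sup>2 + (norm v)\<^sup>2))"
      unfolding power_mult_distrib by (intro mult_left_mono sq_sum4) auto
    finally show "(norm (grad_Phi i y - (grad_x (f i) x t - hess_xt (g i) x t *v v)))\<^sup>2
      \<le> 4 * Q\<^sup>2 * (1 + (norm (x - y))\<^sup>2 + (norm (t - sol i y))\<^sup>2 + (norm v)\<^sup>2)" by (simp add: algebra_simps)
  qed simp
qed

lemma gradient_Phi_avg: "gradient (Phi f g) x = avg (\<chi> i. grad_Phi i x)"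
  by (simp add: gradient_Phi avg_def)

context
  fixes B assumes B: "B \<ge> 0"
    "\<And>\<eta> i x y. 0 < \<eta> \<Longrightarrow> \<eta> \<le> 1 \<Longrightarrow> norm (grad_Phi i x - grad_Phi i y) \<le> \<eta> + B / \<eta> * norm (x - y)"
begin

lemma gradient_Phi_variation:
  assumes "0 < \<eta>" "\<eta> \<le> 1"
  shows "norm (gradient (Phi f g) x - gradient (Phi f g) y) \<le> \<eta> + B / \<eta> * norm (x - y)"
proof -
  have "gradient (Phi f g) x - gradient (Phi f g) y = (\<Sum>i\<in>UNIV. grad_Phi i x - grad_Phi i y) /\<^sub>R real CARD('m)"
    by (simp add: gradient_Phi sum_subtractf scaleR_diff_right)
  also have "norm \<dots> \<le> (\<Sum>i\<in>(UNIV :: 'm set). \<eta> + B / \<eta> * norm (x - y)) / real CARD('m)"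
  proof -
    have "norm (\<Sum>i\<in>UNIV. grad_Phi i x - grad_Phi i y) \<le> (\<Sum>i\<in>(UNIV :: 'm set). \<eta> + B / \<eta> * norm (x - y))"
      by (rule sum_norm_le) (rule B(2)[OF assms])
    then show ?thesis by (simp add: divide_inverse mult.commute mult_left_mono)
  qed
  also have "\<dots> = \<eta> + B / \<eta> * norm (x - y)" by simp
  finally show ?thesis .
qed

text \<open>A descent inequality with an additive error of order \<open>u\<close>: on the unit scale the gradient behaves like a
Lipschitz map up to a jump of size one.\<close>

lemma objective_step:
  assumes u: "0 < u" "u * B \<le> 1 / 8"
  shows "Phi f g (x - u *\<^sub>R z) \<le> Phi f g x - u / 2 * (norm (gradient (Phi f g) x))\<^sup>2 - u / 4 * (norm z)\<^sup>2
    + u / 2 * (norm (gradient (Phi f g) x - z))\<^sup>2 + u * 2"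
proof -
  let ?D = "gradient (Phi f g)"
  have G: "GDERIV (Phi f g) w :> ?D w" for w using Phi_GDERIV by (simp add: gradient_Phi)
  have "\<bar>Phi f g (x + (- u) *\<^sub>R z) - Phi f g x - ?D x \<bullet> ((- u) *\<^sub>R z)\<bar> \<le> (1 + B * (u * norm z)) * norm ((- u) *\<^sub>R z)"
  proof (rule gradient_linear_approximation[OF G])
    fix w assume "norm (w - x) \<le> norm ((- u) *\<^sub>R z)"
    then have "B * norm (w - x) \<le> B * (u * norm z)" using B u by (intro mult_left_mono) auto
    then show "norm (?D w - ?D x) \<le> 1 + B * (u * norm z)" using gradient_Phi_variation[of 1 w x] by simp
  qed
  then have 1: "Phi f g (x - u *\<^sub>R z) \<le> Phi f g x - u * (?D x \<bullet> z) + u * norm z + u * ((u * B) * (norm z)\<^sup>2)"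
    using u by (simp add: power2_eq_square algebra_simps abs_le_iff)
  have 2: "u * norm z \<le> u * (2 + (norm z)\<^sup>2 / 8)"
  proof (rule mult_left_mono)
    have "0 \<le> (norm z - 4)\<^sup>2" by simp
    then show "norm z \<le> 2 + (norm z)\<^sup>2 / 8" by (simp add: power2_eq_square algebra_simps)
  qed (use u in simp)
  have 3: "u * ((u * B) * (norm z)\<^sup>2) \<le> u * (1 / 8 * (norm z)\<^sup>2)" using u by (intro mult_left_mono mult_right_mono) auto
  have 4: "u / 2 * (norm (?D x - z))\<^sup>2 = u / 2 * (norm (?D x))\<^sup>2 - u * (?D x \<bullet> z) + u / 2 * (norm z)\<^sup>2"
    by (simp add: power2_norm_eq_inner inner_diff_left inner_diff_right inner_commute algebra_simps)
  show ?thesis using 1 2 3 4 by (simp add: algebra_simps)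
qed

lemma gradient_step:
  assumes u: "0 \<le> u"
  shows "(norm (gradient (Phi f g) (x - u *\<^sub>R z)))\<^sup>2
    \<le> 3 / 2 * (norm (gradient (Phi f g) x))\<^sup>2 + 6 * (1 + B\<^sup>2 * (u\<^sup>2 * (norm z)\<^sup>2))"
proof -
  let ?D = "gradient (Phi f g)"
  define a b where "a = norm (?D x)" and "b = 1 + B * (u * norm z)"
  have "norm (?D (x - u *\<^sub>R z) - ?D x) \<le> b" using gradient_Phi_variation[of 1 "x - u *\<^sub>R z" x] u by (simp add: b_def)
  then have "norm (?D (x - u *\<^sub>R z)) \<le> a + b" unfolding a_def using norm_triangle_sub[of "?D (x - u *\<^sub>R z)" "?D x"] by linarith
  then have "(norm (?D (x - u *\<^sub>R z)))\<^sup>2 \<le> (a + b)\<^sup>2" by (intro power_mono) auto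
  also have "\<dots> \<le> 3 / 2 * a\<^sup>2 + 3 * b\<^sup>2"
  proof -
    have "0 \<le> (a / 2 - b)\<^sup>2 * 2" by simp
    then show ?thesis by (simp add: power2_eq_square algebra_simps)
  qed
  also have "b\<^sup>2 \<le> 2 * 1\<^sup>2 + 2 * (B * (u * norm z))\<^sup>2" unfolding b_def by (rule sq_sum2)
  finally show ?thesis by (simp add: a_def power_mult_distrib algebra_simps)
qed

end

lemma tracking_step:
  fixes a b d :: "real^'n"
  assumes \<gamma>: "0 < \<gamma>" "\<gamma> < 1"
  shows "(norm ((1 - \<gamma>) *\<^sub>R a + (\<gamma> *\<^sub>R b + d)))\<^sup>2 \<le> (1 - \<gamma>) * (norm a)\<^sup>2 + 2 * \<gamma> * (norm b)\<^sup>2 + 2 / \<gamma> * (norm d)\<^sup>2"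
proof -
  have "(norm ((1 - \<gamma>) *\<^sub>R a + (\<gamma> *\<^sub>R b + d)))\<^sup>2 \<le> (1 - \<gamma>) * (norm a)\<^sup>2 + (norm (\<gamma> *\<^sub>R b + d))\<^sup>2 / \<gamma>"
    using \<gamma> by (intro convex_norm_square_le) auto
  also have "(norm (\<gamma> *\<^sub>R b + d))\<^sup>2 / \<gamma> \<le> (2 * (norm (\<gamma> *\<^sub>R b))\<^sup>2 + 2 * (norm d)\<^sup>2) / \<gamma>"
    using \<gamma> norm_sum2_sq[of "\<gamma> *\<^sub>R b" d] by (intro divide_right_mono) auto
  also have "\<dots> = 2 * \<gamma> * (norm b)\<^sup>2 + 2 / \<gamma> * (norm d)\<^sup>2"
    using \<gamma> by (simp add: power_mult_distrib power2_eq_square field_simps)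
  finally show ?thesis by simp
qed

end

section \<open>Recursions for the second moments\<close>

text \<open>A run with the inner and adjoint steps fixed.  The constants \<open>B\<close>, \<open>H\<close> and \<open>A\<close> depend on the problem only, so
that the constants of the recursion derived below do not depend on the remaining step sizes.\<close>

locale lopa_run = lopa M c f g E W fh gh Df Dg S init p
  for M :: "'w measure" and c and f g :: "'m::finite \<Rightarrow> real^'n \<Rightarrow> real^'p \<Rightarrow> real"
    and E and W :: "real^'m^'m"
    and fh :: "'m \<Rightarrow> real^'n \<Rightarrow> real^'p \<Rightarrow> 'c \<Rightarrow> real" and gh :: "'m \<Rightarrow> real^'n \<Rightarrow> real^'p \<Rightarrow> 'b \<Rightarrow> real"
    and Df :: "'m \<Rightarrow> 'c measure" and Dg :: "'m \<Rightarrow> 'b measure" and S :: "('w, 'm, 'b, 'c) samples"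
    and init :: "'w \<Rightarrow> (real^'n^'m) \<times> (real^'p^'m) \<times> (real^'p^'m) \<times> (real^'n^'m)"
    and p :: step_sizes +
  fixes B H A m :: real
  assumes B: "B \<ge> 0"
    "\<And>\<eta> i x y. 0 < \<eta> \<Longrightarrow> \<eta> \<le> 1 \<Longrightarrow> norm (grad_Phi i x - grad_Phi i y) \<le> \<eta> + B / \<eta> * norm (x - y)"
    and H: "H \<ge> 0"
    "\<And>i x t v y. (norm (grad_Phi i y - (grad_x (f i) x t - hess_xt (g i) x t *v v)))\<^sup>2
      \<le> H * (1 + (norm (x - y))\<^sup>2 + (norm (t - sol i y))\<^sup>2 + (norm v)\<^sup>2)"
    and A: "A \<ge> 0" "\<And>i j x. norm (grad_Phi i x - grad_Phi j x) \<le> A"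
    and steps: "0 < alpha p" "alpha p < 1" "beta p = beta0" "lambda p = lambda0" "0 < gamma p" "gamma p < 1" "0 < tau p" "tau p < 1"
    and m_eq [simp]: "real CARD('m) = m"
    and small: "tau p * alpha p * B \<le> 1 / 8"
begin

abbreviation "\<alpha> \<equiv> alpha p"
abbreviation "\<gamma> \<equiv> gamma p"
abbreviation "\<tau> \<equiv> tau p"
abbreviation "u \<equiv> tau p * alpha p"

lemma m_pos: "m \<ge> 1"
proof -
  have "1 \<le> CARD('m)" by (simp add: Suc_leI)
  then have "real 1 \<le> real CARD('m)" by (rule of_nat_mono)
  then show ?thesis by simp
qed

lemma u_pos: "0 < u"
  using steps by simp

definition "xbar (s :: ('n, 'p, 'm) iterate) = avg (fst s)"
definition "zbar (s :: ('n, 'p, 'm) iterate) = avg (snd (snd (snd s)))"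
text \<open>The next mean is a function of the present state; the noise of the current step reaches it only one
iteration later.\<close>

definition "xnext s = xbar s - u *\<^sub>R zbar s"
definition "eX i s = fst s $ i - xbar s"
definition "eT i s = fst (snd s) $ i - sol i (xbar s)"
definition "eV i (s :: ('n, 'p, 'm) iterate) = fst (snd (snd s)) $ i"
definition "eY i s = snd (snd (snd s)) $ i - grad_Phi i (xbar s)"
definition "eG s = gradient (Phi f g) (xbar s)"
definition "eQ s = zbar s - eG s"

lemma linear_growth_errors [simp]:
  "linear_growth xbar" "linear_growth zbar" "linear_growth xnext" "linear_growth (eX i)"
  "linear_growth (eT i)" "linear_growth (eV i)" "linear_growth (eY i)" "linear_growth eG" "linear_growth eQ"
proof -
  note comp = linear_growth_vec_nth[OF linear_growth_components(1)] linear_growth_vec_nth[OF linear_growth_components(2)]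
    linear_growth_vec_nth[OF linear_growth_components(3)] linear_growth_vec_nth[OF linear_growth_components(4)]
  show x: "linear_growth xbar" unfolding xbar_def[abs_def]
    by (intro linear_growth_avg linear_growth_components)
  show z: "linear_growth zbar" unfolding zbar_def[abs_def]
    by (intro linear_growth_avg linear_growth_components)
  show "linear_growth xnext" unfolding xnext_def[abs_def]
    by (intro linear_growth_diff linear_growth_scaleR x z)
  show "linear_growth (eX i)" unfolding eX_def[abs_def] by (intro linear_growth_diff comp x)
  show "linear_growth (eT i)" unfolding eT_def[abs_def]
    by (intro linear_growth_diff comp linear_growth_compose[OF linear_growth_problem(1)] x)
  show "linear_growth (eV i)" unfolding eV_def[abs_def] by (rule comp)
  show "linear_growth (eY i)" unfolding eY_def[abs_def]
    by (intro linear_growth_diff comp linear_growth_compose[OF linear_growth_problem(2)] x)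
  show G: "linear_growth eG" unfolding eG_def[abs_def]
    by (intro linear_growth_compose[OF linear_growth_problem(3)] x)
  show "linear_growth eQ" unfolding eQ_def[abs_def] by (intro linear_growth_diff z G)
qed

lemma integrable_errors [simp]:
  "linear_growth h \<Longrightarrow> integrable M (\<lambda>\<omega>. (norm (h (st k \<omega>)))\<^sup>2)"
  by (rule state_moment(2))

definition "moment h k = (\<integral>\<omega>. (norm (h (st k \<omega>)))\<^sup>2 \<partial>M)"

lemma moment_nonneg: "moment h k \<ge> 0"
  by (simp add: moment_def)

lemma moment_mono:
  assumes "linear_growth h" "integrable M (\<lambda>\<omega>. r (st k \<omega>))" "\<And>s. (norm (h s))\<^sup>2 \<le> r s"
  shows "moment h k \<le> (\<integral>\<omega>. r (st k \<omega>) \<partial>M)"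
  unfolding moment_def by (rule integral_mono[OF integrable_errors[OF assms(1)] assms(2) assms(3)])

lemma xbar_Suc: "xbar (st (Suc k) \<omega>) = xnext (st k \<omega>)"
  by (simp add: xbar_def zbar_def xnext_def xs_Suc avg_add avg_diff avg_scaleR avg_mix algebra_simps)

text \<open>A common contraction rate for consensus, inner and adjoint variables.\<close>

definition "gap0 = min gap (min (beta0 * mu_g c / 2) (lambda0 * mu_g c / 4))"

lemma gap0: "0 < gap0" "gap0 \<le> 1" "gap0 \<le> gap" "gap0 \<le> beta0 * mu_g c / 2" "gap0 \<le> lambda0 * mu_g c / 4"
proof -
  have "0 < beta0 * mu_g c / 2" "0 < lambda0 * mu_g c / 4"
    using beta0(1) lambda0(1) positive_constants(1) by simp_all
  then show "0 < gap0" unfolding gap0_def using gap by simp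
  show "gap0 \<le> gap" "gap0 \<le> beta0 * mu_g c / 2" "gap0 \<le> lambda0 * mu_g c / 4"
    unfolding gap0_def by (rule min.cobounded1 min.coboundedI2[OF min.cobounded1] min.coboundedI2[OF min.cobounded2])+
  then show "gap0 \<le> 1" using gap by linarith
qed

definition "phi_moment k = (\<integral>\<omega>. Phi f g (xbar (st k \<omega>)) \<partial>M)"
definition "X_moment k = (\<Sum>i\<in>UNIV. moment (eX i) k)"
definition "T_moment k = (\<Sum>i\<in>UNIV. moment (eT i) k)"
definition "V_moment k = (\<Sum>i\<in>UNIV. moment (eV i) k)"
definition "Y_moment k = (\<Sum>i\<in>UNIV. moment (eY i) k)"

lemma moments_nonneg: "X_moment k \<ge> 0" "T_moment k \<ge> 0" "V_moment k \<ge> 0" "Y_moment k \<ge> 0"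
  by (auto simp: X_moment_def T_moment_def V_moment_def Y_moment_def intro!: sum_nonneg moment_nonneg)

definition "C_T = (8 * lip\<^sup>2 / (beta0 * mu_g c / 2) + 2 * lip\<^sup>2 * m / (beta0 * mu_g c / 2) + m * (beta0\<^sup>2 * (s_gt c)\<^sup>2)) / gap0"

lemma T_step: "T_moment (Suc k) \<le> (1 - gap0) * T_moment k + gap0 * (C_T * (1 + X_moment k + u\<^sup>2 * moment zbar k))"
proof -
  define a where "a = beta0 * mu_g c / 2"
  have a: "a > 0" using beta0 positive_constants by (simp add: a_def)
  define h where "h i s = drift_\<theta> i s - sol i (xnext s)" for i s
  have hg: "linear_growth (h i)" for i
    unfolding h_def[abs_def]
    by (intro linear_growth_diff linear_growth_drifts linear_growth_compose[OF linear_growth_problem(1)]) simp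
  have one: "moment (eT i) (Suc k) \<le> (1 - a) * moment (eT i) k
      + (8 * lip\<^sup>2 * moment (eX i) k + 2 * lip\<^sup>2 * (u\<^sup>2 * moment zbar k)) / a + beta0\<^sup>2 * (s_gt c)\<^sup>2" for i
  proof -
    have "moment (eT i) (Suc k) = (\<integral>\<omega>. (norm (h i (st k \<omega>) + (\<Sum>j\<in>{()}. noise_\<theta> k i \<omega>)))\<^sup>2 \<partial>M)"
      unfolding moment_def eT_def st_components ts_decompose xbar_Suc h_def by (simp add: algebra_simps)
    also have "\<dots> \<le> moment (h i) k + real (card {()}) * (\<Sum>j\<in>{()}. \<integral>\<omega>. beta0\<^sup>2 * (s_gt c)\<^sup>2 \<partial>M)"
      unfolding moment_def using noise_\<theta>[of k i] steps by (intro drift_noise_moment(3)[OF hg]) auto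
    also have "\<dots> = moment (h i) k + beta0\<^sup>2 * (s_gt c)\<^sup>2" by (simp add: prob_space)
    also have "moment (h i) k \<le> (\<integral>\<omega>. (1 - a) * (norm (eT i (st k \<omega>)))\<^sup>2
        + (8 * lip\<^sup>2 * (norm (eX i (st k \<omega>)))\<^sup>2 + 2 * lip\<^sup>2 * (u\<^sup>2 * (norm (zbar (st k \<omega>)))\<^sup>2)) / a \<partial>M)"
    proof (rule moment_mono[OF hg])
      fix s show "(norm (h i s))\<^sup>2 \<le> (1 - a) * (norm (eT i s))\<^sup>2
        + (8 * lip\<^sup>2 * (norm (eX i s))\<^sup>2 + 2 * lip\<^sup>2 * (u\<^sup>2 * (norm (zbar s))\<^sup>2)) / a"
        unfolding h_def drift_\<theta>_def xnext_def eT_def eX_def a_def steps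
        using u_pos by (intro inner_step beta0) simp
    qed simp
    also have "\<dots> = (1 - a) * moment (eT i) k + (8 * lip\<^sup>2 * moment (eX i) k + 2 * lip\<^sup>2 * (u\<^sup>2 * moment zbar k)) / a"
      by (simp add: moment_def)
    finally show ?thesis by simp
  qed
  have "T_moment (Suc k) \<le> (\<Sum>i\<in>UNIV. (1 - a) * moment (eT i) k
      + (8 * lip\<^sup>2 * moment (eX i) k + 2 * lip\<^sup>2 * (u\<^sup>2 * moment zbar k)) / a + beta0\<^sup>2 * (s_gt c)\<^sup>2)"
    unfolding T_moment_def by (intro sum_mono one)
  also have "\<dots> = (1 - a) * T_moment k + (8 * lip\<^sup>2 * X_moment k + m * (2 * lip\<^sup>2 * (u\<^sup>2 * moment zbar k))) / a + m * (beta0\<^sup>2 * (s_gt c)\<^sup>2)"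
    by (simp add: T_moment_def X_moment_def sum.distrib sum_distrib_left[symmetric] sum_divide_distrib[symmetric])
  also have "\<dots> = (1 - a) * T_moment k + (8 * lip\<^sup>2 / a * X_moment k + 2 * lip\<^sup>2 * m / a * (u\<^sup>2 * moment zbar k) + m * (beta0\<^sup>2 * (s_gt c)\<^sup>2) * 1)"
    by (simp add: add_divide_distrib mult_ac)
  also have "\<dots> \<le> (1 - gap0) * T_moment k + (gap0 * C_T * X_moment k + gap0 * C_T * (u\<^sup>2 * moment zbar k) + gap0 * C_T * 1)"
  proof (intro add_mono mult_right_mono)
    show "1 - a \<le> 1 - gap0" using gap0 by (simp add: a_def)
    have eq: "gap0 * C_T = 8 * lip\<^sup>2 / a + 2 * lip\<^sup>2 * m / a + m * (beta0\<^sup>2 * (s_gt c)\<^sup>2)"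
      using gap0 by (simp add: C_T_def a_def)
    have "0 \<le> 8 * lip\<^sup>2 / a" "0 \<le> 2 * lip\<^sup>2 * m / a" "0 \<le> m * (beta0\<^sup>2 * (s_gt c)\<^sup>2)" using a m_pos by simp_all
    then show "8 * lip\<^sup>2 / a \<le> gap0 * C_T" "2 * lip\<^sup>2 * m / a \<le> gap0 * C_T" "m * (beta0\<^sup>2 * (s_gt c)\<^sup>2) \<le> gap0 * C_T"
      unfolding eq by linarith+
  qed (use moments_nonneg moment_nonneg in \<open>auto intro!: mult_nonneg_nonneg\<close>)
  finally show ?thesis by (simp add: algebra_simps)
qed

definition "C_V = (2 * lambda0\<^sup>2 * (C_ft c)\<^sup>2 * m / (lambda0 * mu_g c / 2) + 4 * lambda0\<^sup>2 * (L_ft c)\<^sup>2 / (lambda0 * mu_g c / 2)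
  + 4 * lambda0\<^sup>2 * (L_ft c)\<^sup>2 * lip\<^sup>2 / (lambda0 * mu_g c / 2) + 2 * m * (lambda0\<^sup>2 * (s_ft c)\<^sup>2)) / gap0"

lemma V_step: "V_moment (Suc k) \<le> (1 - gap0) * V_moment k + gap0 * (C_V * (1 + T_moment k + X_moment k))"
proof -
  define a where "a = lambda0 * mu_g c / 2"
  have a: "a > 0" using lambda0 positive_constants by (simp add: a_def)
  define q where "q = 2 * lambda0\<^sup>2 * (C_ft c)\<^sup>2"
  define r where "r = 4 * lambda0\<^sup>2 * (L_ft c)\<^sup>2"
  define w where "w = 4 * lambda0\<^sup>2 * (L_ft c)\<^sup>2 * lip\<^sup>2"
  have hg: "linear_growth (drift_v i)" for i by (rule linear_growth_drifts)
  have one: "moment (eV i) (Suc k) \<le> (1 - a) * moment (eV i) k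
      + (q + r * moment (eT i) k + w * moment (eX i) k) / a
      + 2 * (lambda0\<^sup>2 * (s_gtt c)\<^sup>2 * moment (eV i) k + lambda0\<^sup>2 * (s_ft c)\<^sup>2)" for i
  proof -
    have "moment (eV i) (Suc k) = (\<integral>\<omega>. (norm (drift_v i (st k \<omega>) + (\<Sum>b\<in>UNIV. noise_v k i b \<omega>)))\<^sup>2 \<partial>M)"
      unfolding moment_def eV_def st_components vs_decompose by simp
    also have "\<dots> \<le> moment (drift_v i) k + real (card (UNIV :: bool set)) * (\<Sum>b\<in>UNIV. \<integral>\<omega>. noise_v_var i b (st k \<omega>) \<partial>M)"
      unfolding moment_def using noise_v[OF state_square_integrable] by (intro drift_noise_moment(3)[OF hg]) auto
    also have "\<dots> = moment (drift_v i) k + 2 * (lambda0\<^sup>2 * (s_gtt c)\<^sup>2 * moment (eV i) k + lambda0\<^sup>2 * (s_ft c)\<^sup>2)"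
      by (simp add: UNIV_bool noise_v_var_def moment_def eV_def steps prob_space)
    also have "moment (drift_v i) k \<le> (\<integral>\<omega>. (1 - a) * (norm (eV i (st k \<omega>)))\<^sup>2
        + (q + r * (norm (eT i (st k \<omega>)))\<^sup>2 + w * (norm (eX i (st k \<omega>)))\<^sup>2) / a \<partial>M)"
    proof (rule moment_mono[OF hg])
      fix s show "(norm (drift_v i s))\<^sup>2 \<le> (1 - a) * (norm (eV i s))\<^sup>2
        + (q + r * (norm (eT i s))\<^sup>2 + w * (norm (eX i s))\<^sup>2) / a"
        unfolding drift_v_def eT_def eX_def eV_def a_def q_def r_def w_def steps
        by (intro adjoint_step lambda0)
    qed simp
    also have "\<dots> = (1 - a) * moment (eV i) k + (q + r * moment (eT i) k + w * moment (eX i) k) / a"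
      by (simp add: moment_def prob_space)
    finally show ?thesis by simp
  qed
  have "V_moment (Suc k) \<le> (\<Sum>i\<in>UNIV. (1 - a) * moment (eV i) k
      + (q + r * moment (eT i) k + w * moment (eX i) k) / a
      + 2 * (lambda0\<^sup>2 * (s_gtt c)\<^sup>2 * moment (eV i) k + lambda0\<^sup>2 * (s_ft c)\<^sup>2))"
    unfolding V_moment_def by (intro sum_mono one)
  also have "\<dots> = (1 - a) * V_moment k + (m * q + r * T_moment k + w * X_moment k) / a
      + 2 * (lambda0\<^sup>2 * (s_gtt c)\<^sup>2 * V_moment k + m * (lambda0\<^sup>2 * (s_ft c)\<^sup>2))"
    by (simp add: V_moment_def T_moment_def X_moment_def sum.distrib sum_distrib_left[symmetric] sum_divide_distrib[symmetric])
  also have "\<dots> = (1 - a + 2 * (lambda0\<^sup>2 * (s_gtt c)\<^sup>2)) * V_moment k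
      + ((q * m / a + 2 * m * (lambda0\<^sup>2 * (s_ft c)\<^sup>2)) * 1 + r / a * T_moment k + w / a * X_moment k)"
    by (simp add: add_divide_distrib distrib_right distrib_left mult_ac)
  also have "\<dots> \<le> (1 - gap0) * V_moment k + (gap0 * C_V * 1 + gap0 * C_V * T_moment k + gap0 * C_V * X_moment k)"
  proof (intro add_mono mult_right_mono)
    have "lambda0 * (8 * lambda0 * (s_gtt c)\<^sup>2) \<le> lambda0 * mu_g c" using lambda0 by (intro mult_left_mono) auto
    then have "8 * (lambda0\<^sup>2 * (s_gtt c)\<^sup>2) \<le> lambda0 * mu_g c" by (simp add: power2_eq_square mult_ac)
    then show "1 - a + 2 * (lambda0\<^sup>2 * (s_gtt c)\<^sup>2) \<le> 1 - gap0" using gap0(5) by (simp add: a_def)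
    have eq: "gap0 * C_V = q * m / a + r / a + w / a + 2 * m * (lambda0\<^sup>2 * (s_ft c)\<^sup>2)"
      using gap0 by (simp add: C_V_def a_def q_def r_def w_def)
    have "0 \<le> q * m / a" "0 \<le> r / a" "0 \<le> w / a" "0 \<le> 2 * m * (lambda0\<^sup>2 * (s_ft c)\<^sup>2)"
      using a m_pos by (simp_all add: q_def r_def w_def)
    then show "q * m / a + 2 * m * (lambda0\<^sup>2 * (s_ft c)\<^sup>2) \<le> gap0 * C_V" "r / a \<le> gap0 * C_V" "w / a \<le> gap0 * C_V"
      unfolding eq by linarith+
  qed (use moments_nonneg in auto)
  finally show ?thesis by (simp add: algebra_simps)
qed

lemma X_moment_eq: "X_moment k = (\<integral>\<omega>. (norm (disagreement (xs k \<omega>)))\<^sup>2 \<partial>M)"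
  unfolding X_moment_def moment_def
  by (subst Bochner_Integration.integral_sum[symmetric])
    (rule integrable_errors, simp, simp add: norm_sq_stacked disagreement_def eX_def xbar_def)

text \<open>The directions of the nodes track gradients that are within \<open>A\<close> of each other.\<close>

lemma disagreement_z: "(norm (disagreement (snd (snd (snd s)))))\<^sup>2 \<le> 8 * (\<Sum>i\<in>UNIV. (norm (eY i s))\<^sup>2) + 2 * m * A\<^sup>2"
proof -
  define D where "D = (\<chi> i. grad_Phi i (xbar s))"
  define Y where "Y = (\<chi> i. eY i s)"
  have "snd (snd (snd s)) = Y + D" by (simp add: D_def Y_def eY_def vec_eq_iff)
  moreover have "disagreement (Y + D) = disagreement Y + disagreement D"
    by (simp add: disagreement_def avg_add vec_eq_iff)
  ultimately have "(norm (disagreement (snd (snd (snd s)))))\<^sup>2 \<le> 2 * (norm (disagreement Y))\<^sup>2 + 2 * (norm (disagreement D))\<^sup>2"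
    using norm_sum2_sq by simp
  moreover have "(norm (disagreement Y))\<^sup>2 \<le> 4 * (\<Sum>i\<in>UNIV. (norm (eY i s))\<^sup>2)"
  proof -
    have "(norm (disagreement Y))\<^sup>2 \<le> (2 * norm Y)\<^sup>2" by (intro power_mono norm_disagreement_le) simp
    then show ?thesis by (simp add: power_mult_distrib norm_sq_stacked Y_def)
  qed
  moreover have "(norm (disagreement D))\<^sup>2 \<le> m * A\<^sup>2"
  proof -
    have "norm (disagreement D $ i) \<le> A" for i
    proof -
      have "disagreement D $ i = (\<Sum>j\<in>UNIV. grad_Phi i (xbar s) - grad_Phi j (xbar s)) /\<^sub>R m"
        by (simp add: disagreement_def D_def avg_def sum_subtractf scaleR_diff_right sum_constant_scaleR m_pos[THEN order.strict_trans2[OF zero_less_one], THEN less_imp_neq, symmetric] del: sum_constant)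
      moreover have "norm (\<Sum>j\<in>UNIV. grad_Phi i (xbar s) - grad_Phi j (xbar s)) \<le> (\<Sum>j\<in>(UNIV :: 'm set). A)"
        by (rule sum_norm_le) (rule A(2))
      ultimately show ?thesis using m_pos by (simp add: divide_simps mult.commute)
    qed
    then have "(\<Sum>i\<in>UNIV. (norm (disagreement D $ i))\<^sup>2) \<le> (\<Sum>i\<in>(UNIV :: 'm set). A\<^sup>2)"
      by (intro sum_mono power_mono) auto
    then show ?thesis by (simp add: norm_sq_stacked)
  qed
  ultimately show ?thesis by linarith
qed

definition "C_X = (8 + 2 * m * A\<^sup>2) / (gap0 * gap)"

lemma X_step: "X_moment (Suc k) \<le> (1 - gap0 * \<tau>) * X_moment k + gap0 * \<tau> * (\<alpha>\<^sup>2 * (C_X * (1 + Y_moment k)))"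
proof -
  have intX: "integrable M (\<lambda>\<omega>. (norm (disagreement (xs k \<omega>)))\<^sup>2)" for k
  proof -
    have "(\<lambda>\<omega>. (norm (disagreement (xs k \<omega>)))\<^sup>2) = (\<lambda>\<omega>. \<Sum>i\<in>UNIV. (norm (eX i (st k \<omega>)))\<^sup>2)"
      by (simp add: norm_sq_stacked disagreement_def eX_def xbar_def)
    then show ?thesis by (simp add: Bochner_Integration.integrable_sum)
  qed
  have path: "(norm (disagreement (xs (Suc k) \<omega>)))\<^sup>2 \<le> (1 - gap * \<tau>) * (norm (disagreement (xs k \<omega>)))\<^sup>2
      + \<tau> * \<alpha>\<^sup>2 / gap * (8 * (\<Sum>i\<in>UNIV. (norm (eY i (st k \<omega>)))\<^sup>2) + 2 * m * A\<^sup>2)" for \<omega>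
  proof -
    have "\<tau> * \<alpha>\<^sup>2 / gap * (norm (disagreement (zs k \<omega>)))\<^sup>2
        \<le> \<tau> * \<alpha>\<^sup>2 / gap * (8 * (\<Sum>i\<in>UNIV. (norm (eY i (st k \<omega>)))\<^sup>2) + 2 * m * A\<^sup>2)"
      using disagreement_z[of "st k \<omega>"] steps gap by (intro mult_left_mono) auto
    then show ?thesis
      unfolding xs_Suc using disagreement_step[OF steps(7,8), of "xs k \<omega>" \<alpha> "zs k \<omega>"] by simp
  qed
  have "X_moment (Suc k) \<le> (\<integral>\<omega>. (1 - gap * \<tau>) * (norm (disagreement (xs k \<omega>)))\<^sup>2
      + \<tau> * \<alpha>\<^sup>2 / gap * (8 * (\<Sum>i\<in>UNIV. (norm (eY i (st k \<omega>)))\<^sup>2) + 2 * m * A\<^sup>2) \<partial>M)"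
    unfolding X_moment_eq using intX by (intro integral_mono path) auto
  also have "\<dots> = (1 - gap * \<tau>) * X_moment k + \<tau> * \<alpha>\<^sup>2 / gap * (8 * Y_moment k + 2 * m * A\<^sup>2)"
    using intX by (simp add: X_moment_eq Y_moment_def moment_def prob_space)
  also have "\<dots> \<le> (1 - gap0 * \<tau>) * X_moment k + \<tau> * \<alpha>\<^sup>2 / gap * ((8 + 2 * m * A\<^sup>2) * (1 + Y_moment k))"
  proof (intro add_mono mult_right_mono mult_left_mono)
    show "1 - gap * \<tau> \<le> 1 - gap0 * \<tau>" using gap0 steps by (simp add: mult_right_mono)
    have "0 \<le> m * A\<^sup>2 * Y_moment k" using moments_nonneg m_pos by simp
    then show "8 * Y_moment k + 2 * m * A\<^sup>2 \<le> (8 + 2 * m * A\<^sup>2) * (1 + Y_moment k)"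
      by (simp add: algebra_simps)
  qed (use moments_nonneg steps gap in auto)
  also have "\<tau> * \<alpha>\<^sup>2 / gap * ((8 + 2 * m * A\<^sup>2) * (1 + Y_moment k)) = gap0 * \<tau> * (\<alpha>\<^sup>2 * (C_X * (1 + Y_moment k)))"
    using gap0 gap by (simp add: C_X_def)
  finally show ?thesis .
qed

definition "C_Y = 2 * H * (m + 1) + 4 * m + 4 * m * B\<^sup>2 + 2 * (s_gxt c)\<^sup>2 + 2 * m * (s_fx c)\<^sup>2"

definition "bias i s = grad_Phi i (xbar s) - hypergrad_estimate i s"

lemma bias_bound: "(norm (bias i s))\<^sup>2 \<le> H * (1 + (norm (eX i s))\<^sup>2 + (norm (eT i s))\<^sup>2 + (norm (eV i s))\<^sup>2)"
  unfolding bias_def hypergrad_estimate_def eX_def eT_def eV_def by (rule H(2))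

lemma distance_xnext: "norm (xbar s - xnext s) = u * norm (zbar s)"
  using u_pos by (simp add: xnext_def)

lemma C_Y_terms:
  "2 * H * m + 4 * m + 2 * m * (s_fx c)\<^sup>2 \<le> C_Y" "2 * H \<le> C_Y" "2 * H + 2 * (s_gxt c)\<^sup>2 \<le> C_Y" "4 * m * B\<^sup>2 \<le> C_Y"
  "2 * H + 4 + 2 * m * (s_fx c)\<^sup>2 \<le> C_Y" "4 * B\<^sup>2 \<le> C_Y" "0 \<le> C_Y"
proof -
  have nn: "0 \<le> H" "0 \<le> H * m" "0 \<le> m * B\<^sup>2" "0 \<le> m * (s_fx c)\<^sup>2" "0 \<le> (s_gxt c)\<^sup>2" "1 \<le> m"
    using H(1) m_pos by auto
  have "H * 1 \<le> H * m" "1 * B\<^sup>2 \<le> m * B\<^sup>2" using H(1) m_pos by (intro mult_left_mono mult_right_mono; simp)+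
  moreover have "C_Y = 2 * (H * m) + 2 * H + 4 * m + 4 * (m * B\<^sup>2) + 2 * (s_gxt c)\<^sup>2 + 2 * (m * (s_fx c)\<^sup>2)"
    by (simp add: C_Y_def algebra_simps)
  ultimately show "2 * H * m + 4 * m + 2 * m * (s_fx c)\<^sup>2 \<le> C_Y" "2 * H \<le> C_Y" "2 * H + 2 * (s_gxt c)\<^sup>2 \<le> C_Y" "4 * m * B\<^sup>2 \<le> C_Y"
    "2 * H + 4 + 2 * m * (s_fx c)\<^sup>2 \<le> C_Y" "4 * B\<^sup>2 \<le> C_Y" "0 \<le> C_Y"
    using nn unfolding mult.assoc by linarith+
qed

text \<open>The bookkeeping shared by the tracking errors of the nodes and of their mean.\<close>

lemma tracking_assembly:
  fixes x t v n m1 m2 :: real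
  assumes \<Theta>: "0 \<le> x" "0 \<le> t" "0 \<le> v" "0 \<le> n"
    and coeff: "2 * H * m1 + 4 * m1 + 2 * m2 * (s_fx c)\<^sup>2 \<le> C_Y" "4 * m1 * B\<^sup>2 \<le> C_Y" and m2: "0 \<le> m2"
  shows "2 * \<gamma> * (H * (m1 + x + t + v)) + \<gamma> * (4 * m1 + 4 * m1 * B\<^sup>2 * (u\<^sup>2 / \<gamma> ^ 4 * n))
      + 2 * (\<gamma>\<^sup>2 * ((s_gxt c)\<^sup>2 * v) + m2 * (\<gamma>\<^sup>2 * (s_fx c)\<^sup>2))
    \<le> \<gamma> * (C_Y * (1 + x + t + v + u\<^sup>2 / \<gamma> ^ 4 * n))"
proof -
  have g: "\<gamma>\<^sup>2 \<le> \<gamma>" using steps by (simp add: power2_eq_square mult_left_le)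
  define N where "N = u\<^sup>2 / \<gamma> ^ 4 * n"
  have N: "0 \<le> N" using \<Theta> steps by (simp add: N_def)
  have "2 * (\<gamma>\<^sup>2 * ((s_gxt c)\<^sup>2 * v) + m2 * (\<gamma>\<^sup>2 * (s_fx c)\<^sup>2)) \<le> 2 * (\<gamma> * ((s_gxt c)\<^sup>2 * v) + m2 * (\<gamma> * (s_fx c)\<^sup>2))"
    using g \<Theta> m2 by (intro mult_left_mono add_mono mult_right_mono) auto
  moreover have "\<gamma> * ((2 * H * m1 + 4 * m1 + 2 * m2 * (s_fx c)\<^sup>2) * 1 + 2 * H * x + 2 * H * t + (2 * H + 2 * (s_gxt c)\<^sup>2) * v + 4 * m1 * B\<^sup>2 * N)
      \<le> \<gamma> * (C_Y * 1 + C_Y * x + C_Y * t + C_Y * v + C_Y * N)"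
    using coeff C_Y_terms \<Theta> N steps by (intro mult_left_mono add_mono mult_right_mono) auto
  ultimately show ?thesis unfolding N_def[symmetric] by (simp add: algebra_simps)
qed

lemma Y_step: "Y_moment (Suc k) \<le> (1 - \<gamma>) * Y_moment k
    + \<gamma> * (C_Y * (1 + X_moment k + T_moment k + V_moment k + u\<^sup>2 / \<gamma> ^ 4 * moment zbar k))"
proof -
  define h where "h i s = drift_z i s - grad_Phi i (xnext s)" for i s
  have hg: "linear_growth (h i)" for i
    unfolding h_def[abs_def]
    by (intro linear_growth_diff linear_growth_drifts linear_growth_compose[OF linear_growth_problem(2)]) simp
  have path: "(norm (h i s))\<^sup>2 \<le> (1 - \<gamma>) * (norm (eY i s))\<^sup>2
      + 2 * \<gamma> * (H * (1 + (norm (eX i s))\<^sup>2 + (norm (eT i s))\<^sup>2 + (norm (eV i s))\<^sup>2))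
      + \<gamma> * (4 + 4 * B\<^sup>2 * (u\<^sup>2 / \<gamma> ^ 4 * (norm (zbar s))\<^sup>2))" for i s
  proof -
    define d where "d = grad_Phi i (xbar s) - grad_Phi i (xnext s)"
    have "h i s = (1 - \<gamma>) *\<^sub>R eY i s + (\<gamma> *\<^sub>R (- bias i s) + d)"
      by (simp add: h_def drift_z_def eY_def bias_def d_def algebra_simps)
    then have "(norm (h i s))\<^sup>2 \<le> (1 - \<gamma>) * (norm (eY i s))\<^sup>2 + 2 * \<gamma> * (norm (- bias i s))\<^sup>2 + 2 / \<gamma> * (norm d)\<^sup>2"
      by (simp only: tracking_step[OF steps(5,6)])
    moreover have "2 * \<gamma> * (norm (- bias i s))\<^sup>2 \<le> 2 * \<gamma> * (H * (1 + (norm (eX i s))\<^sup>2 + (norm (eT i s))\<^sup>2 + (norm (eV i s))\<^sup>2))"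
      using bias_bound[of i s] steps by (intro mult_left_mono) auto
    moreover have "2 / \<gamma> * (norm d)\<^sup>2 \<le> \<gamma> * (4 + 4 * B\<^sup>2 * (u\<^sup>2 / \<gamma> ^ 4 * (norm (zbar s))\<^sup>2))"
      using B(2)[of \<gamma> i "xbar s" "xnext s"] steps
      by (intro jump_square_le) (simp_all add: d_def distance_xnext)
    ultimately show ?thesis by linarith
  qed
  have one: "moment (eY i) (Suc k) \<le> (1 - \<gamma>) * moment (eY i) k
      + 2 * \<gamma> * (H * (1 + moment (eX i) k + moment (eT i) k + moment (eV i) k))
      + \<gamma> * (4 + 4 * B\<^sup>2 * (u\<^sup>2 / \<gamma> ^ 4 * moment zbar k))
      + 2 * (\<gamma>\<^sup>2 * ((s_gxt c)\<^sup>2 * moment (eV i) k) + \<gamma>\<^sup>2 * (s_fx c)\<^sup>2)" for i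
  proof -
    have "moment (eY i) (Suc k) = (\<integral>\<omega>. (norm (h i (st k \<omega>) + (\<Sum>b\<in>UNIV. noise_z k i \<gamma> b \<omega>)))\<^sup>2 \<partial>M)"
      unfolding moment_def eY_def st_components zs_decompose xbar_Suc h_def by (simp add: algebra_simps)
    also have "\<dots> \<le> moment (h i) k + real (card (UNIV :: bool set)) * (\<Sum>b\<in>UNIV. \<integral>\<omega>. noise_z_var i \<gamma> b (st k \<omega>) \<partial>M)"
      unfolding moment_def using noise_z[OF state_square_integrable] by (intro drift_noise_moment(3)[OF hg]) auto
    also have "\<dots> = moment (h i) k + 2 * (\<gamma>\<^sup>2 * ((s_gxt c)\<^sup>2 * moment (eV i) k) + \<gamma>\<^sup>2 * (s_fx c)\<^sup>2)"
      by (simp add: UNIV_bool noise_z_var_def moment_def eV_def prob_space)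
    also have "moment (h i) k \<le> (\<integral>\<omega>. (1 - \<gamma>) * (norm (eY i (st k \<omega>)))\<^sup>2
      + 2 * \<gamma> * (H * (1 + (norm (eX i (st k \<omega>)))\<^sup>2 + (norm (eT i (st k \<omega>)))\<^sup>2 + (norm (eV i (st k \<omega>)))\<^sup>2))
      + \<gamma> * (4 + 4 * B\<^sup>2 * (u\<^sup>2 / \<gamma> ^ 4 * (norm (zbar (st k \<omega>)))\<^sup>2)) \<partial>M)"
      by (rule moment_mono[OF hg _ path]) simp
    also have "\<dots> = (1 - \<gamma>) * moment (eY i) k
      + 2 * \<gamma> * (H * (1 + moment (eX i) k + moment (eT i) k + moment (eV i) k))
      + \<gamma> * (4 + 4 * B\<^sup>2 * (u\<^sup>2 / \<gamma> ^ 4 * moment zbar k))"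
      by (simp add: moment_def prob_space)
    finally show ?thesis by simp
  qed
  have "Y_moment (Suc k) \<le> (\<Sum>i\<in>UNIV. (1 - \<gamma>) * moment (eY i) k
      + 2 * \<gamma> * (H * (1 + moment (eX i) k + moment (eT i) k + moment (eV i) k))
      + \<gamma> * (4 + 4 * B\<^sup>2 * (u\<^sup>2 / \<gamma> ^ 4 * moment zbar k))
      + 2 * (\<gamma>\<^sup>2 * ((s_gxt c)\<^sup>2 * moment (eV i) k) + \<gamma>\<^sup>2 * (s_fx c)\<^sup>2))"
    unfolding Y_moment_def by (intro sum_mono one)
  also have "\<dots> = (1 - \<gamma>) * Y_moment k + (2 * \<gamma> * (H * (m + X_moment k + T_moment k + V_moment k))
      + m * (\<gamma> * (4 + 4 * B\<^sup>2 * (u\<^sup>2 / \<gamma> ^ 4 * moment zbar k)))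
      + 2 * (\<gamma>\<^sup>2 * ((s_gxt c)\<^sup>2 * V_moment k) + m * (\<gamma>\<^sup>2 * (s_fx c)\<^sup>2)))"
    by (simp add: Y_moment_def X_moment_def T_moment_def V_moment_def sum.distrib sum_distrib_left[symmetric] sum_divide_distrib[symmetric])
  also have "m * (\<gamma> * (4 + 4 * B\<^sup>2 * (u\<^sup>2 / \<gamma> ^ 4 * moment zbar k))) = \<gamma> * (4 * m + 4 * m * B\<^sup>2 * (u\<^sup>2 / \<gamma> ^ 4 * moment zbar k))"
    by (simp add: distrib_left mult_ac)
  finally show ?thesis
    using tracking_assembly[OF moments_nonneg(1,2,3) moment_nonneg C_Y_terms(1,4), of k k k zbar k] m_pos by simp
qed

text \<open>The mean is tracked by the mean of the directions, so the argument for a single node applies after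
averaging; the noises of the mean are indexed by a node and one of its two samples.\<close>

lemma Q_step: "moment eQ (Suc k) \<le> (1 - \<gamma>) * moment eQ k
    + \<gamma> * (C_Y * (1 + X_moment k + T_moment k + V_moment k + u\<^sup>2 / \<gamma> ^ 4 * moment zbar k))"
proof -
  define h where "h s = avg (\<chi> i. drift_z i s) - gradient (Phi f g) (xnext s)" for s
  have av: "avg (\<chi> i. w i) = (1 / m) *\<^sub>R (\<Sum>i\<in>UNIV. w i)" for w :: "'m \<Rightarrow> real^'n"
    by (simp add: avg_def divide_inverse)
  have lg_sum: "linear_growth (\<lambda>s. \<Sum>i\<in>I. drift_z i s)" if "finite I" for I
    using that by induction (auto simp: linear_growth_const linear_growth_add linear_growth_drifts)
  have hg: "linear_growth h"
    unfolding h_def[abs_def] av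
    by (intro linear_growth_diff linear_growth_scaleR lg_sum linear_growth_compose[OF linear_growth_problem(3)]) simp_all
  have path: "(norm (h s))\<^sup>2 \<le> (1 - \<gamma>) * (norm (eQ s))\<^sup>2
      + 2 * \<gamma> * (H * (1 + (\<Sum>i\<in>UNIV. (norm (eX i s))\<^sup>2) + (\<Sum>i\<in>UNIV. (norm (eT i s))\<^sup>2) + (\<Sum>i\<in>UNIV. (norm (eV i s))\<^sup>2)))
      + \<gamma> * (4 + 4 * B\<^sup>2 * (u\<^sup>2 / \<gamma> ^ 4 * (norm (zbar s))\<^sup>2))" for s
  proof -
    define d where "d = eG s - gradient (Phi f g) (xnext s)"
    define b where "b = avg (\<chi> i. bias i s)"
    have "(\<chi> i. drift_z i s) = (1 - \<gamma>) *\<^sub>R snd (snd (snd s)) + \<gamma> *\<^sub>R ((\<chi> i. grad_Phi i (xbar s)) - (\<chi> i. bias i s))"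
      by (simp add: vec_eq_iff drift_z_def bias_def)
    then have "avg (\<chi> i. drift_z i s) = (1 - \<gamma>) *\<^sub>R zbar s + \<gamma> *\<^sub>R (eG s - b)"
      by (simp add: avg_add avg_scaleR avg_diff zbar_def eG_def gradient_Phi_avg b_def)
    then have "h s = (1 - \<gamma>) *\<^sub>R eQ s + (\<gamma> *\<^sub>R (- b) + d)"
      by (simp add: h_def eQ_def d_def algebra_simps)
    then have "(norm (h s))\<^sup>2 \<le> (1 - \<gamma>) * (norm (eQ s))\<^sup>2 + 2 * \<gamma> * (norm (- b))\<^sup>2 + 2 / \<gamma> * (norm d)\<^sup>2"
      by (simp only: tracking_step[OF steps(5,6)])
    moreover have "(norm b)\<^sup>2 \<le> H * (1 + (\<Sum>i\<in>UNIV. (norm (eX i s))\<^sup>2) + (\<Sum>i\<in>UNIV. (norm (eT i s))\<^sup>2) + (\<Sum>i\<in>UNIV. (norm (eV i s))\<^sup>2))"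
    proof -
      define N where "N = (\<Sum>i\<in>UNIV. (norm (eX i s))\<^sup>2) + (\<Sum>i\<in>UNIV. (norm (eT i s))\<^sup>2) + (\<Sum>i\<in>UNIV. (norm (eV i s))\<^sup>2)"
      have N: "0 \<le> N" by (auto simp: N_def intro!: add_nonneg_nonneg sum_nonneg)
      have "(norm b)\<^sup>2 \<le> (\<Sum>i\<in>UNIV. (norm (bias i s))\<^sup>2) / m"
        unfolding b_def using norm_avg_sq_le_sum[of "\<lambda>i. bias i s"] by simp
      also have "\<dots> \<le> (\<Sum>i\<in>UNIV. H * (1 + (norm (eX i s))\<^sup>2 + (norm (eT i s))\<^sup>2 + (norm (eV i s))\<^sup>2)) / m"
        using m_pos by (intro divide_right_mono sum_mono bias_bound) auto
      also have "\<dots> = H * (m + N) / m"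
        by (simp add: sum_distrib_left[symmetric] sum.distrib N_def)
      also have "\<dots> = H * (1 + N / m)" using m_pos by (simp add: field_simps)
      also have "\<dots> \<le> H * (1 + N)"
        using H(1) N m_pos mult_left_mono[OF m_pos N] by (intro mult_left_mono add_left_mono) (auto simp: divide_le_eq)
      finally show ?thesis by (simp add: N_def add.assoc)
    qed
    then have "2 * \<gamma> * (norm (- b))\<^sup>2 \<le> 2 * \<gamma> * (H * (1 + (\<Sum>i\<in>UNIV. (norm (eX i s))\<^sup>2) + (\<Sum>i\<in>UNIV. (norm (eT i s))\<^sup>2) + (\<Sum>i\<in>UNIV. (norm (eV i s))\<^sup>2)))"
      using steps by (intro mult_left_mono) auto
    moreover have "2 / \<gamma> * (norm d)\<^sup>2 \<le> \<gamma> * (4 + 4 * B\<^sup>2 * (u\<^sup>2 / \<gamma> ^ 4 * (norm (zbar s))\<^sup>2))"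
      using gradient_Phi_variation[OF B, of \<gamma> "xbar s" "xnext s"] steps
      by (intro jump_square_le) (simp_all add: d_def eG_def distance_xnext)
    ultimately show ?thesis by linarith
  qed
  have "avg (zs (Suc k) \<omega>) = avg (\<chi> i. drift_z i (st k \<omega>)) + (\<Sum>j\<in>UNIV. noise_z k (fst j) (\<gamma> / m) (snd j) \<omega>)" for \<omega>
  proof -
    have "zs (Suc k) \<omega> = (\<chi> i. drift_z i (st k \<omega>)) + (\<chi> i. \<Sum>b\<in>UNIV. noise_z k i \<gamma> b \<omega>)"
      by (simp add: vec_eq_iff zs_decompose)
    then have "avg (zs (Suc k) \<omega>) = avg (\<chi> i. drift_z i (st k \<omega>)) + (1 / m) *\<^sub>R (\<Sum>i\<in>UNIV. \<Sum>b\<in>UNIV. noise_z k i \<gamma> b \<omega>)"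
      by (simp add: avg_add av)
    also have "(1 / m) *\<^sub>R (\<Sum>i\<in>UNIV. \<Sum>b\<in>UNIV. noise_z k i \<gamma> b \<omega>) = (\<Sum>i\<in>UNIV. \<Sum>b\<in>UNIV. noise_z k i (\<gamma> / m) b \<omega>)"
      unfolding scaleR_right.sum by (intro sum.cong refl) (simp add: noise_z_def)
    also have "\<dots> = (\<Sum>j\<in>UNIV. noise_z k (fst j) (\<gamma> / m) (snd j) \<omega>)"
      by (simp add: sum.cartesian_product case_prod_unfold)
    finally show ?thesis .
  qed
  then have "moment eQ (Suc k) = (\<integral>\<omega>. (norm (h (st k \<omega>) + (\<Sum>j\<in>UNIV. noise_z k (fst j) (\<gamma> / m) (snd j) \<omega>)))\<^sup>2 \<partial>M)"
    unfolding moment_def eQ_def eG_def xbar_Suc h_def zbar_def st_components by (simp add: algebra_simps)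
  also have "\<dots> \<le> moment h k + real (card (UNIV :: ('m \<times> bool) set)) * (\<Sum>j\<in>UNIV. \<integral>\<omega>. noise_z_var (fst j) (\<gamma> / m) (snd j) (st k \<omega>) \<partial>M)"
    unfolding moment_def using noise_z[OF state_square_integrable] by (intro drift_noise_moment(3)[OF hg]) auto
  also have "(\<Sum>j\<in>UNIV. \<integral>\<omega>. noise_z_var (fst j) (\<gamma> / m) (snd j) (st k \<omega>) \<partial>M)
      = (\<gamma> / m)\<^sup>2 * ((s_gxt c)\<^sup>2 * V_moment k) + m * ((\<gamma> / m)\<^sup>2 * (s_fx c)\<^sup>2)"
  proof -
    have "(\<Sum>j\<in>UNIV. \<integral>\<omega>. noise_z_var (fst j) (\<gamma> / m) (snd j) (st k \<omega>) \<partial>M)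
        = (\<Sum>i\<in>UNIV. \<Sum>b\<in>UNIV. \<integral>\<omega>. noise_z_var i (\<gamma> / m) b (st k \<omega>) \<partial>M)"
      by (simp add: sum.cartesian_product case_prod_unfold)
    also have "\<dots> = (\<Sum>i\<in>UNIV. (\<gamma> / m)\<^sup>2 * ((s_gxt c)\<^sup>2 * moment (eV i) k) + (\<gamma> / m)\<^sup>2 * (s_fx c)\<^sup>2)"
      by (intro sum.cong refl) (simp add: UNIV_bool noise_z_var_def moment_def eV_def prob_space)
    also have "\<dots> = (\<gamma> / m)\<^sup>2 * ((s_gxt c)\<^sup>2 * V_moment k) + m * ((\<gamma> / m)\<^sup>2 * (s_fx c)\<^sup>2)"
      by (simp only: sum.distrib sum_distrib_left[symmetric] V_moment_def sum_constant m_eq mult.left_commute[of _ m])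
    finally show ?thesis .
  qed
  also have "real (card (UNIV :: ('m \<times> bool) set)) * ((\<gamma> / m)\<^sup>2 * ((s_gxt c)\<^sup>2 * V_moment k) + m * ((\<gamma> / m)\<^sup>2 * (s_fx c)\<^sup>2))
      = 2 * ((\<gamma>\<^sup>2 * ((s_gxt c)\<^sup>2 * V_moment k)) / m + \<gamma>\<^sup>2 * (s_fx c)\<^sup>2)"
  proof -
    have "real (card (UNIV :: ('m \<times> bool) set)) = 2 * m" by (simp flip: m_eq)
    then show ?thesis using m_pos by (simp add: power2_eq_square field_simps)
  qed
  also have "\<dots> \<le> 2 * (\<gamma>\<^sup>2 * ((s_gxt c)\<^sup>2 * V_moment k) + m * (\<gamma>\<^sup>2 * (s_fx c)\<^sup>2))"
  proof (intro mult_left_mono add_mono)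
    have "0 \<le> \<gamma>\<^sup>2 * ((s_gxt c)\<^sup>2 * V_moment k)" using moments_nonneg by simp
    from mult_left_mono[OF m_pos this]
    show "\<gamma>\<^sup>2 * ((s_gxt c)\<^sup>2 * V_moment k) / m \<le> \<gamma>\<^sup>2 * ((s_gxt c)\<^sup>2 * V_moment k)"
      using m_pos by (simp add: divide_le_eq)
    have "1 * (\<gamma>\<^sup>2 * (s_fx c)\<^sup>2) \<le> m * (\<gamma>\<^sup>2 * (s_fx c)\<^sup>2)" using m_pos by (intro mult_right_mono) auto
    then show "\<gamma>\<^sup>2 * (s_fx c)\<^sup>2 \<le> m * (\<gamma>\<^sup>2 * (s_fx c)\<^sup>2)" by simp
  qed simp
  also have "moment h k \<le> (\<integral>\<omega>. (1 - \<gamma>) * (norm (eQ (st k \<omega>)))\<^sup>2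
      + 2 * \<gamma> * (H * (1 + (\<Sum>i\<in>UNIV. (norm (eX i (st k \<omega>)))\<^sup>2) + (\<Sum>i\<in>UNIV. (norm (eT i (st k \<omega>)))\<^sup>2) + (\<Sum>i\<in>UNIV. (norm (eV i (st k \<omega>)))\<^sup>2)))
      + \<gamma> * (4 + 4 * B\<^sup>2 * (u\<^sup>2 / \<gamma> ^ 4 * (norm (zbar (st k \<omega>)))\<^sup>2)) \<partial>M)"
    by (rule moment_mono[OF hg _ path]) simp
  also have "\<dots> = (1 - \<gamma>) * moment eQ k
      + 2 * \<gamma> * (H * (1 + X_moment k + T_moment k + V_moment k))
      + \<gamma> * (4 + 4 * B\<^sup>2 * (u\<^sup>2 / \<gamma> ^ 4 * moment zbar k))"
    by (simp add: moment_def X_moment_def T_moment_def V_moment_def prob_space)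
  finally have "moment eQ (Suc k) \<le> (1 - \<gamma>) * moment eQ k
      + 2 * \<gamma> * (H * (1 + X_moment k + T_moment k + V_moment k))
      + \<gamma> * (4 + 4 * B\<^sup>2 * (u\<^sup>2 / \<gamma> ^ 4 * moment zbar k))
      + 2 * (\<gamma>\<^sup>2 * ((s_gxt c)\<^sup>2 * V_moment k) + m * (\<gamma>\<^sup>2 * (s_fx c)\<^sup>2))" by simp
  moreover have "2 * H * 1 + 4 * 1 + 2 * m * (s_fx c)\<^sup>2 \<le> C_Y" "4 * 1 * B\<^sup>2 \<le> C_Y" using C_Y_terms(5,6) by simp_all
  from tracking_assembly[OF moments_nonneg(1,2,3) moment_nonneg this, of k k k zbar k]
  have "2 * \<gamma> * (H * (1 + X_moment k + T_moment k + V_moment k)) + \<gamma> * (4 + 4 * B\<^sup>2 * (u\<^sup>2 / \<gamma> ^ 4 * moment zbar k))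
      + 2 * (\<gamma>\<^sup>2 * ((s_gxt c)\<^sup>2 * V_moment k) + m * (\<gamma>\<^sup>2 * (s_fx c)\<^sup>2))
    \<le> \<gamma> * (C_Y * (1 + X_moment k + T_moment k + V_moment k + u\<^sup>2 / \<gamma> ^ 4 * moment zbar k))"
    using m_pos by simp
  ultimately show ?thesis by linarith
qed

text \<open>The gradient grows at most linearly, so the objective grows at most quadratically.\<close>

lemma objective_integrable: "integrable M (\<lambda>\<omega>. Phi f g (xbar (st k \<omega>)))"
proof (rule Bochner_Integration.integrable_bound)
  let ?D = "gradient (Phi f g)"
  have G: "GDERIV (Phi f g) w :> ?D w" for w using Phi_GDERIV by (simp add: gradient_Phi)
  have "isCont (Phi f g) w" for w using G[of w] unfolding gderiv_def by (rule has_derivative_continuous)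
  then have cont: "continuous_on UNIV (Phi f g)" by (simp add: continuous_at_imp_continuous_on)
  show "(\<lambda>\<omega>. Phi f g (xbar (st k \<omega>))) \<in> borel_measurable M"
    by (rule borel_measurable_continuous_on[OF cont state_moment(1)]) simp
  define R where "R w = \<bar>Phi f g 0\<bar> + (norm (?D 0) + 1)\<^sup>2 + (norm w)\<^sup>2 + B * (norm w)\<^sup>2" for w :: "real^'n"
  show "integrable M (\<lambda>\<omega>. R (xbar (st k \<omega>)))" unfolding R_def by simp
  show "AE \<omega> in M. norm (Phi f g (xbar (st k \<omega>))) \<le> norm (R (xbar (st k \<omega>)))"
  proof (rule AE_I2)
    fix \<omega>
    define w where "w = xbar (st k \<omega>)"
    have "\<bar>Phi f g (0 + w) - Phi f g 0 - ?D 0 \<bullet> w\<bar> \<le> (1 + B * norm w) * norm w"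
    proof (rule gradient_linear_approximation[OF G])
      fix z :: "real^'n" assume "norm (z - 0) \<le> norm w"
      then have "B * norm (z - 0) \<le> B * norm w" using B by (intro mult_left_mono) auto
      then show "norm (?D z - ?D 0) \<le> 1 + B * norm w" using gradient_Phi_variation[OF B, of 1 z 0] by simp
    qed
    moreover have "\<bar>?D 0 \<bullet> w\<bar> \<le> norm (?D 0) * norm w" by (rule Cauchy_Schwarz_ineq2)
    ultimately have "\<bar>Phi f g w\<bar> \<le> \<bar>Phi f g 0\<bar> + (norm (?D 0) + 1) * norm w + B * (norm w)\<^sup>2"
      by (simp add: algebra_simps power2_eq_square)
    moreover have "(norm (?D 0) + 1) * norm w \<le> (norm (?D 0) + 1)\<^sup>2 + (norm w)\<^sup>2"
    proof -
      have "0 \<le> (norm (?D 0) + 1) * norm w" by (intro mult_nonneg_nonneg) auto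
      then show ?thesis using sum_squares_bound[of "norm (?D 0) + 1" "norm w"] by linarith
    qed
    ultimately have "\<bar>Phi f g w\<bar> \<le> R w" by (simp add: R_def)
    then show "norm (Phi f g (xbar (st k \<omega>))) \<le> norm (R (xbar (st k \<omega>)))" by (simp add: w_def)
  qed
qed

lemma phi_step: "phi_moment (Suc k) \<le> phi_moment k - u / 2 * moment eG k - u / 4 * moment zbar k
    + u / 2 * moment eQ k + u * 2"
proof -
  have "phi_moment (Suc k) \<le> (\<integral>\<omega>. Phi f g (xbar (st k \<omega>)) - u / 2 * (norm (eG (st k \<omega>)))\<^sup>2 - u / 4 * (norm (zbar (st k \<omega>)))\<^sup>2
      + u / 2 * (norm (eQ (st k \<omega>)))\<^sup>2 + u * 2 \<partial>M)"
    unfolding phi_moment_def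
  proof (rule integral_mono[OF objective_integrable])
    show "integrable M (\<lambda>\<omega>. Phi f g (xbar (st k \<omega>)) - u / 2 * (norm (eG (st k \<omega>)))\<^sup>2 - u / 4 * (norm (zbar (st k \<omega>)))\<^sup>2
      + u / 2 * (norm (eQ (st k \<omega>)))\<^sup>2 + u * 2)" using objective_integrable[of k] by simp
    fix \<omega>
    show "Phi f g (xbar (st (Suc k) \<omega>)) \<le> Phi f g (xbar (st k \<omega>)) - u / 2 * (norm (eG (st k \<omega>)))\<^sup>2 - u / 4 * (norm (zbar (st k \<omega>)))\<^sup>2
      + u / 2 * (norm (eQ (st k \<omega>)))\<^sup>2 + u * 2"
      using objective_step[OF B u_pos small, of "xbar (st k \<omega>)" "zbar (st k \<omega>)"]
      by (simp add: xbar_Suc xnext_def eQ_def eG_def norm_minus_commute)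
  qed
  also have "\<dots> = phi_moment k - u / 2 * moment eG k - u / 4 * moment zbar k + u / 2 * moment eQ k + u * 2"
    using objective_integrable[of k] by (simp add: moment_def phi_moment_def prob_space)
  finally show ?thesis .
qed

lemma G_step: "moment eG (Suc k) \<le> 3 / 2 * moment eG k + 6 * (1 + B\<^sup>2 * (u\<^sup>2 * moment zbar k))"
proof -
  have "moment eG (Suc k) \<le> (\<integral>\<omega>. 3 / 2 * (norm (eG (st k \<omega>)))\<^sup>2 + 6 * (1 + B\<^sup>2 * (u\<^sup>2 * (norm (zbar (st k \<omega>)))\<^sup>2)) \<partial>M)"
    unfolding moment_def
  proof (rule integral_mono)
    fix \<omega>
    show "(norm (eG (st (Suc k) \<omega>)))\<^sup>2 \<le> 3 / 2 * (norm (eG (st k \<omega>)))\<^sup>2 + 6 * (1 + B\<^sup>2 * (u\<^sup>2 * (norm (zbar (st k \<omega>)))\<^sup>2))"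
      using gradient_step[OF B less_imp_le[OF u_pos], of "xbar (st k \<omega>)" "zbar (st k \<omega>)"]
      by (simp add: xbar_Suc xnext_def eG_def)
  qed simp_all
  also have "\<dots> = 3 / 2 * moment eG k + 6 * (1 + B\<^sup>2 * (u\<^sup>2 * moment zbar k))"
    by (simp add: moment_def prob_space)
  finally show ?thesis .
qed

lemma Q_le_Y: "moment eQ k \<le> Y_moment k"
proof -
  have path: "(norm (eQ s))\<^sup>2 \<le> (\<Sum>i\<in>UNIV. (norm (eY i s))\<^sup>2)" for s
  proof -
    have "eQ s = avg (\<chi> i. eY i s)"
    proof -
      have "(\<chi> i. eY i s) = snd (snd (snd s)) - (\<chi> i. grad_Phi i (xbar s))" by (simp add: vec_eq_iff eY_def)
      then show ?thesis by (simp add: eQ_def zbar_def eG_def gradient_Phi_avg avg_diff)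
    qed
    then have "(norm (eQ s))\<^sup>2 \<le> (\<Sum>i\<in>UNIV. (norm (eY i s))\<^sup>2) / m"
      using norm_avg_sq_le_sum[of "\<lambda>i. eY i s"] by simp
    also have "\<dots> \<le> (\<Sum>i\<in>UNIV. (norm (eY i s))\<^sup>2)"
    proof -
      have nn: "0 \<le> (\<Sum>i\<in>UNIV. (norm (eY i s))\<^sup>2)" by (intro sum_nonneg) auto
      show ?thesis using mult_left_mono[OF m_pos nn] m_pos by (simp add: divide_le_eq)
    qed
    finally show ?thesis .
  qed
  have "moment eQ k \<le> (\<integral>\<omega>. (\<Sum>i\<in>UNIV. (norm (eY i (st k \<omega>)))\<^sup>2) \<partial>M)"
    by (rule moment_mono[OF _ _ path]) simp_all
  then show ?thesis by (simp add: Y_moment_def moment_def)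
qed

definition "C_all = 6 + 6 * B\<^sup>2 + C_Y + C_X + C_T + C_V"

lemma constants_nonneg: "0 \<le> C_X" "0 \<le> C_T" "0 \<le> C_V" "0 \<le> C_all"
proof -
  show 1: "0 \<le> C_X" using gap0 gap m_pos by (simp add: C_X_def)
  have "0 \<le> beta0 * mu_g c / 2" "0 \<le> lambda0 * mu_g c / 2" using beta0 lambda0 positive_constants by simp_all
  then show 2: "0 \<le> C_T" "0 \<le> C_V" using gap0 m_pos
    unfolding C_T_def C_V_def by (auto intro!: divide_nonneg_nonneg add_nonneg_nonneg)
  show "0 \<le> C_all" using 1 2 C_Y_terms(7) by (simp add: C_all_def)
qed

lemma moment_recursion: "moment_recursion phi_moment (moment eG) (moment zbar) (moment eQ) Y_moment X_moment T_moment V_moment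
   C_all gap0 \<alpha> \<gamma> \<tau>"
proof -
  have C: "C_Y \<le> C_all" "C_X \<le> C_all" "C_T \<le> C_all" "C_V \<le> C_all" "2 \<le> C_all" "6 \<le> C_all" "6 * B\<^sup>2 \<le> C_all"
    using constants_nonneg C_Y_terms(7) by (simp_all add: C_all_def)
  have w: "a * (b * x) \<le> a * (C_all * x)" if "b \<le> C_all" "0 \<le> x" "0 \<le> a" for a b x
    using that by (intro mult_left_mono mult_right_mono) auto
  show ?thesis
  proof
    fix k
    have nn: "0 \<le> X_moment k" "0 \<le> T_moment k" "0 \<le> V_moment k" "0 \<le> Y_moment k" "0 \<le> moment zbar k"
      "0 \<le> u\<^sup>2 / \<gamma> ^ 4 * moment zbar k" "0 \<le> u\<^sup>2 * moment zbar k"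
      using moments_nonneg moment_nonneg by (auto intro!: mult_nonneg_nonneg divide_nonneg_nonneg)
    show "phi_moment (Suc k) \<le> phi_moment k - u / 2 * moment eG k - u / 4 * moment zbar k + u / 2 * moment eQ k + u * C_all"
    proof -
      have "u * 2 \<le> u * C_all" using C(5) u_pos by (intro mult_left_mono) auto
      then show ?thesis using phi_step[of k] by linarith
    qed
    show "moment eG (Suc k) \<le> 3 / 2 * moment eG k + C_all * (1 + u\<^sup>2 * moment zbar k)"
    proof -
      have "6 * B\<^sup>2 * (u\<^sup>2 * moment zbar k) \<le> C_all * (u\<^sup>2 * moment zbar k)"
        using C(7) nn(7) by (intro mult_right_mono) auto
      then show ?thesis using G_step[of k] C(6) unfolding distrib_left mult_1_right mult.assoc by linarith
    qed
    show "moment eQ (Suc k) \<le> (1 - \<gamma>) * moment eQ k + \<gamma> * (C_all * (1 + X_moment k + T_moment k + V_moment k + u\<^sup>2 / \<gamma> ^ 4 * moment zbar k))"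
      using Q_step[of k] w[OF C(1), of "1 + X_moment k + T_moment k + V_moment k + u\<^sup>2 / \<gamma> ^ 4 * moment zbar k" \<gamma>] nn steps by linarith
    show "Y_moment (Suc k) \<le> (1 - \<gamma>) * Y_moment k + \<gamma> * (C_all * (1 + X_moment k + T_moment k + V_moment k + u\<^sup>2 / \<gamma> ^ 4 * moment zbar k))"
      using Y_step[of k] w[OF C(1), of "1 + X_moment k + T_moment k + V_moment k + u\<^sup>2 / \<gamma> ^ 4 * moment zbar k" \<gamma>] nn steps by linarith
    show "X_moment (Suc k) \<le> (1 - gap0 * \<tau>) * X_moment k + gap0 * \<tau> * (\<alpha>\<^sup>2 * (C_all * (1 + Y_moment k)))"
    proof -
      have "\<alpha>\<^sup>2 * (C_X * (1 + Y_moment k)) \<le> \<alpha>\<^sup>2 * (C_all * (1 + Y_moment k))" using nn by (intro w C) auto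
      then have "gap0 * \<tau> * (\<alpha>\<^sup>2 * (C_X * (1 + Y_moment k))) \<le> gap0 * \<tau> * (\<alpha>\<^sup>2 * (C_all * (1 + Y_moment k)))"
        using gap0 steps by (intro mult_left_mono) auto
      then show ?thesis using X_step[of k] by linarith
    qed
    show "T_moment (Suc k) \<le> (1 - gap0) * T_moment k + gap0 * (C_all * (1 + X_moment k + u\<^sup>2 * moment zbar k))"
      using T_step[of k] w[OF C(3), of "1 + X_moment k + u\<^sup>2 * moment zbar k" gap0] nn gap0 by linarith
    show "V_moment (Suc k) \<le> (1 - gap0) * V_moment k + gap0 * (C_all * (1 + T_moment k + X_moment k))"
      using V_step[of k] w[OF C(4), of "1 + T_moment k + X_moment k" gap0] nn gap0 by linarith
  qed (use moment_nonneg moments_nonneg constants_nonneg gap0 steps Q_le_Y in auto)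
qed

end

section \<open>The Lyapunov function and the rate\<close>

lemma (in problem) constants_positive:
  assumes "bounded_heterogeneity c f g"
  shows "0 < L_fgx c" "0 < L_fgt c" "0 < omega_t c" "0 < phi_const c" "0 < b_sq c" "0 \<le> M_const c"
proof -
  note pos = positive_constants
  have bg: "0 < b_f c" "0 < b_g c" using assms by (auto simp: bounded_heterogeneity_def)
  show M: "0 \<le> M_const c" using pos by (simp add: M_const_def)
  show 1: "0 < L_fgx c" "0 < L_fgt c" using pos by (auto simp: L_fgx_def L_fgt_def intro!: add_pos_nonneg)
  show 2: "0 < omega_t c" using pos by (simp add: omega_t_def)
  show "0 < phi_const c" unfolding phi_const_def using 1 2 pos
    by (intro mult_pos_pos add_pos_nonneg divide_nonneg_nonneg mult_nonneg_nonneg) auto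
  show "0 < b_sq c" unfolding b_sq_def using bg pos
    by (intro add_pos_nonneg mult_pos_pos mult_nonneg_nonneg add_nonneg_nonneg divide_nonneg_nonneg) auto
qed

context lopa_run
begin

text \<open>The adjoint error in the Lyapunov function; up to the bounded target it is the adjoint variable.\<close>

definition "eS i s = fst (snd (snd s)) $ i - v_star (f i) (g i) (xbar s)"

lemma linear_growth_eS [simp]: "linear_growth (eS i)"
proof -
  have v: "linear_growth (v_star (f i) (g i))"
  proof (rule linear_growthI[where K = "M_const c"])
    show "v_star (f i) (g i) \<in> borel_measurable borel"
      by (rule borel_measurable_continuous_onI[OF v_star_continuous])
    fix x :: "real^'n"
    have "0 \<le> M_const c * norm x" using positive_constants by (simp add: M_const_def)
    then show "norm (v_star (f i) (g i) x) \<le> M_const c * (1 + norm x)"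
      using v_star_bounded[of i x] by (simp add: distrib_left)
  qed
  have "linear_growth (\<lambda>s. v_star (f i) (g i) (xbar s))"
    by (rule linear_growth_compose[OF v]) simp
  then show ?thesis unfolding eS_def[abs_def]
    by (intro linear_growth_diff linear_growth_vec_nth[OF linear_growth_components(3)])
qed

lemma eS_moment: "moment (eS i) k \<le> 2 * moment (eV i) k + 2 * (M_const c)\<^sup>2"
proof -
  have "moment (eS i) k \<le> (\<integral>\<omega>. 2 * (norm (eV i (st k \<omega>)))\<^sup>2 + 2 * (M_const c)\<^sup>2 \<partial>M)"
  proof (rule moment_mono)
    fix s
    have "(norm (eS i s))\<^sup>2 \<le> 2 * (norm (eV i s))\<^sup>2 + 2 * (norm (v_star (f i) (g i) (xbar s)))\<^sup>2"
      using norm_sum2_sq[of "eV i s" "- v_star (f i) (g i) (xbar s)"] by (simp add: eS_def eV_def)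
    moreover have "(norm (v_star (f i) (g i) (xbar s)))\<^sup>2 \<le> (M_const c)\<^sup>2" by (intro power_mono v_star_bounded) simp
    ultimately show "(norm (eS i s))\<^sup>2 \<le> 2 * (norm (eV i s))\<^sup>2 + 2 * (M_const c)\<^sup>2" by linarith
  qed simp_all
  also have "\<dots> = 2 * moment (eV i) k + 2 * (M_const c)\<^sup>2" by (simp add: moment_def prob_space)
  finally show ?thesis .
qed

lemma lyapunov_eq: "lyapunov c (rho W) p f g (X k \<omega>) = Phi f g (xbar (st k \<omega>))
    + d1 c p / m * (\<Sum>i\<in>UNIV. (norm (eS i (st k \<omega>)))\<^sup>2) + d2 c p / m * (\<Sum>i\<in>UNIV. (norm (eT i (st k \<omega>)))\<^sup>2)
    + d3 p * (norm (eQ (st k \<omega>)))\<^sup>2 + d4 c (rho W) p / m * (\<Sum>i\<in>UNIV. (norm (eY i (st k \<omega>)))\<^sup>2)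
    + d5 c (rho W) p / m * (\<Sum>i\<in>UNIV. (norm (eX i (st k \<omega>)))\<^sup>2)"
  by (simp add: lyapunov_def Let_def d0_def d6_def norm_sq_stacked eS_def eT_def eQ_def eY_def eX_def eG_def xbar_def zbar_def
      norm_minus_commute flip: xs_def ts_def vs_def zs_def)

lemma lyapunov_integrable: "integrable M (\<lambda>\<omega>. lyapunov c (rho W) p f g (X k \<omega>))"
  unfolding lyapunov_eq using objective_integrable[of k] by (simp add: Bochner_Integration.integrable_sum)

lemma lyapunov_expectation: "(\<integral>\<omega>. lyapunov c (rho W) p f g (X k \<omega>) \<partial>M) = phi_moment k
    + d1 c p / m * (\<Sum>i\<in>UNIV. moment (eS i) k) + d2 c p / m * T_moment k
    + d3 p * moment eQ k + d4 c (rho W) p / m * Y_moment k + d5 c (rho W) p / m * X_moment k"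
  unfolding lyapunov_eq using objective_integrable[of k]
  by (simp add: Bochner_Integration.integrable_sum phi_moment_def moment_def T_moment_def Y_moment_def X_moment_def)

lemma gradient_at_average: "(norm (gradient (Phi f g) (avg (st_x (X k \<omega>)))))\<^sup>2 = (norm (eG (st k \<omega>)))\<^sup>2"
  by (simp add: eG_def xbar_def flip: xs_def)

lemma initial_moment: "moment h 0 = (\<integral>\<omega>. (norm (h (init \<omega>)))\<^sup>2 \<partial>M)"
  by (simp add: moment_def st_0)

end

lemma (in problem) sigma_LG_sq_nonneg:
  assumes het: "bounded_heterogeneity c f g" and r: "r < 1"
    and p: "alpha p > 0" "beta p > 0" "lambda p > 0" "gamma p > 0" "tau p > 0"
  shows "0 \<le> sigma_LG_sq n c r p"
proof -
  note cs = constants_positive[OF het]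
  have "0 \<le> d1 c p" "0 \<le> d2 c p" "0 \<le> d3 p" "0 \<le> d4 c r p"
    unfolding d1_def d2_def d3_def d4_def using p cs positive_constants r
    by (auto intro!: divide_nonneg_nonneg mult_nonneg_nonneg add_nonneg_nonneg)
  then show ?thesis unfolding sigma_LG_sq_def using p
    by (intro add_nonneg_nonneg mult_nonneg_nonneg divide_nonneg_nonneg) auto
qed

lemma rate_from_budget:
  fixes u N S D \<kappa> :: real
  assumes u: "u > 0" and N: "N > 0" and le: "u / 4 * S \<le> D + N * (u * \<kappa>)"
  shows "1 / N * S \<le> 4 * D / (u * N) + 4 * \<kappa>"
proof -
  have "1 / N * S = (u / 4 * S) * (4 / (u * N))" using u N by (simp add: field_simps)
  also have "\<dots> \<le> (D + N * (u * \<kappa>)) * (4 / (u * N))" using le u N by (intro mult_right_mono) auto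
  also have "\<dots> = 4 * D / (u * N) + 4 * \<kappa>" using u N by (simp add: field_simps)
  finally show ?thesis .
qed

theorem theorem6:
  fixes c :: problem_constants
    and E :: "('m::finite \<times> 'm) set" and W :: "real^'m^'m"
    and f g :: "'m \<Rightarrow> real^'n \<Rightarrow> real^'p \<Rightarrow> real"
    and fh :: "'m \<Rightarrow> real^'n \<Rightarrow> real^'p \<Rightarrow> 'c \<Rightarrow> real"
    and gh :: "'m \<Rightarrow> real^'n \<Rightarrow> real^'p \<Rightarrow> 'b \<Rightarrow> real"
    and Df :: "'m \<Rightarrow> 'c measure" and Dg :: "'m \<Rightarrow> 'b measure"
    and M :: "'w measure" and S :: "('w, 'm, 'b, 'c) samples"
    and init :: "'w \<Rightarrow> (real^'n^'m) \<times> (real^'p^'m) \<times> (real^'p^'m) \<times> (real^'n^'m)"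
  assumes "prob_space M"
    and "expectation_of f fh Df" and "expectation_of g gh Dg"
    and "network E W"
    and "outer_functions c f g"
    and "inner_functions c g"
    and "bounded_heterogeneity c f g"
    and "stochastic_estimates c f g fh gh Df Dg M S init"
    and "init \<in> borel_measurable M" and "integrable M (\<lambda>\<omega>. (norm (init \<omega>))\<^sup>2)"
  shows "\<exists>p :: step_sizes.
    alpha p > 0 \<and> beta p > 0 \<and> lambda p > 0 \<and>
    0 < gamma p \<and> gamma p < 1 \<and> 0 < tau p \<and> tau p < 1 \<and>
    (let X = (\<lambda>k \<omega>. lopa_lg E W fh gh S init p k \<omega>);
         V = (\<lambda>k \<omega>. lyapunov c (rho W) p f g (X k \<omega>));
         G = (\<lambda>k \<omega>. (norm (gradient (Phi f g) (avg (st_x (X k \<omega>)))))\<^sup>2)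
     in (\<forall>k. integrable M (V k) \<and> integrable M (G k)) \<and>
        (\<forall>K. 1 / real (K + 1) * (\<Sum>k=0..K. \<integral>\<omega>. G k \<omega> \<partial>M)
           \<le> 4 * ((\<integral>\<omega>. V 0 \<omega> \<partial>M) - (\<integral>\<omega>. V K \<omega> \<partial>M)) / (tau p * alpha p * real (K + 1))
             + 4 * alpha p * sigma_LG_sq CARD('m) c (rho W) p
             + 4 * vartheta c (rho W) p / real CARD('m) * (alpha p)\<^sup>2 * b_sq c))"
proof -
  interpret problem c f g using assms(5,6) by unfold_locales
  interpret gossip E W using assms(4) by unfold_locales
  note cs = constants_positive[OF assms(7)]
  have het: "bounded_heterogeneity c f g" by fact
  obtain B where B: "B \<ge> 0"
    "\<And>\<eta> i x y. 0 < \<eta> \<Longrightarrow> \<eta> \<le> 1 \<Longrightarrow> norm (grad_Phi i x - grad_Phi i y) \<le> \<eta> + B / \<eta> * norm (x - y)"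
    using uniform_regularity by metis
  obtain H where H: "H \<ge> 0"
    "\<And>i x t v y. (norm (grad_Phi i y - (grad_x (f i) x t - hess_xt (g i) x t *v v)))\<^sup>2
      \<le> H * (1 + (norm (x - y))\<^sup>2 + (norm (t - sol i y))\<^sup>2 + (norm v)\<^sup>2)"
    using hypergradient_error by metis
  obtain A where A: "A \<ge> 0" "\<And>i j x. norm (grad_Phi i x - grad_Phi j x) \<le> A"
    using gradient_dissimilarity[OF het] by metis
  define m where "m = real CARD('m)"
  have m: "m > 0" by (simp add: m_def)
  have run: "lopa_run M c f g E W fh gh Df Dg S init p B H A m"
    if "0 < alpha p" "alpha p < 1" "beta p = beta0" "lambda p = lambda0" "0 < gamma p" "gamma p < 1" "0 < tau p" "tau p < 1"
      "tau p * alpha p * B \<le> 1 / 8" for p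
    using assms(1,8,9,10) that B H A
    by (intro lopa_run.intro lopa.intro lopa_axioms.intro lopa_run_axioms.intro problem_axioms gossip_axioms) (auto simp: m_def)
  \<comment> \<open>An auxiliary run with some admissible step sizes: its recursion constants and initial moments are those
    of every admissible run, so they can be named before the actual step sizes are chosen.\<close>
  define p0 where "p0 = \<lparr>alpha = 1 / 2, beta = beta0, lambda = lambda0, gamma = 1 / 2, tau = min (1 / 2) (1 / (8 * (B + 1)))\<rparr>"
  interpret D: lopa_run M c f g E W fh gh Df Dg S init p0 B H A m
  proof (rule run)
    have "tau p0 * alpha p0 * B \<le> 1 / (8 * (B + 1)) * 1 * B"
      using B by (intro mult_mono) (auto simp: p0_def)
    also have "\<dots> \<le> 1 / 8" using B by (simp add: field_simps)
    finally show "tau p0 * alpha p0 * B \<le> 1 / 8" .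
  qed (use B in \<open>auto simp: p0_def\<close>)
  define r where "r = rho W"
  have r: "r < 1" using rho_le by (simp add: r_def)
  define Q where "Q = L_fgx c + 32 * (C_gxt c)\<^sup>2 * L_fgt c / (mu_g c)\<^sup>2"
  have Q: "Q \<ge> 0" using cs by (simp add: Q_def)
  define \<kappa>4 where "\<kappa>4 = 24 * phi_const c / ((1 - r)\<^sup>2 * m)"
  define \<kappa>5 where "\<kappa>5 = 2 * phi_const c / ((1 - r) * m)"
  define \<kappa>2 where "\<kappa>2 = Q / (omega_t c * beta0 * m)"
  define \<kappa>1 where "\<kappa>1 = 16 * (C_gxt c)\<^sup>2 / (mu_g c * lambda0 * m)"
  define \<kappa>v where "\<kappa>v = m * (M_const c)\<^sup>2"
  have \<kappa>: "\<kappa>1 \<ge> 0" "\<kappa>2 \<ge> 0" "\<kappa>4 > 0" "\<kappa>5 \<ge> 0" "\<kappa>v \<ge> 0" "\<kappa>4 * b_sq c > 0"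
    using cs r m Q beta0(1) lambda0(1) positive_constants
    by (auto simp: \<kappa>1_def \<kappa>2_def \<kappa>4_def \<kappa>5_def \<kappa>v_def)
  have u0: "1 / (8 * (B + 1)) > 0" using B by simp
  obtain \<alpha> \<gamma> \<tau> :: real where par: "0 < \<alpha>" "\<alpha> < 1" "0 < \<gamma>" "\<gamma> < 1" "0 < \<tau>" "\<tau> < 1" "\<tau> * \<alpha> \<le> 1 / (8 * (B + 1))"
    and main: "\<And>\<phi> G n q y Z T v K. moment_recursion \<phi> G n q y Z T v D.C_all D.gap0 \<alpha> \<gamma> \<tau> \<Longrightarrow>
        y 0 = D.Y_moment 0 \<Longrightarrow> Z 0 = D.X_moment 0 \<Longrightarrow> T 0 = D.T_moment 0 \<Longrightarrow> v 0 = D.V_moment 0 \<Longrightarrow> G 0 = D.moment D.eG 0 \<Longrightarrow>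
        \<tau> * \<alpha> / 4 * (\<Sum>k\<le>K. G k)
          + (\<phi> K + \<kappa>4 * (\<tau> * \<alpha> ^ 4 / \<gamma>) * y K + \<kappa>5 * \<alpha> * Z K + \<tau> * \<alpha> / (2 * \<gamma>) * q K
              + \<kappa>2 * (\<tau> * \<alpha>) * T K + \<kappa>1 * (\<tau> * \<alpha>) * (v K + \<kappa>v))
        \<le> (\<phi> 0 + \<kappa>4 * (\<tau> * \<alpha> ^ 4 / \<gamma>) * y 0 + \<kappa>5 * \<alpha> * Z 0 + \<tau> * \<alpha> / (2 * \<gamma>) * q 0)
          + real (K + 1) * ((\<kappa>4 * b_sq c) * (\<tau> * \<alpha> ^ 4 / \<gamma>))"
    by (rule step_size_choice[OF D.constants_nonneg(4) D.gap0(1,2) \<kappa>(6) u0 \<kappa>(1,2) less_imp_le[OF \<kappa>(3)] \<kappa>(4,5)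
        D.moments_nonneg(4,1,2,3) D.moment_nonneg, of 0 0 0 0 D.eG 0]) blast
  define p where "p = \<lparr>alpha = \<alpha>, beta = beta0, lambda = lambda0, gamma = \<gamma>, tau = \<tau>\<rparr>"
  have psel: "alpha p = \<alpha>" "beta p = beta0" "lambda p = lambda0" "gamma p = \<gamma>" "tau p = \<tau>" by (simp_all add: p_def)
  interpret R: lopa_run M c f g E W fh gh Df Dg S init p B H A m
  proof (rule run)
    have "\<tau> * \<alpha> * B \<le> 1 / (8 * (B + 1)) * B" using par B by (intro mult_right_mono) auto
    also have "\<dots> \<le> 1 / 8" using B by (simp add: field_simps)
    finally show "tau p * alpha p * B \<le> 1 / 8" by (simp add: psel)
  qed (use par in \<open>auto simp: psel\<close>)
  \<comment> \<open>The initial state does not depend on the step sizes.\<close>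
  have init_eq: "R.moment h 0 = D.moment h 0" for h :: "_ \<Rightarrow> 'z::euclidean_space"
    by (simp add: R.initial_moment D.initial_moment)
  have bound: "\<tau> * \<alpha> / 4 * (\<Sum>k\<le>K. R.moment R.eG k)
          + (R.phi_moment K + \<kappa>4 * (\<tau> * \<alpha> ^ 4 / \<gamma>) * R.Y_moment K + \<kappa>5 * \<alpha> * R.X_moment K + \<tau> * \<alpha> / (2 * \<gamma>) * R.moment R.eQ K
              + \<kappa>2 * (\<tau> * \<alpha>) * R.T_moment K + \<kappa>1 * (\<tau> * \<alpha>) * (R.V_moment K + \<kappa>v))
        \<le> (R.phi_moment 0 + \<kappa>4 * (\<tau> * \<alpha> ^ 4 / \<gamma>) * R.Y_moment 0 + \<kappa>5 * \<alpha> * R.X_moment 0 + \<tau> * \<alpha> / (2 * \<gamma>) * R.moment R.eQ 0)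
          + real (K + 1) * ((\<kappa>4 * b_sq c) * (\<tau> * \<alpha> ^ 4 / \<gamma>))" for K
  proof (rule main)
    show "moment_recursion R.phi_moment (R.moment R.eG) (R.moment R.zbar) (R.moment R.eQ) R.Y_moment R.X_moment R.T_moment R.V_moment
       D.C_all D.gap0 \<alpha> \<gamma> \<tau>"
      using R.moment_recursion by (simp add: psel)
    show "R.Y_moment 0 = D.Y_moment 0" "R.X_moment 0 = D.X_moment 0" "R.T_moment 0 = D.T_moment 0" "R.V_moment 0 = D.V_moment 0"
      "R.moment R.eG 0 = D.moment D.eG 0"
      by (simp_all add: R.Y_moment_def D.Y_moment_def R.X_moment_def D.X_moment_def R.T_moment_def D.T_moment_def
          R.V_moment_def D.V_moment_def init_eq)
  qed
  have d: "d4 c r p / m = \<kappa>4 * (\<tau> * \<alpha> ^ 4 / \<gamma>)" "d5 c r p / m = \<kappa>5 * \<alpha>" "d3 p = \<tau> * \<alpha> / (2 * \<gamma>)"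
    "d2 c p / m = \<kappa>2 * (\<tau> * \<alpha>)" "d1 c p / m * 2 = \<kappa>1 * (\<tau> * \<alpha>)"
  proof -
    show "d4 c r p / m = \<kappa>4 * (\<tau> * \<alpha> ^ 4 / \<gamma>)" by (simp add: d4_def \<kappa>4_def psel mult_ac)
  qed (simp_all add: d1_def d2_def d3_def d5_def \<kappa>1_def \<kappa>2_def \<kappa>5_def psel flip: Q_def)
  have d0: "0 \<le> d1 c p / m" "0 \<le> d2 c p / m"
  proof -
    have nn: "0 \<le> \<kappa>1 * (\<tau> * \<alpha>)" "0 \<le> \<kappa>2 * (\<tau> * \<alpha>)" using \<kappa> par by simp_all
    show "0 \<le> d1 c p / m" using nn(1)[folded d(5), unfolded zero_le_mult_iff] by simp
    show "0 \<le> d2 c p / m" using nn(2) unfolding d(4) .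
  qed
  define EV where "EV k = (\<integral>\<omega>. lyapunov c (rho W) p f g (R.X k \<omega>) \<partial>M)" for k
  \<comment> \<open>At the final time the inner and adjoint terms are bounded by the moments of the recursion.\<close>
  have upper: "EV K \<le> R.phi_moment K + \<kappa>4 * (\<tau> * \<alpha> ^ 4 / \<gamma>) * R.Y_moment K + \<kappa>5 * \<alpha> * R.X_moment K + \<tau> * \<alpha> / (2 * \<gamma>) * R.moment R.eQ K
              + \<kappa>2 * (\<tau> * \<alpha>) * R.T_moment K + \<kappa>1 * (\<tau> * \<alpha>) * (R.V_moment K + \<kappa>v)" for K
  proof -
    have "(\<Sum>i\<in>UNIV. R.moment (R.eS i) K) \<le> (\<Sum>i\<in>UNIV. 2 * R.moment (R.eV i) K + 2 * (M_const c)\<^sup>2)"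
      by (intro sum_mono R.eS_moment)
    also have "\<dots> = 2 * (R.V_moment K + \<kappa>v)"
      by (simp add: R.V_moment_def sum.distrib sum_distrib_left \<kappa>v_def distrib_left)
    finally have "d1 c p / m * (\<Sum>i\<in>UNIV. R.moment (R.eS i) K) \<le> d1 c p / m * (2 * (R.V_moment K + \<kappa>v))"
      using d0 by (intro mult_left_mono)
    also have "\<dots> = \<kappa>1 * (\<tau> * \<alpha>) * (R.V_moment K + \<kappa>v)" unfolding d(5)[symmetric] by simp
    finally show ?thesis unfolding EV_def r_def[symmetric] R.lyapunov_expectation[folded r_def] d by linarith
  qed
  have lower: "R.phi_moment 0 + \<kappa>4 * (\<tau> * \<alpha> ^ 4 / \<gamma>) * R.Y_moment 0 + \<kappa>5 * \<alpha> * R.X_moment 0 + \<tau> * \<alpha> / (2 * \<gamma>) * R.moment R.eQ 0 \<le> EV 0"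
  proof -
    have "0 \<le> d1 c p / m * (\<Sum>i\<in>UNIV. R.moment (R.eS i) 0)"
      using d0(1) R.moment_nonneg by (intro mult_nonneg_nonneg sum_nonneg) auto
    moreover have "0 \<le> \<kappa>2 * (\<tau> * \<alpha>) * R.T_moment 0"
      using \<kappa> par R.moments_nonneg by (intro mult_nonneg_nonneg) auto
    ultimately show ?thesis unfolding EV_def r_def[symmetric] R.lyapunov_expectation[folded r_def] d by linarith
  qed
  have rate: "1 / real (K + 1) * (\<Sum>k=0..K. R.moment R.eG k)
      \<le> 4 * (EV 0 - EV K) / (tau p * alpha p * real (K + 1)) + 4 * alpha p * sigma_LG_sq CARD('m) c (rho W) p
        + 4 * vartheta c (rho W) p / real CARD('m) * (alpha p)\<^sup>2 * b_sq c" for K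
  proof -
    define \<kappa> where "\<kappa> = \<kappa>4 * b_sq c * \<alpha> ^ 3 / \<gamma>"
    have "\<tau> * \<alpha> / 4 * (\<Sum>k\<le>K. R.moment R.eG k) \<le> (EV 0 - EV K) + real (K + 1) * (\<tau> * \<alpha> * \<kappa>)"
    proof -
      have "(\<kappa>4 * b_sq c) * (\<tau> * \<alpha> ^ 4 / \<gamma>) = \<tau> * \<alpha> * \<kappa>" by (simp add: \<kappa>_def power_numeral_reduce)
      then show ?thesis using bound[of K] upper[of K] lower by simp
    qed
    then have "1 / real (K + 1) * (\<Sum>k\<le>K. R.moment R.eG k) \<le> 4 * (EV 0 - EV K) / (\<tau> * \<alpha> * real (K + 1)) + 4 * \<kappa>"
      using par by (intro rate_from_budget) auto
    moreover have "4 * \<kappa> = 4 * vartheta c (rho W) p / real CARD('m) * (alpha p)\<^sup>2 * b_sq c"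
      by (simp add: \<kappa>_def \<kappa>4_def vartheta_def psel power_numeral_reduce power2_eq_square flip: r_def m_def)
        (simp add: mult_ac)
    moreover have "0 \<le> 4 * alpha p * sigma_LG_sq CARD('m) c (rho W) p"
      using par beta0(1) lambda0(1) rho_le by (intro mult_nonneg_nonneg sigma_LG_sq_nonneg[OF het]) (auto simp: psel)
    ultimately show ?thesis unfolding psel atMost_atLeast0 by linarith
  qed
  show ?thesis
    unfolding Let_def
  proof (intro exI[of _ p] conjI allI)
    show "0 < alpha p" "0 < beta p" "0 < lambda p" "0 < gamma p" "gamma p < 1" "0 < tau p" "tau p < 1"
      using par beta0(1) lambda0(1) by (simp_all add: psel)
    show "integrable M (\<lambda>\<omega>. lyapunov c (rho W) p f g (lopa_lg E W fh gh S init p k \<omega>))" for k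
      using R.lyapunov_integrable[of k] by (simp add: R.X_def)
    show "integrable M (\<lambda>\<omega>. (norm (gradient (Phi f g) (avg (st_x (lopa_lg E W fh gh S init p k \<omega>)))))\<^sup>2)" for k
      using R.integrable_errors[of R.eG k] unfolding R.gradient_at_average[symmetric] R.X_def by simp
    show "1 / real (K + 1) * (\<Sum>k=0..K. \<integral>\<omega>. (norm (gradient (Phi f g) (avg (st_x (lopa_lg E W fh gh S init p k \<omega>)))))\<^sup>2 \<partial>M)
           \<le> 4 * ((\<integral>\<omega>. lyapunov c (rho W) p f g (lopa_lg E W fh gh S init p 0 \<omega>) \<partial>M)
                - (\<integral>\<omega>. lyapunov c (rho W) p f g (lopa_lg E W fh gh S init p K \<omega>) \<partial>M)) / (tau p * alpha p * real (K + 1))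
             + 4 * alpha p * sigma_LG_sq CARD('m) c (rho W) p
             + 4 * vartheta c (rho W) p / real CARD('m) * (alpha p)\<^sup>2 * b_sq c" for K
      using rate[of K] unfolding EV_def R.moment_def R.gradient_at_average[symmetric] R.X_def .
  qed
qed

end
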